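(* Suppose for $i=1,2$ that $(\mathcal{C}_i,\mathcal{D}_i)$ are pseudo-Cartan inclusions such that $(\tilde{\mathcal{C}}_i,\tilde{\mathcal{D}}_i)$ are pseudo-Cartan inclusions, and $\mathcal{A}_i$ are Banach algebras (closed subalgebras of $\mathcal{C}_i$) satisfying $\mathcal{D}_i\subseteq\mathcal{A}_i\subseteq\mathcal{C}_i$. Let $C^*(\mathcal{A}_i)$ be the C*-subalgebra of $\mathcal{C}_i$ generated by $\mathcal{A}_i$. If $u:\mathcal{A}_1\to\mathcal{A}_2$ is an isometric (algebra) isomorphism, then $u$ extends uniquely to a $*$-isomorphism of $C^*(\mathcal{A}_1)$ onto $C^*(\mathcal{A}_2)$.
   Context: For a C*-algebra $\mathcal{X}$, $\tilde{\mathcal{X}}=\mathcal{X}$ if unital and the unitization $\mathcal{X}\times\mathbb{C}$ otherwise; $\tilde{\mathcal{D}}_i$ is regarded inside $\tilde{\mathcal{C}}_i$ via the standard extension of the inclusion ($d\mapsto d$, adjoined unit $\mapsto$ unit of $\tilde{\mathcal{C}}_i$ when $\mathcal{D}_i$ is non-unital). Inclusion: C*-algebra with C*-subalgebra. $\mathcal{N}(\mathcal{C},\mathcal{D})=\{v: v\mathcal{D}v^*\cup v^*\mathcal{D}v\subseteq\mathcal{D}\}$; regular: span dense. $\mathcal{D}^c$: relative commutant. Ideal intersection property: every nonzero closed ideal of the larger algebra meets the subalgebra nontrivially. Pseudo-Cartan inclusion: regular inclusion with $\mathcal{D}$ and $\mathcal{D}^c$ abelian and both $(\mathcal{C},\mathcal{D}^c)$,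 $(\mathcal{D}^c,\mathcal{D})$ having the ideal intersection property. *)

theory Defs
  imports "HOL-Analysis.Analysis"
begin

text \<open>C*-algebras are modelled as closed *-subalgebras of an ambient unital complex
C*-algebra, given by a type of class real_normed_algebra_1 + banach together with a
complex scalar multiplication cs and an involution st satisfying the C*-axioms.\<close>

definition cstar_ops :: "(complex \<Rightarrow> 'a::{real_normed_algebra_1,banach} \<Rightarrow> 'a) \<Rightarrow> ('a \<Rightarrow> 'a) \<Rightarrow> bool"
  where "cstar_ops cs st \<longleftrightarrow>
    (\<forall>c x y. cs c (x + y) = cs c x + cs c y) \<and>
    (\<forall>a b x. cs (a + b) x = cs a x + cs b x) \<and>
    (\<forall>a b x. cs (a * b) x = cs a (cs b x)) \<and>
    (\<forall>r x. cs (complex_of_real r) x = scaleR r x) \<and>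
    (\<forall>c x y. cs c (x * y) = cs c x * y \<and> cs c (x * y) = x * cs c y) \<and>
    (\<forall>c x. norm (cs c x) = cmod c * norm x) \<and>
    (\<forall>x. st (st x) = x) \<and>
    (\<forall>x y. st (x + y) = st x + st y) \<and>
    (\<forall>c x. st (cs c x) = cs (cnj c) (st x)) \<and>
    (\<forall>x y. st (x * y) = st y * st x) \<and>
    (\<forall>x. norm (st x * x) = (norm x)\<^sup>2)"

definition csubspace :: "(complex \<Rightarrow> 'a \<Rightarrow> 'a) \<Rightarrow> 'a::{real_normed_algebra_1,banach} set \<Rightarrow> bool"
  where "csubspace cs V \<longleftrightarrow> 0 \<in> V \<and> (\<forall>x\<in>V. \<forall>y\<in>V. x + y \<in> V) \<and> (\<forall>c. \<forall>x\<in>V. cs c x \<in> V)"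

definition cspan :: "(complex \<Rightarrow> 'a \<Rightarrow> 'a) \<Rightarrow> 'a::{real_normed_algebra_1,banach} set \<Rightarrow> 'a set"
  where "cspan cs S = \<Inter>{V. csubspace cs V \<and> S \<subseteq> V}"

definition banach_subalg :: "(complex \<Rightarrow> 'a \<Rightarrow> 'a) \<Rightarrow> 'a::{real_normed_algebra_1,banach} set \<Rightarrow> bool"
  where "banach_subalg cs A \<longleftrightarrow> csubspace cs A \<and> (\<forall>x\<in>A. \<forall>y\<in>A. x * y \<in> A) \<and> closed A"

definition cstar_subalg :: "(complex \<Rightarrow> 'a \<Rightarrow> 'a) \<Rightarrow> ('a \<Rightarrow> 'a) \<Rightarrow> 'a::{real_normed_algebra_1,banach} set \<Rightarrow> bool"
  where "cstar_subalg cs st A \<longleftrightarrow> banach_subalg cs A \<and> (\<forall>x\<in>A. st x \<in> A)"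

definition generated_cstar :: "(complex \<Rightarrow> 'a \<Rightarrow> 'a) \<Rightarrow> ('a \<Rightarrow> 'a) \<Rightarrow> 'a::{real_normed_algebra_1,banach} set \<Rightarrow> 'a set"
  where "generated_cstar cs st S = \<Inter>{B. cstar_subalg cs st B \<and> S \<subseteq> B}"

definition inclusion :: "(complex \<Rightarrow> 'a \<Rightarrow> 'a) \<Rightarrow> ('a \<Rightarrow> 'a) \<Rightarrow> 'a::{real_normed_algebra_1,banach} set \<Rightarrow> 'a set \<Rightarrow> bool"
  where "inclusion cs st C D \<longleftrightarrow> cstar_subalg cs st C \<and> cstar_subalg cs st D \<and> D \<subseteq> C"

definition closed_ideal :: "(complex \<Rightarrow> 'a \<Rightarrow> 'a) \<Rightarrow> 'a::{real_normed_algebra_1,banach} set \<Rightarrow> 'a set \<Rightarrow> bool"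
  where "closed_ideal cs C I \<longleftrightarrow> I \<subseteq> C \<and> csubspace cs I \<and> closed I \<and>
     (\<forall>c\<in>C. \<forall>x\<in>I. c * x \<in> I \<and> x * c \<in> I)"

definition ideal_intersection_property :: "(complex \<Rightarrow> 'a \<Rightarrow> 'a) \<Rightarrow> 'a::{real_normed_algebra_1,banach} set \<Rightarrow> 'a set \<Rightarrow> bool"
  where "ideal_intersection_property cs C D \<longleftrightarrow>
     (\<forall>I. closed_ideal cs C I \<and> I \<noteq> {0} \<longrightarrow> I \<inter> D \<noteq> {0})"

definition normalizers :: "('a \<Rightarrow> 'a) \<Rightarrow> 'a::{real_normed_algebra_1,banach} set \<Rightarrow> 'a set \<Rightarrow> 'a set"
  where "normalizers st C D = {v\<in>C. \<forall>d\<in>D. v * d * st v \<in> D \<and> st v * d * v \<in> D}"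

definition regular_inclusion :: "(complex \<Rightarrow> 'a \<Rightarrow> 'a) \<Rightarrow> ('a \<Rightarrow> 'a) \<Rightarrow> 'a::{real_normed_algebra_1,banach} set \<Rightarrow> 'a set \<Rightarrow> bool"
  where "regular_inclusion cs st C D \<longleftrightarrow> inclusion cs st C D \<and> closure (cspan cs (normalizers st C D)) = C"

definition rel_commutant :: "'a::{real_normed_algebra_1,banach} set \<Rightarrow> 'a set \<Rightarrow> 'a set"
  where "rel_commutant C D = {x\<in>C. \<forall>d\<in>D. x * d = d * x}"

definition abelian :: "'a::{real_normed_algebra_1,banach} set \<Rightarrow> bool"
  where "abelian A \<longleftrightarrow> (\<forall>x\<in>A. \<forall>y\<in>A. x * y = y * x)"

definition pseudo_cartan :: "(complex \<Rightarrow> 'a \<Rightarrow> 'a) \<Rightarrow> ('a \<Rightarrow> 'a) \<Rightarrow> 'a::{real_normed_algebra_1,banach} set \<Rightarrow> 'a set \<Rightarrow> bool"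
  where "pseudo_cartan cs st C D \<longleftrightarrow> regular_inclusion cs st C D \<and> abelian D \<and>
     abelian (rel_commutant C D) \<and>
     ideal_intersection_property cs C (rel_commutant C D) \<and>
     ideal_intersection_property cs (rel_commutant C D) D"

text \<open>Unitization, realised inside the (unital) ambient algebra.\<close>
definition has_unit :: "'a::{real_normed_algebra_1,banach} set \<Rightarrow> 'a \<Rightarrow> bool"
  where "has_unit A e \<longleftrightarrow> e \<in> A \<and> (\<forall>x\<in>A. e * x = x \<and> x * e = x)"

definition unital :: "'a::{real_normed_algebra_1,banach} set \<Rightarrow> bool"
  where "unital A \<longleftrightarrow> (\<exists>e. has_unit A e)"

text \<open>Unit of the unitization of C: the unit of C if C is unital, otherwise the
ambient unit (which then lies outside C).\<close>
definition unit_of_tilde :: "'a::{real_normed_algebra_1,banach} set \<Rightarrow> 'a"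
  where "unit_of_tilde A = (if unital A then (THE e. has_unit A e) else 1)"

definition tildeC :: "(complex \<Rightarrow> 'a \<Rightarrow> 'a) \<Rightarrow> 'a::{real_normed_algebra_1,banach} set \<Rightarrow> 'a set"
  where "tildeC cs C = (if unital C then C else {x + cs z 1 | x z. x \<in> C})"

definition tildeD :: "(complex \<Rightarrow> 'a \<Rightarrow> 'a) \<Rightarrow> 'a::{real_normed_algebra_1,banach} set \<Rightarrow> 'a set \<Rightarrow> 'a set"
  where "tildeD cs C D = (if unital D then D else {d + cs z (unit_of_tilde C) | d z. d \<in> D})"

definition clinear_on :: "(complex \<Rightarrow> 'a::{real_normed_algebra_1,banach} \<Rightarrow> 'a) \<Rightarrow> (complex \<Rightarrow> 'b \<Rightarrow> 'b) \<Rightarrow> 'a set \<Rightarrow> ('a \<Rightarrow> 'b::{real_normed_algebra_1,banach}) \<Rightarrow> bool"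
  where "clinear_on cs1 cs2 S f \<longleftrightarrow> (\<forall>x\<in>S. \<forall>y\<in>S. f (x + y) = f x + f y) \<and> (\<forall>c. \<forall>x\<in>S. f (cs1 c x) = cs2 c (f x))"

definition multiplicative_on :: "'a::{real_normed_algebra_1,banach} set \<Rightarrow> ('a \<Rightarrow> 'b::{real_normed_algebra_1,banach}) \<Rightarrow> bool"
  where "multiplicative_on S f \<longleftrightarrow> (\<forall>x\<in>S. \<forall>y\<in>S. f (x * y) = f x * f y)"

definition isometric_alg_iso :: "(complex \<Rightarrow> 'a \<Rightarrow> 'a) \<Rightarrow> (complex \<Rightarrow> 'b \<Rightarrow> 'b) \<Rightarrow> 'a::{real_normed_algebra_1,banach} set \<Rightarrow> 'b::{real_normed_algebra_1,banach} set \<Rightarrow> ('a \<Rightarrow> 'b) \<Rightarrow> bool"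
  where "isometric_alg_iso cs1 cs2 A B u \<longleftrightarrow> clinear_on cs1 cs2 A u \<and> multiplicative_on A u \<and>
     bij_betw u A B \<and> (\<forall>x\<in>A. norm (u x) = norm x)"

definition star_iso :: "(complex \<Rightarrow> 'a \<Rightarrow> 'a) \<Rightarrow> ('a \<Rightarrow> 'a) \<Rightarrow> (complex \<Rightarrow> 'b \<Rightarrow> 'b) \<Rightarrow> ('b \<Rightarrow> 'b) \<Rightarrow> 'a::{real_normed_algebra_1,banach} set \<Rightarrow> 'b::{real_normed_algebra_1,banach} set \<Rightarrow> ('a \<Rightarrow> 'b) \<Rightarrow> bool"
  where "star_iso cs1 st1 cs2 st2 A B U \<longleftrightarrow> clinear_on cs1 cs2 A U \<and> multiplicative_on A U \<and>
     (\<forall>x\<in>A. U (st1 x) = st2 (U x)) \<and> bij_betw U A B"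

end

theory Submission
  imports Defs "HOL-Real_Asymp.Real_Asymp"
begin

text \<open>The extension is the closure \<open>K\<close> of the *-algebra of pairs generated by the pairs \<open>(x, u x)\<close>
and \<open>(x\<^sup>*, (u x)\<^sup>*)\<close>, \<open>x \<in> A1\<close>. A closed *-algebra of pairs containing no pair \<open>(0, y)\<close> with \<open>y \<noteq> 0\<close>
and no \<open>(x, 0)\<close> with \<open>x \<noteq> 0\<close> is the graph of an isometric *-isomorphism, so what has to be shown is
that \<open>(x, 0) \<in> K\<close> forces \<open>x = 0\<close>, and the same for \<open>u\<^sup>-\<^sup>1\<close>.

On the pseudo-Cartan side, normalizers, and hence all elements of \<open>C\<close>, are almost scalar when
compressed by suitable elements of \<open>D\<close>; by the two ideal intersection properties an element whose
compressions are locally small vanishes. Sequences \<open>h\<^sub>n\<close> in \<open>D\<close> with \<open>h\<^sub>n h\<^sub>n\<^sub>+\<^sub>1 = h\<^sub>n\<^sub>+\<^sub>1\<close> therefore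
excise functionals \<open>phi\<close> that detect all of \<open>C\<close>, and it suffices to prove \<open>|phi f| \<le> \<parallel>g\<parallel>\<close> whenever
the same *-polynomial in elements of \<open>A1\<close> and in their images has the values \<open>f\<close> and \<open>g\<close>.

In the GNS representation of \<open>phi\<close>, words \<open>w\<close> of normalizers define vectors any two of which are
orthogonal or parallel, and \<open>w h\<^sub>n w\<^sup>* \<in> D\<close> approximates the projection onto the vector of \<open>w\<close>.
For \<open>a \<in> A1\<close> the compressions \<open>(w h\<^sub>n w\<^sup>*) a (v h\<^sub>n v\<^sup>*)\<close>, which carry the matrix entries of \<open>a\<close>, lie in
\<open>A1\<close>, so that \<open>u\<close> transports them together with their norms. As \<open>u\<close> is *-preserving on \<open>D\<close>, a
norm computation in \<open>A1\<close> followed by a graph Laplacian argument yields unit elements of the second algebra on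
which the images act by the same matrix entries, adjoints included. On them \<open>g\<close> acts as \<open>f\<close> does on
the vector of \<open>1\<close>, whence the bound.\<close>

section \<open>Square roots of elements close to the unit\<close>

text \<open>The obstacle is that \<open>u\<close> transports norms of elements of \<open>A1\<close>
  only. The adjoint of an element of \<open>A1\<close> may lie outside \<open>A1\<close>, yet the
  matrix entries of adjoint letters have to be followed as well. Compressions by elements of
  \<open>D\<close> are harmless, as \<open>u\<close> respects adjoints there. For the rest, the real
  part of an element \<open>S\<close> of \<open>A1\<close> is made visible by the first-order growth
  of \<parallel>Q + t S\<parallel>, where \<open>Q\<close> is self-adjoint, nearly contractive and
  nearly a unit for \<open>S\<close>: the square of this norm is controlled by
  \<open>1 + t (S + st S)\<close> up to order \<open>t^2\<close>. With arrows normalised to matrix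
  entry 1, the sum of the orthonormal vectors is invariant in the first algebra, so the norm there
  is about \<open>1 + t\<close>. In the second algebra the same norm leaves no room for a Laplacian
  bounded below on all unit elements, and so produces almost invariant ones. Invariance under the
  arrows and their adjoints fixes the matrix entries, and connectedness of the graph gives all
  components asymptotically the same length.\<close>

primrec sqrt_iter :: "'a::real_normed_algebra_1 \<Rightarrow> nat \<Rightarrow> 'a" where
  "sqrt_iter x 0 = 0"
| "sqrt_iter x (Suc n) = (1/2) *\<^sub>R (x + sqrt_iter x n * sqrt_iter x n)"

text \<open>The iteration converges to the \<open>y\<close> with \<open>(1 - y)\<^sup>2 = 1 - x\<close>. Since it has no
constant term, it stays in every closed (possibly non-unital) subalgebra containing \<open>x\<close>.\<close>
definition cosqrt :: "'a::{real_normed_algebra_1,banach} \<Rightarrow> 'a"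
  where "cosqrt x = lim (sqrt_iter x)"

lemma sqrt_iter_commute: "x * c = c * x \<Longrightarrow> sqrt_iter x n * c = c * sqrt_iter x n"
proof (induction n)
  case (Suc n)
  have "sqrt_iter x n * sqrt_iter x n * c = c * (sqrt_iter x n * sqrt_iter x n)"
    using Suc by (metis mult.assoc)
  then show ?case using Suc by (simp add: algebra_simps)
qed simp

lemma sqrt_iter_real: "0 \<le> sqrt_iter (1::real) n" "sqrt_iter (1::real) n \<le> 1"
    "sqrt_iter (1::real) n \<le> sqrt_iter 1 (Suc n)"
proof -
  have *: "0 \<le> sqrt_iter (1::real) n \<and> sqrt_iter (1::real) n \<le> 1" for n
  proof (induction n)
    case (Suc n)
    then have "sqrt_iter (1::real) n * sqrt_iter (1::real) n \<le> 1 * 1"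
      by (intro mult_mono) auto
    then show ?case using Suc by auto
  qed simp
  then show "0 \<le> sqrt_iter (1::real) n" "sqrt_iter (1::real) n \<le> 1" by auto
  have "0 \<le> (1 - sqrt_iter (1::real) n)^2" by simp
  then show "sqrt_iter (1::real) n \<le> sqrt_iter 1 (Suc n)"
    by (simp add: power2_eq_square algebra_simps)
qed

lemma norm_sqrt_iter:
  fixes x :: "'a::real_normed_algebra_1"
  assumes "norm x \<le> 1"
  shows "norm (sqrt_iter x n) \<le> sqrt_iter 1 n"
proof (induction n)
  case (Suc n)
  have "norm (sqrt_iter x (Suc n)) \<le> (1/2) * (norm x + norm (sqrt_iter x n) * norm (sqrt_iter x n))"
    by (simp) (meson norm_mult_ineq norm_triangle_le add_mono order_refl order_trans)
  also have "\<dots> \<le> (1/2) * (1 + sqrt_iter 1 n * sqrt_iter 1 n)"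
    using Suc assms by (intro mult_left_mono add_mono mult_mono) (auto simp: sqrt_iter_real)
  finally show ?case by simp
qed simp

text \<open>Consecutive iterates commute, so an increment is half the product of the preceding sum
  and difference. Hence the increments are dominated by those of the scalar iteration at 1, which
  gives convergence also for \<parallel>x\<parallel> = 1.\<close>

lemma norm_sqrt_iter_step:
  fixes x :: "'a::real_normed_algebra_1"
  assumes "norm x \<le> 1"
  shows "norm (sqrt_iter x (Suc n) - sqrt_iter x n) \<le> sqrt_iter 1 (Suc n) - sqrt_iter 1 n"
proof (induction n)
  case 0
  then show ?case using assms by simp
next
  case (Suc n)
  define a b where "a = sqrt_iter x (Suc n)" and "b = sqrt_iter x n"
  have c: "a * b = b * a"
    unfolding a_def b_def by (intro sqrt_iter_commute) (metis sqrt_iter_commute)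
  have "sqrt_iter x (Suc (Suc n)) - sqrt_iter x (Suc n) = (1/2) *\<^sub>R ((a + b) * (a - b))"
    using c by (simp add: a_def b_def algebra_simps del: sqrt_iter.simps)
      (simp add: algebra_simps)
  then have "norm (sqrt_iter x (Suc (Suc n)) - sqrt_iter x (Suc n)) \<le> (1/2) * (norm (a + b) * norm (a - b))"
    by (simp add: norm_mult_ineq del: sqrt_iter.simps)
  also have "\<dots> \<le> (1/2) * ((sqrt_iter 1 (Suc n) + sqrt_iter 1 n) * (sqrt_iter 1 (Suc n) - sqrt_iter 1 n))"
    using Suc norm_sqrt_iter[OF assms, of "Suc n"] norm_sqrt_iter[OF assms, of n]
    unfolding a_def b_def
    by (intro mult_left_mono mult_mono norm_triangle_le add_mono)
      (auto intro: add_nonneg_nonneg simp: sqrt_iter_real simp del: sqrt_iter.simps)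
  also have "\<dots> = sqrt_iter 1 (Suc (Suc n)) - sqrt_iter 1 (Suc n)"
    by (simp add: algebra_simps)
  finally show ?case .
qed

lemma sqrt_iter_tendsto:
  fixes x :: "'a::{real_normed_algebra_1,banach}"
  assumes "norm x \<le> 1"
  shows "sqrt_iter x \<longlonglongrightarrow> cosqrt x"
proof -
  have d: "norm (sqrt_iter x (n + k) - sqrt_iter x n) \<le> sqrt_iter 1 (n + k) - sqrt_iter 1 n" for n k
  proof (induction k)
    case (Suc k)
    have "norm (sqrt_iter x (n + Suc k) - sqrt_iter x n)
        \<le> norm (sqrt_iter x (Suc (n + k)) - sqrt_iter x (n + k)) + norm (sqrt_iter x (n + k) - sqrt_iter x n)"
      using norm_triangle_ineq[of "sqrt_iter x (Suc (n + k)) - sqrt_iter x (n + k)"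
          "sqrt_iter x (n + k) - sqrt_iter x n"] by (simp del: sqrt_iter.simps)
    then show ?case using Suc norm_sqrt_iter_step[OF assms, of "n + k"]
      by (simp del: sqrt_iter.simps)
  qed simp
  have inc: "incseq (sqrt_iter (1::real))"
    by (intro incseq_SucI sqrt_iter_real)
  have "convergent (sqrt_iter (1::real))"
    by (rule Bseq_mono_convergent[OF BseqI'[of _ 1]])
      (use inc in \<open>auto simp: sqrt_iter_real incseq_def\<close>)
  then have C: "Cauchy (sqrt_iter (1::real))" by (rule convergent_Cauchy)
  have "Cauchy (sqrt_iter x)"
  proof (rule CauchyI')
    fix e :: real assume "0 < e"
    then obtain M where M: "\<And>m n. m \<ge> M \<Longrightarrow> n \<ge> M \<Longrightarrow> norm (sqrt_iter (1::real) m - sqrt_iter 1 n) < e"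
      using CauchyD[OF C] by blast
    show "\<exists>M. \<forall>m\<ge>M. \<forall>n>m. dist (sqrt_iter x m) (sqrt_iter x n) < e"
    proof (intro exI allI impI)
      fix m n assume "m \<ge> M" "n > m"
      then have "norm (sqrt_iter x n - sqrt_iter x m) < e"
        using d[of m "n - m"] M[of n m] by auto
      then show "dist (sqrt_iter x m) (sqrt_iter x n) < e" by (simp add: dist_norm norm_minus_commute)
    qed
  qed
  then show ?thesis
    unfolding cosqrt_def using Cauchy_convergent_iff convergent_LIMSEQ_iff by blast
qed

lemma norm_cosqrt:
  fixes x :: "'a::{real_normed_algebra_1,banach}"
  assumes "norm x \<le> 1"
  shows "norm (cosqrt x) \<le> 1"
proof (rule Lim_norm_ubound[OF sequentially_bot sqrt_iter_tendsto[OF assms]])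
  show "\<forall>\<^sub>F n in sequentially. norm (sqrt_iter x n) \<le> 1"
    by (intro always_eventually allI order_trans[OF norm_sqrt_iter[OF assms] sqrt_iter_real(2)])
qed

lemma cosqrt_fixpoint:
  fixes x :: "'a::{real_normed_algebra_1,banach}"
  assumes "norm x \<le> 1"
  shows "2 *\<^sub>R cosqrt x = x + cosqrt x * cosqrt x"
proof -
  have "(\<lambda>n. sqrt_iter x (Suc n)) \<longlonglongrightarrow> (1/2) *\<^sub>R (x + cosqrt x * cosqrt x)"
    unfolding sqrt_iter.simps by (intro tendsto_intros sqrt_iter_tendsto assms)
  moreover have "(\<lambda>n. sqrt_iter x (Suc n)) \<longlonglongrightarrow> cosqrt x"
    using sqrt_iter_tendsto[OF assms] by (rule LIMSEQ_Suc)
  ultimately have "cosqrt x = (1/2) *\<^sub>R (x + cosqrt x * cosqrt x)"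
    using LIMSEQ_unique by blast
  then show ?thesis by (metis scaleR_half_double scaleR_2 scaleR_add_right)
qed

lemma cosqrt_square:
  fixes x :: "'a::{real_normed_algebra_1,banach}"
  assumes "norm x \<le> 1"
  shows "(1 - cosqrt x) * (1 - cosqrt x) = 1 - x"
  using cosqrt_fixpoint[OF assms] by (simp add: algebra_simps scaleR_2)

text \<open>This is how properties pass from \<open>x\<close> to its root: commutation,
  self-adjointness and membership in an algebra without unit are closed conditions preserved by one
  step of the iteration.\<close>

lemma cosqrt_in:
  fixes x :: "'a::{real_normed_algebra_1,banach}"
  assumes "norm x \<le> 1" "closed B" "0 \<in> B" "\<And>y. y \<in> B \<Longrightarrow> (1/2) *\<^sub>R (x + y * y) \<in> B"
  shows "cosqrt x \<in> B"
proof -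
  have "sqrt_iter x n \<in> B" for n
    by (induction n) (use assms in auto)
  then show ?thesis
    using closed_sequentially[OF assms(2)] sqrt_iter_tendsto[OF assms(1)] by blast
qed

lemma cosqrt_commute:
  fixes x :: "'a::{real_normed_algebra_1,banach}"
  assumes "norm x \<le> 1" "x * c = c * x"
  shows "cosqrt x * c = c * cosqrt x"
proof -
  have "closed {y. y * c = c * y}"
    by (intro closed_Collect_eq continuous_intros)
  moreover have "((1/2) *\<^sub>R (x + y * y)) * c = c * ((1/2) *\<^sub>R (x + y * y))" if "y * c = c * y" for y
  proof -
    have "y * y * c = c * (y * y)" using that by (metis mult.assoc)
    then show ?thesis using assms by (simp add: algebra_simps)
  qed
  ultimately show ?thesis using cosqrt_in[of x "{y. y * c = c * y}"] assms by auto
qed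

section \<open>C*-algebras and their order\<close>

locale cstar_algebra =
  fixes cs :: "complex \<Rightarrow> 'a::{real_normed_algebra_1,banach} \<Rightarrow> 'a" and st :: "'a \<Rightarrow> 'a"
  assumes ops: "cstar_ops cs st"
begin

section \<open>Arithmetic of the complex scalars and the involution\<close>

lemma cs_add_right: "cs c (x + y) = cs c x + cs c y"
  and cs_add_left: "cs (a + b) x = cs a x + cs b x"
  and cs_cs: "cs a (cs b x) = cs (a * b) x"
  and cs_of_real: "cs (complex_of_real r) x = r *\<^sub>R x"
  and cs_mult_left: "cs c x * y = cs c (x * y)"
  and cs_mult_right: "x * cs c y = cs c (x * y)"
  and norm_cs: "norm (cs c x) = cmod c * norm x"
  and st_st [simp]: "st (st x) = x"
  and st_add: "st (x + y) = st x + st y"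
  and st_cs: "st (cs c x) = cs (cnj c) (st x)"
  and st_mult: "st (x * y) = st y * st x"
  and norm_st_mult: "norm (st x * x) = (norm x)\<^sup>2"
  using ops unfolding cstar_ops_def by (blast | metis)+

lemma cs_1 [simp]: "cs 1 x = x" using cs_of_real[of 1 x] by simp
lemma cs_0 [simp]: "cs 0 x = 0" using cs_of_real[of 0 x] by simp
lemma cs_0_right [simp]: "cs c 0 = 0" by (metis cs_0 cs_cs mult_zero_right)
lemma cs_minus_left: "cs (- c) x = - cs c x"
  by (metis add.right_inverse add_eq_0_iff cs_0 cs_add_left)
lemma cs_minus_right: "cs c (- x) = - cs c x"
  by (metis add.right_inverse add_eq_0_iff cs_0_right cs_add_right)
lemma cs_diff_right: "cs c (x - y) = cs c x - cs c y"
  by (metis cs_add_right cs_minus_right diff_conv_add_uminus)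
lemma cs_diff_left: "cs (a - b) x = cs a x - cs b x"
  by (metis cs_add_left cs_minus_left diff_conv_add_uminus)
lemma cs_sum_right: "cs c (sum f A) = (\<Sum>i\<in>A. cs c (f i))"
  by (induction A rule: infinite_finite_induct) (auto simp: cs_add_right)
lemma cs_sum_left: "cs (sum f A) x = (\<Sum>i\<in>A. cs (f i) x)"
  by (induction A rule: infinite_finite_induct) (auto simp: cs_add_left)

lemma st_scaleR: "st (r *\<^sub>R x) = r *\<^sub>R st x"
  by (metis cs_of_real st_cs complex_cnj_complex_of_real)
lemma st_0 [simp]: "st 0 = 0" by (metis st_scaleR scaleR_zero_left)
lemma st_1 [simp]: "st 1 = 1" by (metis mult.left_neutral mult.right_neutral st_mult st_st)
lemma st_minus: "st (- x) = - st x"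
  by (metis add.right_inverse add_eq_0_iff st_0 st_add)
lemma st_diff: "st (x - y) = st x - st y"
  by (metis diff_conv_add_uminus st_add st_minus)
lemma st_sum: "st (sum f A) = (\<Sum>i\<in>A. st (f i))"
  by (induction A rule: infinite_finite_induct) (auto simp: st_add)

lemma norm_st [simp]: "norm (st x) = norm x"
proof -
  have *: "norm y \<le> norm (st y)" for y
  proof (cases "norm y = 0")
    case False
    have "norm y * norm y \<le> norm (st y) * norm y"
      using norm_st_mult[of y] norm_mult_ineq[of "st y" y] by (simp add: power2_eq_square)
    then show ?thesis using False by simp
  qed simp
  show ?thesis using *[of x] *[of "st x"] by simp
qed

lemma norm_mult_st: "norm (x * st x) = (norm x)\<^sup>2"
  using norm_st_mult[of "st x"] by simp

lemma norm_sa_square: "st x = x \<Longrightarrow> norm (x * x) = (norm x)\<^sup>2"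
  using norm_st_mult[of x] by simp

lemma tendsto_st [tendsto_intros]: "(f \<longlongrightarrow> l) F \<Longrightarrow> ((\<lambda>x. st (f x)) \<longlongrightarrow> st l) F"
  unfolding tendsto_iff dist_norm by (simp flip: st_diff)

lemma tendsto_cs [tendsto_intros]:
  assumes "(f \<longlongrightarrow> c) F" "(g \<longlongrightarrow> l) F"
  shows "((\<lambda>x. cs (f x) (g x)) \<longlongrightarrow> cs c l) F"
proof -
  have "((\<lambda>x. cs (f x - c) (g x) + cs c (g x - l)) \<longlongrightarrow> 0) F"
  proof (intro tendsto_add_zero)
    have "((\<lambda>x. cmod (f x - c) * norm (g x)) \<longlongrightarrow> cmod (c - c) * norm l) F"
      by (intro tendsto_intros assms)
    then show "((\<lambda>x. cs (f x - c) (g x)) \<longlongrightarrow> 0) F"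
      by - (rule tendsto_norm_zero_cancel, simp add: norm_cs)
    have "((\<lambda>x. cmod c * norm (g x - l)) \<longlongrightarrow> cmod c * norm (l - l)) F"
      by (intro tendsto_intros assms)
    then show "((\<lambda>x. cs c (g x - l)) \<longlongrightarrow> 0) F"
      by - (rule tendsto_norm_zero_cancel, simp add: norm_cs)
  qed
  then show ?thesis
    by - (rule LIM_zero_cancel, simp add: cs_diff_left cs_diff_right)
qed

lemma continuous_on_st [continuous_intros]: "continuous_on A f \<Longrightarrow> continuous_on A (\<lambda>x. st (f x))"
  by (auto simp: continuous_on_def intro: tendsto_st)

lemma st_cosqrt:
  assumes "norm x \<le> 1" "st x = x"
  shows "st (cosqrt x) = cosqrt x"
proof -
  have "closed {y. st y = y}" by (intro closed_Collect_eq continuous_intros)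
  then show ?thesis
    using cosqrt_in[of x "{y. st y = y}"] assms
    by (auto simp: st_scaleR st_add st_mult)
qed

text \<open>\<open>w = a + i b\<close> satisfies \<open>st w * w = s\<close>, so its norm is
  \<open>sqrt s\<close>, and \<open>a\<close> is its real part. This takes the place of the
  functional calculus wherever two commuting roots have squares adding up to a scalar.\<close>

lemma norm_commuting_pair:
  assumes "st a = a" "st b = b" "a * b = b * a" "a * a + b * b = s *\<^sub>R 1" "0 \<le> s"
  shows "norm a \<le> sqrt s"
proof -
  define w where "w = a + cs \<i> b"
  have sw: "st w = a - cs \<i> b" by (simp add: w_def st_add st_cs assms cs_minus_left)
  have "st w * w = a * a + cs \<i> (a * b) - (cs \<i> (b * a) + cs (\<i> * \<i>) (b * b))"
    unfolding sw by (simp add: w_def left_diff_distrib distrib_left cs_mult_left cs_mult_right cs_cs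
        cs_add_right cs_diff_right cs_minus_left)
  also have "\<dots> = s *\<^sub>R 1"
    by (simp add: assms(3) cs_minus_left flip: assms(4))
  finally have "st w * w = s *\<^sub>R 1" .
  then have "(norm w)\<^sup>2 = s" using norm_st_mult[of w] assms(5) by simp
  then have w: "norm w = sqrt s" by (metis norm_ge_zero real_sqrt_unique)
  have "2 *\<^sub>R a = w + st w" unfolding sw by (simp add: w_def scaleR_2)
  then have "2 * norm a \<le> norm w + norm (st w)"
    by (metis abs_numeral norm_scaleR norm_triangle_ineq)
  then show ?thesis by (simp add: w)
qed

text \<open>For self-adjoint \<open>a\<close> the inequality says that the spectrum lies between 0
  and 2\<parallel>a\<parallel>, which is positivity. In this form sums and limits of positive
  elements are easy, and the hard fact is the positivity of \<open>st y * y\<close>.\<close>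

definition pos :: "'a \<Rightarrow> bool"
  where "pos a \<longleftrightarrow> st a = a \<and> norm (norm a *\<^sub>R 1 - a) \<le> norm a"

lemma pos_sa: "pos a \<Longrightarrow> st a = a" by (simp add: pos_def)

lemma pos_0 [simp]: "pos 0" by (simp add: pos_def)

lemma pos_scaleR: "pos a \<Longrightarrow> 0 \<le> r \<Longrightarrow> pos (r *\<^sub>R a)"
  using mult_left_mono[of "norm (norm a *\<^sub>R 1 - a)" "norm a" r]
  by (simp add: pos_def st_scaleR flip: scaleR_scaleR scaleR_diff_right)

text \<open>After scaling, the root \<open>k\<close> of \<open>1 - b * b\<close> commutes with
  \<open>b\<close> and \<open>k * k + b * b = 1\<close>. Hence \<parallel>k\<parallel> \<le> 1, and
  \<parallel>1 - b * b\<parallel> = \<parallel>k\<parallel>^2 \<le> 1.\<close>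

lemma pos_square:
  assumes "st a = a" shows "pos (a * a)"
proof (cases "a = 0")
  case False
  define b where "b = (1 / norm a) *\<^sub>R a"
  have b: "st b = b" "norm b = 1" using False assms by (auto simp: b_def st_scaleR)
  define x where "x = b * b"
  have x: "norm x = 1" "st x = x"
    using b norm_sa_square[of b] by (auto simp: x_def st_mult)
  define k where "k = 1 - cosqrt x"
  have k: "st k = k" "k * k = 1 - x"
    using x st_cosqrt[of x] cosqrt_square[of x] by (auto simp: k_def st_diff)
  have "cosqrt x * b = b * cosqrt x"
    by (intro cosqrt_commute) (use x(1) in simp, simp add: x_def mult.assoc)
  then have "k * b = b * k" by (simp add: k_def algebra_simps)
  then have "norm k \<le> sqrt 1"
    by (intro norm_commuting_pair[of k b]) (use k b in \<open>auto simp: x_def\<close>)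
  then have "norm (1 - x) \<le> 1"
    using norm_sa_square[OF k(1)] k(2) by (simp add: power_le_one)
  then have "pos x" using x by (simp add: pos_def)
  moreover have "a * a = (norm a * norm a) *\<^sub>R x"
    using False by (simp add: x_def b_def)
  ultimately show ?thesis using pos_scaleR by simp
qed simp

text \<open>A root that lies in every closed set stable under the operations of the iteration
for a suitably normalised argument.\<close>
lemma root_scaled:
  assumes "st a = a" "0 < t" "norm (t *\<^sub>R 1 - a) \<le> t"
  obtains b where "st b = b" "b * b = a" "\<And>c. a * c = c * a \<Longrightarrow> b * c = c * b"
    "b = sqrt t *\<^sub>R (1 - cosqrt (1 - (1/t) *\<^sub>R a))" "norm (1 - (1/t) *\<^sub>R a) \<le> 1"
proof -
  define x where "x = 1 - (1/t) *\<^sub>R a"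
  have "x = (1/t) *\<^sub>R (t *\<^sub>R 1 - a)" using assms by (simp add: x_def algebra_simps)
  then have x: "norm x \<le> 1" using assms by simp
  have sx: "st x = x" using assms by (simp add: x_def st_diff st_scaleR)
  define b where "b = sqrt t *\<^sub>R (1 - cosqrt x)"
  have "b * b = t *\<^sub>R (1 - x)"
    using assms by (simp add: b_def cosqrt_square[OF x])
  then have 1: "b * b = a" using assms by (simp add: x_def)
  have 2: "st b = b" by (simp add: b_def st_scaleR st_diff st_cosqrt x sx)
  have 3: "b * c = c * b" if "a * c = c * a" for c
  proof -
    have "x * c = c * x" using that by (simp add: x_def algebra_simps)
    from cosqrt_commute[OF x this] show ?thesis by (simp add: b_def algebra_simps)
  qed
  show thesis using that[OF 2 1 3] b_def x x_def by blast
qed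

text \<open>The scalar in the definition may be any bound of the norm; in the reverse direction
  \<open>a\<close> is recognised as the square of a self-adjoint root.\<close>

lemma pos_iff:
  assumes "st a = a" "norm a \<le> t"
  shows "pos a \<longleftrightarrow> norm (t *\<^sub>R 1 - a) \<le> t"
proof
  assume "pos a"
  have "t *\<^sub>R 1 - a = (norm a *\<^sub>R 1 - a) + (t - norm a) *\<^sub>R 1" by (simp add: algebra_simps)
  then have "norm (t *\<^sub>R 1 - a) \<le> norm (norm a *\<^sub>R 1 - a) + norm ((t - norm a) *\<^sub>R (1::'a))"
    by (metis norm_triangle_ineq)
  then show "norm (t *\<^sub>R 1 - a) \<le> t" using \<open>pos a\<close> assms by (simp add: pos_def)
next
  assume *: "norm (t *\<^sub>R 1 - a) \<le> t"
  show "pos a"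
  proof (cases "t = 0")
    case False
    then have "0 < t" using assms norm_ge_zero[of a] by linarith
    from root_scaled[OF assms(1) this *] show ?thesis using pos_square by metis
  qed (use assms in auto)
qed

lemma pos_add:
  assumes "pos a" "pos b" shows "pos (a + b)"
proof -
  have "norm ((norm a + norm b) *\<^sub>R 1 - (a + b)) \<le> norm a + norm b"
  proof -
    have "(norm a + norm b) *\<^sub>R 1 - (a + b) = (norm a *\<^sub>R 1 - a) + (norm b *\<^sub>R 1 - b)"
      by (simp add: algebra_simps)
    moreover have "norm (norm a *\<^sub>R 1 - a) + norm (norm b *\<^sub>R 1 - b) \<le> norm a + norm b"
      using assms by (intro add_mono) (auto simp: pos_def)
    ultimately show ?thesis by (metis norm_triangle_le)
  qed
  then show ?thesis
    using pos_iff[of "a + b" "norm a + norm b"] assms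
    by (simp add: st_add pos_sa norm_triangle_ineq)
qed

lemma pos_sum: "(\<And>i. i \<in> A \<Longrightarrow> pos (f i)) \<Longrightarrow> pos (sum f A)"
  by (induction A rule: infinite_finite_induct) (auto intro: pos_add)

lemma pos_norm_diff:
  assumes "st a = a" "norm a \<le> t" shows "pos (t *\<^sub>R 1 - a)"
proof -
  have t: "0 \<le> t" using assms norm_ge_zero[of a] by linarith
  have "norm (t *\<^sub>R 1 - a) \<le> 2 * t"
    using norm_triangle_ineq4[of "t *\<^sub>R 1" a] assms t by simp
  moreover have "norm ((2 * t) *\<^sub>R 1 - (t *\<^sub>R 1 - a)) \<le> 2 * t"
  proof -
    have eq: "(2 * t) *\<^sub>R 1 - (t *\<^sub>R 1 - a) = t *\<^sub>R 1 + a"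
      unfolding mult_2 scaleR_add_left by simp
    show ?thesis unfolding eq using norm_triangle_ineq[of "t *\<^sub>R 1" a] assms t by simp
  qed
  ultimately show ?thesis using pos_iff[of "t *\<^sub>R 1 - a" "2 * t"] assms by (simp add: st_diff st_scaleR)
qed

lemma pos_root:
  assumes "pos a"
  obtains b where "pos b" "b * b = a" "\<forall>c. a * c = c * a \<longrightarrow> b * c = c * b"
proof (cases "a = 0")
  case True then show ?thesis using that[of 0] by simp
next
  case False
  then have t: "0 < norm a" by simp
  from assms have a: "st a = a" "norm (norm a *\<^sub>R 1 - a) \<le> norm a" by (auto simp: pos_def)
  let ?x = "1 - (1 / norm a) *\<^sub>R a"
  show ?thesis
  proof (rule root_scaled[OF a(1) t a(2)])
    fix b assume b: "b * b = a" "\<And>c. a * c = c * a \<Longrightarrow> b * c = c * b"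
      "b = sqrt (norm a) *\<^sub>R (1 - cosqrt ?x)" "norm ?x \<le> 1"
    have "pos (1 *\<^sub>R 1 - cosqrt ?x)"
      by (intro pos_norm_diff st_cosqrt norm_cosqrt b) (simp add: st_diff st_scaleR a)
    then have "pos b" unfolding b(3) by (intro pos_scaleR) simp_all
    with b that show ?thesis by blast
  qed
qed

lemma pos_root_sa:
  assumes "pos a"
  obtains b where "st b = b" "b * b = a" "\<forall>c. a * c = c * a \<longrightarrow> b * c = c * b"
proof -
  obtain b where "pos b" "b * b = a" "\<forall>c. a * c = c * a \<longrightarrow> b * c = c * b"
    using pos_root[OF assms] by blast
  then show thesis using that[OF pos_sa] by blast
qed

text \<open>The roots \<open>b\<close> of \<open>a\<close> and \<open>c\<close> of
  \<open>s - a\<close> commute, and their squares add up to \<open>s\<close>.\<close>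

lemma norm_le_of_pos:
  assumes "pos a" "pos (s *\<^sub>R 1 - a)" "0 \<le> s" shows "norm a \<le> s"
proof -
  obtain b where b: "st b = b" "b * b = a" "\<forall>c. a * c = c * a \<longrightarrow> b * c = c * b"
    using pos_root_sa[OF assms(1)] by blast
  obtain c where c: "st c = c" "c * c = s *\<^sub>R 1 - a"
    "\<forall>d. (s *\<^sub>R 1 - a) * d = d * (s *\<^sub>R 1 - a) \<longrightarrow> c * d = d * c"
    using pos_root_sa[OF assms(2)] by blast
  have "c * b = b * c"
    by (rule c(3)[rule_format]) (simp add: algebra_simps flip: b(2))
  then have "norm b \<le> sqrt s"
    using norm_commuting_pair[OF b(1) c(1) _ _ assms(3)] by (simp add: b(2) c(2))
  then have "(norm b)\<^sup>2 \<le> s" using assms(3) by (metis norm_ge_zero power_mono real_sqrt_pow2)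
  then show ?thesis using norm_sa_square[OF b(1)] b(2) by simp
qed

lemma norm_mono_pos:
  assumes "pos a" "pos (b - a)" shows "norm a \<le> norm b"
proof (rule norm_le_of_pos[OF assms(1)])
  have "pos b" using pos_add[OF assms] by simp
  then have "pos (norm b *\<^sub>R 1 - b)" using pos_norm_diff pos_sa by blast
  from pos_add[OF this assms(2)] show "pos (norm b *\<^sub>R 1 - a)" by simp
qed simp

text \<open>For commuting roots \<open>b\<close>, \<open>c\<close> of \<open>s - a\<close> and
  \<open>s + a\<close> one has \<open>a * a + (b * c) * (b * c) = s * s\<close>, so \<open>a\<close>
  and \<open>b * c\<close> form a commuting pair.\<close>

lemma norm_le_of_pos_pair:
  assumes "st a = a" "pos (s *\<^sub>R 1 - a)" "pos (s *\<^sub>R 1 + a)" "0 \<le> s" shows "norm a \<le> s"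
proof -
  obtain b where b: "st b = b" "b * b = s *\<^sub>R 1 - a" "\<forall>c. (s *\<^sub>R 1 - a) * c = c * (s *\<^sub>R 1 - a) \<longrightarrow> b * c = c * b"
    using pos_root_sa[OF assms(2)] by blast
  obtain c where c: "st c = c" "c * c = s *\<^sub>R 1 + a"
    "\<forall>d. (s *\<^sub>R 1 + a) * d = d * (s *\<^sub>R 1 + a) \<longrightarrow> c * d = d * c"
    using pos_root_sa[OF assms(3)] by blast
  have cb: "c * b = b * c"
  proof (rule c(3)[rule_format])
    have "(s *\<^sub>R 1 - a) * b = b * (s *\<^sub>R 1 - a)" by (metis b(2) mult.assoc)
    then show "(s *\<^sub>R 1 + a) * b = b * (s *\<^sub>R 1 + a)" by (simp add: algebra_simps)
  qed
  have "(b * c) * (b * c) = b * (c * b) * c" by (simp add: mult.assoc)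
  also have "\<dots> = (b * b) * (c * c)" by (simp add: cb mult.assoc)
  also have "\<dots> = (s * s) *\<^sub>R 1 - a * a"
    by (simp add: b c algebra_simps)
  finally have "a * a + (b * c) * (b * c) = (s * s) *\<^sub>R 1" by simp
  moreover have "a * (b * c) = b * c * a"
  proof -
    have "(s *\<^sub>R 1 - a) * b = b * (s *\<^sub>R 1 - a)" by (metis b(2) mult.assoc)
    then have ab: "a * b = b * a" by (simp add: algebra_simps)
    have "(s *\<^sub>R 1 + a) * c = c * (s *\<^sub>R 1 + a)" by (metis c(2) mult.assoc)
    then have ac: "a * c = c * a" by (simp add: algebra_simps)
    show ?thesis by (metis ab ac mult.assoc)
  qed
  ultimately have "norm a \<le> sqrt (s * s)"
    using norm_commuting_pair[of a "b * c" "s * s"] assms b(1) c(1) cb by (simp add: st_mult)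
  then show ?thesis using assms(4) by simp
qed

text \<open>With \<open>r = |a|\<close> for \<open>a = y\<^sup>* y\<close>, the element \<open>x = y (r - a)\<close> satisfies \<open>x\<^sup>* x = - p\<^sup>2\<close>.
As \<open>x\<^sup>* x + x x\<^sup>*\<close> is positive, so is \<open>c = x x\<^sup>*\<close>, and comparing the norm of
\<open>c (s + c)\<^sup>2 = x (s - p\<^sup>2)\<^sup>2 x\<^sup>*\<close>, \<open>s = \<parallel>c\<parallel>\<close>, on both sides forces \<open>x = 0\<close>.\<close>
lemma pos_st_mult: "pos (st y * y)"
proof -
  define a where "a = st y * y"
  have sa: "st a = a" by (simp add: a_def st_mult)
  have "pos (a * a)" by (rule pos_square[OF sa])
  obtain r where r: "pos r" "r * r = a * a" "\<forall>c. a * a * c = c * (a * a) \<longrightarrow> r * c = c * r"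
    using pos_root[OF \<open>pos (a * a)\<close>] by blast
  have ra: "r * a = a * r" by (rule r(3)[rule_format]) (simp add: mult.assoc)
  obtain q where q: "st q = q" "q * q = r" "\<forall>c. r * c = c * r \<longrightarrow> q * c = c * q"
    using pos_root_sa[OF r(1)] by blast
  define x where "x = y * (r - a)"
  define p where "p = q * (r - a)"
  have qa: "q * (r - a) = (r - a) * q" by (rule q(3)[rule_format]) (use ra in \<open>simp add: algebra_simps\<close>)
  have sra: "st (r - a) = r - a" by (simp add: st_diff sa pos_sa[OF r(1)])
  have sp: "st p = p" by (simp add: p_def st_mult sra q(1) qa)
  have xx: "st x * x = - (p * p)"
  proof -
    have "st x * x = (r - a) * a * (r - a)" unfolding x_def st_mult sra by (simp add: a_def mult.assoc)
    also have "(r - a) * a = - ((r - a) * r)" using r(2) ra by (simp add: algebra_simps)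
    also have "- ((r - a) * r) * (r - a) = - ((r - a) * (r * (r - a)))" by (simp add: mult.assoc)
    also have "(r - a) * (r * (r - a)) = p * p"
      unfolding p_def by (metis q(2) qa mult.assoc)
    finally show ?thesis .
  qed
  \<comment> \<open>Up to the factors 2 and -2 the real and imaginary parts of \<open>x\<close>;
    their squares add up to twice \<open>st x * x + x * st x\<close>.\<close>
  define h k where "h = x + st x" and "k = cs \<i> (x - st x)"
  have hk: "st h = h" "st k = k"
    by (simp_all add: h_def k_def st_add st_cs st_diff cs_minus_left flip: cs_minus_right)
  have "h * h + k * k = 2 *\<^sub>R (st x * x + x * st x)"
    by (simp add: h_def k_def cs_mult_left cs_mult_right cs_cs cs_minus_left cs_diff_right
        algebra_simps scaleR_2)
  moreover have "pos (h * h + k * k)" using hk by (intro pos_add pos_square)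
  ultimately have "pos (2 *\<^sub>R (st x * x + x * st x))" by simp
  from pos_scaleR[OF this, of "1/2"] have "pos (st x * x + x * st x)" by simp
  from pos_add[OF this pos_square[OF sp]] have cp: "pos (x * st x)" by (simp add: xx)
  define c where "c = x * st x"
  define s where "s = (norm x)\<^sup>2"
  have nc: "norm c = s" by (simp add: c_def s_def norm_mult_st)
  have np: "norm (p * p) = s" using norm_st_mult[of x] by (simp add: xx s_def)
  have s0: "0 \<le> s" by (simp add: s_def)
  have sc: "st c = c" using cp pos_sa c_def by blast
  define z where "z = s *\<^sub>R 1 - p * p"
  have eq: "c * (s *\<^sub>R 1 + c) * (s *\<^sub>R 1 + c) = x * (z * z) * st x"
  proof -
    have 1: "st x * (s *\<^sub>R 1 + c) = z * st x"
      unfolding c_def z_def using xx by (simp add: algebra_simps flip: mult.assoc)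
    have "c * (s *\<^sub>R 1 + c) * (s *\<^sub>R 1 + c) = x * (st x * (s *\<^sub>R 1 + c)) * (s *\<^sub>R 1 + c)"
      by (simp add: c_def mult.assoc)
    also have "\<dots> = x * z * (st x * (s *\<^sub>R 1 + c))" by (simp add: 1 mult.assoc)
    also have "\<dots> = x * (z * z) * st x" by (simp add: 1 mult.assoc)
    finally show ?thesis .
  qed
  have "norm z \<le> s"
    using pos_square[OF sp] np by (simp add: pos_def z_def)
  then have "norm (z * z) \<le> s * s"
    using norm_mult_ineq[of z z] mult_mono[of "norm z" s "norm z" s] s0 by simp
  have "norm (x * (z * z) * st x) \<le> norm x * norm (z * z) * norm x"
    using norm_mult_ineq[of "x * (z * z)" "st x"] mult_right_mono[OF norm_mult_ineq[of x "z * z"], of "norm x"]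
    by simp
  also have "\<dots> = s * norm (z * z)" by (simp add: s_def power2_eq_square)
  also have "\<dots> \<le> s * (s * s)" using \<open>norm (z * z) \<le> s * s\<close> s0 by (intro mult_left_mono)
  finally have up: "norm (c * (s *\<^sub>R 1 + c) * (s *\<^sub>R 1 + c)) \<le> s * (s * s)" by (simp add: eq)
  have pc: "pos c" using cp by (simp add: c_def)
  have c3: "pos (c * c * c)"
  proof -
    obtain d where d: "st d = d" "d * d = c" "\<forall>e. c * e = e * c \<longrightarrow> d * e = e * d"
      using pos_root_sa[OF pc] by blast
    have "d * c = c * d" by (rule d(3)[rule_format]) simp
    then have "c * c * c = (c * d) * (c * d)" by (metis d(2) mult.assoc)
    moreover have "st (c * d) = c * d" using d(1) sc \<open>d * c = c * d\<close> by (simp add: st_mult)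
    ultimately show ?thesis using pos_square by metis
  qed
  \<comment> \<open>\<open>c (s + c)^2\<close> exceeds \<open>2 s c^2\<close> by the positive
    element \<open>s^2 c + c^3\<close>, so its norm is at least \<open>2 s^3\<close>, against the
    upper bound \<open>s^3\<close>.\<close>
  have "norm ((2 * s) *\<^sub>R (c * c)) \<le> norm (c * (s *\<^sub>R 1 + c) * (s *\<^sub>R 1 + c))"
  proof (rule norm_mono_pos)
    show "pos ((2 * s) *\<^sub>R (c * c))" using pos_square[OF sc] s0 by (intro pos_scaleR) auto
    have "c * (s *\<^sub>R 1 + c) * (s *\<^sub>R 1 + c) - (2 * s) *\<^sub>R (c * c) = (s * s) *\<^sub>R c + c * c * c"
      unfolding mult_2 scaleR_add_left by (simp add: algebra_simps)
    then show "pos (c * (s *\<^sub>R 1 + c) * (s *\<^sub>R 1 + c) - (2 * s) *\<^sub>R (c * c))"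
      using pos_add[OF pos_scaleR[OF pc, of "s * s"] c3] s0 by simp
  qed
  then have "2 * s * (s * s) \<le> s * (s * s)"
    using up norm_sa_square[OF sc] nc s0 by (simp add: power2_eq_square)
  then have "s * (s * s) \<le> 0" by simp
  then have "s = 0" using s0 by (metis mult_pos_pos not_less order_le_less)
  then have "x = 0" by (simp add: s_def)
  then have "a * (r - a) = 0" by (metis a_def x_def mult.assoc mult_zero_right)
  then have "a * r = a * a" by (simp add: algebra_simps)
  then have "(r - a) * (r - a) = 0" using r(2) ra by (simp add: algebra_simps)
  then have "r - a = 0" using norm_sa_square[OF sra] by simp
  then show ?thesis using r(1) by (simp add: a_def)
qed

lemma pos_mult_st: "pos (y * st y)"
  using pos_st_mult[of "st y"] by simp

lemma pos_conj:
  assumes "pos a" shows "pos (st c * a * c)"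
proof -
  obtain b where "st b = b" "b * b = a" using pos_root_sa[OF assms] by metis
  then have "st c * a * c = st (b * c) * (b * c)" by (metis st_mult mult.assoc)
  then show ?thesis using pos_st_mult by metis
qed

lemma pos_mult_commute:
  assumes "pos a" "pos b" "a * b = b * a" shows "pos (a * b)"
proof -
  obtain c where c: "st c = c" "c * c = a" "\<forall>d. a * d = d * a \<longrightarrow> c * d = d * c" using pos_root_sa[OF assms(1)] by blast
  have "a * b = st c * b * c" using c assms(3) by (metis mult.assoc)
  then show ?thesis using pos_conj[OF assms(2)] by metis
qed

lemma pos_antisym: "pos a \<Longrightarrow> pos (- a) \<Longrightarrow> a = 0"
  using norm_le_of_pos[of a 0] by simp

end

section \<open>Powers of positive contractions, absolute values and local units\<close>

context cstar_algebra
begin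

lemma pos_closed:
  assumes "f \<longlonglongrightarrow> l" "\<And>n. pos (f n)" shows "pos l"
proof -
  have "(\<lambda>n. st (f n)) \<longlonglongrightarrow> st l" by (intro tendsto_intros assms)
  moreover have "(\<lambda>n. st (f n)) = f" using assms(2) pos_sa by blast
  ultimately have "st l = l" using assms(1) LIMSEQ_unique by metis
  moreover have "norm (norm l *\<^sub>R 1 - l) \<le> norm l"
    by (rule LIMSEQ_le[of "\<lambda>n. norm (norm (f n) *\<^sub>R 1 - f n)" _ "\<lambda>n. norm (f n)"])
      (use assms in \<open>auto intro!: tendsto_intros simp: pos_def\<close>)
  ultimately show ?thesis by (simp add: pos_def)
qed

lemma pos_1: "pos 1" using pos_square[of 1] by simp

lemma pos_power: "pos y \<Longrightarrow> pos (y ^ n)"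
  by (induction n) (auto simp: pos_1 power_commutes intro: pos_mult_commute)

lemma pos_one_minus: "st a = a \<Longrightarrow> norm a \<le> 1 \<Longrightarrow> pos (1 - a)"
  using pos_norm_diff[of a 1] by simp

lemma norm_le_one_of_pos: "pos a \<Longrightarrow> pos (1 - a) \<Longrightarrow> norm a \<le> 1"
  using norm_le_of_pos[of a 1] by simp

lemma one_minus_times_geometric: "(1 - y) * (\<Sum>j<n. y ^ j) = 1 - y ^ n" for y :: 'a
  by (induction n) (simp_all add: distrib_left left_diff_distrib)

lemma pos_geometric: "pos y \<Longrightarrow> pos (\<Sum>j<n. y ^ j)"
  by (intro pos_sum pos_power)

text \<open>Summing the decreasing sequence \<open>y\<^sup>j (1 - y)\<close> telescopes to at most \<open>1\<close>.\<close>
lemma norm_power_times_complement: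
  assumes "pos y" "norm y \<le> 1"
  shows "norm (y ^ k * (1 - y)) \<le> 1 / (real k + 1)"
proof -
  have q: "pos (1 - y)" using assms pos_one_minus pos_sa by blast
  define a where "a j = y ^ j * (1 - y)" for j
  have comm: "y ^ j * (1 - y) = (1 - y) * y ^ j" for j by (simp add: algebra_simps power_commutes)
  have a: "pos (a j)" for j unfolding a_def by (intro pos_mult_commute pos_power assms q comm)
  have step: "pos (a j - a (Suc j))" for j
  proof -
    have "a j - a (Suc j) = a j * (1 - y)"
      unfolding a_def power_Suc2 by (simp add: algebra_simps)
    moreover have "a j * (1 - y) = (1 - y) * a j" unfolding a_def by (metis comm mult.assoc)
    ultimately show ?thesis using pos_mult_commute[OF a q] by simp
  qed
  have mono: "pos (a j - a (j + i))" for j i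
  proof (induction i)
    case (Suc i)
    from pos_add[OF this step[of "j + i"]] show ?case by simp
  qed simp
  have tel: "(\<Sum>j<n. a j) = 1 - y ^ n" for n
    by (induction n) (simp_all add: a_def power_Suc2 algebra_simps del: power_Suc)
  have "(\<Sum>j<Suc k. a j - a k) = 1 - y ^ Suc k - (real k + 1) *\<^sub>R a k"
    unfolding sum_subtractf tel by (simp add: scaleR_conv_of_real add.commute del: power_Suc)
  moreover have "pos (\<Sum>j<Suc k. a j - a k)"
  proof (intro pos_sum)
    fix j assume "j \<in> {..<Suc k}"
    then show "pos (a j - a k)" using mono[of j "k - j"] by simp
  qed
  ultimately have "pos (1 - (real k + 1) *\<^sub>R a k)"
    using pos_add[of "1 - y ^ Suc k - (real k + 1) *\<^sub>R a k" "y ^ Suc k"] pos_power[OF assms(1)]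
    by (simp del: power_Suc)
  then have "norm ((real k + 1) *\<^sub>R a k) \<le> 1"
    by (intro norm_le_one_of_pos pos_scaleR a) auto
  then have "(real k + 1) * norm (a k) \<le> 1" by simp
  then have "norm (a k) \<le> 1 / (real k + 1)" by (simp only: field_simps)
  then show ?thesis by (simp add: a_def)
qed

lemma norm_mono_pos_square:
  assumes "pos (b - st a * a)" shows "(norm a)\<^sup>2 \<le> norm b"
  using norm_mono_pos[OF pos_st_mult assms] by (simp add: norm_st_mult)

text \<open>The C*-identity doubles exponents, hence powers of two; large powers that have to keep
  their norm are chosen of this form.\<close>

lemma norm_power_sa:
  assumes "st a = a" shows "norm (a ^ (2 ^ n)) = norm a ^ (2 ^ n)"
proof (induction n)
  case (Suc n)
  have sp: "st (a ^ m) = a ^ m" for m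
    by (induction m) (auto simp: st_mult assms power_commutes)
  have "norm (a ^ (2 ^ Suc n)) = norm (a ^ (2 ^ n) * a ^ (2 ^ n))"
    by (simp add: mult_2 power_add)
  also have "\<dots> = (norm a ^ (2 ^ n))\<^sup>2" using norm_sa_square[OF sp] Suc by simp
  finally show ?case by (simp add: power_mult[symmetric] mult.commute)
qed simp

text \<open>Since \<open>c = r - a\<close> satisfies \<open>c\<^sup>2 = 2 r c\<close>, it is the limit of \<open>c (1 - (1 - r)\<^sup>k)
= c\<^sup>2 (1 + \<dots> + (1 - r)\<^sup>k\<^sup>-\<^sup>1) / 2\<close>.\<close>
lemma pos_abs_minus:
  assumes "pos r" "st a = a" "r * r = a * a" "r * a = a * r"
  shows "pos (r - a)"
proof -
  have key: "pos c" if r: "pos r" "norm r \<le> 1" and c: "st c = c" "c * c = 2 *\<^sub>R (r * c)" "r * c = c * r" for r c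
  proof -
    define y where "y = 1 - r"
    have y: "pos y" "norm y \<le> 1"
    proof -
      show "pos y" unfolding y_def using r pos_one_minus pos_sa by blast
      then show "norm y \<le> 1" using r by (intro norm_le_one_of_pos) (auto simp: y_def)
    qed
    have yc: "y * c = c * y" using c(3) by (simp add: y_def algebra_simps)
    have ync: "y ^ n * c = c * y ^ n" for n
      using yc by (metis power_commuting_commutes)
    have ync': "y ^ n * (c * z) = c * (y ^ n * z)" for n z
      using ync by (metis mult.assoc)
    have syn: "st (y ^ n) = y ^ n" for n using pos_sa pos_power y by blast
    have "pos (c - c * y ^ n)" for n
    proof -
      have "c - c * y ^ n = c * (1 - y) * (\<Sum>j<n. y ^ j)"
        unfolding mult.assoc one_minus_times_geometric by (simp add: right_diff_distrib)
      also have "c * (1 - y) = (1/2) *\<^sub>R (c * c)" using c by (simp add: y_def)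
      finally have e: "c - c * y ^ n = (1/2) *\<^sub>R ((c * c) * (\<Sum>j<n. y ^ j))" by simp
      have "pos ((c * c) * (\<Sum>j<n. y ^ j))"
      proof (rule pos_mult_commute[OF pos_square[OF c(1)] pos_geometric[OF y(1)]])
        have "c * c * y ^ j = y ^ j * (c * c)" for j by (metis ync mult.assoc)
        then show "c * c * (\<Sum>j<n. y ^ j) = (\<Sum>j<n. y ^ j) * (c * c)"
          by (simp add: sum_distrib_left sum_distrib_right)
      qed
      then show ?thesis unfolding e by (intro pos_scaleR) auto
    qed
    moreover have "(\<lambda>n. c * y ^ n) \<longlonglongrightarrow> 0"
    proof (rule tendsto_norm_zero_cancel)
      have b: "(norm (c * y ^ n))\<^sup>2 \<le> 2 * norm c * (1 / (real (n + n) + 1))" for n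
      proof -
        have "(norm (c * y ^ n))\<^sup>2 = norm (st (c * y ^ n) * (c * y ^ n))" by (simp add: norm_st_mult)
        also have "st (c * y ^ n) * (c * y ^ n) = c * c * y ^ (n + n)"
          by (simp add: st_mult syn c(1) power_add mult.assoc ync ync')
        also have "\<dots> = 2 *\<^sub>R (c * (y ^ (n + n) * (1 - y)))"
        proof -
          have "c * c * y ^ (n + n) = 2 *\<^sub>R (c * (r * y ^ (n + n)))" by (simp add: c mult.assoc)
          also have "r * y ^ (n + n) = y ^ (n + n) * (1 - y)"
          proof -
            have "y * y ^ (n+n) = y ^ (n+n) * y" by (rule power_commutes[symmetric])
            moreover have "r = 1 - y" by (simp add: y_def)
            ultimately show ?thesis by (metis left_diff_distrib right_diff_distrib mult_1_left mult_1_right)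
          qed
          finally show ?thesis .
        qed
        also have "norm \<dots> \<le> 2 * (norm c * norm (y ^ (n + n) * (1 - y)))"
          using norm_mult_ineq[of c] by simp
        also have "\<dots> \<le> 2 * (norm c * (1 / (real (n + n) + 1)))"
          using norm_power_times_complement[OF y, of "n + n"] by (intro mult_left_mono) auto
        finally show ?thesis by simp
      qed
      have "(\<lambda>n. 2 * norm c * (1 / (real (n + n) + 1))) \<longlonglongrightarrow> 0"
        by real_asymp
      then have "(\<lambda>n. (norm (c * y ^ n))\<^sup>2) \<longlonglongrightarrow> 0"
        by (rule tendsto_sandwich[OF _ _ tendsto_const, rotated 2]) (use b in auto)
      from tendsto_real_sqrt[OF this] show "(\<lambda>n. norm (c * y ^ n)) \<longlonglongrightarrow> 0" by simp
    qed
    then have "(\<lambda>n. c - c * y ^ n) \<longlonglongrightarrow> c - 0" by (intro tendsto_intros)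
    ultimately show "pos c" using pos_closed by (metis diff_zero)
  qed
  show ?thesis
  proof (cases "r = 0")
    case True
    then have "a = 0" using assms norm_sa_square[of a] by simp
    then show ?thesis using True by simp
  next
    case False
    define t where "t = norm r"
    have t: "0 < t" using False by (simp add: t_def)
    have "pos ((1/t) *\<^sub>R (r - a))"
    proof (rule key)
      show "pos ((1/t) *\<^sub>R r)" using t by (intro pos_scaleR assms) auto
      show "norm ((1/t) *\<^sub>R r) \<le> 1" using t by (simp add: t_def)
      show "st ((1/t) *\<^sub>R (r - a)) = (1/t) *\<^sub>R (r - a)"
        by (simp add: st_scaleR st_diff assms pos_sa[OF assms(1)])
      have "(r - a) * (r - a) = 2 *\<^sub>R (r * (r - a))" using assms(3,4) by (simp add: algebra_simps scaleR_2)
      then show "(1/t) *\<^sub>R (r - a) * (1/t) *\<^sub>R (r - a) = 2 *\<^sub>R ((1/t) *\<^sub>R r * (1/t) *\<^sub>R (r - a))"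
        by simp
      show "(1/t) *\<^sub>R r * (1/t) *\<^sub>R (r - a) = (1/t) *\<^sub>R (r - a) * (1/t) *\<^sub>R r"
        using assms(4) by (simp add: algebra_simps)
    qed
    from pos_scaleR[OF this, of t] t show ?thesis by simp
  qed
qed

text \<open>The root has a scalar part and need not lie in a non-unital algebra \<open>V\<close>;
  what survives is that it multiplies \<open>V\<close> into itself. In the application
  \<open>V\<close> is the relative commutant and \<open>a\<close> the square of \<open>b - m\<close>
  with \<open>b\<close> in \<open>V\<close> and a scalar \<open>m\<close>.\<close>

lemma pos_root_invariant:
  assumes "pos a" "subspace V" "closed V" "\<And>y. y \<in> V \<Longrightarrow> a * y \<in> V"
  obtains b where "pos b" "b * b = a" "\<forall>c. a * c = c * a \<longrightarrow> b * c = c * b" "\<forall>y\<in>V. b * y \<in> V"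
proof (cases "a = 0")
  case True then show ?thesis using that[of 0] assms(2) subspace_0 by auto
next
  case False
  then have t: "0 < norm a" by simp
  from assms have a: "st a = a" "norm (norm a *\<^sub>R 1 - a) \<le> norm a" by (auto simp: pos_def)
  let ?x = "1 - (1 / norm a) *\<^sub>R a"
  let ?B = "{z. \<forall>y\<in>V. z * y \<in> V}"
  show ?thesis
  proof (rule root_scaled[OF a(1) t a(2)])
    fix b assume b: "b * b = a" "\<And>c. a * c = c * a \<Longrightarrow> b * c = c * b"
      "b = sqrt (norm a) *\<^sub>R (1 - cosqrt ?x)" "norm ?x \<le> 1"
    have "pos (1 - cosqrt ?x)"
      by (intro pos_one_minus st_cosqrt norm_cosqrt b) (simp add: st_diff st_scaleR a)
    then have "pos b" unfolding b(3) by (intro pos_scaleR) simp_all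
    moreover have "cosqrt ?x \<in> ?B"
    proof (rule cosqrt_in[OF b(4)])
      have "closed (\<Inter>y\<in>V. (\<lambda>z. z * y) -` V)"
        by (intro closed_INT ballI closed_vimage continuous_intros assms)
      moreover have "(\<Inter>y\<in>V. (\<lambda>z. z * y) -` V) = ?B" by auto
      ultimately show "closed ?B" by simp
      show "0 \<in> ?B" using assms(2) subspace_0 by auto
      fix z assume z: "z \<in> ?B"
      have "(1/2) *\<^sub>R (?x + z * z) * y \<in> V" if "y \<in> V" for y
      proof -
        have "(1/2) *\<^sub>R (?x + z * z) * y = (1/2) *\<^sub>R (y - (1 / norm a) *\<^sub>R (a * y) + z * (z * y))"
          by (simp add: algebra_simps)
        moreover have "\<dots> \<in> V"
          by (intro subspace_scale subspace_add subspace_diff assms that) (use z that in auto)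
        ultimately show ?thesis by simp
      qed
      then show "(1/2) *\<^sub>R (?x + z * z) \<in> ?B" by blast
    qed
    then have "\<forall>y\<in>V. b * y \<in> V"
      unfolding b(3) using assms(2)
      by (auto simp: left_diff_distrib intro!: subspace_scale subspace_diff)
    ultimately show ?thesis using b that by blast
  qed
qed

lemma csubspace_subspace: "csubspace cs V \<Longrightarrow> subspace V"
  unfolding csubspace_def subspace_def by (metis cs_of_real)

lemma csubspace_diff: "csubspace cs V \<Longrightarrow> x \<in> V \<Longrightarrow> y \<in> V \<Longrightarrow> x - y \<in> V"
  using csubspace_subspace subspace_diff by blast

text \<open>With \<open>k = h h\<^sup>* / \<parallel>h\<parallel>\<^sup>2\<close> these are \<open>min (2 k) 1\<close> and \<open>max (2 k - 1) 0\<close>.\<close>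
lemma local_unit_pair:
  assumes D: "cstar_subalg cs st D" and h: "h \<in> D" "h \<noteq> 0"
  obtains y p where "y \<in> D" "p \<in> D" "p \<noteq> 0" "st (h * y) = h * y" "norm (h * y) = 1" "h * y * p = p"
proof -
  have cl: "closed D" and sub: "csubspace cs D" and mult: "\<And>x y. x \<in> D \<Longrightarrow> y \<in> D \<Longrightarrow> x * y \<in> D"
    and star: "\<And>x. x \<in> D \<Longrightarrow> st x \<in> D"
    using D by (auto simp: cstar_subalg_def banach_subalg_def)
  have rsub: "subspace D" using csubspace_subspace[OF sub] .
  define n where "n = (norm h)\<^sup>2"
  have n: "0 < n" using h by (simp add: n_def)
  define k where "k = (1/n) *\<^sub>R (h * st h)"
  have kD: "k \<in> D" unfolding k_def by (intro subspace_scale rsub mult star h)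
  have k: "pos k" "norm k = 1"
    using n by (auto simp: k_def norm_mult_st n_def intro!: pos_scaleR pos_mult_st)
  have k1: "pos (1 - k)" using k pos_sa by (intro pos_one_minus) auto
  \<comment> \<open>With \<open>b = 2 k - 1\<close> one has \<open>1 - x = b * b\<close>, so that
    \<open>Y = cosqrt x\<close> is \<open>1 - |b|\<close>. It lies in \<open>D\<close> because the
    iteration has no constant term.\<close>
  define x where "x = 4 *\<^sub>R (k * (1 - k))"
  have "pos x" unfolding x_def by (intro pos_scaleR pos_mult_commute k k1) (auto simp: algebra_simps)
  moreover have ex: "1 - x = (1 - 2 *\<^sub>R k) * (1 - 2 *\<^sub>R k)"
    by (simp add: x_def algebra_simps scaleR_2) (simp add: scaleR_2 flip: scaleR_scaleR[of 2 2, simplified])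
  have s2: "st (1 - 2 *\<^sub>R k) = 1 - 2 *\<^sub>R k" by (simp add: st_diff st_scaleR pos_sa[OF k(1)])
  then have "pos (1 - x)" unfolding ex by (rule pos_square)
  ultimately have x: "norm x \<le> 1" by (intro norm_le_one_of_pos)
  have sx: "st x = x" using \<open>pos x\<close> pos_sa by blast
  have xD: "x \<in> D" unfolding x_def right_diff_distrib mult_1_right
    by (intro subspace_scale subspace_diff rsub kD mult)
  define Y where "Y = cosqrt x"
  have Y: "norm Y \<le> 1" "st Y = Y" "2 *\<^sub>R Y = x + Y * Y"
    unfolding Y_def by (intro norm_cosqrt x st_cosqrt sx cosqrt_fixpoint)+
  have YD: "Y \<in> D" unfolding Y_def
    by (rule cosqrt_in[OF x cl]) (use rsub xD mult in \<open>auto intro!: subspace_scale subspace_add subspace_0\<close>)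
  define r where "r = 1 - Y"
  have r: "pos r" unfolding r_def by (intro pos_one_minus Y)
  have Yk: "Y * k = k * Y" unfolding Y_def
    by (rule cosqrt_commute[OF x]) (simp add: x_def algebra_simps)
  define b where "b = 2 *\<^sub>R k - 1"
  have sb: "st b = b" by (simp add: b_def st_diff st_scaleR pos_sa[OF k(1)])
  have rr: "r * r = b * b" unfolding r_def Y_def cosqrt_square[OF x] ex b_def by (simp add: algebra_simps)
  have rb: "r * b = b * r" using Yk by (simp add: r_def b_def algebra_simps)
  have p1: "pos (r - b)" by (rule pos_abs_minus[OF r sb rr rb])
  have "1 - r * r = x" unfolding r_def Y_def cosqrt_square[OF x] by simp
  then have "norm (r * r) \<le> 1"
    using \<open>pos x\<close> pos_square[OF pos_sa[OF r]] by (intro norm_le_one_of_pos) auto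
  then have "norm r \<le> 1" using norm_sa_square[of r] pos_sa[OF r] by (simp add: abs_square_le_1)
  then have "pos (1 - r)" by (intro pos_one_minus pos_sa r)
  then have pY: "pos Y" by (simp add: r_def)
  define g where "g = k + (1/2) *\<^sub>R Y"
  define p where "p = k - (1/2) *\<^sub>R Y"
  have e1: "2 *\<^sub>R (1 - g) = r - b"
  proof -
    have "2 *\<^sub>R g = 2 *\<^sub>R k + Y" by (simp add: g_def scaleR_add_right)
    then show ?thesis unfolding scaleR_diff_right by (simp add: scaleR_2[of "1::'a"] r_def b_def)
  qed
  have e2: "2 *\<^sub>R p = r + b" by (simp add: p_def r_def b_def scaleR_diff_right)
  have "pos g" unfolding g_def by (intro pos_add pos_scaleR k pY) simp
  moreover have "pos (1 - g)" using pos_scaleR[OF p1, of "1/2"] by (simp flip: e1)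
  ultimately have g: "norm g \<le> 1" "st g = g" using norm_le_one_of_pos pos_sa by auto
  have gp: "g * p = p"
  proof -
    have "4 *\<^sub>R ((1 - g) * p) = (2 *\<^sub>R (1 - g)) * (2 *\<^sub>R p)" by simp
    also have "\<dots> = 0" unfolding e1 e2 by (simp add: distrib_left left_diff_distrib rr rb)
    finally have "(1 - g) * p = 0" by simp
    then show ?thesis by (simp add: algebra_simps)
  qed
  have p0: "p \<noteq> 0"
  proof
    assume "p = 0"
    then have "2 *\<^sub>R k = Y" by (simp add: p_def)
    then have "norm (2 *\<^sub>R k) \<le> 1" using Y by simp
    then show False using k by simp
  qed
  have "norm p \<le> norm g * norm p" using norm_mult_ineq[of g p] gp by simp
  then have g1: "norm g = 1" using g p0 by simp
  have pD: "p \<in> D" unfolding p_def by (intro subspace_diff subspace_scale rsub kD YD)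
  \<comment> \<open>It remains to divide \<open>g\<close> by \<open>h\<close>. From
    \<open>x = 2 Y (1 - Y/2)\<close> the Neumann series \<open>W\<close> for the inverse of
    \<open>1 - Y/2\<close> gives \<open>Y/2 = k (1 - k) W\<close>, and \<open>k\<close> is a
    multiple of \<open>h * st h\<close>. \<open>W\<close> may lie outside \<open>D\<close>, but
    right multiplication by it preserves \<open>D\<close>.\<close>
  define a where "a = (1/2) *\<^sub>R Y"
  have a: "norm a < 1" using Y by (simp add: a_def)
  have aD: "a \<in> D" unfolding a_def by (intro subspace_scale rsub YD)
  have sm: "summable (\<lambda>i. a ^ i)" using complete_algebra_summable_geometric[OF a] .
  define W where "W = (\<Sum>i. a ^ i)"
  have WD: "v * W \<in> D" if "v \<in> D" for v
  proof -
    have 0: "v * a ^ i \<in> D" for i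
    proof (induction i)
      case (Suc i)
      then have "v * a ^ i * a \<in> D" using aD by (rule mult)
      then show ?case by (simp only: mult.assoc power_Suc2)
    qed (simp add: that)
    have 1: "(\<Sum>i<m. v * a ^ i) \<in> D" for m by (rule subspace_sum[OF rsub 0])
    have 2: "(\<lambda>m. \<Sum>i<m. v * a ^ i) \<longlonglongrightarrow> v * W"
      using summable_LIMSEQ[OF sm] unfolding W_def sum_distrib_left[symmetric] by (intro tendsto_intros)
    show ?thesis by (rule closed_sequentially[OF cl 1 2])
  qed
  have aW: "(1 - a) * W = 1"
  proof -
    have "(\<Sum>i. a ^ Suc i) = a * W" unfolding W_def using suminf_mult[OF sm] by simp
    then have "W = 1 + a * W" using suminf_split_head[OF sm] by (simp add: W_def)
    then show ?thesis by (simp add: algebra_simps)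
  qed
  have "x = 2 *\<^sub>R Y - Y * Y" using Y(3) by simp
  also have "\<dots> = 2 *\<^sub>R (Y * (1 - a))" by (simp add: a_def algebra_simps)
  finally have xW: "x * W = 2 *\<^sub>R Y" using aW by (simp add: mult.assoc)
  define y where "y = (1/n) *\<^sub>R (st h + (st h - st h * k) * W)"
  have yD: "y \<in> D" unfolding y_def
    by (intro subspace_scale subspace_add subspace_diff WD mult rsub star h kD)
  have "h * y = k + k * (1 - k) * W"
    by (simp add: y_def k_def algebra_simps)
  also have "k * (1 - k) * W = (1/4) *\<^sub>R (x * W)" by (simp add: x_def)
  also have "k + \<dots> = g" by (simp add: xW g_def)
  finally have hy: "h * y = g" .
  show thesis using that[OF yD pD p0] by (simp add: hy g g1 gp)
qed

end

section \<open>Localisation in pseudo-Cartan inclusions\<close>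

context cstar_algebra
begin

lemma cstar_subalgD:
  assumes "cstar_subalg cs st A"
  shows "closed A" "csubspace cs A" "subspace A" "0 \<in> A"
    "\<And>x y. x \<in> A \<Longrightarrow> y \<in> A \<Longrightarrow> x * y \<in> A" "\<And>x. x \<in> A \<Longrightarrow> st x \<in> A"
    "\<And>x y. x \<in> A \<Longrightarrow> y \<in> A \<Longrightarrow> x + y \<in> A" "\<And>x y. x \<in> A \<Longrightarrow> y \<in> A \<Longrightarrow> x - y \<in> A"
    "\<And>c x. x \<in> A \<Longrightarrow> cs c x \<in> A" "\<And>r x. x \<in> A \<Longrightarrow> r *\<^sub>R x \<in> A"
proof -
  show 1: "csubspace cs A" using assms by (auto simp: cstar_subalg_def banach_subalg_def)
  show 2: "subspace A" using csubspace_subspace[OF 1] .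
  show "\<And>x y. x \<in> A \<Longrightarrow> y \<in> A \<Longrightarrow> x - y \<in> A" using subspace_diff[OF 2] .
  show "\<And>r x. x \<in> A \<Longrightarrow> r *\<^sub>R x \<in> A" using subspace_scale[OF 2] .
qed (use assms in \<open>auto simp: cstar_subalg_def banach_subalg_def csubspace_def\<close>)

lemma cspan_subset: "csubspace cs V \<Longrightarrow> S \<subseteq> V \<Longrightarrow> cspan cs S \<subseteq> V"
  unfolding cspan_def by blast

lemma csubspace_cspan: "csubspace cs (cspan cs S)"
  unfolding cspan_def csubspace_def by blast

lemma cspan_superset: "S \<subseteq> cspan cs S"
  unfolding cspan_def by blast

end

section \<open>The relative commutant and the nonzero closed ideals of the abelian
  subalgebra\<close>

locale pseudo_cartan_inclusion = cstar_algebra +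
  fixes C D :: "'a::{real_normed_algebra_1,banach} set"
  assumes pc: "pseudo_cartan cs st C D"
begin

lemma C_sub: "cstar_subalg cs st C" and D_sub: "cstar_subalg cs st D" and D_C: "D \<subseteq> C"
  and dense: "closure (cspan cs (normalizers st C D)) = C"
  using pc by (auto simp: pseudo_cartan_def regular_inclusion_def inclusion_def)

lemma D_comm: "x \<in> D \<Longrightarrow> y \<in> D \<Longrightarrow> x * y = y * x"
  using pc by (auto simp: pseudo_cartan_def abelian_def)

lemmas C_closure = cstar_subalgD[OF C_sub]
lemmas D_closure = cstar_subalgD[OF D_sub]

definition B :: "'a set" where "B = rel_commutant C D"

lemma B_iff: "x \<in> B \<longleftrightarrow> x \<in> C \<and> (\<forall>d\<in>D. x * d = d * x)"
  by (auto simp: B_def rel_commutant_def)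

lemma B_comm: "x \<in> B \<Longrightarrow> y \<in> B \<Longrightarrow> x * y = y * x"
  using pc by (auto simp: pseudo_cartan_def abelian_def B_def)

lemma D_B: "D \<subseteq> B" using D_C D_comm by (auto simp: B_iff)

lemma B_sub: "cstar_subalg cs st B"
proof -
  have "closed (\<Inter>d\<in>D. {x. x * d = d * x})"
    by (intro closed_INT ballI closed_Collect_eq continuous_intros)
  moreover have "B = C \<inter> (\<Inter>d\<in>D. {x. x * d = d * x})" by (auto simp: B_iff)
  ultimately have "closed B" using C_closure(1) by auto
  moreover have "csubspace cs B"
    unfolding csubspace_def
    by (auto simp: B_iff C_closure distrib_left distrib_right cs_mult_left cs_mult_right)
  moreover have "x * y \<in> B" if "x \<in> B" "y \<in> B" for x y
  proof -
    have "x * y * d = d * (x * y)" if "d \<in> D" for d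
      using \<open>x \<in> B\<close> \<open>y \<in> B\<close> that unfolding B_iff by (metis mult.assoc)
    then show ?thesis using that by (auto simp: B_iff C_closure)
  qed
  moreover have "st x \<in> B" if "x \<in> B" for x
  proof -
    have "st x * d = d * st x" if "d \<in> D" for d
      using \<open>x \<in> B\<close> D_closure(6)[OF that] unfolding B_iff by (metis st_mult st_st)
    then show ?thesis using that by (auto simp: B_iff C_closure)
  qed
  ultimately show ?thesis by (auto simp: cstar_subalg_def banach_subalg_def)
qed

lemmas B_closure = cstar_subalgD[OF B_sub]

lemma ideal_intersection_C: "closed_ideal cs C I \<Longrightarrow> I \<noteq> {0} \<Longrightarrow> I \<inter> B \<noteq> {0}"
  and ideal_intersection_B: "closed_ideal cs B I \<Longrightarrow> I \<noteq> {0} \<Longrightarrow> I \<inter> D \<noteq> {0}"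
  using pc by (auto simp: pseudo_cartan_def ideal_intersection_property_def B_def)

text \<open>A nonzero closed ideal of the abelian algebra \<open>D\<close> is a nonempty open subset
  of its spectrum. Quantification over such ideals expresses local statements without
  points.\<close>

definition ideal :: "'a set \<Rightarrow> bool"
  where "ideal I \<longleftrightarrow> closed_ideal cs D I \<and> I \<noteq> {0}"

text \<open>The elements of \<open>D\<close> supported where \<open>g\<close> equals \<open>1\<close>.\<close>
definition U :: "'a \<Rightarrow> 'a set"
  where "U g = {p\<in>D. g * p = p}"

lemma idealD:
  assumes "ideal I"
  shows "x \<in> I \<Longrightarrow> x \<in> D" "0 \<in> I" "x \<in> I \<Longrightarrow> d \<in> D \<Longrightarrow> d * x \<in> I" "x \<in> I \<Longrightarrow> d \<in> D \<Longrightarrow> x * d \<in> I"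
    "x \<in> I \<Longrightarrow> y \<in> I \<Longrightarrow> x - y \<in> I"
  using assms csubspace_diff[of I x y] by (auto simp: ideal_def closed_ideal_def csubspace_def)

lemma ideal_nonzero:
  assumes "ideal I" obtains x where "x \<in> I" "x \<in> D" "x \<noteq> 0"
  using assms by (auto simp: ideal_def closed_ideal_def csubspace_def)

lemma ideal_U:
  assumes "g \<in> D" "p \<in> D" "g * p = p" "p \<noteq> 0" shows "ideal (U g)"
proof -
  have "U g = D \<inter> {p. g * p = p}" by (auto simp: U_def)
  moreover have "closed {p. g * p = p}" by (intro closed_Collect_eq continuous_intros)
  ultimately have "closed (U g)" using D_closure(1) by auto
  moreover have "csubspace cs (U g)" unfolding csubspace_def
    by (auto simp: U_def D_closure distrib_left cs_mult_right)
  moreover have "c * x \<in> U g" "x * c \<in> U g" if "c \<in> D" "x \<in> U g" for c x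
    using that D_comm[OF that(1)] by (auto simp: U_def D_closure mult.assoc[symmetric])
  ultimately have "closed_ideal cs D (U g)" by (auto simp: closed_ideal_def U_def)
  moreover have "p \<in> U g" using assms by (simp add: U_def)
  ultimately show ?thesis using assms(4) by (auto simp: ideal_def)
qed

lemma U_left: "g \<in> D \<Longrightarrow> p \<in> U g \<Longrightarrow> g * p = p \<and> p * g = p \<and> p \<in> D"
  using D_comm by (auto simp: U_def)

lemma local_unit:
  assumes "h \<in> D" "h \<noteq> 0"
  obtains y where "y \<in> D" "h * y \<in> D" "st (h * y) = h * y" "norm (h * y) = 1" "ideal (U (h * y))"
proof -
  obtain y p where y: "y \<in> D" "p \<in> D" "p \<noteq> 0" "st (h * y) = h * y" "norm (h * y) = 1" "h * y * p = p"
    using local_unit_pair[OF D_sub assms] by blast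
  have hy: "h * y \<in> D" by (intro D_closure assms y)
  show thesis using that[OF y(1) hy y(4,5) ideal_U[OF hy y(2,6,3)]] .
qed

lemma local_unit_ideal:
  assumes "ideal I"
  obtains g where "g \<in> I" "g \<in> D" "st g = g" "norm g = 1" "ideal (U g)" "U g \<subseteq> I"
proof -
  obtain h where h: "h \<in> I" "h \<in> D" "h \<noteq> 0" using ideal_nonzero[OF assms] .
  obtain y where y: "y \<in> D" "h * y \<in> D" "st (h * y) = h * y" "norm (h * y) = 1" "ideal (U (h * y))"
    using local_unit[OF h(2,3)] .
  have hyI: "h * y \<in> I" using idealD(4)[OF assms h(1) y(1)] .
  have "U (h * y) \<subseteq> I"
  proof
    fix p assume "p \<in> U (h * y)"
    then have "p = h * y * p" "p \<in> D" by (auto simp: U_def)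
    then show "p \<in> I" using idealD(4)[OF assms hyI] by metis
  qed
  then show thesis using that hyI y by blast
qed

lemma normalizer_conj:
  assumes "v \<in> normalizers st C D" "d \<in> D" shows "v * d * st v \<in> D" "st v * d * v \<in> D"
  using assms by (auto simp: normalizers_def)

subsection \<open>Locally small elements vanish\<close>

text \<open>Elements that are arbitrarily small on some open set inside any given one. They form a
  closed ideal of \<open>C\<close> meeting \<open>D\<close> only in 0, which the two intersection
  properties force to be zero.\<close>

definition locally_small :: "'a set"
  where "locally_small = {c\<in>C. \<forall>e>0. \<forall>I. ideal I \<longrightarrow> (\<exists>J. ideal J \<and> J \<subseteq> I \<and> (\<forall>p\<in>J. norm (c * p) \<le> e * norm p))}"

lemma locally_smallD:
  assumes "c \<in> locally_small" "0 < e" "ideal I"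
  obtains J where "ideal J" "J \<subseteq> I" "\<And>p. p \<in> J \<Longrightarrow> norm (c * p) \<le> e * norm p"
  using assms unfolding locally_small_def by blast

lemma locally_smallI:
  assumes "c \<in> C" "\<And>e I. 0 < e \<Longrightarrow> ideal I \<Longrightarrow> \<exists>J. ideal J \<and> J \<subseteq> I \<and> (\<forall>p\<in>J. norm (c * p) \<le> e * norm p)"
  shows "c \<in> locally_small"
  using assms unfolding locally_small_def by blast

lemma locally_small_add:
  assumes "x \<in> locally_small" "y \<in> locally_small" shows "x + y \<in> locally_small"
proof (rule locally_smallI)
  show "x + y \<in> C" using assms by (auto simp: locally_small_def C_closure)
  fix e :: real and I assume e: "0 < e" and I: "ideal I"
  from e have e2: "0 < e / 2" by simp
  obtain J where J: "ideal J" "J \<subseteq> I" "\<And>p. p \<in> J \<Longrightarrow> norm (x * p) \<le> e/2 * norm p"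
    using locally_smallD[OF assms(1) e2 I] by blast
  obtain K where K: "ideal K" "K \<subseteq> J" "\<And>p. p \<in> K \<Longrightarrow> norm (y * p) \<le> e/2 * norm p"
    using locally_smallD[OF assms(2) e2 J(1)] by blast
  have "norm ((x + y) * p) \<le> e * norm p" if "p \<in> K" for p
  proof -
    have "norm ((x + y) * p) \<le> norm (x * p) + norm (y * p)" by (simp add: distrib_right norm_triangle_ineq)
    also have "\<dots> \<le> e/2 * norm p + e/2 * norm p" using J(3) K that by (intro add_mono) auto
    finally show ?thesis by simp
  qed
  then show "\<exists>J. ideal J \<and> J \<subseteq> I \<and> (\<forall>p\<in>J. norm ((x + y) * p) \<le> e * norm p)"
    using J K by (intro exI[of _ K]) auto
qed

lemma locally_small_left:
  assumes "x \<in> locally_small" "z * x \<in> C" "\<And>p. norm (z * (x * p)) \<le> K * norm (x * p)"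
  shows "z * x \<in> locally_small"
proof (rule locally_smallI[OF assms(2)])
  fix e :: real and I assume e: "0 < e" and I: "ideal I"
  define L where "L = \<bar>K\<bar> + 1"
  have L: "0 < L" "K \<le> L" by (auto simp: L_def)
  have e2: "0 < e / L" using e L by simp
  obtain J where J: "ideal J" "J \<subseteq> I" "\<And>p. p \<in> J \<Longrightarrow> norm (x * p) \<le> e/L * norm p"
    using locally_smallD[OF assms(1) e2 I] by blast
  have "norm (z * x * p) \<le> e * norm p" if "p \<in> J" for p
  proof -
    have "norm (z * x * p) \<le> K * norm (x * p)" using assms(3) by (simp add: mult.assoc)
    also have "\<dots> \<le> L * norm (x * p)" using L by (intro mult_right_mono) auto
    also have "\<dots> \<le> L * (e/L * norm p)" using J(3)[OF that] L by (intro mult_left_mono) auto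
    finally show ?thesis using L by simp
  qed
  then show "\<exists>J. ideal J \<and> J \<subseteq> I \<and> (\<forall>p\<in>J. norm (z * x * p) \<le> e * norm p)"
    using J by blast
qed

text \<open>\<open>v\<close> induces a partial homeomorphism of the spectrum of \<open>D\<close>. If
  it does not vanish on \<open>I\<close>, a part of \<open>I\<close> is moved to an open set; inside
  the latter there is a local unit \<open>q0\<close> with \<parallel>x * q0\<parallel> small, and
  pulling back gives the required ideal. There \<open>v * s = q0 * (v * s)\<close>, so only
  \<parallel>x * q0\<parallel> enters.\<close>

lemma locally_small_normalizer:
  assumes x: "x \<in> locally_small" and v: "v \<in> normalizers st C D"
  shows "x * v \<in> locally_small"
proof (rule locally_smallI)
  show "x * v \<in> C" using assms by (auto simp: locally_small_def C_closure normalizers_def)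
  fix e :: real and I assume e: "0 < e" and I: "ideal I"
  show "\<exists>J. ideal J \<and> J \<subseteq> I \<and> (\<forall>p\<in>J. norm (x * v * p) \<le> e * norm p)"
  proof (cases "\<forall>p\<in>I. v * p = 0")
    case True
    then have "norm (x * v * p) \<le> e * norm p" if "p \<in> I" for p using that e by (simp add: mult.assoc)
    then show ?thesis using I by blast
  next
    case False
    then obtain p where p: "p \<in> I" "v * p \<noteq> 0" by blast
    have pD: "p \<in> D" using idealD(1)[OF I p(1)] .
    define k where "k = v * (p * st p) * st v"
    have kD: "k \<in> D" unfolding k_def by (rule normalizer_conj[OF v]) (intro D_closure pD)
    have "k = (v * p) * st (v * p)" by (simp add: k_def st_mult mult.assoc)
    then have "k \<noteq> 0" using p(2) norm_mult_st[of "v * p"] by auto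
    then obtain y0 where y0: "y0 \<in> D" "k * y0 \<in> D" "ideal (U (k * y0))"
      using local_unit[OF kD] by metis
    define e' where "e' = e / (norm v + 1)"
    have nv: "0 < norm v + 1" by (simp add: add_nonneg_pos)
    have e': "0 < e'" using e nv by (simp add: e'_def)
    obtain I2 where I2: "ideal I2" "I2 \<subseteq> U (k * y0)" "\<And>p. p \<in> I2 \<Longrightarrow> norm (x * p) \<le> e' * norm p"
      using locally_smallD[OF x e' y0(3)] by blast
    obtain q0 where q0: "q0 \<in> I2" "q0 \<in> D" "st q0 = q0" "norm q0 = 1" "ideal (U q0)"
      using local_unit_ideal[OF I2(1)] by metis
    obtain q1 where q1: "q1 \<in> U q0" "q1 \<in> D" "q1 \<noteq> 0" using ideal_nonzero[OF q0(5)] by metis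
    have q01: "q0 * q1 = q1" using q1 by (simp add: U_def)
    have q01s: "q0 * st q1 = st q1"
      using arg_cong[OF q01, of st] D_comm[OF q0(2) D_closure(6)[OF q1(2)]] q0(3) by (simp add: st_mult)
    have "q1 * v * p \<noteq> 0"
    proof
      assume "q1 * v * p = 0"
      then have "q1 * (k * y0) = 0" by (simp add: k_def mult.assoc[symmetric])
      moreover have "k * y0 * q0 = q0" using I2(2) q0(1) by (auto simp: U_def)
      then have "k * y0 * q1 = q1" by (metis q01 mult.assoc)
      ultimately show False using q1(3) D_comm[OF q1(2) y0(2)] by simp
    qed
    define h where "h = st (q1 * v * p) * (q1 * v * p)"
    have h0: "h \<noteq> 0" using \<open>q1 * v * p \<noteq> 0\<close> norm_st_mult[of "q1 * v * p"] by (auto simp: h_def)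
    have h: "h = st p * (st v * (st q1 * q1) * v) * p" by (simp add: h_def st_mult mult.assoc)
    have svD: "st v * (st q1 * q1) * v \<in> D" by (rule normalizer_conj[OF v]) (intro D_closure q1)
    have hI: "h \<in> I" unfolding h by (intro idealD(3)[OF I p(1)] D_closure(5)[OF _ svD] D_closure(6) pD)
    have hD: "h \<in> D" using idealD(1)[OF I hI] .
    obtain Y where Y: "Y \<in> D" "h * Y \<in> D" "ideal (U (h * Y))" using local_unit[OF hD h0] by metis
    have sub: "U (h * Y) \<subseteq> I"
    proof
      fix s assume "s \<in> U (h * Y)"
      then have s: "h * (Y * s) = s" "s \<in> D" by (auto simp: U_def mult.assoc)
      show "s \<in> I" using idealD(4)[OF I hI D_closure(5)[OF Y(1) s(2)]] s(1) by simp
    qed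
    have "norm (x * v * s) \<le> e * norm s" if s: "s \<in> U (h * Y)" for s
    proof -
      \<comment> \<open>Writing \<open>s\<close> as \<open>h * Y * s\<close> puts
        \<open>t * st q1\<close> in front of \<open>v * s\<close>. As \<open>t\<close> lies in
        \<open>D\<close> it commutes with \<open>st q1\<close>, and \<open>q0\<close> absorbs
        \<open>st q1\<close>.\<close>
      define t where "t = v * st p * st v"
      have tD: "t \<in> D" unfolding t_def by (rule normalizer_conj[OF v]) (intro D_closure pD)
      have "s = h * Y * s" using s by (simp add: U_def)
      then have "v * s = v * (h * Y * s)" by simp
      also have "\<dots> = t * st q1 * (q1 * v * p * Y * s)"
        unfolding h t_def by (simp add: mult.assoc)
      also have "\<dots> = st q1 * t * (q1 * v * p * Y * s)" using D_comm tD D_closure(6)[OF q1(2)] by simp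
      also have "\<dots> = q0 * (st q1 * t * (q1 * v * p * Y * s))" using q01s by (simp add: mult.assoc[symmetric])
      finally have vs: "v * s = q0 * (st q1 * t * (q1 * v * p * Y * s))" .
      have "q0 * (v * s) = v * s"
      proof -
        have "q0 * q0 * st q1 = st q1" using q01s by (simp add: mult.assoc)
        then show ?thesis unfolding vs using q01s by (simp add: mult.assoc[symmetric])
      qed
      then have "norm (x * v * s) = norm (x * q0 * (v * s))" by (simp add: mult.assoc)
      also have "\<dots> \<le> norm (x * q0) * (norm v * norm s)"
        by (meson norm_mult_ineq mult_left_mono norm_ge_zero order_trans)
      also have "\<dots> \<le> e' * (norm v * norm s)"
        using I2(3)[OF q0(1)] q0(4) by (intro mult_right_mono) auto
      also have "\<dots> \<le> e' * ((norm v + 1) * norm s)"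
        using e' by (intro mult_left_mono mult_right_mono) auto
      also have "\<dots> = e * norm s" using nv by (simp add: e'_def)
      finally show ?thesis .
    qed
    then show ?thesis using Y(3) sub by blast
  qed
qed

lemma csubspace_locally_small: "csubspace cs locally_small"
proof -
  have "0 \<in> locally_small" by (rule locally_smallI) (auto simp: C_closure)
  moreover have "cs c x \<in> locally_small" if "x \<in> locally_small" for c x
  proof -
    have "cs c 1 * x \<in> locally_small"
      by (rule locally_small_left[OF that, of _ "cmod c"])
        (use that in \<open>auto simp: cs_mult_left norm_cs locally_small_def C_closure\<close>)
    then show ?thesis by (simp add: cs_mult_left)
  qed
  ultimately show ?thesis by (auto simp: csubspace_def locally_small_add)
qed

lemma closed_locally_small: "closed locally_small"
  unfolding closed_sequential_limits
proof (intro allI impI, elim conjE)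
  fix f l assume f: "\<forall>n. f n \<in> locally_small" and lim: "f \<longlonglongrightarrow> l"
  show "l \<in> locally_small"
  proof (rule locally_smallI)
    show "l \<in> C" using closed_sequentially[OF C_closure(1) _ lim] f by (auto simp: locally_small_def)
    fix e :: real and I assume e: "0 < e" and I: "ideal I"
    from e have e2: "0 < e / 2" by simp
    obtain n where n: "norm (f n - l) < e / 2" using LIMSEQ_D[OF lim e2] by blast
    obtain J where J: "ideal J" "J \<subseteq> I" "\<And>p. p \<in> J \<Longrightarrow> norm (f n * p) \<le> e/2 * norm p"
      using locally_smallD[OF f[rule_format] e2 I] by blast
    have "norm (l * p) \<le> e * norm p" if "p \<in> J" for p
    proof -
      have "norm (l * p) \<le> norm (f n * p) + norm ((l - f n) * p)"
        using norm_triangle_ineq[of "f n * p" "(l - f n) * p"] by (simp add: algebra_simps)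
      also have "\<dots> \<le> e/2 * norm p + e/2 * norm p"
      proof (rule add_mono[OF J(3)[OF that]])
        have "norm ((l - f n) * p) \<le> norm (l - f n) * norm p" by (rule norm_mult_ineq)
        also have "\<dots> \<le> e/2 * norm p" using n by (intro mult_right_mono) (auto simp: norm_minus_commute)
        finally show "norm ((l - f n) * p) \<le> e/2 * norm p" .
      qed
      finally show ?thesis by simp
    qed
    then show "\<exists>J. ideal J \<and> J \<subseteq> I \<and> (\<forall>p\<in>J. norm (l * p) \<le> e * norm p)" using J by blast
  qed
qed

lemma C_induct:
  assumes "closed V" "csubspace cs V" "normalizers st C D \<subseteq> V" "c \<in> C" shows "c \<in> V"
  using cspan_subset[OF assms(2,3)] closure_minimal[OF _ assms(1)] assms(4) dense by blast

text \<open>Left multiples are estimated directly. For right multiples, the admissible factors form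
  a closed subspace containing the normalizers, hence all of \<open>C\<close> by regularity.\<close>

lemma closed_ideal_locally_small: "closed_ideal cs C locally_small"
proof -
  have "c * x \<in> locally_small" if "c \<in> C" "x \<in> locally_small" for c x
    by (rule locally_small_left[OF that(2), of _ "norm c"])
      (use that in \<open>auto simp: norm_mult_ineq locally_small_def C_closure\<close>)
  moreover have "x * c \<in> locally_small" if "c \<in> C" "x \<in> locally_small" for c x
  proof -
    let ?V = "(\<lambda>c. x * c) -` locally_small"
    have "closed ?V" by (intro closed_vimage closed_locally_small continuous_intros)
    moreover have "csubspace cs ?V" using csubspace_locally_small
      by (auto simp: csubspace_def distrib_left cs_mult_right)
    moreover have "normalizers st C D \<subseteq> ?V" using locally_small_normalizer[OF that(2)] by auto
    ultimately show ?thesis using C_induct that(1) by blast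
  qed
  ultimately show ?thesis
    using csubspace_locally_small closed_locally_small by (auto simp: closed_ideal_def locally_small_def)
qed

text \<open>Where \<open>d * y\<close> acts as the identity, \<open>d\<close> is bounded below by
  the inverse of \<parallel>y\<parallel> and cannot be small.\<close>

lemma locally_small_D:
  assumes "d \<in> locally_small" "d \<in> D" shows "d = 0"
proof (rule ccontr)
  assume "d \<noteq> 0"
  then obtain y where y: "y \<in> D" "d * y \<in> D" "norm (d * y) = 1" "ideal (U (d * y))"
    using local_unit[OF assms(2)] by metis
  have "y \<noteq> 0" using y(3) by auto
  then have e: "0 < 1 / (2 * norm y)" by simp
  obtain J where J: "ideal J" "J \<subseteq> U (d * y)" "\<And>p. p \<in> J \<Longrightarrow> norm (d * p) \<le> 1 / (2 * norm y) * norm p"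
    using locally_smallD[OF assms(1) e y(4)] by blast
  obtain q where q: "q \<in> J" "q \<noteq> 0" using ideal_nonzero[OF J(1)] by metis
  have "q = y * (d * q)" using J(2) q(1) D_comm[OF assms(2) y(1)] by (auto simp: U_def mult.assoc[symmetric])
  then have "norm q \<le> norm y * norm (d * q)" by (metis norm_mult_ineq)
  also have "\<dots> \<le> norm y * (1 / (2 * norm y) * norm q)" using J(3)[OF q(1)] by (intro mult_left_mono) auto
  also have "\<dots> = norm q / 2" using \<open>y \<noteq> 0\<close> by simp
  finally show False using q(2) by simp
qed

text \<open>The intersection properties apply in succession: a nonzero ideal of \<open>C\<close>
  meets \<open>B\<close> in a nonzero ideal of \<open>B\<close>, which in turn meets
  \<open>D\<close>.\<close>

lemma locally_small_zero:
  assumes "c \<in> locally_small" shows "c = 0"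
proof (rule ccontr)
  assume "c \<noteq> 0"
  then have "locally_small \<noteq> {0}" using assms by auto
  then have 1: "locally_small \<inter> B \<noteq> {0}" using ideal_intersection_C closed_ideal_locally_small by blast
  have "closed_ideal cs B (locally_small \<inter> B)"
    using closed_ideal_locally_small B_closure unfolding closed_ideal_def csubspace_def
    by (auto simp: B_iff)
  then have "locally_small \<inter> B \<inter> D \<noteq> {0}" using ideal_intersection_B 1 by blast
  moreover have "0 \<in> locally_small \<inter> B \<inter> D"
    using csubspace_locally_small B_closure D_closure by (auto simp: csubspace_def)
  ultimately show False using locally_small_D by blast
qed

end

context pseudo_cartan_inclusion
begin

subsection \<open>Elements are locally almost scalar\<close>

text \<open>Lower the bound \<open>m\<close> of \<open>b\<close> on \<open>U g\<close> in steps of \<open>e\<close> as long as possible. Where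
\<open>c = b - (m - e)\<close> agrees with \<open>|c|\<close>, which happens on a nonzero ideal, \<open>m - e \<le> b \<le> m\<close>.\<close>
lemma almost_scalar_sa:
  assumes b: "b \<in> B" "st b = b" and I: "ideal I" and e: "0 < e"
  obtains J m where "ideal J" "J \<subseteq> I" "\<And>p. p \<in> J \<Longrightarrow> norm (b * p - (m::real) *\<^sub>R p) \<le> e * norm p"
proof -
  obtain g where g: "g \<in> I" "g \<in> D" "st g = g" "ideal (U g)" using local_unit_ideal[OF I] by metis
  have gI: "y \<in> I" if "g * y = y" "y \<in> D" for y using idealD(4)[OF I g(1) that(2)] that(1) by simp
  \<comment> \<open>\<open>F m\<close> expresses \<open>b \<le> m\<close> on the open set
    \<open>U g\<close>.\<close>
  define F where "F m \<longleftrightarrow> (\<forall>p\<in>U g. pos (st p * (m *\<^sub>R 1 - b) * p))" for m :: real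
  define n where "n = norm b"
  have F0: "F n" unfolding F_def n_def using pos_norm_diff[OF b(2)] pos_conj by auto
  have Flow: "\<not> F m" if m: "m < - n" for m
  proof
    assume "F m"
    obtain p where p: "p \<in> U g" "p \<noteq> 0" using ideal_nonzero[OF g(4)] by metis
    have 1: "pos (st p * (m *\<^sub>R 1 - b) * p)" using \<open>F m\<close> p by (auto simp: F_def)
    have "pos (n *\<^sub>R 1 - (- b))" using pos_norm_diff[of "- b" n] b by (simp add: st_minus n_def)
    from pos_conj[OF this, of p] have 2: "pos (st p * (n *\<^sub>R 1 + b) * p)" by simp
    have "st p * (m *\<^sub>R 1 - b) * p + st p * (n *\<^sub>R 1 + b) * p = (m + n) *\<^sub>R (st p * p)"
      by (simp add: algebra_simps)
    then have "pos ((m + n) *\<^sub>R (st p * p))" using pos_add[OF 1 2] by simp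
    moreover have "1 / (- (m + n)) * (m + n) = -1" using m by (simp add: field_simps)
    ultimately have "pos (- (st p * p))"
      using pos_scaleR[of "(m + n) *\<^sub>R (st p * p)" "1 / (- (m + n))"] m
      by (simp only: scaleR_scaleR) simp
    then have "st p * p = 0" using pos_antisym[OF pos_st_mult] by blast
    then show False using p(2) norm_st_mult[of p] by simp
  qed
  have "\<exists>k::nat. F (n - real k * e) \<and> \<not> F (n - real (Suc k) * e)"
  proof (rule ccontr)
    assume "\<not> ?thesis"
    then have step: "F (n - real k * e) \<Longrightarrow> F (n - real (Suc k) * e)" for k by blast
    have all: "F (n - real k * e)" for k
    proof (induction k)
      case 0 show ?case using F0 by simp
    next
      case (Suc k) then show ?case by (rule step)
    qed
    obtain k :: nat where "2 * n < real k * e" using e reals_Archimedean3 by blast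
    then have "n - real k * e < - n" by simp
    then show False using Flow all by blast
  qed
  then obtain k where k: "F (n - real k * e)" "\<not> F (n - real (Suc k) * e)" by blast
  define m m' where "m = n - real k * e" and "m' = m - e"
  have Fm: "F m" "\<not> F m'" using k by (auto simp: m_def m'_def algebra_simps)
  then obtain p0 where p0: "p0 \<in> U g" "\<not> pos (st p0 * (m' *\<^sub>R 1 - b) * p0)" by (auto simp: F_def)
  define c where "c = b - m' *\<^sub>R 1"
  have sc: "st c = c" by (simp add: c_def st_diff st_scaleR b)
  have cB: "c * y \<in> B" if "y \<in> B" for y
  proof -
    have "c * y = b * y - m' *\<^sub>R y" by (simp add: c_def algebra_simps)
    then show ?thesis using that b B_closure by simp
  qed
  have ccB: "c * c * y \<in> B" if "y \<in> B" for y using cB[OF cB[OF that]] by (simp add: mult.assoc)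
  obtain r where r: "pos r" "r * r = c * c" "\<forall>z. c * c * z = z * (c * c) \<longrightarrow> r * z = z * r" "\<forall>y\<in>B. r * y \<in> B"
    by (rule pos_root_invariant[OF pos_square[OF sc] B_closure(3,1) ccB])
  have rc: "r * c = c * r" using r(3) by (simp add: mult.assoc)
  \<comment> \<open>\<open>r + c\<close> is twice the positive part of \<open>c\<close> and is
    annihilated by \<open>r - c\<close>. It does not kill \<open>p0\<close>: otherwise
    \<open>st p0 * (m' - b) * p0 = st p0 * r * p0\<close> would be positive.\<close>
  define f where "f = r * p0 + c * p0"
  have p0B: "p0 \<in> B" "p0 \<in> D" using p0 D_B by (auto simp: U_def)
  have fB: "f \<in> B" unfolding f_def using r(4) cB p0B by (intro B_closure(7)) auto
  have f0: "f \<noteq> 0"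
  proof
    assume "f = 0"
    then have "r * p0 = - (c * p0)" unfolding f_def by (rule eq_neg_iff_add_eq_0[THEN iffD2])
    then have "st p0 * r * p0 = - (st p0 * c * p0)" by (simp add: mult.assoc)
    also have "\<dots> = st p0 * (m' *\<^sub>R 1 - b) * p0" unfolding c_def by (simp add: algebra_simps)
    finally have "st p0 * r * p0 = st p0 * (m' *\<^sub>R 1 - b) * p0" .
    then show False using pos_conj[OF r(1), of p0] p0(2) by simp
  qed
  \<comment> \<open>The elements of \<open>B\<close> supported where \<open>c \<ge> 0\<close> and
    \<open>g = 1\<close>. They form an ideal of \<open>B\<close>, and the intersection property of
    \<open>B\<close> over \<open>D\<close> brings it down to \<open>D\<close>.\<close>
  define J0 where "J0 = {y\<in>B. r * y = c * y \<and> g * y = y}"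
  have gB: "g \<in> B" using g D_B by auto
  have gc: "g * c = c * g"
  proof -
    have "g * b = b * g" using B_comm[OF gB b(1)] .
    then show ?thesis by (simp add: c_def algebra_simps)
  qed
  have gr: "r * g = g * r"
  proof -
    have "c * c * g = g * (c * c)" using gc by (metis mult.assoc)
    then show ?thesis using r(3) by blast
  qed
  have "f \<in> J0"
  proof -
    have "r * f = c * f"
    proof -
      have "r * f = c * c * p0 + r * c * p0" unfolding f_def by (simp add: distrib_left r(2) flip: mult.assoc)
      moreover have "c * f = r * c * p0 + c * c * p0" unfolding f_def by (simp add: distrib_left rc flip: mult.assoc)
      ultimately show ?thesis by simp
    qed
    moreover have "g * f = f"
    proof -
      have "g * p0 = p0" using p0 by (simp add: U_def)
      moreover have "g * (r * p0) = r * (g * p0)" by (metis gr mult.assoc)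
      moreover have "g * (c * p0) = c * (g * p0)" by (metis gc mult.assoc)
      ultimately show ?thesis unfolding f_def by (simp add: distrib_left)
    qed
    ultimately show ?thesis using fB by (simp add: J0_def)
  qed
  have cl: "closed J0"
  proof -
    have "closed ({y. r * y = c * y} \<inter> {y. g * y = y})"
      by (intro closed_Int closed_Collect_eq continuous_intros)
    moreover have "J0 = B \<inter> ({y. r * y = c * y} \<inter> {y. g * y = y})" by (auto simp: J0_def)
    ultimately show ?thesis using B_closure(1) by auto
  qed
  have lin: "csubspace cs J0" unfolding csubspace_def
    by (auto simp: J0_def B_closure distrib_left cs_mult_right)
  have idl: "y * z \<in> J0" "z * y \<in> J0" if "z \<in> B" "y \<in> J0" for y z
  proof -
    show 1: "y * z \<in> J0" using that by (auto simp: J0_def B_closure simp flip: mult.assoc)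
    have "z * y = y * z" using B_comm that by (auto simp: J0_def)
    then show "z * y \<in> J0" using 1 by simp
  qed
  have "closed_ideal cs B J0" using cl lin idl by (auto simp: closed_ideal_def J0_def)
  moreover have "J0 \<noteq> {0}" using \<open>f \<in> J0\<close> f0 by auto
  ultimately have ne: "J0 \<inter> D \<noteq> {0}" by (rule ideal_intersection_B)
  have I': "ideal (J0 \<inter> D)"
  proof -
    have "closed (J0 \<inter> D)" using cl D_closure by auto
    moreover have "csubspace cs (J0 \<inter> D)" using lin D_closure by (auto simp: csubspace_def)
    moreover have "d * x \<in> J0 \<inter> D \<and> x * d \<in> J0 \<inter> D" if "d \<in> D" "x \<in> J0 \<inter> D" for d x
      using that idl[of d x] D_B D_closure by auto
    ultimately show ?thesis using ne by (auto simp: ideal_def closed_ideal_def)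
  qed
  obtain G where G: "G \<in> J0 \<inter> D" "st G = G" "norm G = 1" "ideal (U G)" "U G \<subseteq> J0 \<inter> D"
    using local_unit_ideal[OF I'] by metis
  have GD: "G \<in> D" using G by auto
  have GU: "G \<in> U g" using G by (auto simp: J0_def U_def)
  have bG: "b * G = G * b" using b GD by (auto simp: B_iff)
  have up: "pos (G * (m *\<^sub>R 1 - b) * G)" using Fm GU G(2) unfolding F_def by metis
  have "pos (G * r * G)" using pos_conj[OF r(1), of G] G(2) by simp
  moreover have "G * r * G = G * c * G" using G(1) by (auto simp: J0_def mult.assoc)
  moreover have "G * c * G = e *\<^sub>R (G * G) - G * (m *\<^sub>R 1 - b) * G"
    by (simp add: c_def m'_def algebra_simps)
  ultimately have "pos (e *\<^sub>R (G * G) - G * (m *\<^sub>R 1 - b) * G)" by simp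
  from norm_mono_pos[OF up this] have nG: "norm (G * (m *\<^sub>R 1 - b) * G) \<le> e"
    using e norm_sa_square[OF G(2)] G(3) by simp
  have "norm (b * p - m *\<^sub>R p) \<le> e * norm p" if p: "p \<in> U G" for p
  proof -
    have Gp: "G * p = p" using p by (simp add: U_def)
    have "b * p - m *\<^sub>R p = - (G * (m *\<^sub>R 1 - b) * G * p)"
    proof -
      have "G * (m *\<^sub>R 1 - b) * G * p = G * ((m *\<^sub>R 1 - b) * p)" using Gp by (simp add: mult.assoc)
      also have "\<dots> = (m *\<^sub>R 1 - b) * (G * p)" using bG by (simp add: algebra_simps flip: mult.assoc)
      finally show ?thesis by (simp add: Gp algebra_simps)
    qed
    then have "norm (b * p - m *\<^sub>R p) \<le> norm (G * (m *\<^sub>R 1 - b) * G) * norm p"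
      by (simp add: norm_mult_ineq)
    also have "\<dots> \<le> e * norm p" using nG by (intro mult_right_mono) auto
    finally show ?thesis .
  qed
  moreover have "U G \<subseteq> I" using G(5) gI by (auto simp: J0_def)
  ultimately show thesis using that G(4) by blast
qed

lemma almost_scalar_commutant:
  assumes b: "b \<in> B" and I: "ideal I" and e: "0 < e"
  obtains J l where "ideal J" "J \<subseteq> I" "\<And>p. p \<in> J \<Longrightarrow> norm (b * p - cs l p) \<le> e * norm p"
proof -
  define b1 b2 where "b1 = (1/2) *\<^sub>R (b + st b)" and "b2 = cs (- \<i> / 2) (b - st b)"
  have s: "st b1 = b1" by (simp add: b1_def st_scaleR st_add add.commute)
  have s2: "st b2 = b2"
    by (simp add: b2_def st_cs st_diff cs_minus_left cs_diff_right)
  have B12: "b1 \<in> B" "b2 \<in> B" unfolding b1_def b2_def by (intro B_closure b)+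
  have b12: "b = b1 + cs \<i> b2"
  proof -
    have "cs \<i> b2 = cs (complex_of_real (1/2)) (b - st b)" unfolding b2_def cs_cs by (simp add: field_simps)
    then have "cs \<i> b2 = (1/2) *\<^sub>R (b - st b)" unfolding cs_of_real .
    then have "b1 + cs \<i> b2 = (1/2) *\<^sub>R (b + b)" by (simp add: b1_def scaleR_add_right scaleR_diff_right)
    then show ?thesis by simp
  qed
  from e have e2: "0 < e/2" by simp
  obtain J1 m1 where J1: "ideal J1" "J1 \<subseteq> I" "\<And>p. p \<in> J1 \<Longrightarrow> norm (b1 * p - m1 *\<^sub>R p) \<le> e/2 * norm p"
    using almost_scalar_sa[OF B12(1) s I e2] by blast
  obtain J2 m2 where J2: "ideal J2" "J2 \<subseteq> J1" "\<And>p. p \<in> J2 \<Longrightarrow> norm (b2 * p - m2 *\<^sub>R p) \<le> e/2 * norm p"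
    using almost_scalar_sa[OF B12(2) s2 J1(1) e2] by blast
  have "norm (b * p - cs (complex_of_real m1 + \<i> * complex_of_real m2) p) \<le> e * norm p" if p: "p \<in> J2" for p
  proof -
    have "b * p - cs (complex_of_real m1 + \<i> * complex_of_real m2) p
        = (b1 * p - m1 *\<^sub>R p) + cs \<i> (b2 * p - m2 *\<^sub>R p)"
      by (subst b12) (simp add: distrib_right cs_mult_left cs_add_left cs_diff_right cs_of_real flip: cs_cs)
    then have "norm (b * p - cs (complex_of_real m1 + \<i> * complex_of_real m2) p)
        \<le> norm (b1 * p - m1 *\<^sub>R p) + norm (b2 * p - m2 *\<^sub>R p)"
      using norm_triangle_ineq[of "b1 * p - m1 *\<^sub>R p" "cs \<i> (b2 * p - m2 *\<^sub>R p)"] by (simp add: norm_cs)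
    also have "\<dots> \<le> e/2 * norm p + e/2 * norm p"
      using J1(3)[of p] J2(2,3) p by (intro add_mono) auto
    finally show ?thesis by simp
  qed
  then show thesis using that J1 J2 by blast
qed

text \<open>Compression is two-sided because an element outside \<open>B\<close> may move points:
  what it moves is cut off. A normalizer moving all of \<open>J\<close> away from \<open>J\<close>
  gets the scalar 0.\<close>

definition almost_scalar :: "'a \<Rightarrow> real \<Rightarrow> 'a set \<Rightarrow> bool"
  where "almost_scalar c e J \<longleftrightarrow> (\<exists>l. \<forall>p\<in>J. \<forall>q\<in>J. norm (q * c * p - cs l (q * p)) \<le> e * norm q * norm p)"

text \<open>Compression by a local unit of an element that acts locally commutes with \<open>D\<close>,
because the commutators are locally small.\<close>
lemma local_compression_commutes:
  assumes v: "v \<in> C" and I: "ideal I"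
    and loc: "\<And>d e. d \<in> I \<Longrightarrow> e \<in> I \<Longrightarrow> d * e = 0 \<Longrightarrow> d * v * e = 0"
    and g: "g \<in> I"
  shows "g * v * g \<in> B"
proof -
  have gD: "g \<in> D" using idealD(1)[OF I g] .
  define x where "x = g * v * g"
  have xC: "x \<in> C" unfolding x_def using gD D_C v by (intro C_closure) auto
  have "x * d = d * x" if d: "d \<in> D" for d
  proof -
    have "x * d - d * x \<in> locally_small"
    proof (rule locally_smallI)
      show "x * d - d * x \<in> C" using xC d D_C by (intro C_closure) auto
      fix e :: real and K assume e: "0 < e" and K: "ideal K"
      define N where "N = norm x + 1"
      define e' where "e' = e / (2 * N)"
      have nx: "0 < N" by (simp add: N_def add_nonneg_pos)
      then have e': "0 < e'" using e by (simp add: e'_def)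
      have dB: "d \<in> B" using d D_B by auto
      obtain J1 l where J1: "ideal J1" "J1 \<subseteq> K" "\<And>p. p \<in> J1 \<Longrightarrow> norm (d * p - cs l p) \<le> e' * norm p"
        using almost_scalar_commutant[OF dB K e'] by blast
      obtain g1 where g1: "g1 \<in> J1" "g1 \<in> D" "norm g1 = 1" "ideal (U g1)" "U g1 \<subseteq> J1"
        using local_unit_ideal[OF J1(1)] by metis
      obtain g2 where g2: "g2 \<in> U g1" "g2 \<in> D" "ideal (U g2)" "U g2 \<subseteq> U g1"
        using local_unit_ideal[OF g1(4)] by metis
      have "norm ((x * d - d * x) * p) \<le> e * norm p" if p: "p \<in> U g2" for p
      proof -
        have g2p: "g2 * p = p" using p by (simp add: U_def)
        have g12: "g1 * g2 = g2" using g2 by (simp add: U_def)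
        \<comment> \<open>Locality of \<open>v\<close> shows that \<open>x * p\<close> is absorbed
          by \<open>g1\<close> for \<open>p\<close> in \<open>U g2\<close>. Since \<open>d\<close>
          is nearly the scalar \<open>l\<close> on both \<open>p\<close> and \<open>g1\<close>, both
          terms of the commutator are near \<open>l x p\<close>.\<close>
        have "(g - g * g1) * v * (g * g2) = 0"
        proof (rule loc)
          show "g - g * g1 \<in> I" using idealD(4,5)[OF I] g g1(2) by blast
          show "g * g2 \<in> I" using idealD(4)[OF I g g2(2)] .
          have "g * g1 * (g * g2) = g * (g * (g1 * g2))" using D_comm[OF gD g1(2)] by (metis mult.assoc)
          then show "(g - g * g1) * (g * g2) = 0" by (simp add: left_diff_distrib g12 mult.assoc)
        qed
        then have "(g - g * g1) * v * (g * g2) * p = 0" by simp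
        then have "x * p = g * g1 * v * g * p" using g2p by (simp add: x_def left_diff_distrib mult.assoc)
        also have "g * g1 = g1 * g" using D_comm[OF gD g1(2)] .
        finally have xp: "x * p = g1 * (x * p)" by (simp add: x_def mult.assoc)
        have "(x * d - d * x) * p = x * (d * p - cs l p) - (d * g1 - cs l g1) * (x * p)"
        proof -
          have "(d * g1 - cs l g1) * (x * p) = d * (g1 * (x * p)) - cs l (g1 * (x * p))"
            by (simp add: left_diff_distrib cs_mult_left mult.assoc)
          then show ?thesis
            by (simp add: left_diff_distrib right_diff_distrib cs_mult_right mult.assoc flip: xp)
        qed
        then have "norm ((x * d - d * x) * p)
            \<le> norm x * norm (d * p - cs l p) + norm (d * g1 - cs l g1) * (norm x * norm p)"
          using norm_triangle_ineq4[of "x * (d * p - cs l p)" "(d * g1 - cs l g1) * (x * p)"]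
            norm_mult_ineq[of x "d * p - cs l p"] norm_mult_ineq[of "d * g1 - cs l g1" "x * p"]
            mult_left_mono[OF norm_mult_ineq[of x p], of "norm (d * g1 - cs l g1)"] by simp
        also have "\<dots> \<le> norm x * (e' * norm p) + e' * (norm x * norm p)"
        proof (intro add_mono mult_left_mono mult_right_mono)
          show "norm (d * p - cs l p) \<le> e' * norm p" using J1(3) g1(5) g2(4) p by blast
          show "norm (d * g1 - cs l g1) \<le> e'" using J1(3)[OF g1(1)] g1(3) by simp
        qed auto
        also have "\<dots> = 2 * e' * norm x * norm p" by simp
        also have "\<dots> \<le> 2 * e' * N * norm p"
          using e' by (intro mult_right_mono mult_left_mono) (auto simp: N_def)
        also have "\<dots> = e * norm p" using nx by (simp add: e'_def)
        finally show ?thesis .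
      qed
      then show "\<exists>J. ideal J \<and> J \<subseteq> K \<and> (\<forall>p\<in>J. norm ((x * d - d * x) * p) \<le> e * norm p)"
        using g2(3,4) g1(5) J1(2) by blast
    qed
    then show ?thesis using locally_small_zero by fastforce
  qed
  then show ?thesis using xC by (simp add: B_iff x_def)
qed

text \<open>Either \<open>v\<close> respects disjointness inside \<open>I\<close>, and then a
  compression of \<open>v\<close> lies in \<open>B\<close>, whose elements are already known to be
  almost scalar; or \<open>d * v * f \<noteq> 0\<close> for some \<open>d\<close>, \<open>f\<close>
  in \<open>I\<close> with \<open>d * f = 0\<close>, so \<open>v\<close> moves a part of
  \<open>I\<close> off itself and the compressions to that part vanish.\<close>

lemma almost_scalar_normalizer:
  assumes v: "v \<in> normalizers st C D" and I: "ideal I" and e: "0 < e"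
  shows "\<exists>J. ideal J \<and> J \<subseteq> I \<and> almost_scalar v e J"
proof (cases "\<forall>d\<in>I. \<forall>e\<in>I. d * e = 0 \<longrightarrow> d * v * e = 0")
  case True
  have vC: "v \<in> C" using v by (simp add: normalizers_def)
  obtain g where g: "g \<in> I" "g \<in> D" "ideal (U g)" "U g \<subseteq> I" using local_unit_ideal[OF I] by metis
  have "g * v * g \<in> B" by (rule local_compression_commutes[OF vC I _ g(1)]) (use True in blast)
  then obtain J l where J: "ideal J" "J \<subseteq> U g" "\<And>p. p \<in> J \<Longrightarrow> norm (g * v * g * p - cs l p) \<le> e * norm p"
    using almost_scalar_commutant[OF _ g(3) e] by blast
  have "norm (q * v * p - cs l (q * p)) \<le> e * norm q * norm p" if "p \<in> J" "q \<in> J" for p q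
  proof -
    have "g * p = p" "q * g = q" using U_left[OF g(2)] J(2) that by blast+
    then have "q * v * p - cs l (q * p) = q * (g * v * g * p - cs l p)"
      by (simp add: right_diff_distrib cs_mult_right flip: mult.assoc) (simp add: mult.assoc)
    then have "norm (q * v * p - cs l (q * p)) \<le> norm q * norm (g * v * g * p - cs l p)"
      by (simp add: norm_mult_ineq)
    also have "\<dots> \<le> norm q * (e * norm p)" using J(3)[OF that(1)] by (intro mult_left_mono) auto
    finally show ?thesis by (simp add: mult.commute mult.left_commute)
  qed
  then show ?thesis using J g(4) unfolding almost_scalar_def by blast
next
  case False
  then obtain d f where df: "d \<in> I" "f \<in> I" "d * f = 0" "d * v * f \<noteq> 0" by blast
  have D: "d \<in> D" "f \<in> D" using idealD(1)[OF I] df by auto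
  define g1 where "g1 = st v * (st d * d) * v"
  have g1D: "g1 \<in> D" unfolding g1_def by (rule normalizer_conj[OF v]) (intro D_closure D)
  define h where "h = st f * g1 * f"
  have hh: "h = st (d * v * f) * (d * v * f)" by (simp add: h_def g1_def st_mult mult.assoc)
  then have h0: "h \<noteq> 0" using df(4) norm_st_mult[of "d * v * f"] by auto
  have hI: "h \<in> I" unfolding h_def by (intro idealD(3)[OF I df(2)] D_closure D g1D)
  have hD: "h \<in> D" using idealD(1)[OF I hI] .
  \<comment> \<open>\<open>v * h\<close> can be written with \<open>st d * d\<close> in front, which
    is annihilated by the last factor \<open>f\<close> of \<open>h\<close>.\<close>
  have hvh: "h * v * h = 0"
  proof -
    define t where "t = v * (st f * f) * st v"
    have tD: "t \<in> D" unfolding t_def by (rule normalizer_conj[OF v]) (intro D_closure D)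
    have ddD: "st d * d \<in> D" by (intro D_closure D)
    have ffd: "f * (st d * d) = 0" using D_comm[OF D(2) ddD] df(3) by (simp add: mult.assoc)
    have "v * h = v * (st f * f) * g1" unfolding h_def
      using D_comm[OF g1D D(2)] by (simp add: mult.assoc)
    also have "\<dots> = t * (st d * d) * v" by (simp add: t_def g1_def mult.assoc)
    also have "\<dots> = st d * d * t * v" using D_comm[OF tD ddD] by simp
    finally have "h * v * h = st f * g1 * (f * (st d * d)) * t * v" by (simp add: h_def mult.assoc)
    then show ?thesis by (simp add: ffd)
  qed
  obtain y where y: "y \<in> D" "h * y \<in> D" "ideal (U (h * y))" using local_unit[OF hD h0] by metis
  have sub: "U (h * y) \<subseteq> I"
  proof
    fix s assume "s \<in> U (h * y)"
    then have s: "h * (y * s) = s" "s \<in> D" by (auto simp: U_def mult.assoc)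
    show "s \<in> I" using idealD(4)[OF I hI D_closure(5)[OF y(1) s(2)]] s(1) by simp
  qed
  have "norm (q * v * p - cs 0 (q * p)) \<le> e * norm q * norm p" if "p \<in> U (h * y)" "q \<in> U (h * y)" for p q
  proof -
    have 1: "h * y * p = p" "q * (h * y) = q" using U_left[OF y(2)] that by blast+
    have hy: "h * y = y * h" using D_comm[OF hD y(1)] .
    have "q * v * p = q * (y * h) * v * (h * y * p)" by (simp add: 1 flip: hy)
    also have "\<dots> = q * y * (h * v * h) * y * p" by (simp only: mult.assoc)
    finally have "q * v * p = 0" by (simp add: hvh)
    then show ?thesis using e by simp
  qed
  then show ?thesis using y(3) sub unfolding almost_scalar_def by blast
qed

text \<open>The elements with this property for all ideals and tolerances form a closed subspace;
  for sums, the ideal of the second summand is chosen inside that of the first.\<close>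

lemma almost_scalar_C:
  assumes c: "c \<in> C" and "ideal I" "0 < e"
  shows "\<exists>J. ideal J \<and> J \<subseteq> I \<and> almost_scalar c e J"
proof -
  define V where "V = {c. \<forall>e>0. \<forall>I. ideal I \<longrightarrow> (\<exists>J. ideal J \<and> J \<subseteq> I \<and> almost_scalar c e J)}"
  have VI: "c \<in> V" if "\<And>e I. 0 < e \<Longrightarrow> ideal I \<Longrightarrow> \<exists>J. ideal J \<and> J \<subseteq> I \<and> almost_scalar c e J" for c
    using that by (auto simp: V_def)
  have VD: "\<exists>J. ideal J \<and> J \<subseteq> I \<and> almost_scalar c e J" if "c \<in> V" "0 < e" "ideal I" for c e I
    using that by (auto simp: V_def)
  have zero: "0 \<in> V"
  proof (rule VI)
    fix e :: real and I assume "0 < e" "ideal I"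
    then have "almost_scalar 0 e I" unfolding almost_scalar_def by (intro exI[of _ 0]) simp
    then show "\<exists>J. ideal J \<and> J \<subseteq> I \<and> almost_scalar 0 e J" using \<open>ideal I\<close> by blast
  qed
  have add: "x + y \<in> V" if xy: "x \<in> V" "y \<in> V" for x y
  proof (rule VI)
    fix e :: real and I assume e: "0 < e" and I: "ideal I"
    from e have e2: "0 < e/2" by simp
    obtain J l where J: "ideal J" "J \<subseteq> I" "\<And>p q. p \<in> J \<Longrightarrow> q \<in> J \<Longrightarrow> norm (q * x * p - cs l (q * p)) \<le> e/2 * norm q * norm p"
      using VD[OF xy(1) e2 I] unfolding almost_scalar_def by blast
    obtain K k where K: "ideal K" "K \<subseteq> J" "\<And>p q. p \<in> K \<Longrightarrow> q \<in> K \<Longrightarrow> norm (q * y * p - cs k (q * p)) \<le> e/2 * norm q * norm p"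
      using VD[OF xy(2) e2 J(1)] unfolding almost_scalar_def by blast
    have "norm (q * (x + y) * p - cs (l + k) (q * p)) \<le> e * norm q * norm p" if "p \<in> K" "q \<in> K" for p q
    proof -
      have "q * (x + y) * p - cs (l + k) (q * p) = (q * x * p - cs l (q * p)) + (q * y * p - cs k (q * p))"
        by (simp add: distrib_left distrib_right cs_add_left)
      then have "norm (q * (x + y) * p - cs (l + k) (q * p)) \<le> norm (q * x * p - cs l (q * p)) + norm (q * y * p - cs k (q * p))"
        by (metis norm_triangle_ineq)
      also have "\<dots> \<le> e/2 * norm q * norm p + e/2 * norm q * norm p"
        using J(3)[of p q] K(2,3) that by (intro add_mono) auto
      finally show ?thesis by (simp add: mult_ac)
    qed
    then show "\<exists>J. ideal J \<and> J \<subseteq> I \<and> almost_scalar (x + y) e J"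
      using J K unfolding almost_scalar_def by blast
  qed
  have scal: "cs a x \<in> V" if x: "x \<in> V" for a x
  proof (rule VI)
    fix e :: real and I assume e: "0 < e" and I: "ideal I"
    define e' where "e' = e / (cmod a + 1)"
    have na: "0 < cmod a + 1" by (simp add: add_nonneg_pos)
    then have e': "0 < e'" using e by (simp add: e'_def)
    obtain J l where J: "ideal J" "J \<subseteq> I" "\<And>p q. p \<in> J \<Longrightarrow> q \<in> J \<Longrightarrow> norm (q * x * p - cs l (q * p)) \<le> e' * norm q * norm p"
      using VD[OF x e' I] unfolding almost_scalar_def by blast
    have "norm (q * cs a x * p - cs (a * l) (q * p)) \<le> e * norm q * norm p" if "p \<in> J" "q \<in> J" for p q
    proof -
      have "q * cs a x * p - cs (a * l) (q * p) = cs a (q * x * p - cs l (q * p))"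
        by (simp add: cs_mult_left cs_mult_right cs_diff_right cs_cs)
      then have "norm (q * cs a x * p - cs (a * l) (q * p)) \<le> cmod a * (e' * norm q * norm p)"
        using J(3)[OF that] by (simp add: norm_cs mult_left_mono)
      also have "\<dots> \<le> (cmod a + 1) * (e' * norm q * norm p)" using e' by (intro mult_right_mono) auto
      also have "\<dots> = e * norm q * norm p" using na by (simp add: e'_def)
      finally show ?thesis .
    qed
    then show "\<exists>J. ideal J \<and> J \<subseteq> I \<and> almost_scalar (cs a x) e J"
      using J unfolding almost_scalar_def by blast
  qed
  have "closed V" unfolding closed_sequential_limits
  proof (intro allI impI, elim conjE)
    fix f x assume f: "\<forall>n. f n \<in> V" and lim: "f \<longlonglongrightarrow> x"
    show "x \<in> V"
    proof (rule VI)
      fix e :: real and I assume e: "0 < e" and I: "ideal I"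
      from e have e2: "0 < e/2" by simp
      obtain n where n: "norm (f n - x) < e/2" using LIMSEQ_D[OF lim e2] by blast
      obtain J l where J: "ideal J" "J \<subseteq> I" "\<And>p q. p \<in> J \<Longrightarrow> q \<in> J \<Longrightarrow> norm (q * f n * p - cs l (q * p)) \<le> e/2 * norm q * norm p"
        using VD[OF f[rule_format] e2 I] unfolding almost_scalar_def by blast
      have "norm (q * x * p - cs l (q * p)) \<le> e * norm q * norm p" if "p \<in> J" "q \<in> J" for p q
      proof -
        have "q * x * p - cs l (q * p) = (q * f n * p - cs l (q * p)) - q * (f n - x) * p"
          by (simp add: algebra_simps)
        then have "norm (q * x * p - cs l (q * p)) \<le> norm (q * f n * p - cs l (q * p)) + norm (q * (f n - x) * p)"
          by (metis norm_triangle_ineq4)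
        also have "\<dots> \<le> e/2 * norm q * norm p + norm q * (e/2) * norm p"
        proof (rule add_mono[OF J(3)[OF that]])
          have "norm (q * (f n - x) * p) \<le> norm q * norm (f n - x) * norm p"
            by (meson norm_mult_ineq mult_right_mono norm_ge_zero order_trans)
          also have "\<dots> \<le> norm q * (e/2) * norm p" using n by (intro mult_right_mono mult_left_mono) auto
          finally show "norm (q * (f n - x) * p) \<le> norm q * (e/2) * norm p" .
        qed
        finally show ?thesis by (simp add: mult_ac)
      qed
      then show "\<exists>J. ideal J \<and> J \<subseteq> I \<and> almost_scalar x e J"
        using J unfolding almost_scalar_def by blast
    qed
  qed
  moreover have "csubspace cs V" using zero add scal by (auto simp: csubspace_def)
  moreover have "normalizers st C D \<subseteq> V" using almost_scalar_normalizer VI by blast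
  ultimately have "c \<in> V" using C_induct c by blast
  then show ?thesis using VD assms by blast
qed

lemma almost_scalar_mono: "almost_scalar c e I \<Longrightarrow> J \<subseteq> I \<Longrightarrow> almost_scalar c e J"
  unfolding almost_scalar_def by blast

lemma almost_scalar_finite:
  fixes c :: "nat \<Rightarrow> 'a"
  assumes "range c \<subseteq> C" "ideal I" "0 < e"
  shows "\<exists>J. ideal J \<and> J \<subseteq> I \<and> (\<forall>i<n. almost_scalar (c i) e J)"
proof (induction n)
  case (Suc n)
  then obtain J where J: "ideal J" "J \<subseteq> I" "\<forall>i<n. almost_scalar (c i) e J" by blast
  have "c n \<in> C" using assms(1) by blast
  then obtain K where K: "ideal K" "K \<subseteq> J" "almost_scalar (c n) e K"
    using almost_scalar_C J(1) assms(3) by blast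
  then have "\<forall>i<Suc n. almost_scalar (c i) e K" using J(3) almost_scalar_mono less_Suc_eq by metis
  then show ?case using J K by blast
qed (use assms in auto)

subsection \<open>Sequences that excise\<close>

text \<open>A diagonal choice: \<open>h (Suc n)\<close> and all later members lie in an ideal on
  which the first \<open>n\<close> elements are scalar up to \<open>1/(n+1)\<close>. One scalar
  therefore serves all indices beyond \<open>n\<close>, and the scalars for growing \<open>n\<close>
  form a Cauchy sequence.\<close>

lemma excising_sequence:
  fixes c :: "nat \<Rightarrow> 'a"
  assumes c: "range c \<subseteq> C" and I: "ideal I"
  obtains h where "\<And>n. h n \<in> D" "\<And>n. st (h n) = h n" "\<And>n. norm (h n) = 1"
    "\<And>n. h n * h (Suc n) = h (Suc n)" "\<And>n. ideal (U (h n))" "\<And>n. U (h n) \<subseteq> I"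
    "\<And>i. \<exists>l. (\<lambda>n. h n * c i * h n - cs l (h n * h n)) \<longlonglongrightarrow> 0"
proof -
  define P where "P n h \<longleftrightarrow> h \<in> D \<and> st h = h \<and> norm h = 1 \<and> ideal (U h) \<and> U h \<subseteq> I" for n :: nat and h
  define Q where "Q n h h' \<longleftrightarrow> (\<exists>J. h' \<in> J \<and> U h' \<subseteq> J \<and> J \<subseteq> U h \<and> (\<forall>i<n. almost_scalar (c i) (1 / real (Suc n)) J))"
    for n h h'
  obtain h0 where "P 0 h0" using local_unit_ideal[OF I] unfolding P_def by metis
  moreover have "\<exists>h'. P (Suc n) h' \<and> Q n h h'" if "P n h" for n h
  proof -
    have iU: "ideal (U h)" using that by (simp add: P_def)
    obtain J where J: "ideal J" "J \<subseteq> U h" "\<forall>i<n. almost_scalar (c i) (1 / real (Suc n)) J"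
      using almost_scalar_finite[OF c iU, of "1 / real (Suc n)" n] by auto
    obtain h' where "h' \<in> J" "h' \<in> D" "st h' = h'" "norm h' = 1" "ideal (U h')" "U h' \<subseteq> J"
      using local_unit_ideal[OF J(1)] by metis
    then show ?thesis using J that unfolding P_def Q_def by (intro exI[of _ h'] conjI exI[of _ J]) auto
  qed
  ultimately obtain h where h: "\<And>n. P n (h n)" "\<And>n. Q n (h n) (h (Suc n))"
    using dependent_nat_choice[of P Q] by metis
  have hD: "h n \<in> D" and hs: "st (h n) = h n" and hn: "norm (h n) = 1" for n
    using h(1)[of n] by (auto simp: P_def)
  have in_U: "h (Suc n) \<in> U (h n)" "U (h (Suc n)) \<subseteq> U (h n)" for n using h(2)[of n] unfolding Q_def by blast+
  have hm: "h m \<in> U (h n)" if "n < m" for n m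
    using that
  proof (induction m)
    case (Suc m)
    have 1: "h m * h (Suc m) = h (Suc m)" using in_U[of m] by (simp add: U_def)
    show ?case
    proof (cases "n = m")
      case False
      then have "h n * h m = h m" using Suc by (simp add: U_def)
      then have "h n * h (Suc m) = h (Suc m)" using 1 by (metis mult.assoc)
      then show ?thesis using hD by (simp add: U_def)
    qed (use in_U in simp)
  qed simp
  have hh1: "norm (h n * h n) = 1" for n using norm_sa_square[OF hs] hn by simp
  have ex: "\<exists>l. \<forall>m\<ge>Suc n. norm (h m * c i * h m - cs l (h m * h m)) \<le> 1 / real (Suc n)" if "i < n" for i n
  proof -
    obtain J where J: "h (Suc n) \<in> J" "U (h (Suc n)) \<subseteq> J" "almost_scalar (c i) (1 / real (Suc n)) J"
      using h(2)[of n] \<open>i < n\<close> unfolding Q_def by blast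
    obtain l where l: "\<And>p q. p \<in> J \<Longrightarrow> q \<in> J \<Longrightarrow> norm (q * c i * p - cs l (q * p)) \<le> 1 / real (Suc n) * norm q * norm p"
      using J(3) unfolding almost_scalar_def by blast
    have "h m \<in> J" if "m \<ge> Suc n" for m
      using that J hm[of "Suc n" m] by (cases "m = Suc n") auto
    then show ?thesis using l hn by (metis mult.right_neutral)
  qed
  have "\<exists>l. (\<lambda>n. h n * c i * h n - cs l (h n * h n)) \<longlonglongrightarrow> 0" for i
  proof -
    obtain L where L: "\<And>n m. i < n \<Longrightarrow> m \<ge> Suc n \<Longrightarrow> norm (h m * c i * h m - cs (L n) (h m * h m)) \<le> 1 / real (Suc n)"
      using ex by metis
    have LL: "norm (L n - L k) \<le> 2 / real (Suc n)" if "i < n" "n \<le> k" for n k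
    proof -
      define m where "m = Suc k"
      have "norm (L n - L k) = norm (cs (L n - L k) (h m * h m))" by (simp add: norm_cs hh1)
      also have "cs (L n - L k) (h m * h m) = (h m * c i * h m - cs (L k) (h m * h m)) - (h m * c i * h m - cs (L n) (h m * h m))"
        by (simp add: cs_diff_left)
      also have "norm \<dots> \<le> 1 / real (Suc k) + 1 / real (Suc n)"
        using L[of k m] L[of n m] that by (intro order_trans[OF norm_triangle_ineq4 add_mono]) (auto simp: m_def)
      also have "\<dots> \<le> 1 / real (Suc n) + 1 / real (Suc n)"
        using that by (intro add_mono divide_left_mono) auto
      finally show ?thesis by simp
    qed
    have "Cauchy L"
    proof (rule CauchyI')
      fix e :: real assume e: "0 < e"
      obtain N :: nat where N: "2 / e < real N" using reals_Archimedean2 by blast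
      show "\<exists>M. \<forall>m\<ge>M. \<forall>n>m. dist (L m) (L n) < e"
      proof (intro exI[of _ "max N (Suc i)"] allI impI)
        fix m n assume m: "m \<ge> max N (Suc i)" and n: "n > m"
        have "dist (L m) (L n) \<le> 2 / real (Suc m)" using LL[of m n] m n by (simp add: dist_norm)
        also have "\<dots> < e"
        proof -
          have "2 < e * real N" using N e by (simp add: field_simps)
          also have "\<dots> \<le> e * real (Suc m)" using m e by (intro mult_left_mono) auto
          finally show ?thesis by (simp add: field_simps)
        qed
        finally show "dist (L m) (L n) < e" .
      qed
    qed
    then obtain l where l: "L \<longlonglongrightarrow> l" using Cauchy_convergent convergent_def by blast
    have "(\<lambda>n. h n * c i * h n - cs l (h n * h n)) \<longlonglongrightarrow> 0"
    proof (rule LIMSEQ_imp_Suc, rule Lim_null_comparison)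
      show "\<forall>\<^sub>F n in sequentially. norm (h (Suc n) * c i * h (Suc n) - cs l (h (Suc n) * h (Suc n)))
          \<le> 1 / real (Suc n) + norm (L n - l)"
      proof (rule eventually_sequentiallyI[of "Suc i"])
        fix n assume n: "Suc i \<le> n"
        let ?m = "Suc n"
        have "h ?m * c i * h ?m - cs l (h ?m * h ?m) = (h ?m * c i * h ?m - cs (L n) (h ?m * h ?m)) + cs (L n - l) (h ?m * h ?m)"
          by (simp add: cs_diff_left)
        also have "norm \<dots> \<le> 1 / real (Suc n) + norm (L n - l)"
          using L[of n ?m] n by (intro norm_triangle_le add_mono) (auto simp: norm_cs hh1)
        finally show "norm (h ?m * c i * h ?m - cs l (h ?m * h ?m)) \<le> 1 / real (Suc n) + norm (L n - l)" .
      qed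
      have "(\<lambda>n. 1 / real (Suc n) + norm (L n - l)) \<longlonglongrightarrow> 0 + norm (l - l)"
        by (intro tendsto_intros l LIMSEQ_Suc[OF lim_1_over_n])
      then show "(\<lambda>n. 1 / real (Suc n) + norm (L n - l)) \<longlonglongrightarrow> 0" by simp
    qed
    then show ?thesis by blast
  qed
  moreover have "h n * h (Suc n) = h (Suc n)" for n using in_U[of n] by (simp add: U_def)
  moreover have "ideal (U (h n))" "U (h n) \<subseteq> I" for n using h(1)[of n] by (auto simp: P_def)
  ultimately show thesis using that hD hs hn by blast
qed

end

section \<open>Excised functionals\<close>

lemma norm_add_diff_le: "norm (a + b - c) \<le> norm a + norm b + norm (c :: 'a::real_normed_vector)"
  using norm_triangle_ineq4[of "a + b" c] norm_triangle_ineq[of a b] by linarith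

lemma null_mult_bounded:
  fixes f g :: "nat \<Rightarrow> 'a::real_normed_algebra"
  assumes "f \<longlonglongrightarrow> 0" "\<And>n. norm (g n) \<le> K"
  shows "(\<lambda>n. g n * f n) \<longlonglongrightarrow> 0" "(\<lambda>n. f n * g n) \<longlonglongrightarrow> 0"
proof -
  have K: "0 \<le> K" using assms(2)[of 0] norm_ge_zero[of "g 0"] by linarith
  have "norm (g n * f n) \<le> norm (f n) * K" "norm (f n * g n) \<le> norm (f n) * K" for n
    using norm_mult_ineq[of "g n" "f n"] norm_mult_ineq[of "f n" "g n"]
      mult_left_mono[OF assms(2)[of n], of "norm (f n)"] by (auto simp: mult.commute)
  then show "(\<lambda>n. g n * f n) \<longlonglongrightarrow> 0" "(\<lambda>n. f n * g n) \<longlonglongrightarrow> 0"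
    using tendsto_0_le[OF assms(1), of _ K] by (metis (mono_tags, lifting) always_eventually)+
qed

text \<open>\<open>W\<close> stands for the scalar multiples of products of normalizers. Only
  \<open>W_conj\<close> is kept of the normalizer property, so that the ambient unit, possibly
  outside a non-unital algebra, may belong to \<open>W\<close>; it defines the cyclic
  vector.\<close>

locale excision = cstar_algebra +
  fixes D W :: "'a::{real_normed_algebra_1,banach} set" and h :: "nat \<Rightarrow> 'a"
  assumes D_sub: "cstar_subalg cs st D" and D_comm: "\<And>x y. x \<in> D \<Longrightarrow> y \<in> D \<Longrightarrow> x * y = y * x"
    and h_D: "h n \<in> D" and h_sa: "st (h n) = h n" and norm_h: "norm (h n) = 1"
    and h_Suc: "h n * h (Suc n) = h (Suc n)"
    and W_1: "1 \<in> W" and W_cs: "w \<in> W \<Longrightarrow> cs c w \<in> W" and W_mult: "v \<in> W \<Longrightarrow> w \<in> W \<Longrightarrow> v * w \<in> W"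
    and W_st: "w \<in> W \<Longrightarrow> st w \<in> W" and W_conj: "w \<in> W \<Longrightarrow> d \<in> D \<Longrightarrow> w * d * st w \<in> D"
    and W_scalar: "w \<in> W \<Longrightarrow> \<exists>l. (\<lambda>n. h n * w * h n - cs l (h n * h n)) \<longlonglongrightarrow> 0"
begin

lemmas D_closure = cstar_subalgD[OF D_sub]

lemma norm_hh: "norm (h n * h n) = 1"
  using norm_sa_square[OF h_sa] norm_h by simp

lemma h_less: "i < j \<Longrightarrow> h i * h j = h j"
proof (induction j)
  case (Suc j)
  show ?case
  proof (cases "i = j")
    case False
    then have "h i * h j = h j" using Suc by simp
    then show ?thesis using h_Suc[of j] by (metis mult.assoc)
  qed (simp add: h_Suc)
qed simp

definition A :: "'a set" where "A = closure (cspan cs W)"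

lemma A_induct:
  assumes "closed V" "csubspace cs V" "W \<subseteq> V" "c \<in> A" shows "c \<in> V"
  using cspan_subset[OF assms(2,3)] closure_minimal[OF _ assms(1)] assms(4) unfolding A_def by blast

lemma W_A: "W \<subseteq> A" unfolding A_def using cspan_superset closure_subset by blast

lemma closed_A: "closed A" by (simp add: A_def)

lemma csubspace_closure:
  assumes "csubspace cs V" shows "csubspace cs (closure V)"
  unfolding csubspace_def
proof (intro conjI ballI allI)
  show "0 \<in> closure V" using assms closure_subset unfolding csubspace_def by blast
  show "x + y \<in> closure V" if xy: "x \<in> closure V" "y \<in> closure V" for x y
  proof -
    obtain f where f: "\<forall>n. f n \<in> V" "f \<longlonglongrightarrow> x" using xy(1) unfolding closure_sequential by blast
    obtain g where g: "\<forall>n. g n \<in> V" "g \<longlonglongrightarrow> y" using xy(2) unfolding closure_sequential by blast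
    have "(\<lambda>n. f n + g n) \<longlonglongrightarrow> x + y" by (intro tendsto_intros f g)
    moreover have "\<forall>n. f n + g n \<in> V" using f g assms by (auto simp: csubspace_def)
    ultimately show ?thesis unfolding closure_sequential by (intro exI[of _ "\<lambda>n. f n + g n"]) simp
  qed
  show "cs c x \<in> closure V" if x: "x \<in> closure V" for c x
  proof -
    obtain f where f: "\<forall>n. f n \<in> V" "f \<longlonglongrightarrow> x" using x unfolding closure_sequential by blast
    have "(\<lambda>n. cs c (f n)) \<longlonglongrightarrow> cs c x" by (intro tendsto_intros f)
    moreover have "\<forall>n. cs c (f n) \<in> V" using f assms by (auto simp: csubspace_def)
    ultimately show ?thesis unfolding closure_sequential by (intro exI[of _ "\<lambda>n. cs c (f n)"]) simp
  qed
qed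

lemma csubspace_A: "csubspace cs A" unfolding A_def by (intro csubspace_closure csubspace_cspan)

lemma A_0: "0 \<in> A" and A_add: "x \<in> A \<Longrightarrow> y \<in> A \<Longrightarrow> x + y \<in> A" and A_cs: "x \<in> A \<Longrightarrow> cs c x \<in> A"
  using csubspace_A by (auto simp: csubspace_def)

lemma A_diff: "x \<in> A \<Longrightarrow> y \<in> A \<Longrightarrow> x - y \<in> A"
  using csubspace_diff[OF csubspace_A] .

lemma A_sum: "(\<And>i. i \<in> F \<Longrightarrow> f i \<in> A) \<Longrightarrow> sum f F \<in> A"
  by (induction F rule: infinite_finite_induct) (auto intro: A_add A_0)

lemma A_mult: assumes "x \<in> A" "y \<in> A" shows "x * y \<in> A"
proof -
  have 1: "w * y \<in> A" if "w \<in> W" "y \<in> A" for w y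
  proof -
    have "y \<in> (\<lambda>y. w * y) -` A"
    proof (rule A_induct[OF _ _ _ \<open>y \<in> A\<close>])
      show "closed ((\<lambda>y. w * y) -` A)" by (intro closed_vimage closed_A continuous_intros)
      show "csubspace cs ((\<lambda>y. w * y) -` A)"
        using csubspace_A by (auto simp: csubspace_def distrib_left cs_mult_right)
      show "W \<subseteq> (\<lambda>y. w * y) -` A" using W_A W_mult[OF that(1)] by auto
    qed
    then show ?thesis by simp
  qed
  have "x \<in> (\<lambda>x. x * y) -` A"
  proof (rule A_induct[OF _ _ _ assms(1)])
    show "closed ((\<lambda>x. x * y) -` A)" by (intro closed_vimage closed_A continuous_intros)
    show "csubspace cs ((\<lambda>x. x * y) -` A)"
      using csubspace_A by (auto simp: csubspace_def distrib_right cs_mult_left)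
    show "W \<subseteq> (\<lambda>x. x * y) -` A" using 1[OF _ assms(2)] by auto
  qed
  then show ?thesis by simp
qed

lemma A_st: assumes "x \<in> A" shows "st x \<in> A"
proof -
  have "x \<in> st -` A"
  proof (rule A_induct[OF _ _ _ assms])
    show "closed (st -` A)" by (intro closed_vimage closed_A continuous_intros)
    show "csubspace cs (st -` A)" using csubspace_A by (auto simp: csubspace_def st_add st_cs)
    show "W \<subseteq> st -` A" using W_A W_st by auto
  qed
  then show ?thesis by simp
qed

lemma A_1: "1 \<in> A" using W_A W_1 by blast

lemmas A_intros = A_add A_diff A_cs A_mult A_st A_1 A_0 A_sum

text \<open>As \<open>h n * h n\<close> has norm 1, the scalar depends on the element with Lipschitz
  constant 1, so the scalars of a convergent sequence converge.\<close>

lemma A_scalar: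
  assumes "c \<in> A" shows "\<exists>l. (\<lambda>n. h n * c * h n - cs l (h n * h n)) \<longlonglongrightarrow> 0"
proof -
  define V where "V = {c. \<exists>l. (\<lambda>n. h n * c * h n - cs l (h n * h n)) \<longlonglongrightarrow> 0}"
  have "csubspace cs V" unfolding csubspace_def
  proof (intro conjI ballI allI)
    have "(\<lambda>n. h n * 0 * h n - cs 0 (h n * h n)) \<longlonglongrightarrow> 0" by simp
    then show "0 \<in> V" unfolding V_def by blast
    show "x + y \<in> V" if xy: "x \<in> V" "y \<in> V" for x y
    proof -
      obtain l k where 1: "(\<lambda>n. h n * x * h n - cs l (h n * h n)) \<longlonglongrightarrow> 0"
        and 2: "(\<lambda>n. h n * y * h n - cs k (h n * h n)) \<longlonglongrightarrow> 0" using xy unfolding V_def by blast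
      have "(\<lambda>n. h n * (x + y) * h n - cs (l + k) (h n * h n)) \<longlonglongrightarrow> 0"
        using tendsto_add[OF 1 2] by (simp add: distrib_left distrib_right cs_add_left algebra_simps)
      then show ?thesis unfolding V_def by blast
    qed
    show "cs a x \<in> V" if xy: "x \<in> V" for a x
    proof -
      obtain l where 1: "(\<lambda>n. h n * x * h n - cs l (h n * h n)) \<longlonglongrightarrow> 0" using xy unfolding V_def by blast
      have "(\<lambda>n. h n * cs a x * h n - cs (a * l) (h n * h n)) \<longlonglongrightarrow> 0"
        using tendsto_cs[OF tendsto_const 1, of a] by (simp add: cs_diff_right cs_mult_left cs_mult_right cs_cs)
      then show ?thesis unfolding V_def by blast
    qed
  qed
  moreover have "closed V" unfolding closed_sequential_limits
  proof (intro allI impI, elim conjE)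
    fix f x assume f: "\<forall>n. f n \<in> V" and lim: "f \<longlonglongrightarrow> x"
    obtain L where L: "\<And>k. (\<lambda>n. h n * f k * h n - cs (L k) (h n * h n)) \<longlonglongrightarrow> 0"
      using f unfolding V_def by (auto simp: choice_iff)
    have LL: "norm (L j - L k) \<le> norm (f j - f k)" for j k
    proof (rule LIMSEQ_le_const)
      have "(\<lambda>n. norm (f j - f k) + norm (h n * f k * h n - cs (L k) (h n * h n)) + norm (h n * f j * h n - cs (L j) (h n * h n)))
          \<longlonglongrightarrow> norm (f j - f k) + norm (0::'a) + norm (0::'a)" by (intro tendsto_intros L)
      then show "(\<lambda>n. norm (f j - f k) + norm (h n * f k * h n - cs (L k) (h n * h n)) + norm (h n * f j * h n - cs (L j) (h n * h n)))
          \<longlonglongrightarrow> norm (f j - f k)" by simp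
      show "\<exists>N. \<forall>n\<ge>N. norm (L j - L k) \<le> norm (f j - f k) + norm (h n * f k * h n - cs (L k) (h n * h n)) + norm (h n * f j * h n - cs (L j) (h n * h n))"
      proof (intro exI allI impI)
        fix n
        have "norm (L j - L k) = norm (cs (L j - L k) (h n * h n))" by (simp add: norm_cs norm_hh)
        also have "cs (L j - L k) (h n * h n) = h n * (f j - f k) * h n + (h n * f k * h n - cs (L k) (h n * h n))
            - (h n * f j * h n - cs (L j) (h n * h n))"
          by (simp add: cs_diff_left algebra_simps)
        also have "norm \<dots> \<le> norm (h n * (f j - f k) * h n) + norm (h n * f k * h n - cs (L k) (h n * h n)) + norm (h n * f j * h n - cs (L j) (h n * h n))"
          by (rule norm_add_diff_le)
        also have "norm (h n * (f j - f k) * h n) \<le> norm (f j - f k)"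
          using norm_mult_ineq[of "h n * (f j - f k)" "h n"] norm_mult_ineq[of "h n" "f j - f k"] norm_h[of n] by simp
        finally show "norm (L j - L k) \<le> norm (f j - f k) + norm (h n * f k * h n - cs (L k) (h n * h n)) + norm (h n * f j * h n - cs (L j) (h n * h n))"
          by simp
      qed
    qed
    have "Cauchy f" using lim convergent_Cauchy convergent_def by blast
    then have "Cauchy L" unfolding Cauchy_def dist_norm using LL by (meson le_less_trans)
    then obtain l where l: "L \<longlonglongrightarrow> l" using Cauchy_convergent convergent_def by blast
    have "(\<lambda>n. h n * x * h n - cs l (h n * h n)) \<longlonglongrightarrow> 0"
    proof (rule LIMSEQ_I)
      fix e :: real assume e: "0 < e"
      then have e3: "0 < e/3" by simp
      obtain k1 where k1: "\<And>k. k \<ge> k1 \<Longrightarrow> norm (f k - x) < e/3" using LIMSEQ_D[OF lim e3] by blast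
      obtain k2 where k2: "\<And>k. k \<ge> k2 \<Longrightarrow> norm (L k - l) < e/3" using LIMSEQ_D[OF l e3] by blast
      define k where "k = max k1 k2"
      have k: "norm (f k - x) < e/3" "norm (L k - l) < e/3" using k1 k2 by (auto simp: k_def)
      obtain N where N: "\<And>n. n \<ge> N \<Longrightarrow> norm (h n * f k * h n - cs (L k) (h n * h n) - 0) < e/3"
        using LIMSEQ_D[OF L e3] by blast
      have "norm (h n * x * h n - cs l (h n * h n) - 0) < e" if "n \<ge> N" for n
      proof -
        have "h n * x * h n - cs l (h n * h n) - 0 = (h n * f k * h n - cs (L k) (h n * h n)) + cs (L k - l) (h n * h n)
            - h n * (f k - x) * h n"
          by (simp add: cs_diff_left algebra_simps)
        also have "norm \<dots> \<le> norm (h n * f k * h n - cs (L k) (h n * h n)) + norm (cs (L k - l) (h n * h n)) + norm (h n * (f k - x) * h n)"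
          by (rule norm_add_diff_le)
        also have "norm (h n * (f k - x) * h n) \<le> norm (f k - x)"
          using norm_mult_ineq[of "h n * (f k - x)" "h n"] norm_mult_ineq[of "h n" "f k - x"] norm_h[of n] by simp
        finally show ?thesis using N[OF that] k by (simp add: norm_cs norm_hh)
      qed
      then show "\<exists>N. \<forall>n\<ge>N. norm (h n * x * h n - cs l (h n * h n) - 0) < e" by blast
    qed
    then show "x \<in> V" unfolding V_def by blast
  qed
  moreover have "W \<subseteq> V" using W_scalar by (auto simp: V_def)
  ultimately show ?thesis using A_induct assms by (auto simp: V_def)
qed

text \<open>The functional excised by \<open>h\<close>; it is only meaningful on \<open>A\<close>.\<close>
definition phi :: "'a \<Rightarrow> complex"
  where "phi c = (SOME l. (\<lambda>n. h n * c * h n - cs l (h n * h n)) \<longlonglongrightarrow> 0)"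

lemma phi_lim: "c \<in> A \<Longrightarrow> (\<lambda>n. h n * c * h n - cs (phi c) (h n * h n)) \<longlonglongrightarrow> 0"
  unfolding phi_def by (rule someI_ex[OF A_scalar])

lemma cs_hh_null: "(\<lambda>n. cs l (h n * h n)) \<longlonglongrightarrow> 0 \<Longrightarrow> l = 0"
proof -
  assume "(\<lambda>n. cs l (h n * h n)) \<longlonglongrightarrow> 0"
  from tendsto_norm_zero[OF this] have "(\<lambda>n. cmod l) \<longlonglongrightarrow> 0" by (simp add: norm_cs norm_hh)
  then show "l = 0" by (simp add: LIMSEQ_const_iff)
qed

lemma phi_eqI:
  assumes "c \<in> A" "(\<lambda>n. h n * c * h n - cs l (h n * h n)) \<longlonglongrightarrow> 0" shows "phi c = l"
proof -
  have "(\<lambda>n. cs (l - phi c) (h n * h n)) \<longlonglongrightarrow> 0"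
    using tendsto_diff[OF phi_lim[OF assms(1)] assms(2)] by (simp add: cs_diff_left)
  then show ?thesis using cs_hh_null by fastforce
qed

lemma phi_add: "x \<in> A \<Longrightarrow> y \<in> A \<Longrightarrow> phi (x + y) = phi x + phi y"
  using tendsto_add[OF phi_lim[of x] phi_lim[of y]]
  by (intro phi_eqI) (auto intro: A_intros simp: distrib_left distrib_right cs_add_left algebra_simps)

lemma phi_cs: "x \<in> A \<Longrightarrow> phi (cs a x) = a * phi x"
  using tendsto_cs[OF tendsto_const phi_lim[of x], of a]
  by (intro phi_eqI) (auto intro: A_intros simp: cs_diff_right cs_mult_left cs_mult_right cs_cs)

lemma phi_0: "phi 0 = 0" using phi_cs[OF A_0, of 0] by simp

lemma phi_diff: "x \<in> A \<Longrightarrow> y \<in> A \<Longrightarrow> phi (x - y) = phi x - phi y"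
  using phi_add[of x "cs (-1) y"] phi_cs[of y "-1"] A_cs[of y "-1"] by (simp add: cs_minus_left)

lemma phi_sum: "(\<And>i. i \<in> F \<Longrightarrow> f i \<in> A) \<Longrightarrow> phi (sum f F) = (\<Sum>i\<in>F. phi (f i))"
  by (induction F rule: infinite_finite_induct) (auto simp: phi_0 phi_add A_sum)

lemma phi_st: "x \<in> A \<Longrightarrow> phi (st x) = cnj (phi x)"
  using tendsto_st[OF phi_lim[of x]]
  by (intro phi_eqI) (auto intro: A_intros simp: st_diff st_mult st_cs h_sa mult.assoc)

lemma phi_1: "phi 1 = 1"
  by (rule phi_eqI) (auto intro: A_intros)

lemma phi_norm_lim: "c \<in> A \<Longrightarrow> (\<lambda>n. norm (h n * c * h n)) \<longlonglongrightarrow> cmod (phi c)"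
proof -
  assume c: "c \<in> A"
  have "(\<lambda>n. norm (h n * c * h n) - norm (cs (phi c) (h n * h n))) \<longlonglongrightarrow> 0"
    by (rule tendsto_0_le[OF phi_lim[OF c], of _ 1]) (auto simp: norm_triangle_ineq3)
  then show ?thesis by (simp add: norm_cs norm_hh LIM_zero_iff)
qed

text \<open>Were the real number \<open>z\<close> negative, the positive element
  \<open>- z h^2\<close> would be dominated by \<open>h * (st c * c) * h - z h^2\<close>, whose norm
  tends to 0.\<close>

lemma phi_st_mult:
  assumes "c \<in> A" shows "phi (st c * c) = complex_of_real (cmod (phi (st c * c)))"
proof -
  have A: "st c * c \<in> A" using assms by (intro A_intros)
  define z where "z = phi (st c * c)"
  have "cnj z = z" unfolding z_def using phi_st[OF A] by (simp add: st_mult)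
  then have zr: "z = complex_of_real (Re z)" by (simp add: complex_eq_iff)
  have "0 \<le> Re z"
  proof (rule ccontr)
    assume neg: "\<not> 0 \<le> Re z"
    have "norm ((- Re z) *\<^sub>R (h n * h n)) \<le> norm (h n * (st c * c) * h n - cs z (h n * h n))" for n
    proof (rule norm_mono_pos)
      show "pos ((- Re z) *\<^sub>R (h n * h n))" using pos_scaleR[OF pos_square[OF h_sa], of "- Re z"] neg by simp
      have "cs z (h n * h n) = Re z *\<^sub>R (h n * h n)" by (subst zr) (rule cs_of_real)
      then have "h n * (st c * c) * h n - cs z (h n * h n) - (- Re z) *\<^sub>R (h n * h n) = st (c * h n) * (c * h n)"
        by (simp add: st_mult h_sa mult.assoc)
      then show "pos (h n * (st c * c) * h n - cs z (h n * h n) - (- Re z) *\<^sub>R (h n * h n))"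
        using pos_st_mult by simp
    qed
    then have "- Re z \<le> norm (h n * (st c * c) * h n - cs z (h n * h n))" for n using neg by (simp add: norm_hh)
    then have "\<exists>N. \<forall>n\<ge>N. - Re z \<le> norm (h n * (st c * c) * h n - cs z (h n * h n))" by blast
    then have "- Re z \<le> norm (0::'a)"
      unfolding z_def by (rule LIMSEQ_le_const[OF tendsto_norm[OF phi_lim[OF A]]])
    then show False using neg by simp
  qed
  then show ?thesis using zr by (metis norm_of_real abs_of_nonneg z_def)
qed

text \<open>The seminorm of the vector that \<open>c\<close> defines in the GNS representation of \<open>phi\<close>.\<close>
definition N :: "'a \<Rightarrow> real" where "N c = sqrt (cmod (phi (st c * c)))"

text \<open>The seminorm is a limit of norms, so the triangle inequality and the bound for left
  multiplication are inherited from the algebra.\<close>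

lemma N_lim: assumes "c \<in> A" shows "(\<lambda>n. norm (c * h n)) \<longlonglongrightarrow> N c"
proof -
  have A: "st c * c \<in> A" using assms by (intro A_intros)
  have "norm (h n * (st c * c) * h n) = (norm (c * h n))\<^sup>2" for n
    using norm_st_mult[of "c * h n"] by (simp add: st_mult h_sa mult.assoc)
  then have "(\<lambda>n. sqrt ((norm (c * h n))\<^sup>2)) \<longlonglongrightarrow> N c"
    unfolding N_def using tendsto_real_sqrt[OF phi_norm_lim[OF A]] by simp
  then show ?thesis by simp
qed

lemma N_nonneg: "0 \<le> N c" by (simp add: N_def)

lemma N_triangle: "x \<in> A \<Longrightarrow> y \<in> A \<Longrightarrow> N (x + y) \<le> N x + N y"
  by (rule LIMSEQ_le[OF N_lim tendsto_add[OF N_lim N_lim]])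
    (auto intro: A_intros simp: distrib_right norm_triangle_ineq)

lemma N_cs: "x \<in> A \<Longrightarrow> N (cs a x) = cmod a * N x"
  by (rule LIMSEQ_unique[OF N_lim]) (auto intro!: A_intros tendsto_intros N_lim simp: cs_mult_left norm_cs)

lemma N_mult: "x \<in> A \<Longrightarrow> y \<in> A \<Longrightarrow> N (x * y) \<le> norm x * N y"
  by (rule LIMSEQ_le[OF N_lim tendsto_mult[OF tendsto_const N_lim]])
    (auto intro: A_intros simp: mult.assoc norm_mult_ineq)

lemma N_le_norm: "x \<in> A \<Longrightarrow> N x \<le> norm x"
  using N_mult[of x 1] by (simp add: A_1 N_def[of 1] phi_1)

lemma N_0: "N 0 = 0" by (simp add: N_def phi_0)

lemma N_sum: "(\<And>i. i \<in> F \<Longrightarrow> f i \<in> A) \<Longrightarrow> N (sum f F) \<le> (\<Sum>i\<in>F. N (f i))"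
  by (induction F rule: infinite_finite_induct) (auto simp: N_0 A_sum intro: order_trans[OF N_triangle])

lemma phi_le_N: assumes "c \<in> A" shows "cmod (phi c) \<le> N c"
proof (rule LIMSEQ_le[OF phi_norm_lim[OF assms] N_lim[OF assms]])
  have "norm (h n * c * h n) \<le> norm (c * h n)" for n
    using norm_mult_ineq[of "h n" "c * h n"] norm_h[of n] by (simp add: mult.assoc)
  then show "\<exists>N. \<forall>n\<ge>N. norm (h n * c * h n) \<le> norm (c * h n)" by blast
qed

lemma N_square: "c \<in> A \<Longrightarrow> phi (st c * c) = complex_of_real ((N c)\<^sup>2)"
  using phi_st_mult by (simp add: N_def)

text \<open>With different indices the larger one absorbs the smaller one, which turns the
  \<open>h * h\<close> of the excision into a single \<open>h\<close>.\<close>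

lemma compress_lim:
  assumes "c \<in> A" "i < j"
  shows "(\<lambda>n. h (n + i) * c * h (n + j) - cs (phi c) (h (n + j))) \<longlonglongrightarrow> 0"
proof -
  have "(\<lambda>n. (h (n + i) * c * h (n + i) - cs (phi c) (h (n + i) * h (n + i))) * h (n + j)) \<longlonglongrightarrow> 0"
    by (rule null_mult_bounded(2)[OF LIMSEQ_ignore_initial_segment[OF phi_lim[OF assms(1)], of i], of _ 1])
      (simp add: norm_h)
  then show ?thesis
    using assms(2) by (simp add: left_diff_distrib mult.assoc cs_mult_left h_less)
qed

text \<open>In the GNS representation, \<open>v * h n * st v\<close> acts in the limit as the
  rank-one operator given by the vector of \<open>v\<close>, for a unit vector as the projection
  onto it.\<close>

lemma W_compress:
  assumes "v \<in> A" "c \<in> A" "w \<in> A" "i < j"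
  shows "(\<lambda>n. v * h (n + i) * st v * c * w * h (n + j) - cs (phi (st v * c * w)) (v * h (n + j))) \<longlonglongrightarrow> 0"
proof -
  have "st v * c * w \<in> A" by (intro A_intros assms)
  from tendsto_mult_right_zero[OF compress_lim[OF this assms(4)], of v]
  show ?thesis by (simp add: right_diff_distrib mult.assoc cs_mult_right)
qed

lemma conj_bounded: "norm (v * h n * st v) \<le> norm v * norm v"
  using norm_mult_ineq[of "v * h n" "st v"] norm_mult_ineq[of v "h n"]
    mult_right_mono[of "norm (v * h n)" "norm v" "norm v"] norm_h[of n] by simp

text \<open>Apply the commuting elements \<open>w h\<^sub>n w\<^sup>*\<close> and \<open>v h\<^sub>n v\<^sup>*\<close> of \<open>D\<close> to \<open>w h\<^sub>n\<^sub>+\<^sub>1\<close>.\<close>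
lemma W_parallel:
  assumes v: "v \<in> W" and w: "w \<in> W" and ww: "phi (st w * w) = 1" and nz: "phi (st w * v) \<noteq> 0"
  shows "N (v - cs (phi (st w * v)) w) = 0"
proof -
  define a where "a = phi (st w * v)"
  have vA: "v \<in> A" and wA: "w \<in> A" using v w W_A by auto
  have ca: "phi (st v * w) = cnj a"
    using phi_st[of "st w * v"] vA wA by (simp add: a_def st_mult A_intros)
  define r q where "r n = w * h n * st w" and "q n = v * h n * st v" for n
  have rq: "r n * q n = q n * r n" for n
    unfolding r_def q_def by (intro D_comm W_conj v w h_D)
  have 1: "(\<lambda>n. r n * (w * h (Suc n)) - w * h (Suc n)) \<longlonglongrightarrow> 0"
    using W_compress[OF wA A_1 wA, of 0 1] ww by (simp add: r_def mult.assoc)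
  have 2: "(\<lambda>n. q n * (w * h (Suc n)) - cs (cnj a) (v * h (Suc n))) \<longlonglongrightarrow> 0"
    using W_compress[OF vA A_1 wA, of 0 1] ca by (simp add: q_def mult.assoc)
  have 3: "(\<lambda>n. r n * (v * h (Suc n)) - cs a (w * h (Suc n))) \<longlonglongrightarrow> 0"
    using W_compress[OF wA A_1 vA, of 0 1] by (simp add: r_def a_def mult.assoc)
  have 4: "(\<lambda>n. q n * (r n * (w * h (Suc n)) - w * h (Suc n))) \<longlonglongrightarrow> 0"
    by (rule null_mult_bounded(1)[OF 1]) (unfold q_def, rule conj_bounded)
  have 5: "(\<lambda>n. r n * (q n * (w * h (Suc n)) - cs (cnj a) (v * h (Suc n)))) \<longlonglongrightarrow> 0"
    by (rule null_mult_bounded(1)[OF 2]) (unfold r_def, rule conj_bounded)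
  have 6: "(\<lambda>n. cs (cnj a) (r n * (v * h (Suc n)) - cs a (w * h (Suc n)))) \<longlonglongrightarrow> 0"
    using tendsto_cs[OF tendsto_const 3, of "cnj a"] by simp
  \<comment> \<open>On \<open>w h\<close> the product \<open>q r\<close> tends to
    \<open>cnj a v h\<close> and \<open>r q\<close> to \<open>cnj a * a w h\<close>. The products
    agree, and \<open>cnj a\<close> can be cancelled.\<close>
  have "(\<lambda>n. cs (cnj a) (v * h (Suc n)) - cs (cnj a * a) (w * h (Suc n))) \<longlonglongrightarrow> 0"
  proof -
    have eq: "q n * (r n * (w * h (Suc n)) - w * h (Suc n)) + (q n * (w * h (Suc n)) - cs (cnj a) (v * h (Suc n)))
        = r n * (q n * (w * h (Suc n)) - cs (cnj a) (v * h (Suc n)))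
         + cs (cnj a) (r n * (v * h (Suc n)) - cs a (w * h (Suc n)))
         - (cs (cnj a) (v * h (Suc n)) - cs (cnj a * a) (w * h (Suc n)))" for n
    proof -
      have "q n * (r n * (w * h (Suc n))) = r n * (q n * (w * h (Suc n)))"
        using rq by (metis mult.assoc)
      then show ?thesis by (simp add: right_diff_distrib cs_diff_right cs_mult_right cs_cs)
    qed
    have "(\<lambda>n. r n * (q n * (w * h (Suc n)) - cs (cnj a) (v * h (Suc n)))
         + cs (cnj a) (r n * (v * h (Suc n)) - cs a (w * h (Suc n)))
         - (q n * (r n * (w * h (Suc n)) - w * h (Suc n)) + (q n * (w * h (Suc n)) - cs (cnj a) (v * h (Suc n))))) \<longlonglongrightarrow> 0 + 0 - (0 + 0)"
      by (intro tendsto_intros 2 4 5 6)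
    then show ?thesis unfolding eq by simp
  qed
  from tendsto_cs[OF tendsto_const this, of "1 / cnj a"]
  have "(\<lambda>n. (v - cs a w) * h (Suc n)) \<longlonglongrightarrow> 0"
    using nz by (simp add: a_def cs_diff_right cs_cs left_diff_distrib cs_mult_left)
  from tendsto_norm_zero[OF LIMSEQ_imp_Suc[OF this]]
  have "(\<lambda>n. norm ((v - cs a w) * h n)) \<longlonglongrightarrow> 0" .
  moreover have "(\<lambda>n. norm ((v - cs a w) * h n)) \<longlonglongrightarrow> N (v - cs a w)"
    by (intro N_lim A_intros vA wA)
  ultimately show ?thesis unfolding a_def[symmetric] using LIMSEQ_unique by blast
qed

subsection \<open>Orthonormal families of words\<close>

definition orth :: "'a set \<Rightarrow> bool"
  where "orth F \<longleftrightarrow> finite F \<and> F \<subseteq> W \<and> (\<forall>i\<in>F. \<forall>j\<in>F. phi (st i * j) = (if i = j then 1 else 0))"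

lemma orthD: "orth F \<Longrightarrow> finite F" "orth F \<Longrightarrow> i \<in> F \<Longrightarrow> i \<in> W" "orth F \<Longrightarrow> i \<in> F \<Longrightarrow> i \<in> A"
  "orth F \<Longrightarrow> i \<in> F \<Longrightarrow> j \<in> F \<Longrightarrow> phi (st i * j) = (if i = j then 1 else 0)"
  using W_A by (auto simp: orth_def)

definition proj :: "'a set \<Rightarrow> 'a \<Rightarrow> 'a"
  where "proj F c = (\<Sum>i\<in>F. cs (phi (st i * c)) i)"

lemma comb_A: "orth F \<Longrightarrow> (\<Sum>i\<in>F. cs (b i) i) \<in> A"
  by (intro A_sum A_cs orthD(3))

lemma proj_A: "orth F \<Longrightarrow> proj F c \<in> A"
  unfolding proj_def by (rule comb_A)

lemma phi_comb:
  assumes "orth F" "i \<in> F" shows "phi (st i * (\<Sum>j\<in>F. cs (b j) j)) = b i"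
proof -
  have "phi (st i * (\<Sum>j\<in>F. cs (b j) j)) = (\<Sum>j\<in>F. b j * phi (st i * j))"
    using assms by (simp add: sum_distrib_left cs_mult_right phi_sum phi_cs A_intros orthD)
  also have "\<dots> = (\<Sum>j\<in>F. if i = j then b j else 0)"
    by (intro sum.cong) (auto simp: orthD(4)[OF assms(1)] assms)
  also have "\<dots> = b i" using orthD(1)[OF assms(1)] assms by simp
  finally show ?thesis .
qed

lemma N_proj_best:
  assumes F: "orth F" and c: "c \<in> A"
  shows "N (c - proj F c) \<le> N (c - (\<Sum>i\<in>F. cs (b i) i))"
proof -
  define x where "x = c - proj F c"
  define a where "a i = phi (st i * c) - b i" for i
  define y where "y = (\<Sum>i\<in>F. cs (a i) i)"
  have A: "x \<in> A" "y \<in> A" unfolding x_def y_def by (intro A_diff c proj_A comb_A F)+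
  have perp: "phi (st i * x) = 0" if "i \<in> F" for i
  proof -
    have "phi (st i * x) = phi (st i * c) - phi (st i * proj F c)"
      unfolding x_def right_diff_distrib by (intro phi_diff A_mult A_st orthD(3)[OF F that] c proj_A[OF F])
    then show ?thesis unfolding proj_def using phi_comb[OF F that] by simp
  qed
  have yx: "phi (st y * x) = 0"
  proof -
    have "st y * x = (\<Sum>i\<in>F. cs (cnj (a i)) (st i * x))"
      unfolding y_def by (simp add: st_sum st_cs sum_distrib_right cs_mult_left)
    then have "phi (st y * x) = (\<Sum>i\<in>F. cnj (a i) * phi (st i * x))"
      using F A by (simp add: phi_sum phi_cs A_intros orthD)
    then show ?thesis by (simp add: perp)
  qed
  have xy: "phi (st x * y) = 0" using phi_st[of "st y * x"] yx A by (simp add: st_mult A_intros)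
  have eq: "c - (\<Sum>i\<in>F. cs (b i) i) = x + y"
    unfolding x_def y_def proj_def a_def by (simp add: cs_diff_left sum_subtractf)
  have "phi (st (x + y) * (x + y)) = phi (st x * x) + phi (st y * y)"
  proof -
    have "st (x + y) * (x + y) = st x * x + st y * x + (st x * y + st y * y)"
      by (simp add: st_add algebra_simps)
    then show ?thesis using A xy yx by (simp add: phi_add A_intros)
  qed
  then have "complex_of_real ((N (x + y))\<^sup>2) = complex_of_real ((N x)\<^sup>2 + (N y)\<^sup>2)"
    using A by (simp add: N_square A_intros)
  then have "(N (x + y))\<^sup>2 = (N x)\<^sup>2 + (N y)\<^sup>2" using of_real_eq_iff by blast
  then have "(N x)\<^sup>2 \<le> (N (x + y))\<^sup>2" by simp
  then have "N x \<le> N (x + y)" using N_nonneg power2_le_imp_le by blast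
  then show ?thesis unfolding eq by (simp add: x_def)
qed

lemma N_proj_mono:
  assumes "orth F" "orth G" "F \<subseteq> G" "c \<in> A"
  shows "N (c - proj G c) \<le> N (c - proj F c)"
proof -
  have "proj F c = (\<Sum>i\<in>G. cs (if i \<in> F then phi (st i * c) else 0) i)"
    unfolding proj_def using assms(3) orthD(1)[OF assms(2)]
    by (intro sum.mono_neutral_cong_left) auto
  then show ?thesis using N_proj_best[OF assms(2,4)] by simp
qed

text \<open>Gram-Schmidt would leave \<open>W\<close>, but is not called for: a word of seminorm 0
  needs nothing, a word not orthogonal to some member of \<open>F\<close> is parallel to it, and a
  word orthogonal to all members is normalised and adjoined.\<close>

lemma orth_extend:
  assumes F: "orth F" and w: "w \<in> W"
  shows "\<exists>G. orth G \<and> F \<subseteq> G \<and> N (w - proj G w) = 0"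
proof -
  have wA: "w \<in> A" using w W_A by auto
  consider "N w = 0" | i where "i \<in> F" "phi (st i * w) \<noteq> 0" | "N w \<noteq> 0" "\<forall>i\<in>F. phi (st i * w) = 0" by blast
  then show ?thesis
  proof cases
    case 1
    have "N (w - proj F w) \<le> N (w - (\<Sum>i\<in>F. cs 0 i))" by (rule N_proj_best[OF F wA])
    then have "N (w - proj F w) = 0" using 1 N_nonneg[of "w - proj F w"] by simp
    then show ?thesis using F by blast
  next
    case 2
    have iW: "i \<in> W" "phi (st i * i) = 1" using orthD[OF F] 2(1) by auto
    have "N (w - proj F w) \<le> N (w - (\<Sum>j\<in>F. cs (if j = i then phi (st i * w) else 0) j))"
      by (rule N_proj_best[OF F wA])
    also have "(\<Sum>j\<in>F. cs (if j = i then phi (st i * w) else 0) j) = (\<Sum>j\<in>F. if j = i then cs (phi (st i * w)) j else 0)"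
      by (intro sum.cong) auto
    also have "\<dots> = cs (phi (st i * w)) i" using 2(1) orthD(1)[OF F] by simp
    also have "N (w - cs (phi (st i * w)) i) = 0" by (rule W_parallel[OF w iW(1,2) 2(2)])
    finally have "N (w - proj F w) = 0" using N_nonneg[of "w - proj F w"] by simp
    then show ?thesis using F by blast
  next
    case 3
    define t where "t = N w"
    define k where "k = cs (complex_of_real (1 / t)) w"
    have t: "t \<noteq> 0" using 3 by (simp add: t_def)
    have kW: "k \<in> W" unfolding k_def by (rule W_cs[OF w])
    have kA: "k \<in> A" using kW W_A by auto
    have kk: "phi (st k * k) = 1"
    proof -
      have "st k * k = cs (complex_of_real (1 / t) * complex_of_real (1 / t)) (st w * w)"
        by (simp add: k_def st_cs cs_mult_left cs_mult_right cs_cs)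
      then have "phi (st k * k) = complex_of_real (1 / t) * complex_of_real (1 / t) * complex_of_real (t\<^sup>2)"
        using wA by (simp add: phi_cs A_intros N_square t_def)
      then show ?thesis using t by (simp add: power2_eq_square flip: of_real_mult)
    qed
    have ik: "phi (st i * k) = 0" if "i \<in> F" for i
      using 3(2) that wA orthD(3)[OF F that] by (simp add: k_def cs_mult_right phi_cs A_intros)
    have ki: "phi (st k * i) = 0" if "i \<in> F" for i
      using ik[OF that] phi_st[of "st i * k"] orthD(3)[OF F that] kA by (simp add: st_mult A_intros)
    have nk: "k \<notin> F" using ik kk by force
    have G: "orth (insert k F)"
      using F kW kk ik ki nk unfolding orth_def by auto
    have "N (w - proj (insert k F) w) \<le> N (w - (\<Sum>j\<in>insert k F. cs (if j = k then complex_of_real t else 0) j))"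
      by (rule N_proj_best[OF G wA])
    also have "(\<Sum>j\<in>insert k F. cs (if j = k then complex_of_real t else 0) j) = (\<Sum>j\<in>insert k F. if j = k then cs (complex_of_real t) j else 0)"
      by (intro sum.cong) auto
    also have "\<dots> = cs (complex_of_real t) k" using orthD(1)[OF G] by (simp add: sum.delta)
    also have "\<dots> = w" using t by (simp add: k_def cs_cs flip: of_real_mult)
    finally have "N (w - proj (insert k F) w) = 0" using N_nonneg[of "w - proj (insert k F) w"] by (simp add: N_0)
    then show ?thesis using G by blast
  qed
qed

lemma proj_add: "orth F \<Longrightarrow> x \<in> A \<Longrightarrow> y \<in> A \<Longrightarrow> proj F (x + y) = proj F x + proj F y"
  unfolding proj_def sum.distrib[symmetric]
  by (intro sum.cong) (auto simp: distrib_left phi_add cs_add_left A_intros orthD)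

lemma proj_cs: "orth F \<Longrightarrow> x \<in> A \<Longrightarrow> proj F (cs a x) = cs a (proj F x)"
  unfolding proj_def cs_sum_right
  by (intro sum.cong) (auto simp: cs_mult_right phi_cs cs_cs A_intros orthD)

text \<open>The set \<open>V\<close> quantifies over all starting families, so that for a sum the
  family found for the first summand can be enlarged for the second; larger families only
  approximate better.\<close>

lemma proj_approx:
  assumes c: "c \<in> A" and F: "orth F" and e: "0 < e"
  shows "\<exists>G. orth G \<and> F \<subseteq> G \<and> N (c - proj G c) \<le> e"
proof -
  define V where "V = {c\<in>A. \<forall>F e. orth F \<longrightarrow> 0 < e \<longrightarrow> (\<exists>G. orth G \<and> F \<subseteq> G \<and> N (c - proj G c) \<le> e)}"
  have W: "W \<subseteq> V" using orth_extend W_A unfolding V_def by (smt (verit) mem_Collect_eq subset_iff)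
  have add: "x + y \<in> V" if xy: "x \<in> V" "y \<in> V" for x y
  proof -
    have A: "x \<in> A" "y \<in> A" using xy by (auto simp: V_def)
    have "\<exists>G. orth G \<and> F \<subseteq> G \<and> N (x + y - proj G (x + y)) \<le> e" if F: "orth F" and e: "0 < e" for F e
    proof -
      have e2: "0 < e/2" using e by simp
      obtain G where G: "orth G" "F \<subseteq> G" "N (x - proj G x) \<le> e/2" using xy(1) F e2 unfolding V_def by blast
      obtain H where H: "orth H" "G \<subseteq> H" "N (y - proj H y) \<le> e/2" using xy(2) G(1) e2 unfolding V_def by blast
      have eq: "x + y - proj H (x + y) = (x - proj H x) + (y - proj H y)" using H A by (simp add: proj_add)
      have "N (x + y - proj H (x + y)) \<le> N (x - proj H x) + N (y - proj H y)"
        unfolding eq by (intro N_triangle A_diff proj_A A H)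
      also have "\<dots> \<le> e/2 + e/2" using H(3) G(3) N_proj_mono[OF G(1) H(1,2) A(1)] by simp
      finally show ?thesis using H G by (intro exI[of _ H]) auto
    qed
    then show ?thesis using A by (auto simp: V_def A_add)
  qed
  have scal: "cs a x \<in> V" if x: "x \<in> V" for a x
  proof -
    have A: "x \<in> A" using x by (auto simp: V_def)
    have "\<exists>G. orth G \<and> F \<subseteq> G \<and> N (cs a x - proj G (cs a x)) \<le> e" if F: "orth F" and e: "0 < e" for F e
    proof -
      have na: "0 < cmod a + 1" by (simp add: add_nonneg_pos)
      then have e': "0 < e / (cmod a + 1)" using e by simp
      obtain G where G: "orth G" "F \<subseteq> G" "N (x - proj G x) \<le> e / (cmod a + 1)" using x F e' unfolding V_def by blast
      have "cs a x - proj G (cs a x) = cs a (x - proj G x)" using G A by (simp add: proj_cs cs_diff_right)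
      then have "N (cs a x - proj G (cs a x)) = cmod a * N (x - proj G x)" using A G by (simp add: N_cs A_diff proj_A)
      also have "\<dots> \<le> (cmod a + 1) * (e / (cmod a + 1))" using G(3) N_nonneg by (intro mult_mono) auto
      finally show ?thesis using G na by (intro exI[of _ G]) auto
    qed
    then show ?thesis using A by (auto simp: V_def A_cs)
  qed
  have cl: "closed V" unfolding closed_sequential_limits
  proof (intro allI impI, elim conjE)
    fix f x assume f: "\<forall>n. f n \<in> V" and lim: "f \<longlonglongrightarrow> x"
    have fA: "f n \<in> A" for n using f by (auto simp: V_def)
    then have xA: "x \<in> A" using closed_sequentially[OF closed_A _ lim] by blast
    have "\<exists>G. orth G \<and> F \<subseteq> G \<and> N (x - proj G x) \<le> e" if F: "orth F" and e: "0 < e" for F e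
    proof -
      have e2: "0 < e/2" using e by simp
      obtain n where n: "norm (f n - x) < e/2" using LIMSEQ_D[OF lim e2] by blast
      obtain G where G: "orth G" "F \<subseteq> G" "N (f n - proj G (f n)) \<le> e/2" using f F e2 unfolding V_def by blast
      have "N (x - proj G x) \<le> N (x - proj G (f n))"
        using N_proj_best[OF G(1) xA, of "\<lambda>i. phi (st i * f n)"] unfolding proj_def[of G "f n"] .
      also have "x - proj G (f n) = (x - f n) + (f n - proj G (f n))" by simp
      also have "N \<dots> \<le> N (x - f n) + N (f n - proj G (f n))"
        by (intro N_triangle A_diff xA fA proj_A G)
      also have "N (x - f n) \<le> norm (x - f n)" by (intro N_le_norm A_diff xA fA)
      finally show ?thesis using G n by (intro exI[of _ G]) (auto simp: norm_minus_commute)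
    qed
    then show "x \<in> V" using xA by (auto simp: V_def)
  qed
  have "csubspace cs V" using add scal W W_1 scal[of 1 0] unfolding csubspace_def by force
  then have "c \<in> V" using A_induct[OF cl _ W c] by blast
  then show ?thesis using F e by (auto simp: V_def)
qed

text \<open>Every member is reached from 1 along nonzero matrix entries of elements of
  \<open>X\<close>. This connectedness later forces the imitating vectors to have asymptotically the
  length of the one for 1.\<close>

definition linked :: "'a set \<Rightarrow> 'a set \<Rightarrow> bool"
  where "linked X F \<longleftrightarrow> 1 \<in> F \<and>
    (\<forall>i\<in>F. (1, i) \<in> {(j, k). j \<in> F \<and> k \<in> F \<and> (\<exists>x\<in>X. phi (st k * x * j) \<noteq> 0)}\<^sup>*)"

lemma linked_singleton: "linked X {1}" by (auto simp: linked_def)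

lemma orth_singleton: "orth {1}" by (simp add: orth_def phi_1 W_1)

text \<open>Of the extending family only the members with nonzero coefficient in
  \<open>x * j\<close> are retained: the projection of \<open>x * j\<close> is unchanged, and each
  new member is joined to \<open>j\<close>.\<close>

lemma linked_extend1:
  assumes F: "orth F" "linked X F" and j: "j \<in> F" and x: "x \<in> X" "x \<in> A" and e: "0 < e"
  shows "\<exists>G. orth G \<and> linked X G \<and> F \<subseteq> G \<and> N (x * j - proj G (x * j)) \<le> e"
proof -
  have A: "x * j \<in> A" using x j orthD(3)[OF F(1)] by (intro A_mult) auto
  obtain H where H: "orth H" "F \<subseteq> H" "N (x * j - proj H (x * j)) \<le> e" using proj_approx[OF A F(1) e] by blast
  define G where "G = F \<union> {i\<in>H. phi (st i * x * j) \<noteq> 0}"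
  have GH: "G \<subseteq> H" using H by (auto simp: G_def)
  have G: "orth G" using H(1) GH finite_subset[OF GH] unfolding orth_def by blast
  have "proj H (x * j) = proj G (x * j)"
    unfolding proj_def using orthD(1)[OF H(1)] GH
    by (intro sum.mono_neutral_right) (auto simp: G_def mult.assoc)
  moreover have "linked X G"
  proof -
    let ?E = "\<lambda>F. {(j, k). j \<in> F \<and> k \<in> F \<and> (\<exists>x\<in>X. phi (st k * x * j) \<noteq> 0)}"
    have "?E F \<subseteq> ?E G" by (auto simp: G_def)
    then have mono: "(?E F)\<^sup>* \<subseteq> (?E G)\<^sup>*" by (rule rtrancl_mono)
    have "(1, i) \<in> (?E G)\<^sup>*" if "i \<in> G" for i
    proof (cases "i \<in> F")
      case True
      then show ?thesis using F(2) mono unfolding linked_def by blast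
    next
      case False
      then have "phi (st i * x * j) \<noteq> 0" using that by (auto simp: G_def)
      moreover have "j \<in> G" using j by (simp add: G_def)
      ultimately have "(j, i) \<in> ?E G" using that x by blast
      moreover have "(1, j) \<in> (?E G)\<^sup>*" using F(2) mono j unfolding linked_def by blast
      ultimately show ?thesis by (rule rtrancl_into_rtrancl[rotated])
    qed
    moreover have "1 \<in> G" using F(2) by (auto simp: linked_def G_def)
    ultimately show ?thesis by (simp add: linked_def)
  qed
  ultimately show ?thesis using G H by (intro exI[of _ G]) (auto simp: G_def)
qed

lemma linked_extend:
  assumes F: "orth F" "linked X F" and S: "finite S" "S \<subseteq> X \<times> F" and X: "X \<subseteq> A" and e: "0 < e"
  shows "\<exists>G. orth G \<and> linked X G \<and> F \<subseteq> G \<and> (\<forall>(x, j)\<in>S. N (x * j - proj G (x * j)) \<le> e)"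
  using S
proof (induction S)
  case (insert s S)
  obtain x j where s: "s = (x, j)" by (cases s)
  obtain G where G: "orth G" "linked X G" "F \<subseteq> G" "\<forall>(x, j)\<in>S. N (x * j - proj G (x * j)) \<le> e"
    using insert by blast
  have xj: "x \<in> X" "x \<in> A" "j \<in> G" using insert(4) s G(3) X by auto
  obtain H where H: "orth H" "linked X H" "G \<subseteq> H" "N (x * j - proj H (x * j)) \<le> e"
    using linked_extend1[OF G(1,2) xj(3,1,2) e] by blast
  have "N (y * k - proj H (y * k)) \<le> e" if "(y, k) \<in> S" for y k
  proof -
    have "y * k \<in> A" using insert(4) that X orthD(3)[OF F(1)] by (intro A_mult) auto
    then show ?thesis using N_proj_mono[OF G(1) H(1,3)] G(4) that by fastforce
  qed
  then show ?case using H G s by (intro exI[of _ H]) auto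
qed (use F in auto)

end

section \<open>Existence of excisions for finitely many elements\<close>

context cstar_algebra
begin

lemma csubspace_sum: "csubspace cs V \<Longrightarrow> (\<And>i. i \<in> F \<Longrightarrow> f i \<in> V) \<Longrightarrow> sum f F \<in> V"
  by (rule subspace_sum[OF csubspace_subspace])

lemma cspan_mono: "S \<subseteq> T \<Longrightarrow> cspan cs S \<subseteq> cspan cs T"
  unfolding cspan_def by blast

lemma cspan_finite:
  assumes "y \<in> cspan cs S" shows "\<exists>T. finite T \<and> T \<subseteq> S \<and> y \<in> cspan cs T"
proof -
  define V where "V = {y. \<exists>T. finite T \<and> T \<subseteq> S \<and> y \<in> cspan cs T}"
  have "csubspace cs V" unfolding csubspace_def
  proof (intro conjI ballI allI)
    show "0 \<in> V" using csubspace_cspan[of "{}"] unfolding V_def csubspace_def by blast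
    show "x + y \<in> V" if xy: "x \<in> V" "y \<in> V" for x y
    proof -
      obtain T where T: "finite T" "T \<subseteq> S" "x \<in> cspan cs T" using xy unfolding V_def by blast
      obtain T' where T': "finite T'" "T' \<subseteq> S" "y \<in> cspan cs T'" using xy unfolding V_def by blast
      have "x \<in> cspan cs (T \<union> T')" "y \<in> cspan cs (T \<union> T')"
        using T(3) T'(3) cspan_mono[of T "T \<union> T'"] cspan_mono[of T' "T \<union> T'"] by auto
      then have "x + y \<in> cspan cs (T \<union> T')" using csubspace_cspan unfolding csubspace_def by blast
      then show ?thesis unfolding V_def using T T' by (intro CollectI exI[of _ "T \<union> T'"]) auto
    qed
    show "cs c x \<in> V" if x: "x \<in> V" for c x
    proof -
      obtain T where T: "finite T" "T \<subseteq> S" "x \<in> cspan cs T" using x unfolding V_def by blast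
      have "cs c x \<in> cspan cs T" using csubspace_cspan T(3) unfolding csubspace_def by blast
      then show ?thesis unfolding V_def using T by blast
    qed
  qed
  moreover have "S \<subseteq> V"
  proof
    fix s assume "s \<in> S"
    then show "s \<in> V" unfolding V_def using cspan_superset[of "{s}"] by (intro CollectI exI[of _ "{s}"]) auto
  qed
  ultimately have "y \<in> V" using cspan_subset assms by blast
  then show ?thesis by (simp add: V_def)
qed

end

context pseudo_cartan_inclusion
begin

text \<open>An excising sequence serves only countably many elements. Each element of
  \<open>X\<close> is a limit of combinations of countably many normalizers, and the words in these
  and their adjoints form the countable monoid \<open>M\<close>.\<close>

lemma excision_exists:
  assumes X: "finite X" "X \<subseteq> C" and I: "ideal I"
  obtains W h where "excision cs st D W h" "X \<subseteq> closure (cspan cs W)"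
    "\<And>n. ideal (U (h n))" "\<And>n. U (h n) \<subseteq> I"
proof -
  let ?N = "normalizers st C D"
  have "\<exists>V. countable V \<and> V \<subseteq> ?N \<and> x \<in> closure (cspan cs V)" if x: "x \<in> X" for x
  proof -
    have "x \<in> closure (cspan cs ?N)" using x X dense by auto
    then obtain f where f: "\<forall>n. f n \<in> cspan cs ?N" "f \<longlonglongrightarrow> x" unfolding closure_sequential by blast
    have "\<forall>n. \<exists>T. finite T \<and> T \<subseteq> ?N \<and> f n \<in> cspan cs T" using f(1) cspan_finite by blast
    then obtain T where T: "\<And>n. finite (T n)" "\<And>n. T n \<subseteq> ?N" "\<And>n. f n \<in> cspan cs (T n)" by metis
    have "f n \<in> cspan cs (\<Union>n. T n)" for n using T(3) cspan_mono[of "T n" "\<Union>n. T n"] by auto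
    then have "x \<in> closure (cspan cs (\<Union>n. T n))" unfolding closure_sequential using f(2) by blast
    moreover have "countable (\<Union>n. T n)" using T(1) by (intro countable_UN) (auto intro: countable_finite)
    ultimately show ?thesis using T(2) by (intro exI[of _ "\<Union>n. T n"]) auto
  qed
  then obtain V0 where V0: "\<And>x. x \<in> X \<Longrightarrow> countable (V0 x)" "\<And>x. x \<in> X \<Longrightarrow> V0 x \<subseteq> ?N"
    "\<And>x. x \<in> X \<Longrightarrow> x \<in> closure (cspan cs (V0 x))" by metis
  define V where "V = (\<Union>x\<in>X. V0 x) \<union> st ` (\<Union>x\<in>X. V0 x)"
  have "countable (\<Union>x\<in>X. V0 x)" using V0(1) X(1) by (intro countable_UN) (auto intro: countable_finite)
  then have cV: "countable V" unfolding V_def by (intro countable_Un countable_image)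
  have nst: "st v \<in> ?N" if "v \<in> ?N" for v using that by (auto simp: normalizers_def C_closure)
  have VN: "V \<subseteq> ?N" unfolding V_def using V0(2) nst by blast
  have Vst: "st v \<in> V" if "v \<in> V" for v using that by (auto simp: V_def)
  define M where "M = prod_list ` lists V"
  have cM: "countable M" unfolding M_def using cV by (intro countable_image countable_lists)
  have M1: "1 \<in> M" unfolding M_def by (intro image_eqI[of _ _ "[]"]) auto
  have VM: "v \<in> M" if "v \<in> V" for v unfolding M_def using that by (intro image_eqI[of _ _ "[v]"]) auto
  have Mmult: "v * w \<in> M" if vw: "v \<in> M" "w \<in> M" for v w
  proof -
    obtain xs ys where "v = prod_list xs" "w = prod_list ys" "xs \<in> lists V" "ys \<in> lists V"
      using vw by (auto simp: M_def)
    then show ?thesis unfolding M_def by (intro image_eqI[of _ _ "xs @ ys"]) auto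
  qed
  have Mst: "st (prod_list xs) \<in> M" if "xs \<in> lists V" for xs
    using that
  proof (induction xs)
    case (Cons v xs)
    then show ?case using Mmult[OF Cons(3) VM[OF Vst[OF Cons(1)]]] by (simp add: st_mult)
  qed (simp add: M1)
  have Mconj: "prod_list xs * d * st (prod_list xs) \<in> D" if "xs \<in> lists V" "d \<in> D" for xs d
    using that
  proof (induction xs arbitrary: d)
    case (Cons v xs)
    have "prod_list (v # xs) * d * st (prod_list (v # xs)) = v * (prod_list xs * d * st (prod_list xs)) * st v"
      by (simp add: st_mult mult.assoc)
    moreover have "v \<in> ?N" using VN Cons(1) by auto
    ultimately show ?case using normalizer_conj(1)[OF _ Cons(3)[OF Cons(4)]] by simp
  qed simp
  have MC: "prod_list xs \<in> C \<or> prod_list xs = 1" if "xs \<in> lists V" for xs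
    using that
  proof (induction xs)
    case (Cons v xs)
    have "v \<in> C" using VN Cons(1) by (auto simp: normalizers_def)
    then show ?case using Cons by (auto intro: C_closure)
  qed simp
  \<comment> \<open>The inserted 0 makes the enumerated set nonempty. The empty word 1 may lie
    outside \<open>C\<close>; its compressions are scalar anyway.\<close>
  define c where "c = from_nat_into (insert 0 (M \<inter> C))"
  have rc: "range c = insert 0 (M \<inter> C)" unfolding c_def by (rule range_from_nat_into) (use cM in auto)
  have rcC: "range c \<subseteq> C" unfolding rc using C_closure(4) by auto
  obtain h where h: "\<And>n. h n \<in> D" "\<And>n. st (h n) = h n" "\<And>n. norm (h n) = 1"
    "\<And>n. h n * h (Suc n) = h (Suc n)" "\<And>n. ideal (U (h n))" "\<And>n. U (h n) \<subseteq> I"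
    "\<And>i. \<exists>l. (\<lambda>n. h n * c i * h n - cs l (h n * h n)) \<longlonglongrightarrow> 0"
    using excising_sequence[OF rcC I] by blast
  define W where "W = {cs a m | a m. m \<in> M}"
  have sc: "\<exists>l. (\<lambda>n. h n * m * h n - cs l (h n * h n)) \<longlonglongrightarrow> 0" if m: "m \<in> M" for m
  proof (cases "m = 1")
    case True
    then show ?thesis by (intro exI[of _ 1]) simp
  next
    case False
    then have "m \<in> range c" using m MC unfolding rc M_def by auto
    then show ?thesis using h(7) by blast
  qed
  have "excision cs st D W h"
  proof (unfold_locales)
    show "1 \<in> W" unfolding W_def using M1 cs_1[of 1, symmetric] by blast
    show "cs a w \<in> W" if w: "w \<in> W" for a w
    proof -
      obtain b m where "w = cs b m" "m \<in> M" using w unfolding W_def by blast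
      then have "cs a w = cs (a * b) m \<and> m \<in> M" by (simp add: cs_cs)
      then show ?thesis unfolding W_def by blast
    qed
    show "v * w \<in> W" if vw: "v \<in> W" "w \<in> W" for v w
    proof -
      obtain a m b n where "v = cs a m" "m \<in> M" "w = cs b n" "n \<in> M" using vw unfolding W_def by blast
      then have "v * w = cs (a * b) (m * n) \<and> m * n \<in> M"
        by (simp add: cs_mult_left cs_mult_right cs_cs Mmult mult.commute)
      then show ?thesis unfolding W_def by blast
    qed
    show "st w \<in> W" if w: "w \<in> W" for w
    proof -
      obtain a m where "w = cs a m" "m \<in> M" using w unfolding W_def by blast
      then have "st w = cs (cnj a) (st m) \<and> st m \<in> M" using Mst by (auto simp: st_cs M_def)
      then show ?thesis unfolding W_def by blast
    qed
    show "w * d * st w \<in> D" if w: "w \<in> W" "d \<in> D" for w d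
    proof -
      obtain a xs where "w = cs a (prod_list xs)" "xs \<in> lists V" using w(1) unfolding W_def M_def by blast
      then show ?thesis using Mconj[of xs d] w(2)
        by (simp add: st_cs cs_mult_left cs_mult_right cs_cs D_closure)
    qed
    show "\<exists>l. (\<lambda>n. h n * w * h n - cs l (h n * h n)) \<longlonglongrightarrow> 0" if ww: "w \<in> W" for w
    proof -
      obtain a m where w: "w = cs a m" "m \<in> M" using ww unfolding W_def by blast
      obtain l where l: "(\<lambda>n. h n * m * h n - cs l (h n * h n)) \<longlonglongrightarrow> 0" using sc[OF w(2)] by blast
      have "(\<lambda>n. h n * w * h n - cs (a * l) (h n * h n)) \<longlonglongrightarrow> 0"
        using tendsto_cs[OF tendsto_const l, of a] by (simp add: w cs_diff_right cs_mult_left cs_mult_right cs_cs)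
      then show ?thesis by blast
    qed
  qed (use D_sub D_comm h in auto)
  moreover have "X \<subseteq> closure (cspan cs W)"
  proof
    fix x assume x: "x \<in> X"
    have "v \<in> W" if "v \<in> V0 x" for v
    proof -
      have "v \<in> M" using that x VM by (auto simp: V_def)
      then show ?thesis unfolding W_def using cs_1[of v, symmetric] by blast
    qed
    then have "cspan cs (V0 x) \<subseteq> cspan cs W" by (intro cspan_mono) blast
    then show "x \<in> closure (cspan cs W)" using V0(3)[OF x] closure_mono by blast
  qed
  ultimately show thesis using that h(5,6) by blast
qed

end

section \<open>Isometric homomorphisms\<close>

context cstar_algebra
begin

text \<open>A quantitative form of the fact that a vector fixed by a contraction is fixed by its
  adjoint: expand the square of \<open>st k * x - x\<close> and use
  \<open>k * st k \<le> 1\<close>.\<close>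

lemma contraction_fixed_adjoint:
  assumes "norm k \<le> 1" shows "(norm (st k * x - x))\<^sup>2 \<le> 2 * norm x * norm (k * x - x)"
proof -
  define w where "w = st x * (x - k * x) + st (x - k * x) * x"
  have "norm (k * st k) \<le> 1" using assms by (simp add: norm_mult_st power_le_one)
  then have "pos (1 - k * st k)" by (intro pos_one_minus) (simp_all add: st_mult)
  from pos_conj[OF this, of x]
  have "pos (w - st (st k * x - x) * (st k * x - x))"
    by (simp add: w_def st_mult st_diff algebra_simps)
  then have "(norm (st k * x - x))\<^sup>2 \<le> norm w" by (rule norm_mono_pos_square)
  also have "\<dots> \<le> norm x * norm (x - k * x) + norm (x - k * x) * norm x"
    unfolding w_def using norm_mult_ineq[of "st x" "x - k * x"] norm_mult_ineq[of "st (x - k * x)" x]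
    by (intro norm_triangle_le add_mono) auto
  finally show ?thesis by (simp add: norm_minus_commute)
qed

lemma sa_zero_of_cube: assumes "st g = g" "g * g * g = 0" shows "g = 0"
proof -
  have "(g * g) * (g * g) = 0" using assms(2) by (metis mult.assoc mult_zero_left)
  moreover have "st (g * g) = g * g" using assms(1) by (simp add: st_mult)
  ultimately have "g * g = 0" using norm_sa_square[of "g * g"] by simp
  then show ?thesis using norm_sa_square[OF assms(1)] by simp
qed

text \<open>\<open>k n = 1 - (1 - h * h)^n\<close> is a polynomial in \<open>h * h\<close> without
  constant term, so it stays in \<open>D\<close> even if \<open>D\<close> has no unit.\<close>

lemma approximate_unit_of_sa:
  assumes D: "cstar_subalg cs st D" and h: "h \<in> D" "st h = h" "norm h \<le> 1"
  obtains k where "\<And>n. k n \<in> D" "\<And>n. st (k n) = k n" "\<And>n. norm (k n) \<le> 1" "\<And>n. k n * h = h * k n"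
    "(\<lambda>n. k n * h) \<longlonglongrightarrow> h"
proof -
  note D_cl = cstar_subalgD[OF D]
  define y where "y = 1 - h * h"
  have y: "pos y" "norm y \<le> 1"
  proof -
    have "norm (h * h) \<le> 1" using norm_sa_square[OF h(2)] h(3) by (simp add: power_le_one)
    then show "pos y" unfolding y_def using h(2) by (intro pos_one_minus) (simp_all add: st_mult)
    then show "norm y \<le> 1" using pos_square[OF h(2)] by (intro norm_le_one_of_pos) (auto simp: y_def)
  qed
  define k where "k n = 1 - y ^ n" for n
  have ny: "norm (y ^ n) \<le> 1" for n
    using norm_power_ineq[of y n] power_le_one[OF norm_ge_zero y(2), of n] by linarith
  have pk: "pos (k n)" for n unfolding k_def by (intro pos_one_minus ny pos_sa pos_power y)
  have yh: "y * h = h * y" by (simp add: y_def algebra_simps)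
  have ynh: "y ^ n * h = h * y ^ n" for n using yh by (metis power_commuting_commutes)
  have "k n \<in> D" for n
  proof (induction n)
    case 0
    show ?case using D_cl(4) by (simp add: k_def)
  next
    case (Suc n)
    have "k (Suc n) = k n + h * h - k n * (h * h)"
      unfolding k_def power_Suc2 by (simp add: y_def algebra_simps)
    then show ?case using Suc D_cl h by simp
  qed
  moreover have "st (k n) = k n" for n using pk pos_sa by blast
  moreover have "norm (k n) \<le> 1" for n
    using pk pos_power[OF y(1)] by (intro norm_le_one_of_pos) (auto simp: k_def)
  moreover have "k n * h = h * k n" for n using ynh by (simp add: k_def algebra_simps)
  moreover have "(\<lambda>n. k n * h) \<longlonglongrightarrow> h"
  proof -
    have b: "(norm (y ^ n * h))\<^sup>2 \<le> 1 / (real (n + n) + 1)" for n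
    proof -
      have "st (y ^ n) = y ^ n" using pos_sa pos_power y by blast
      then have "st (h * y ^ n) * (h * y ^ n) = y ^ n * (h * h) * y ^ n"
        by (simp add: st_mult h mult.assoc)
      also have "\<dots> = y ^ (n + n) * (1 - y)"
      proof -
        have "h * h * y ^ n = y ^ n * (h * h)" using ynh by (metis mult.assoc)
        then have "y ^ n * (h * h) * y ^ n = y ^ n * (y ^ n * (h * h))" by (simp add: mult.assoc)
        moreover have "h * h = 1 - y" by (simp add: y_def)
        ultimately show ?thesis by (simp add: power_add mult.assoc)
      qed
      finally have "(norm (h * y ^ n))\<^sup>2 = norm (y ^ (n + n) * (1 - y))" using norm_st_mult[of "h * y ^ n"] by simp
      then show ?thesis using norm_power_times_complement[OF y, of "n + n"] by (simp add: ynh)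
    qed
    have "(\<lambda>n. 1 / (real (n + n) + 1)) \<longlonglongrightarrow> 0" by real_asymp
    then have "(\<lambda>n. (norm (y ^ n * h))\<^sup>2) \<longlonglongrightarrow> 0"
      by (rule tendsto_sandwich[OF _ _ tendsto_const, rotated 2]) (use b in auto)
    from tendsto_real_sqrt[OF this] have "(\<lambda>n. norm (y ^ n * h)) \<longlonglongrightarrow> 0" by simp
    then have "(\<lambda>n. y ^ n * h) \<longlonglongrightarrow> 0" by (rule tendsto_norm_zero_cancel)
    then have "(\<lambda>n. h - y ^ n * h) \<longlonglongrightarrow> h - 0" by (intro tendsto_intros)
    then show ?thesis by (simp add: k_def left_diff_distrib)
  qed
  ultimately show thesis using that by blast
qed

text \<open>The vectors \<open>z\<close> are large powers of \<open>Y\<close>, normalised.\<close>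
lemma top_vector:
  assumes "pos Y" "Y \<noteq> 0" "0 < (\<delta>::real)"
  obtains z where "norm z = 1"
    "\<And>H \<eta> c. pos (norm Y *\<^sub>R 1 - Y + \<eta> *\<^sub>R 1 - c *\<^sub>R (st H * H)) \<Longrightarrow> 0 \<le> \<eta> \<Longrightarrow> 0 \<le> c \<Longrightarrow>
      c * (norm (H * z))\<^sup>2 \<le> \<delta> + \<eta>"
proof -
  define m where "m = norm Y"
  have m: "0 < m" using assms by (simp add: m_def)
  define y where "y = (1/m) *\<^sub>R Y"
  have y: "pos y" "norm y = 1" using m assms by (auto simp: y_def m_def intro: pos_scaleR)
  obtain j :: nat where j: "m / \<delta> < real j" using reals_Archimedean2 by blast
  \<comment> \<open>A power of two keeps \<parallel>y^K\<parallel> = 1, and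
    \<open>K \<ge> j > m / \<delta>\<close> makes \<open>m y^(2 K) (1 - y)\<close> of norm at most
    \<delta>.\<close>
  define K :: nat where "K = 2 ^ j"
  have "real j \<le> real K" unfolding K_def by (metis less_exp of_nat_le_iff order_less_imp_le)
  define z where "z = y ^ K"
  have sz: "st z = z" unfolding z_def using pos_sa pos_power y by blast
  have nz: "norm z = 1" unfolding z_def K_def using norm_power_sa[OF pos_sa[OF y(1)]] y(2) by simp
  have small: "norm (st z * (m *\<^sub>R 1 - Y) * z) \<le> \<delta>"
  proof -
    have "st z * (m *\<^sub>R 1 - Y) * z = m *\<^sub>R (y ^ (K + K) * (1 - y))"
    proof -
      have "m *\<^sub>R 1 - Y = m *\<^sub>R (1 - y)" using m by (simp add: y_def algebra_simps)
      moreover have "(1 - y) * y ^ K = y ^ K * (1 - y)" by (simp add: left_diff_distrib right_diff_distrib power_commutes)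
      ultimately show ?thesis unfolding sz by (simp add: z_def power_add mult.assoc)
    qed
    then have "norm (st z * (m *\<^sub>R 1 - Y) * z) = m * norm (y ^ (K + K) * (1 - y))" using m by simp
    also have "\<dots> \<le> m * (1 / (real (K + K) + 1))"
      using norm_power_times_complement[of y "K + K"] y m by (intro mult_left_mono) auto
    also have "\<dots> \<le> \<delta>"
    proof -
      have "m < real j * \<delta>" using j assms(3) by (simp add: field_simps)
      also have "\<dots> \<le> (real (K + K) + 1) * \<delta>"
        using \<open>real j \<le> real K\<close> assms(3) by (intro mult_right_mono) auto
      finally show ?thesis by (simp add: field_simps)
    qed
    finally show ?thesis .
  qed
  show thesis
  proof (rule that[OF nz])
    fix H \<eta> c assume p: "pos (norm Y *\<^sub>R 1 - Y + \<eta> *\<^sub>R 1 - c *\<^sub>R (st H * H))" and \<eta>: "0 \<le> \<eta>" and c: "0 \<le> c"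
    have "pos (st z * (m *\<^sub>R 1 - Y + \<eta> *\<^sub>R 1) * z - c *\<^sub>R (st (H * z) * (H * z)))"
      using pos_conj[OF p, of z] by (simp add: m_def st_mult algebra_simps)
    from norm_mono_pos[OF pos_scaleR[OF pos_st_mult c] this]
    have "c * (norm (H * z))\<^sup>2 \<le> norm (st z * (m *\<^sub>R 1 - Y + \<eta> *\<^sub>R 1) * z)"
      using c by (simp add: norm_st_mult)
    also have "st z * (m *\<^sub>R 1 - Y + \<eta> *\<^sub>R 1) * z = st z * (m *\<^sub>R 1 - Y) * z + \<eta> *\<^sub>R (st z * z)"
      by (simp add: algebra_simps)
    also have "norm \<dots> \<le> \<delta> + \<eta>"
      using small nz \<eta> by (intro norm_triangle_le add_mono) (auto simp: norm_st_mult)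
    finally show "c * (norm (H * z))\<^sup>2 \<le> \<delta> + \<eta>" .
  qed
qed

lemma pos_re_error: "norm a \<le> e \<Longrightarrow> pos ((2 * e) *\<^sub>R 1 - (a + st a))"
proof (rule pos_norm_diff)
  assume a: "norm a \<le> e"
  show "st (a + st a) = a + st a" by (simp add: st_add)
  show "norm (a + st a) \<le> 2 * e" using norm_triangle_ineq[of a "st a"] a by simp
qed

text \<open>Here \<open>S + S\<^sup>*\<close> is twice \<open>P\<close> minus a weighted graph Laplacian. A vector at the top of the
spectrum of \<open>(Q + t S)\<^sup>* (Q + t S)\<close> is almost annihilated by the Laplacian, hence by each of its
summands, which dominate the squares of \<open>G e * R (r e) - R (l e)\<close> and \<open>G e\<^sup>* * R (l e) - R (r e)\<close>.\<close>
lemma laplacian_vector: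
  fixes R :: "'i \<Rightarrow> 'a" and V G :: "'e \<Rightarrow> 'a" and l r :: "'e \<Rightarrow> 'i"
  assumes E: "finite E" and R: "\<And>i. st (R i) = R i" "\<And>e. e \<in> E \<Longrightarrow> norm (R (l e)) \<le> K" "\<And>e. e \<in> E \<Longrightarrow> norm (R (r e)) \<le> K"
    and eps: "0 \<le> \<epsilon>" "\<epsilon> \<le> (1::real)"
    and G: "\<And>e. e \<in> E \<Longrightarrow> (norm (G e))\<^sup>2 \<le> 1 + \<epsilon>"
    and V: "\<And>e. e \<in> E \<Longrightarrow> norm (V e - R (l e) * G e * R (r e)) \<le> \<epsilon>"
    and P: "pos P" "norm P \<le> 1 + \<epsilon>"
    and S: "S + st S = 2 *\<^sub>R P - 2 *\<^sub>R (\<Sum>e\<in>E. R (l e) * R (l e) + R (r e) * R (r e) - V e - st (V e))"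
    and Q: "st Q = Q" "(norm Q)\<^sup>2 \<le> 1 + \<epsilon>" "norm (Q * S - S) \<le> \<epsilon>"
    and nS: "(norm S)\<^sup>2 \<le> \<rho>"
    and t: "0 < t" "t \<le> 1" and low: "1 + 2 * t - 3 * t\<^sup>2 \<le> (norm (Q + t *\<^sub>R S))\<^sup>2" "Q + t *\<^sub>R S \<noteq> 0"
    and \<delta>: "0 < \<delta>"
  shows "\<exists>z. norm z = 1 \<and>
     2 * t * (norm ((1 - P) * z))\<^sup>2 \<le> \<delta> + (t\<^sup>2 * (3 + \<rho>) + \<epsilon> * (7 + 2 * (real (card E) * (K\<^sup>2 + 2)))) \<and>
     (\<forall>e\<in>E. 2 * t * (norm ((G e * R (r e) - R (l e)) * z))\<^sup>2 \<le> \<delta> + (t\<^sup>2 * (3 + \<rho>) + \<epsilon> * (7 + 2 * (real (card E) * (K\<^sup>2 + 2))))) \<and>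
     (\<forall>e\<in>E. 2 * t * (norm ((st (G e) * R (l e) - R (r e)) * z))\<^sup>2 \<le> \<delta> + (t\<^sup>2 * (3 + \<rho>) + \<epsilon> * (7 + 2 * (real (card E) * (K\<^sup>2 + 2)))))"
proof -
  define Y where "Y = st (Q + t *\<^sub>R S) * (Q + t *\<^sub>R S)"
  \<comment> \<open>The summand of the Laplacian belonging to \<open>e\<close>. Together with
    \<kappa> it dominates the squares of both edge defects: \<open>2 \<epsilon>\<close> pays for
    replacing \<open>V e\<close> by \<open>R G R\<close>, and \<open>\<epsilon> K^2\<close> for
    \<parallel>G e\<parallel>^2 exceeding 1.\<close>
  define T where "T e = R (l e) * R (l e) + R (r e) * R (r e) - V e - st (V e)" for e
  define \<kappa> where "\<kappa> = \<epsilon> * (K\<^sup>2 + 2)"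
  define n where "n = real (card E)"
  \<comment> \<open>Total loss, using \<open>t \<le> 1\<close>: \<open>3 t^2\<close> from the lower
    bound, \<open>t^2 \<rho>\<close> from \<open>st S * S\<close>,
    \<open>\<epsilon> (1 + 2 t)\<close> from the two hypotheses on \<open>Q\<close>,
    \<open>4 t \<epsilon>\<close> from comparing \<open>1 - P\<close> with its square, and
    \<open>2 t n \<kappa>\<close> from the edges.\<close>
  define \<eta> where "\<eta> = t\<^sup>2 * (3 + \<rho>) + \<epsilon> * (7 + 2 * (n * (K\<^sup>2 + 2)))"
  have \<kappa>0: "0 \<le> \<kappa>" using eps by (simp add: \<kappa>_def)
  have \<rho>0: "0 \<le> \<rho>" using nS by (meson order_trans zero_le_power2)
  have n0: "0 \<le> n" by (simp add: n_def)
  have \<eta>0: "0 \<le> \<eta>" unfolding \<eta>_def using \<rho>0 eps n0 by (intro add_nonneg_nonneg mult_nonneg_nonneg) auto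
  have Y: "pos Y" "norm Y = (norm (Q + t *\<^sub>R S))\<^sup>2" unfolding Y_def by (auto simp: pos_st_mult norm_st_mult)
  then have Y0: "Y \<noteq> 0" using low(2) by auto
  have TD: "pos (T e + \<kappa> *\<^sub>R 1 - st (G e * R (r e) - R (l e)) * (G e * R (r e) - R (l e)))" (is ?A)
    and TD': "pos (T e + \<kappa> *\<^sub>R 1 - st (st (G e) * R (l e) - R (r e)) * (st (G e) * R (l e) - R (r e)))" (is ?B)
    if e: "e \<in> E" for e
  proof -
    let ?i = "R (l e)" and ?j = "R (r e)" and ?g = "G e"
    have err: "pos ((2 * \<epsilon>) *\<^sub>R 1 - ((V e - ?i * ?g * ?j) + st (V e - ?i * ?g * ?j)))"
      by (rule pos_re_error[OF V[OF e]])
    have *: "pos ((\<epsilon> * K\<^sup>2) *\<^sub>R 1 + b * b - b * (st g * g) * b)"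
      if b: "st b = b" "norm b \<le> K" and g: "(norm g)\<^sup>2 \<le> 1 + \<epsilon>" for b g
    proof -
      have "pos ((1 + \<epsilon>) *\<^sub>R 1 - st g * g)"
        using g by (intro pos_norm_diff) (auto simp: st_mult norm_st_mult)
      from pos_conj[OF this, of b] have 1: "pos ((1 + \<epsilon>) *\<^sub>R (b * b) - b * (st g * g) * b)"
        by (simp add: b algebra_simps)
      have "norm (b * b) \<le> K\<^sup>2" using norm_sa_square[OF b(1)] b(2) by (simp add: power_mono)
      then have "pos (K\<^sup>2 *\<^sub>R 1 - b * b)" using b(1) by (intro pos_norm_diff) (auto simp: st_mult)
      from pos_scaleR[OF this eps(1)] have 2: "pos ((\<epsilon> * K\<^sup>2) *\<^sub>R 1 - \<epsilon> *\<^sub>R (b * b))"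
        by (simp add: algebra_simps)
      have eq: "(1 + \<epsilon>) *\<^sub>R (b * b) - b * (st g * g) * b + ((\<epsilon> * K\<^sup>2) *\<^sub>R 1 - \<epsilon> *\<^sub>R (b * b)) =
          (\<epsilon> * K\<^sup>2) *\<^sub>R 1 + b * b - b * (st g * g) * b" by (simp add: algebra_simps)
      show ?thesis using pos_add[OF 1 2] unfolding eq .
    qed
    have 1: "pos ((\<epsilon> * K\<^sup>2) *\<^sub>R 1 + ?j * ?j - ?j * (st ?g * ?g) * ?j)" using * R G e by blast
    have 2: "pos ((\<epsilon> * K\<^sup>2) *\<^sub>R 1 + ?i * ?i - ?i * (st (st ?g) * st ?g) * ?i)"
      using *[of ?i "st ?g"] R G e by auto
    have k: "\<kappa> *\<^sub>R (1::'a) = (2 * \<epsilon>) *\<^sub>R 1 + (\<epsilon> * K\<^sup>2) *\<^sub>R 1" by (simp add: \<kappa>_def algebra_simps)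
    have "T e + \<kappa> *\<^sub>R 1 - st (?g * ?j - ?i) * (?g * ?j - ?i) =
        ((2 * \<epsilon>) *\<^sub>R 1 - ((V e - ?i * ?g * ?j) + st (V e - ?i * ?g * ?j)))
        + ((\<epsilon> * K\<^sup>2) *\<^sub>R 1 + ?j * ?j - ?j * (st ?g * ?g) * ?j)"
      unfolding k T_def by (simp add: st_diff st_mult R algebra_simps)
    then show ?A using pos_add[OF err 1] by simp
    have "T e + \<kappa> *\<^sub>R 1 - st (st ?g * ?i - ?j) * (st ?g * ?i - ?j) =
        ((2 * \<epsilon>) *\<^sub>R 1 - ((V e - ?i * ?g * ?j) + st (V e - ?i * ?g * ?j)))
        + ((\<epsilon> * K\<^sup>2) *\<^sub>R 1 + ?i * ?i - ?i * (st (st ?g) * st ?g) * ?i)"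
      unfolding k T_def by (simp add: st_diff st_mult R algebra_simps)
    then show ?B using pos_add[OF err 2] by simp
  qed
  have T0: "pos (T e + \<kappa> *\<^sub>R 1)" if "e \<in> E" for e
    using pos_add[OF TD[OF that] pos_st_mult[of "G e * R (r e) - R (l e)"]] by simp
  have Yle: "pos ((1 + \<epsilon> + 2 * t * \<epsilon> + t\<^sup>2 * \<rho>) *\<^sub>R 1 + (2 * t) *\<^sub>R (P - sum T E) - Y)"
  proof -
    have 1: "pos ((1 + \<epsilon>) *\<^sub>R 1 - Q * Q)"
      using Q norm_sa_square[OF Q(1)] by (intro pos_norm_diff) (auto simp: st_mult)
    have 2: "pos (t *\<^sub>R ((2 * \<epsilon>) *\<^sub>R 1 - ((Q * S - S) + st (Q * S - S))))"
      using t by (intro pos_scaleR pos_re_error Q) auto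
    have 3: "pos (t\<^sup>2 *\<^sub>R (\<rho> *\<^sub>R 1 - st S * S))"
      using nS by (intro pos_scaleR pos_norm_diff) (auto simp: st_mult norm_st_mult)
    have S': "2 *\<^sub>R (P - sum T E) = S + st S" using S by (simp add: T_def scaleR_diff_right)
    have "(2 * t) *\<^sub>R (P - sum T E) = t *\<^sub>R (S + st S)"
      by (metis S' mult.commute scaleR_scaleR)
    then have "(1 + \<epsilon> + 2 * t * \<epsilon> + t\<^sup>2 * \<rho>) *\<^sub>R 1 + (2 * t) *\<^sub>R (P - sum T E) - Y
      = ((1 + \<epsilon>) *\<^sub>R 1 - Q * Q) + t *\<^sub>R ((2 * \<epsilon>) *\<^sub>R 1 - ((Q * S - S) + st (Q * S - S))) + t\<^sup>2 *\<^sub>R (\<rho> *\<^sub>R 1 - st S * S)"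
      unfolding Y_def by (simp add: st_add st_diff st_mult st_scaleR Q(1) algebra_simps power2_eq_square)
    then show ?thesis using pos_add[OF pos_add[OF 1 2] 3] by simp
  qed
  \<comment> \<open>\<open>Y\<close> is at most about \<open>1 + 2 t (P - sum T E)\<close> while its
    norm is at least about \<open>1 + 2 t\<close>. Hence whatever is dominated by
    \<open>1 - P\<close> plus the Laplacian meets the condition of
    \<open>top_vector\<close>.\<close>
  have main: "pos (norm Y *\<^sub>R 1 - Y + \<eta> *\<^sub>R 1 - (2 * t) *\<^sub>R X)"
    if X: "pos ((1 - P) + sum T E + (n * \<kappa> + 2 * \<epsilon>) *\<^sub>R 1 - X)" for X
  proof -
    define c where "c = norm Y + \<eta> - (1 + \<epsilon> + 2 * t * \<epsilon> + t\<^sup>2 * \<rho> + 2 * t + 2 * t * (n * \<kappa> + 2 * \<epsilon>))"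
    have "0 \<le> c"
    proof -
      have "\<eta> = t\<^sup>2 * (3 + \<rho>) + 7 * \<epsilon> + 2 * (n * \<kappa>)" unfolding \<eta>_def \<kappa>_def by (simp add: algebra_simps)
      moreover have "t * \<epsilon> \<le> \<epsilon>" using mult_right_mono[OF t(2) eps(1)] by simp
      moreover have "t * (n * \<kappa>) \<le> n * \<kappa>" using mult_right_mono[OF t(2) mult_nonneg_nonneg[OF n0 \<kappa>0]] by simp
      moreover have "c = norm Y + \<eta> - 1 - \<epsilon> - 6 * (t * \<epsilon>) - t\<^sup>2 * \<rho> - 2 * t - 2 * (t * (n * \<kappa>))"
        unfolding c_def by (simp add: algebra_simps)
      moreover have "t\<^sup>2 * (3 + \<rho>) = 3 * t\<^sup>2 + t\<^sup>2 * \<rho>" by (simp add: algebra_simps)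
      ultimately show ?thesis using low(1) unfolding Y(2)[symmetric] by linarith
    qed
    then have 1: "pos (c *\<^sub>R 1)" by (intro pos_scaleR pos_1)
    have 2: "pos ((2 * t) *\<^sub>R ((1 - P) + sum T E + (n * \<kappa> + 2 * \<epsilon>) *\<^sub>R 1 - X))"
      using t by (intro pos_scaleR X) auto
    have eq: "norm Y *\<^sub>R 1 - Y + \<eta> *\<^sub>R 1 - (2 * t) *\<^sub>R X = ((1 + \<epsilon> + 2 * t * \<epsilon> + t\<^sup>2 * \<rho>) *\<^sub>R 1 + (2 * t) *\<^sub>R (P - sum T E) - Y)
      + (2 * t) *\<^sub>R ((1 - P) + sum T E + (n * \<kappa> + 2 * \<epsilon>) *\<^sub>R 1 - X) + c *\<^sub>R 1"
    proof -
      have gen: "(k *\<^sub>R 1 + (2 * t) *\<^sub>R (P - sum T E) - Y) + (2 * t) *\<^sub>R ((1 - P) + sum T E + k' *\<^sub>R 1 - X) + c *\<^sub>R 1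
        = (k + 2 * t + 2 * t * k' + c) *\<^sub>R 1 - Y - (2 * t) *\<^sub>R X" for k k' by (simp add: algebra_simps)
      have "1 + \<epsilon> + 2 * t * \<epsilon> + t\<^sup>2 * \<rho> + 2 * t + 2 * t * (n * \<kappa> + 2 * \<epsilon>) + c = norm Y + \<eta>"
        by (simp add: c_def)
      then show ?thesis unfolding gen by (simp add: scaleR_add_left)
    qed
    show ?thesis unfolding eq by (rule pos_add[OF pos_add[OF Yle 2] 1])
  qed
  have sumT: "pos (sum T E + (n * \<kappa>) *\<^sub>R 1 - X)" if e: "e \<in> E" "pos (T e + \<kappa> *\<^sub>R 1 - X)" for X e
  proof -
    have rest: "pos (\<Sum>e\<in>E - {e}. T e + \<kappa> *\<^sub>R 1)" by (intro pos_sum T0) auto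
    have eq: "(\<Sum>e\<in>E. T e + \<kappa> *\<^sub>R 1) - X = (\<Sum>e\<in>E - {e}. T e + \<kappa> *\<^sub>R 1) + (T e + \<kappa> *\<^sub>R 1 - X)"
      using sum.remove[OF E e(1), of "\<lambda>e. T e + \<kappa> *\<^sub>R 1"] by simp
    have "pos ((\<Sum>e\<in>E. T e + \<kappa> *\<^sub>R 1) - X)" unfolding eq by (rule pos_add[OF rest e(2)])
    moreover have "(\<Sum>e\<in>E. T e + \<kappa> *\<^sub>R 1) = sum T E + (n * \<kappa>) *\<^sub>R 1"
      by (simp add: sum.distrib n_def scaleR_conv_of_real)
    ultimately show ?thesis by simp
  qed
  have P1: "pos ((1 - P) + (2 * \<epsilon>) *\<^sub>R 1 - st (1 - P) * (1 - P))"
  proof -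
    have "pos ((1 + \<epsilon>) *\<^sub>R 1 - P)" by (rule pos_norm_diff[OF pos_sa[OF P(1)] P(2)])
    from pos_mult_commute[OF P(1) this] have 1: "pos ((1 + \<epsilon>) *\<^sub>R P - P * P)" by (simp add: algebra_simps)
    have "norm (\<epsilon> *\<^sub>R P) \<le> \<epsilon> * 2" using P(2) eps by (simp add: mult_left_mono)
    then have "pos ((\<epsilon> * 2) *\<^sub>R 1 - \<epsilon> *\<^sub>R P)" by (intro pos_norm_diff) (auto simp: st_scaleR pos_sa P)
    from pos_add[OF 1 this] show ?thesis by (simp add: st_diff pos_sa P algebra_simps)
  qed
  have P0: "pos ((1 - P) + (2 * \<epsilon>) *\<^sub>R 1)" using pos_add[OF P1 pos_st_mult[of "1 - P"]] by simp
  obtain z where z: "norm z = 1" "\<And>H. pos (norm Y *\<^sub>R 1 - Y + \<eta> *\<^sub>R 1 - (2 * t) *\<^sub>R (st H * H)) \<Longrightarrow> 2 * t * (norm (H * z))\<^sup>2 \<le> \<delta> + \<eta>"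
  proof -
    obtain z where "norm z = 1"  "\<And>H \<eta> c. pos (norm Y *\<^sub>R 1 - Y + \<eta> *\<^sub>R 1 - c *\<^sub>R (st H * H)) \<Longrightarrow> 0 \<le> \<eta> \<Longrightarrow> 0 \<le> c \<Longrightarrow>
      c * (norm (H * z))\<^sup>2 \<le> \<delta> + \<eta>" using top_vector[OF Y(1) Y0 \<delta>] by blast
    then show ?thesis using that[of z] \<eta>0 t by simp
  qed
  have edge: "2 * t * (norm (H * z))\<^sup>2 \<le> \<delta> + \<eta>" if "e \<in> E" "pos (T e + \<kappa> *\<^sub>R 1 - st H * H)" for H e
  proof (rule z(2), rule main)
    from pos_add[OF P0 sumT[OF that]]
    show "pos ((1 - P) + sum T E + (n * \<kappa> + 2 * \<epsilon>) *\<^sub>R 1 - st H * H)" by (simp add: algebra_simps)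
  qed
  have "2 * t * (norm ((1 - P) * z))\<^sup>2 \<le> \<delta> + \<eta>"
  proof (rule z(2), rule main)
    have "pos (\<Sum>e\<in>E. T e + \<kappa> *\<^sub>R 1)" by (intro pos_sum T0)
    then have "pos (sum T E + (n * \<kappa>) *\<^sub>R 1)" by (simp add: sum.distrib n_def scaleR_conv_of_real)
    from pos_add[OF P1 this]
    show "pos ((1 - P) + sum T E + (n * \<kappa> + 2 * \<epsilon>) *\<^sub>R 1 - st (1 - P) * (1 - P))" by (simp add: algebra_simps)
  qed
  then show ?thesis using z(1) edge[OF _ TD] edge[OF _ TD'] unfolding \<eta>_def n_def by blast
qed

end

section \<open>Isometric homomorphisms respect adjoints on C*-subalgebras of their domain\<close>

locale isometric_hom =
  a: cstar_algebra cs1 st1 + b: cstar_algebra cs2 st2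
  for cs1 :: "complex \<Rightarrow> 'a::{real_normed_algebra_1,banach} \<Rightarrow> 'a" and st1
    and cs2 :: "complex \<Rightarrow> 'b::{real_normed_algebra_1,banach} \<Rightarrow> 'b" and st2 +
  fixes A1 :: "'a set" and u :: "'a \<Rightarrow> 'b"
  assumes A1: "banach_subalg cs1 A1" and lin: "clinear_on cs1 cs2 A1 u" and mult: "multiplicative_on A1 u"
    and iso: "\<And>x. x \<in> A1 \<Longrightarrow> norm (u x) = norm x"
begin

lemma A1_csubspace: "csubspace cs1 A1" and A1_mult: "x \<in> A1 \<Longrightarrow> y \<in> A1 \<Longrightarrow> x * y \<in> A1"
  using A1 by (auto simp: banach_subalg_def)

lemma A1_add: "x \<in> A1 \<Longrightarrow> y \<in> A1 \<Longrightarrow> x + y \<in> A1" and A1_cs: "x \<in> A1 \<Longrightarrow> cs1 c x \<in> A1" and A1_0: "0 \<in> A1"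
  using A1_csubspace by (auto simp: csubspace_def)

lemma A1_diff: "x \<in> A1 \<Longrightarrow> y \<in> A1 \<Longrightarrow> x - y \<in> A1"
  using a.csubspace_diff[OF A1_csubspace] .

lemma A1_scaleR: "x \<in> A1 \<Longrightarrow> r *\<^sub>R x \<in> A1" using A1_cs[of x "complex_of_real r"] by (simp add: a.cs_of_real)

lemma A1_sum: "(\<And>i. i \<in> F \<Longrightarrow> f i \<in> A1) \<Longrightarrow> sum f F \<in> A1"
  by (rule a.csubspace_sum[OF A1_csubspace])

lemma u_add: "x \<in> A1 \<Longrightarrow> y \<in> A1 \<Longrightarrow> u (x + y) = u x + u y"
  and u_cs: "x \<in> A1 \<Longrightarrow> u (cs1 c x) = cs2 c (u x)"
  and u_mult: "x \<in> A1 \<Longrightarrow> y \<in> A1 \<Longrightarrow> u (x * y) = u x * u y"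
  using lin mult by (auto simp: clinear_on_def multiplicative_on_def)

lemma u_scaleR: "x \<in> A1 \<Longrightarrow> u (r *\<^sub>R x) = r *\<^sub>R u x"
  using u_cs[of x "complex_of_real r"] by (simp add: a.cs_of_real b.cs_of_real)

lemma u_0: "u 0 = 0" using u_scaleR[OF A1_0, of 0] by simp

lemma u_diff: "x \<in> A1 \<Longrightarrow> y \<in> A1 \<Longrightarrow> u (x - y) = u x - u y"
  using u_add[of x "(-1) *\<^sub>R y"] u_scaleR[of y "-1"] A1_scaleR[of y "-1"] by simp

lemma u_sum: "(\<And>i. i \<in> F \<Longrightarrow> f i \<in> A1) \<Longrightarrow> u (sum f F) = (\<Sum>i\<in>F. u (f i))"
  by (induction F rule: infinite_finite_induct) (auto simp: u_0 u_add A1_sum)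

lemmas A1_intros = A1_add A1_diff A1_mult A1_cs A1_scaleR A1_0 A1_sum

text \<open>With an approximate unit \<open>k\<close> for \<open>h\<close> one has \<open>\<parallel>u (k + i t h)\<parallel>\<^sup>2 \<le> 1 + t\<^sup>2\<close>, where the term
linear in \<open>t\<close> is \<open>g = i (u h - (u h)\<^sup>*)\<close>.\<close>
lemma u_sa_contraction:
  assumes D: "cstar_subalg cs1 st1 D" "D \<subseteq> A1" and h: "h \<in> D" "st1 h = h" "norm h \<le> 1"
  shows "st2 (u h) = u h"
proof -
  obtain k where k: "\<And>n. k n \<in> D" "\<And>n. st1 (k n) = k n" "\<And>n. norm (k n) \<le> 1" "\<And>n. k n * h = h * k n"
    "(\<lambda>n. k n * h) \<longlonglongrightarrow> h" using a.approximate_unit_of_sa[OF D(1) h] by blast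
  have A: "h \<in> A1" "k n \<in> A1" for n using h k D by auto
  define v where "v = u h"
  have nk: "norm (u (k n)) \<le> 1" for n using iso A k by simp
  have kv0: "(\<lambda>n. norm (k n * h - h)) \<longlonglongrightarrow> 0" using k(5) tendsto_norm_zero LIM_zero by blast
  have n1: "norm (u (k n) * v - v) = norm (k n * h - h)" for n
    using iso[of "k n * h - h"] A by (simp add: v_def u_diff u_mult A1_intros)
  have n2: "norm (v * u (k n) - v) = norm (k n * h - h)" for n
    using iso[of "h * k n - h"] A k(4)[of n] by (simp add: v_def u_diff u_mult A1_intros)
  have kv: "(\<lambda>n. u (k n) * v) \<longlonglongrightarrow> v"
    using LIM_zero_cancel[OF tendsto_norm_zero_cancel[OF kv0[folded n1]]] .
  \<comment> \<open>As \<open>k n\<close> commutes with \<open>h\<close>, it almost fixes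
    \<open>v\<close> from the right too. So \<open>st2 v\<close> is almost fixed by the adjoint of
    \<open>u (k n)\<close>, and then by the contraction \<open>u (k n)\<close> itself.\<close>
  have kvs: "(\<lambda>n. u (k n) * st2 v) \<longlonglongrightarrow> st2 v"
  proof -
    have "(norm (u (k n) * st2 v - st2 v))\<^sup>2 \<le> 2 * norm v * norm (k n * h - h)" for n
    proof -
      have "norm (st2 (u (k n)) * st2 v - st2 v) = norm (st2 (v * u (k n) - v))"
        by (simp only: b.st_mult b.st_diff)
      then show ?thesis using b.contraction_fixed_adjoint[of "st2 (u (k n))" "st2 v"] nk[of n] n2[of n] by simp
    qed
    then have "\<forall>\<^sub>F n in sequentially. norm ((norm (u (k n) * st2 v - st2 v))\<^sup>2) \<le> 2 * norm v * norm (k n * h - h)"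
      by simp
    moreover have "(\<lambda>n. 2 * norm v * norm (k n * h - h)) \<longlonglongrightarrow> 0"
      by (intro tendsto_mult_right_zero kv0)
    ultimately have "(\<lambda>n. (norm (u (k n) * st2 v - st2 v))\<^sup>2) \<longlonglongrightarrow> 0" by (rule Lim_null_comparison)
    from tendsto_real_sqrt[OF this] have "(\<lambda>n. norm (u (k n) * st2 v - st2 v)) \<longlonglongrightarrow> 0" by simp
    then have "(\<lambda>n. u (k n) * st2 v - st2 v) \<longlonglongrightarrow> 0" by (rule tendsto_norm_zero_cancel)
    then show ?thesis by (rule LIM_zero_cancel)
  qed
  define g where "g = cs2 \<i> (v - st2 v)"
  have sg: "st2 g = g" by (simp add: g_def b.st_cs b.st_diff b.cs_minus_left b.cs_diff_right)
  have kg: "(\<lambda>n. u (k n) * g) \<longlonglongrightarrow> g"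
  proof -
    have "(\<lambda>n. cs2 \<i> (u (k n) * v - u (k n) * st2 v)) \<longlonglongrightarrow> g"
      unfolding g_def by (intro b.tendsto_cs tendsto_diff kv kvs tendsto_const)
    then show ?thesis by (simp add: g_def b.cs_mult_right right_diff_distrib)
  qed
  have main: "b.pos (t\<^sup>2 *\<^sub>R (g * g) - t *\<^sub>R (g * g * g))" for t :: real
  proof -
    define X where "X n = u (k n) + cs2 (\<i> * complex_of_real t) v" for n
    have nX: "(norm (X n))\<^sup>2 \<le> 1 + t\<^sup>2" for n
    proof -
      define x where "x = k n + cs1 (\<i> * complex_of_real t) h"
      have xA: "x \<in> A1" unfolding x_def by (intro A1_intros A)
      have "X n = u x" unfolding X_def x_def v_def using A by (simp add: u_add u_cs A1_intros)
      then have "(norm (X n))\<^sup>2 = norm (st1 x * x)" using iso[OF xA] a.norm_st_mult[of x] by simp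
      also have "st1 x * x = k n * k n + t\<^sup>2 *\<^sub>R (h * h)"
      proof -
        have sx: "st1 x = k n - cs1 (\<i> * complex_of_real t) h"
          by (simp add: x_def a.st_add a.st_cs k h a.cs_minus_left)
        have "cs1 ((\<i> * complex_of_real t) * (\<i> * complex_of_real t)) (h * h) = - (t\<^sup>2 *\<^sub>R (h * h))"
        proof -
          have "(\<i> * complex_of_real t) * (\<i> * complex_of_real t) = - complex_of_real (t\<^sup>2)"
            by (simp add: complex_eq_iff power2_eq_square)
          then show ?thesis by (simp only: a.cs_minus_left a.cs_of_real)
        qed
        then show ?thesis unfolding sx
          by (simp add: x_def algebra_simps a.cs_mult_left a.cs_mult_right a.cs_cs k(4) a.cs_diff_right)
      qed
      also have "norm \<dots> \<le> 1 + t\<^sup>2"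
      proof (intro norm_triangle_le add_mono)
        show "norm (k n * k n) \<le> 1" using norm_mult_ineq[of "k n" "k n"] mult_le_one[OF k(3)[of n] _ k(3)[of n]] by simp
        have "norm (h * h) \<le> 1" using norm_mult_ineq[of h h] mult_le_one[OF h(3) _ h(3)] by simp
        then show "norm (t\<^sup>2 *\<^sub>R (h * h)) \<le> t\<^sup>2" by (simp add: mult_left_le)
      qed
      finally show ?thesis .
    qed
    have "b.pos ((1 + t\<^sup>2) *\<^sub>R (g * g) - st2 (X n * g) * (X n * g))" for n
    proof -
      have "b.pos ((1 + t\<^sup>2) *\<^sub>R 1 - st2 (X n) * X n)"
        using nX[of n] by (intro b.pos_norm_diff) (auto simp: b.st_mult b.norm_st_mult)
      from b.pos_conj[OF this, of g] show ?thesis by (simp add: sg b.st_mult algebra_simps)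
    qed
    moreover have "(\<lambda>n. (1 + t\<^sup>2) *\<^sub>R (g * g) - st2 (X n * g) * (X n * g)) \<longlonglongrightarrow>
        (1 + t\<^sup>2) *\<^sub>R (g * g) - st2 (g + cs2 (\<i> * complex_of_real t) (v * g)) * (g + cs2 (\<i> * complex_of_real t) (v * g))"
    proof -
      have "(\<lambda>n. X n * g) \<longlonglongrightarrow> g + cs2 (\<i> * complex_of_real t) (v * g)"
        unfolding X_def distrib_right b.cs_mult_left by (intro tendsto_add kg tendsto_const)
      then show ?thesis by (intro tendsto_intros)
    qed
    ultimately have p: "b.pos ((1 + t\<^sup>2) *\<^sub>R (g * g) - st2 (g + cs2 (\<i> * complex_of_real t) (v * g)) * (g + cs2 (\<i> * complex_of_real t) (v * g)))"
      by (rule b.pos_closed[rotated])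
    have e1: "cs2 (\<i> * complex_of_real t) (g * (v * g)) - cs2 (\<i> * complex_of_real t) (g * (st2 v * g)) = t *\<^sub>R (g * g * g)"
    proof -
      have "t *\<^sub>R (g * g * g) = cs2 (complex_of_real t) (g * cs2 \<i> (v - st2 v) * g)"
        by (simp add: b.cs_of_real g_def[symmetric])
      then show ?thesis
        by (simp add: b.cs_mult_left b.cs_mult_right b.cs_cs b.cs_diff_right mult.commute algebra_simps)
    qed
    have e2: "cs2 ((\<i> * complex_of_real t) * (\<i> * complex_of_real t)) y = - (t\<^sup>2 *\<^sub>R y)" for y
    proof -
      have "(\<i> * complex_of_real t) * (\<i> * complex_of_real t) = - complex_of_real (t\<^sup>2)"
        by (simp add: complex_eq_iff power2_eq_square)
      then show ?thesis by (simp only: b.cs_minus_left b.cs_of_real)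
    qed
    have "st2 (g + cs2 (\<i> * complex_of_real t) (v * g)) * (g + cs2 (\<i> * complex_of_real t) (v * g))
      = g * g + t *\<^sub>R (g * g * g) + t\<^sup>2 *\<^sub>R (st2 (v * g) * (v * g))"
    proof -
      define w where "w = g + cs2 (\<i> * complex_of_real t) (v * g)"
      have sw: "st2 w = g - cs2 (\<i> * complex_of_real t) (g * st2 v)"
        by (simp add: w_def b.st_add b.st_cs b.st_mult sg b.cs_minus_left)
      have "st2 w * w
        = g * g + (cs2 (\<i> * complex_of_real t) (g * (v * g)) - cs2 (\<i> * complex_of_real t) (g * (st2 v * g)))
          - cs2 ((\<i> * complex_of_real t) * (\<i> * complex_of_real t)) (g * st2 v * (v * g))"
        unfolding sw by (simp add: w_def algebra_simps b.cs_mult_left b.cs_mult_right b.cs_cs b.cs_diff_right)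
      then show ?thesis unfolding e1 e2 w_def[symmetric] by (simp add: b.st_mult sg mult.assoc)
    qed
    then have "(1 + t\<^sup>2) *\<^sub>R (g * g) - st2 (g + cs2 (\<i> * complex_of_real t) (v * g)) * (g + cs2 (\<i> * complex_of_real t) (v * g))
      = t\<^sup>2 *\<^sub>R (g * g) - t *\<^sub>R (g * g * g) - t\<^sup>2 *\<^sub>R (st2 (v * g) * (v * g))" by (simp add: algebra_simps)
    then have "b.pos (t\<^sup>2 *\<^sub>R (g * g) - t *\<^sub>R (g * g * g) - t\<^sup>2 *\<^sub>R (st2 (v * g) * (v * g)))" using p by simp
    from b.pos_add[OF this b.pos_scaleR[OF b.pos_st_mult, of "t\<^sup>2" "v * g"]] show ?thesis by simp
  qed
  \<comment> \<open>Dividing \<open>main\<close> by \<bar>t\<bar>, where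
    \<open>t = s / (n + 1)\<close>, leaves \<open>- s g^3 \<ge> 0\<close> in the limit for both
    signs, whence \<open>g^3 = 0\<close>.\<close>
  have lim: "b.pos (- (s *\<^sub>R (g * g * g)))" if s: "s = 1 \<or> s = -1" for s :: real
  proof (rule b.pos_closed)
    show "(\<lambda>n. (1 / real (Suc n)) *\<^sub>R (g * g) - s *\<^sub>R (g * g * g)) \<longlonglongrightarrow> - (s *\<^sub>R (g * g * g))"
    proof -
      have "(\<lambda>n. (1 / real (Suc n)) *\<^sub>R (g * g) - s *\<^sub>R (g * g * g)) \<longlonglongrightarrow> 0 *\<^sub>R (g * g) - s *\<^sub>R (g * g * g)"
        by (intro tendsto_intros LIMSEQ_Suc[OF lim_1_over_n])
      then show ?thesis by simp
    qed
    fix n :: nat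
    define t where "t = s / real (Suc n)"
    have "real (Suc n) *\<^sub>R (t\<^sup>2 *\<^sub>R (g * g) - t *\<^sub>R (g * g * g)) = (1 / real (Suc n)) *\<^sub>R (g * g) - s *\<^sub>R (g * g * g)"
      using s by (auto simp: t_def scaleR_diff_right power2_eq_square)
    then show "b.pos ((1 / real (Suc n)) *\<^sub>R (g * g) - s *\<^sub>R (g * g * g))"
      using b.pos_scaleR[OF main[of t], of "real (Suc n)"] by simp
  qed
  have "g * g * g = 0" using b.pos_antisym[of "g * g * g"] lim[of 1] lim[of "-1"] by simp
  then have "g = 0" using b.sa_zero_of_cube[OF sg] by simp
  then have "norm (v - st2 v) = 0" using b.norm_cs[of \<i> "v - st2 v"] by (simp add: g_def)
  then show ?thesis by (simp add: v_def)
qed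

lemma u_sa:
  assumes D: "cstar_subalg cs1 st1 D" "D \<subseteq> A1" and h: "h \<in> D" "st1 h = h"
  shows "st2 (u h) = u h"
proof (cases "h = 0")
  case False
  define t where "t = norm h"
  have t: "0 < t" using False by (simp add: t_def)
  have "(1/t) *\<^sub>R h \<in> D" using a.cstar_subalgD(10)[OF D(1) h(1)] .
  then have "st2 (u ((1/t) *\<^sub>R h)) = u ((1/t) *\<^sub>R h)"
    by (rule u_sa_contraction[OF D]) (use h t in \<open>auto simp: a.st_scaleR t_def\<close>)
  then have "(1/t) *\<^sub>R st2 (u h) = (1/t) *\<^sub>R u h" using h D by (simp add: u_scaleR b.st_scaleR subset_iff)
  then show ?thesis using t by simp
qed (simp add: u_0)

end

section \<open>Almost invariant vectors\<close>

definition asymp_eq :: "(nat \<Rightarrow> 'a::real_normed_algebra) \<Rightarrow> (nat \<Rightarrow> 'a) \<Rightarrow> bool" (infix \<open>\<simeq>\<close> 50)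
  where "f \<simeq> g \<longleftrightarrow> (\<lambda>n. f n - g n) \<longlonglongrightarrow> 0"

lemma asymp_eq_refl: "f \<simeq> f" by (simp add: asymp_eq_def)

lemma asymp_eq_sym: "f \<simeq> g \<Longrightarrow> g \<simeq> f"
  using tendsto_minus[of "\<lambda>n. f n - g n" 0] by (simp add: asymp_eq_def)

lemma asymp_eq_trans [trans]: "f \<simeq> g \<Longrightarrow> g \<simeq> k \<Longrightarrow> f \<simeq> k"
  using tendsto_add[of "\<lambda>n. f n - g n" 0 _ "\<lambda>n. g n - k n" 0] by (simp add: asymp_eq_def)

lemma asymp_eq_add: "f \<simeq> g \<Longrightarrow> f' \<simeq> g' \<Longrightarrow> (\<lambda>n. f n + f' n) \<simeq> (\<lambda>n. g n + g' n)"
  using tendsto_add[of "\<lambda>n. f n - g n" 0 _ "\<lambda>n. f' n - g' n" 0] by (simp add: asymp_eq_def add_diff_add)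

lemma asymp_eq_diff: "f \<simeq> g \<Longrightarrow> f' \<simeq> g' \<Longrightarrow> (\<lambda>n. f n - f' n) \<simeq> (\<lambda>n. g n - g' n)"
  using tendsto_diff[of "\<lambda>n. f n - g n" 0 _ "\<lambda>n. f' n - g' n" 0] by (simp add: asymp_eq_def algebra_simps)

lemma asymp_eq_sum: "(\<And>i. i \<in> F \<Longrightarrow> f i \<simeq> g i) \<Longrightarrow> (\<lambda>n. \<Sum>i\<in>F. f i n) \<simeq> (\<lambda>n. \<Sum>i\<in>F. g i n)"
  by (induction F rule: infinite_finite_induct) (auto simp: asymp_eq_refl intro: asymp_eq_add)

lemma asymp_eq_mult_left: "f \<simeq> g \<Longrightarrow> (\<And>n. norm (k n) \<le> K) \<Longrightarrow> (\<lambda>n. k n * f n) \<simeq> (\<lambda>n. k n * g n)"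
  using null_mult_bounded(1)[of "\<lambda>n. f n - g n" k K] by (simp add: asymp_eq_def right_diff_distrib)

lemma asymp_eq_mult_right: "f \<simeq> g \<Longrightarrow> (\<And>n. norm (k n) \<le> K) \<Longrightarrow> (\<lambda>n. f n * k n) \<simeq> (\<lambda>n. g n * k n)"
  using null_mult_bounded(2)[of "\<lambda>n. f n - g n" k K] by (simp add: asymp_eq_def left_diff_distrib)

lemma asymp_eq_scaleR: "f \<simeq> g \<Longrightarrow> (\<lambda>n. r *\<^sub>R f n) \<simeq> (\<lambda>n. r *\<^sub>R g n)"
  using tendsto_scaleR[OF tendsto_const, of "\<lambda>n. f n - g n" 0 sequentially r] by (simp add: asymp_eq_def scaleR_diff_right)

lemma asymp_eq_norm: "f \<simeq> g \<Longrightarrow> (\<lambda>n. norm (f n) - norm (g n)) \<longlonglongrightarrow> 0"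
  unfolding asymp_eq_def by (rule tendsto_0_le[of _ _ _ 1]) (auto simp: norm_triangle_ineq3)

lemma (in cstar_algebra) asymp_eq_cs: "f \<simeq> g \<Longrightarrow> (\<lambda>n. cs c (f n)) \<simeq> (\<lambda>n. cs c (g n))"
  using tendsto_cs[OF tendsto_const, of "\<lambda>n. f n - g n" 0 sequentially c] by (simp add: asymp_eq_def cs_diff_right)

lemma null_eventually_le: "(f \<longlonglongrightarrow> 0) \<Longrightarrow> 0 < e \<Longrightarrow> \<forall>\<^sub>F n in sequentially. norm (f n) \<le> (e :: real)"
  using tendstoD[of f 0 sequentially e] by (auto simp: elim: eventually_mono)

lemma tendsto_subsequence:
  fixes \<nu> :: "nat \<Rightarrow> nat" assumes "f \<longlonglongrightarrow> l" "\<And>m. m \<le> \<nu> m" shows "(\<lambda>m. f (\<nu> m)) \<longlonglongrightarrow> l"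
  using filterlim_compose[OF assms(1)] filterlim_at_top_mono[OF filterlim_ident, of \<nu>] assms(2) by simp

locale excised_isometry = isometric_hom cs1 st1 cs2 st2 A1 u + e: excision cs1 st1 D W h
  for cs1 :: "complex \<Rightarrow> 'a::{real_normed_algebra_1,banach} \<Rightarrow> 'a" and st1
    and cs2 :: "complex \<Rightarrow> 'b::{real_normed_algebra_1,banach} \<Rightarrow> 'b" and st2 and A1 u D W h +
  fixes X :: "'a set"
  assumes D_A1: "D \<subseteq> A1" and X: "finite X" "X \<subseteq> A1" "X \<subseteq> e.A"
begin

definition r :: "'a \<Rightarrow> nat \<Rightarrow> 'a" where "r w n = w * h n * st1 w"

lemma r_D: "w \<in> W \<Longrightarrow> r w n \<in> D" unfolding r_def by (rule e.W_conj[OF _ e.h_D])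

lemma r_A1: "w \<in> W \<Longrightarrow> r w n \<in> A1" using r_D D_A1 by blast

lemma r_sa: "st1 (r w n) = r w n" by (simp add: r_def a.st_mult e.h_sa mult.assoc)

lemma norm_r: "norm (r w n) \<le> norm w * norm w" unfolding r_def by (rule e.conj_bounded)

lemma u_r_sa: "w \<in> W \<Longrightarrow> st2 (u (r w n)) = u (r w n)"
  by (rule u_sa[OF e.D_sub D_A1 r_D r_sa])

lemma compress:
  assumes "c \<in> e.A" "p < q"
  shows "(\<lambda>n. h (n + p) * c * h (n + q)) \<simeq> (\<lambda>n. cs1 (e.phi c) (h (n + q)))"
  using e.compress_lim[OF assms] by (simp add: asymp_eq_def)

lemma excise:
  assumes "c \<in> e.A"
  shows "(\<lambda>n. h (n + p) * c * h (n + p)) \<simeq> (\<lambda>n. cs1 (e.phi c) (h (n + p) * h (n + p)))"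
  using LIMSEQ_ignore_initial_segment[OF e.phi_lim[OF assms], of p] by (simp add: asymp_eq_def)

lemma r_compress:
  assumes "v \<in> e.A" "c \<in> e.A" "w \<in> e.A" "p < q"
  shows "(\<lambda>n. r v (n + p) * c * (w * h (n + q))) \<simeq> (\<lambda>n. cs1 (e.phi (st1 v * c * w)) (v * h (n + q)))"
  using e.W_compress[OF assms] by (simp add: asymp_eq_def r_def mult.assoc)

lemma r_compress_r:
  assumes "v \<in> e.A" "c \<in> e.A" "w \<in> e.A" "p < q"
  shows "(\<lambda>n. r v (n + p) * c * r w (n + q)) \<simeq> (\<lambda>n. cs1 (e.phi (st1 v * c * w)) (v * h (n + q) * st1 w))"
  using asymp_eq_mult_right[OF r_compress[OF assms], of "\<lambda>_. st1 w" "norm w"]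
  by (simp add: r_def mult.assoc a.cs_mult_left)

text \<open>Approximate projections for different members are asymptotically orthogonal; for the
  same member the larger index absorbs the smaller one, in either order as \<open>D\<close> is
  abelian.\<close>

lemma r_r:
  assumes F: "e.orth F" "i \<in> F" "j \<in> F" and "p < q"
  shows "(\<lambda>n. r i (n + p) * r j (n + q)) \<simeq> (\<lambda>n. if i = j then r j (n + q) else 0)"
    and "(\<lambda>n. r j (n + q) * r i (n + p)) \<simeq> (\<lambda>n. if i = j then r j (n + q) else 0)"
proof -
  show 1: "(\<lambda>n. r i (n + p) * r j (n + q)) \<simeq> (\<lambda>n. if i = j then r j (n + q) else 0)"
    using r_compress_r[OF e.orthD(3)[OF F(1,2)] e.A_1 e.orthD(3)[OF F(1,3)] assms(4)] e.orthD(4)[OF F]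
    by (cases "i = j") (auto simp: r_def)
  have "r j (n + q) * r i (n + p) = r i (n + p) * r j (n + q)" for n
    by (intro e.D_comm r_D e.orthD(2)[OF F(1)] F)
  then show "(\<lambda>n. r j (n + q) * r i (n + p)) \<simeq> (\<lambda>n. if i = j then r j (n + q) else 0)" using 1 by simp
qed

lemma N_unit: "e.orth F \<Longrightarrow> i \<in> F \<Longrightarrow> (\<lambda>n. norm (i * h n)) \<longlonglongrightarrow> 1"
  using e.N_lim[OF e.orthD(3)] by (simp add: e.N_def e.orthD(4))

lemma norm_h_st: "norm (h n * st1 j) = norm (j * h n)"
  using a.norm_st[of "j * h n"] by (simp add: a.st_mult e.h_sa del: a.norm_st)

text \<open>Up to a null sequence the product is the matrix entry times
  \<open>(i * h n) * st1 (j * h n)\<close>, and the norms of both factors tend to 1.\<close>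

lemma r_x_r_bound:
  assumes F: "e.orth F" "i \<in> F" "j \<in> F" and x: "x \<in> e.A"
  obtains b where "b \<longlonglongrightarrow> cmod (e.phi (st1 i * x * j))" "\<And>n. norm (r i n * x * r j n) \<le> b n"
proof -
  have A: "st1 i * x * j \<in> e.A" by (intro e.A_mult e.A_st x e.orthD(3)[OF F(1,2)] e.orthD(3)[OF F(1,3)])
  define al where "al = e.phi (st1 i * x * j)"
  define er where "er n = h n * (st1 i * x * j) * h n - cs1 al (h n * h n)" for n
  have er0: "er \<longlonglongrightarrow> 0" using e.phi_lim[OF A] unfolding er_def[abs_def] al_def .
  define b where "b n = cmod al * (norm (i * h n) * norm (j * h n)) + norm i * norm (er n) * norm j" for n
  have "b \<longlonglongrightarrow> cmod al * (1 * 1) + norm i * norm (0::'a) * norm j"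
    unfolding b_def by (intro tendsto_intros N_unit[OF F(1)] F er0)
  then have "b \<longlonglongrightarrow> cmod al" by simp
  moreover have "norm (r i n * x * r j n) \<le> b n" for n
  proof -
    have "r i n * x * r j n = i * (h n * (st1 i * x * j) * h n) * st1 j" by (simp add: r_def mult.assoc)
    also have "\<dots> = cs1 al (i * h n * (h n * st1 j)) + i * er n * st1 j"
      by (simp add: er_def right_diff_distrib left_diff_distrib a.cs_mult_left a.cs_mult_right mult.assoc)
    finally have "norm (r i n * x * r j n) \<le> norm (cs1 al (i * h n * (h n * st1 j))) + norm (i * er n * st1 j)"
      by (metis norm_triangle_ineq)
    also have "\<dots> \<le> b n" unfolding b_def
    proof (rule add_mono)
      show "norm (cs1 al (i * h n * (h n * st1 j))) \<le> cmod al * (norm (i * h n) * norm (j * h n))"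
        using norm_mult_ineq[of "i * h n" "h n * st1 j"] by (simp add: a.norm_cs norm_h_st mult_left_mono)
      show "norm (i * er n * st1 j) \<le> norm i * norm (er n) * norm j"
        using norm_mult_ineq[of "i * er n" "st1 j"] mult_right_mono[OF norm_mult_ineq[of i "er n"], of "norm j"] by simp
    qed
    finally show ?thesis .
  qed
  ultimately show thesis using that al_def by blast
qed

section \<open>The graph of nonzero matrix entries\<close>

definition edges :: "'a set \<Rightarrow> ('a \<times> 'a \<times> 'a) set"
  where "edges F = {(i, x, j). i \<in> F \<and> x \<in> X \<and> j \<in> F \<and> e.phi (st1 i * x * j) \<noteq> 0}"

definition left :: "'a \<times> 'a \<times> 'a \<Rightarrow> 'a" where "left E = fst E"
definition right :: "'a \<times> 'a \<times> 'a \<Rightarrow> 'a" where "right E = snd (snd E)"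

text \<open>Compressed and divided by its matrix entry, the letter becomes an asymptotic contraction
  carrying the vector of \<open>right E\<close> to that of \<open>left E\<close>. The normalisation
  makes the plain sum of the vectors of \<open>F\<close> invariant.\<close>

definition arrow :: "'a \<times> 'a \<times> 'a \<Rightarrow> nat \<Rightarrow> 'a"
  where "arrow E n = (case E of (i, x, j) \<Rightarrow> cs1 (1 / e.phi (st1 i * x * j)) (r i n * x * r j n))"

lemma finite_edges: "e.orth F \<Longrightarrow> finite (edges F)"
  by (rule finite_subset[of _ "F \<times> X \<times> F"]) (use X(1) e.orthD(1) in \<open>auto simp: edges_def\<close>)

lemma edgesD: "E \<in> edges F \<Longrightarrow> left E \<in> F" "E \<in> edges F \<Longrightarrow> right E \<in> F"
  by (auto simp: edges_def left_def right_def)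

lemma arrow_A1: "e.orth F \<Longrightarrow> E \<in> edges F \<Longrightarrow> arrow E n \<in> A1"
  using X(2) by (auto simp: edges_def arrow_def intro!: A1_intros r_A1 e.orthD(2))

lemma arrow_bound:
  assumes F: "e.orth F" and E: "E \<in> edges F"
  obtains b where "b \<longlonglongrightarrow> 1" "\<And>n. norm (arrow E n) \<le> b n"
proof -
  obtain i x j where ijx: "E = (i, x, j)" "i \<in> F" "x \<in> X" "j \<in> F" "e.phi (st1 i * x * j) \<noteq> 0"
    using E by (auto simp: edges_def)
  obtain b where b: "b \<longlonglongrightarrow> cmod (e.phi (st1 i * x * j))" "\<And>n. norm (r i n * x * r j n) \<le> b n"
    using r_x_r_bound[OF F ijx(2,4)] X(3) ijx(3) by blast
  have "(\<lambda>n. b n / cmod (e.phi (st1 i * x * j))) \<longlonglongrightarrow> 1"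
    using tendsto_divide[OF b(1) tendsto_const[of "cmod (e.phi (st1 i * x * j))"]] ijx(5) by simp
  moreover have "norm (arrow E n) \<le> b n / cmod (e.phi (st1 i * x * j))" for n
    using b(2)[of n] ijx(5) by (simp add: arrow_def ijx(1) a.norm_cs norm_divide divide_right_mono)
  ultimately show thesis using that by blast
qed

text \<open>The earlier compressions are absorbed by the later ones. In
  \<open>laplacian_vector\<close> the later arrow plays the part of \<open>V\<close> and the earlier
  one that of \<open>G\<close>.\<close>

lemma arrow_factor:
  assumes F: "e.orth F" and E: "E \<in> edges F"
  shows "(\<lambda>n. arrow E (n + 2)) \<simeq> (\<lambda>n. r (left E) (n + 2) * arrow E n * r (right E) (n + 2))"
proof -
  obtain i x j where E': "E = (i, x, j)" "i \<in> F" "x \<in> X" "j \<in> F" using E by (auto simp: edges_def)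
  have 1: "(\<lambda>n. r i (n + 2)) \<simeq> (\<lambda>n. r i (n + 2) * r i n)"
    using asymp_eq_sym[OF r_r(2)[OF F E'(2,2), of 0 2]] by simp
  have 2: "(\<lambda>n. r j (n + 2)) \<simeq> (\<lambda>n. r j n * r j (n + 2))"
    using asymp_eq_sym[OF r_r(1)[OF F E'(4,4), of 0 2]] by simp
  have "(\<lambda>n. r i (n + 2) * (x * r j (n + 2))) \<simeq> (\<lambda>n. r i (n + 2) * r i n * (x * r j (n + 2)))"
    by (rule asymp_eq_mult_right[OF 1, of _ "norm x * (norm j * norm j)"])
      (meson norm_mult_ineq norm_r mult_left_mono norm_ge_zero order_trans)
  also have "(\<lambda>n. r i (n + 2) * r i n * (x * r j (n + 2))) \<simeq> (\<lambda>n. r i (n + 2) * r i n * (x * (r j n * r j (n + 2))))"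
  proof -
    have "norm (r i (n + 2) * r i n * x) \<le> (norm i * norm i) * (norm i * norm i) * norm x" for n
      using norm_mult_ineq[of "r i (n + 2) * r i n" x] norm_mult_ineq[of "r i (n + 2)" "r i n"]
        mult_mono[OF norm_r[of i "n + 2"] norm_r[of i n]] mult_right_mono[of "norm (r i (n + 2) * r i n)" "(norm i * norm i) * (norm i * norm i)" "norm x"]
      by simp
    from asymp_eq_mult_left[OF 2 this] show ?thesis by (simp add: mult.assoc)
  qed
  finally have "(\<lambda>n. r i (n + 2) * (x * r j (n + 2))) \<simeq> (\<lambda>n. r i (n + 2) * r i n * (x * (r j n * r j (n + 2))))" .
  from a.asymp_eq_cs[OF this, of "1 / e.phi (st1 i * x * j)"] show ?thesis
    by (simp add: E' arrow_def left_def right_def a.cs_mult_left a.cs_mult_right mult.assoc)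
qed

section \<open>Approximate projections onto the span of a family, and the Laplacian\<close>

definition Qs :: "'a set \<Rightarrow> nat \<Rightarrow> 'a" where "Qs F n = (\<Sum>k\<in>F. k * (h (n + 1) * h (n + 1)) * st1 k)"
definition Ps :: "'a set \<Rightarrow> nat \<Rightarrow> 'a" where "Ps F n = (\<Sum>k\<in>F. r k (n + 2) * r k (n + 2))"
text \<open>A Laplacian contains each arrow and its adjoint, but the adjoint may lie outside
  \<open>A1\<close>. Doubling the arrow keeps \<open>Ss\<close> in \<open>A1\<close> without
  changing the real part. The indices are arranged so that \<open>Qs\<close>, at
  \<open>n + 1\<close>, acts as a unit on everything at \<open>n + 2\<close>.\<close>

definition Ss :: "'a set \<Rightarrow> nat \<Rightarrow> 'a"
  where "Ss F n = Ps F n - (\<Sum>E\<in>edges F. r (left E) (n + 2) * r (left E) (n + 2)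
    + r (right E) (n + 2) * r (right E) (n + 2) - 2 *\<^sub>R arrow E (n + 2))"

lemma Qs_D: "e.orth F \<Longrightarrow> Qs F n \<in> D"
  unfolding Qs_def by (rule a.csubspace_sum[OF e.D_closure(2)]) (intro e.W_conj e.orthD e.D_closure e.h_D)

lemma Ps_A1: "e.orth F \<Longrightarrow> Ps F n \<in> A1"
  unfolding Ps_def by (intro A1_intros r_A1 e.orthD)

lemma Ss_A1: "e.orth F \<Longrightarrow> Ss F n \<in> A1"
  unfolding Ss_def by (intro A1_diff A1_sum A1_add A1_scaleR A1_mult Ps_A1 r_A1 arrow_A1) (auto intro: e.orthD edgesD)

lemma Qs_sa: "st1 (Qs F n) = Qs F n"
  by (simp add: Qs_def a.st_sum a.st_mult e.h_sa mult.assoc)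

text \<open>The square of \<open>Qs F n\<close> is asymptotically \<open>Q4 n\<close>, which is
  dominated by \<open>Qs F n\<close> since \<open>h^4 \<le> h^2\<close>. For the norm
  \<open>q\<close> and the error \<open>d\<close> this means \<open>q^2 \<le> q + d\<close>, hence
  \<open>q \<le> 1 + d\<close>.\<close>

lemma Qs_norm:
  assumes F: "e.orth F"
  obtains d where "d \<longlonglongrightarrow> 0" "\<And>n. norm (Qs F n) \<le> 1 + d n" "\<And>n. 0 \<le> d n"
proof -
  define Q4 where "Q4 n = (\<Sum>k\<in>F. k * (h (n + 1) * h (n + 1) * (h (n + 1) * h (n + 1))) * st1 k)" for n
  have "(\<lambda>n. Qs F n * Qs F n) \<simeq> Q4"
  proof -
    have "(\<lambda>n. k * (h (n + 1) * h (n + 1)) * st1 k * (l * (h (n + 1) * h (n + 1)) * st1 l)) \<simeq>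
        (\<lambda>n. if k = l then k * (h (n + 1) * h (n + 1) * (h (n + 1) * h (n + 1))) * st1 k else 0)"
      if kl: "k \<in> F" "l \<in> F" for k l
    proof -
      have A: "st1 k * l \<in> e.A" by (intro e.A_intros e.orthD(3)[OF F] kl)
      have b1: "norm (k * h (n + 1)) \<le> norm k" "norm (h (n + 1) * st1 l) \<le> norm l" for n
        using norm_mult_ineq[of k "h (n + 1)"] norm_mult_ineq[of "h (n + 1)" "st1 l"] by (simp_all add: e.norm_h)
      have "(\<lambda>n. (k * h (n + 1)) * (h (n + 1) * (st1 k * l) * h (n + 1)) * (h (n + 1) * st1 l))
        \<simeq> (\<lambda>n. (k * h (n + 1)) * cs1 (e.phi (st1 k * l)) (h (n + 1) * h (n + 1)) * (h (n + 1) * st1 l))"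
        by (rule asymp_eq_mult_right[OF asymp_eq_mult_left[OF excise[OF A] b1(1)] b1(2)])
      then show ?thesis using e.orthD(4)[OF F kl]
        by (cases "k = l") (auto simp: mult.assoc a.cs_mult_left a.cs_mult_right)
    qed
    then have "(\<lambda>n. \<Sum>k\<in>F. \<Sum>l\<in>F. k * (h (n + 1) * h (n + 1)) * st1 k * (l * (h (n + 1) * h (n + 1)) * st1 l)) \<simeq>
        (\<lambda>n. \<Sum>k\<in>F. \<Sum>l\<in>F. if k = l then k * (h (n + 1) * h (n + 1) * (h (n + 1) * h (n + 1))) * st1 k else 0)"
      by (intro asymp_eq_sum)
    moreover have "(\<Sum>k\<in>F. \<Sum>l\<in>F. k * (h (n + 1) * h (n + 1)) * st1 k * (l * (h (n + 1) * h (n + 1)) * st1 l)) = Qs F n * Qs F n" for n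
      unfolding Qs_def sum_product ..
    moreover have "(\<Sum>k\<in>F. \<Sum>l\<in>F. if k = l then k * (h (n + 1) * h (n + 1) * (h (n + 1) * h (n + 1))) * st1 k else 0) = Q4 n" for n
      unfolding Q4_def using e.orthD(1)[OF F] by (intro sum.cong) (auto simp: sum.delta')
    ultimately show ?thesis by simp
  qed
  then have er: "(\<lambda>n. Qs F n * Qs F n - Q4 n) \<longlonglongrightarrow> 0" by (simp add: asymp_eq_def)
  have "norm (Qs F n) \<le> 1 + norm (Qs F n * Qs F n - Q4 n)" for n
  proof -
    have le: "norm (Q4 n) \<le> norm (Qs F n)"
    proof (rule a.norm_mono_pos)
      let ?h = "h (n + 1)"
      have hs: "st1 (?h * ?h) = ?h * ?h" by (simp add: a.st_mult e.h_sa)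
      have "a.pos (k * (?h * ?h * (?h * ?h)) * st1 k)" for k
        using a.pos_conj[OF a.pos_square[OF hs], of "st1 k"] by (simp add: mult.assoc)
      then show "a.pos (Q4 n)" unfolding Q4_def by (intro a.pos_sum)
      have "a.pos (1 - ?h * ?h)" by (intro a.pos_one_minus hs) (simp add: e.norm_hh)
      from a.pos_conj[OF this, of ?h] have "a.pos (?h * ?h - ?h * ?h * (?h * ?h))"
        by (simp add: e.h_sa algebra_simps)
      from a.pos_conj[OF this, of "st1 k" for k] have "a.pos (k * (?h * ?h) * st1 k - k * (?h * ?h * (?h * ?h)) * st1 k)" for k
        by (simp add: algebra_simps)
      then show "a.pos (Qs F n - Q4 n)" unfolding Qs_def Q4_def sum_subtractf[symmetric] by (intro a.pos_sum)
    qed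
    define q d where "q = norm (Qs F n)" and "d = norm (Qs F n * Qs F n - Q4 n)"
    have qq: "q * q \<le> q + d"
    proof -
      have "q * q = norm (Qs F n * Qs F n)" using a.norm_sa_square[OF Qs_sa] by (simp add: q_def power2_eq_square)
      also have "\<dots> \<le> norm (Q4 n) + d" unfolding d_def by (metis add.commute norm_triangle_sub)
      finally show ?thesis using le by (simp add: q_def)
    qed
    have d0: "0 \<le> d" by (simp add: d_def)
    have "q \<le> 1 + d"
    proof (rule ccontr)
      assume d: "\<not> q \<le> 1 + d"
      have "q * (1 + d) < q * q" using d d0 by (intro mult_strict_left_mono) auto
      moreover have "d \<le> q * d" using d d0 mult_right_mono[of 1 q d] by simp
      ultimately show False using qq by (simp add: distrib_left)
    qed
    then show ?thesis by (simp add: q_def d_def)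
  qed
  then show thesis using that[OF tendsto_norm_zero[OF er]] by simp
qed

text \<open>By orthogonality only the summand of \<open>k\<close> survives, and there
  \<open>h (n + 1)\<close> is absorbed by \<open>h (n + p)\<close>, which needs
  \<open>2 \<le> p\<close>.\<close>

lemma Qs_fixes:
  assumes F: "e.orth F" "k \<in> F" and p: "2 \<le> p"
  shows "(\<lambda>n. Qs F n * (k * h (n + p))) \<simeq> (\<lambda>n. k * h (n + p))"
proof -
  have "(\<lambda>n. l * (h (n + 1) * h (n + 1)) * st1 l * (k * h (n + p))) \<simeq> (\<lambda>n. if l = k then k * h (n + p) else 0)"
    if l: "l \<in> F" for l
  proof -
    have A: "st1 l * k \<in> e.A" by (intro e.A_intros e.orthD(3)[OF F(1)] l F)
    have b: "norm (l * h (n + 1)) \<le> norm l" for n using norm_mult_ineq[of l "h (n + 1)"] by (simp add: e.norm_h)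
    have "(\<lambda>n. (l * h (n + 1)) * (h (n + 1) * (st1 l * k) * h (n + p))) \<simeq>
      (\<lambda>n. (l * h (n + 1)) * cs1 (e.phi (st1 l * k)) (h (n + p)))"
      by (rule asymp_eq_mult_left[OF compress[OF A] b]) (use p in simp)
    then show ?thesis using e.orthD(4)[OF F(1) l F(2)] p e.h_less[of "n + 1" "n + p" for n]
      by (cases "l = k") (auto simp: mult.assoc)
  qed
  then have "(\<lambda>n. \<Sum>l\<in>F. l * (h (n + 1) * h (n + 1)) * st1 l * (k * h (n + p))) \<simeq> (\<lambda>n. \<Sum>l\<in>F. if l = k then k * h (n + p) else 0)"
    by (rule asymp_eq_sum)
  then show ?thesis using e.orthD(1)[OF F(1)] F(2) by (simp add: Qs_def sum_distrib_right)
qed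

lemma Qs_r:
  assumes F: "e.orth F" "k \<in> F"
  shows "(\<lambda>n. Qs F n * r k (n + 2)) \<simeq> (\<lambda>n. r k (n + 2))"
  using asymp_eq_mult_right[OF Qs_fixes[OF F, of 2], of "\<lambda>_. st1 k" "norm k"] by (simp add: r_def mult.assoc)

lemma Qs_Ss:
  assumes F: "e.orth F" shows "(\<lambda>n. Qs F n * Ss F n) \<simeq> (\<lambda>n. Ss F n)"
proof -
  have rr: "(\<lambda>n. Qs F n * (r k (n + 2) * r k (n + 2))) \<simeq> (\<lambda>n. r k (n + 2) * r k (n + 2))" if "k \<in> F" for k
    using asymp_eq_mult_right[OF Qs_r[OF F that], of "\<lambda>n. r k (n + 2)" "norm k * norm k"] norm_r
    by (simp add: mult.assoc)
  have ar: "(\<lambda>n. Qs F n * arrow E (n + 2)) \<simeq> (\<lambda>n. arrow E (n + 2))" if E: "E \<in> edges F" for E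
  proof -
    obtain i x j where E': "E = (i, x, j)" "i \<in> F" "x \<in> X" "j \<in> F" using E by (auto simp: edges_def)
    have "norm (x * r j (n + 2)) \<le> norm x * (norm j * norm j)" for n
      by (meson norm_mult_ineq norm_r mult_left_mono norm_ge_zero order_trans)
    from a.asymp_eq_cs[OF asymp_eq_mult_right[OF Qs_r[OF F E'(2)] this], of "1 / e.phi (st1 i * x * j)"]
    show ?thesis by (simp add: E'(1) arrow_def a.cs_mult_right mult.assoc)
  qed
  have "(\<lambda>n. (\<Sum>k\<in>F. Qs F n * (r k (n + 2) * r k (n + 2))) - (\<Sum>E\<in>edges F. Qs F n * (r (left E) (n + 2) * r (left E) (n + 2))
      + Qs F n * (r (right E) (n + 2) * r (right E) (n + 2)) - 2 *\<^sub>R (Qs F n * arrow E (n + 2)))) \<simeq>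
     (\<lambda>n. (\<Sum>k\<in>F. r k (n + 2) * r k (n + 2)) - (\<Sum>E\<in>edges F. r (left E) (n + 2) * r (left E) (n + 2)
      + r (right E) (n + 2) * r (right E) (n + 2) - 2 *\<^sub>R arrow E (n + 2)))"
    by (intro asymp_eq_diff asymp_eq_sum asymp_eq_add asymp_eq_scaleR rr ar edgesD)
  then show ?thesis unfolding Ss_def Ps_def
    by (simp add: sum_distrib_left right_diff_distrib distrib_left)
qed

text \<open>Excision replaces the inner \<open>st1 k * k\<close> of the squared compression by 1;
  the norm bound for \<open>Qs\<close> thereby carries over to \<open>Ps\<close>.\<close>

lemma Ps_Qs:
  assumes F: "e.orth F" shows "Ps F \<simeq> (\<lambda>n. Qs F (n + 1))"
proof -
  have "(\<lambda>n. r k (n + 2) * r k (n + 2)) \<simeq> (\<lambda>n. k * (h (n + 2) * h (n + 2)) * st1 k)" if k: "k \<in> F" for k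
  proof -
    have A: "st1 k * k \<in> e.A" by (intro e.A_intros e.orthD(3)[OF F] k)
    have "(\<lambda>n. k * (h (n + 2) * (st1 k * k) * h (n + 2)) * st1 k) \<simeq> (\<lambda>n. k * cs1 (e.phi (st1 k * k)) (h (n + 2) * h (n + 2)) * st1 k)"
      by (rule asymp_eq_mult_right[OF asymp_eq_mult_left[OF excise[OF A]]]) (rule order_refl)+
    then show ?thesis using e.orthD(4)[OF F k k] by (simp add: r_def mult.assoc)
  qed
  from asymp_eq_sum[OF this] show ?thesis unfolding Ps_def Qs_def by (simp add: add.assoc)
qed

lemma Ps_norm:
  assumes F: "e.orth F" obtains d where "d \<longlonglongrightarrow> 0" "\<And>n. norm (Ps F n) \<le> 1 + d n"
proof -
  obtain d where d: "d \<longlonglongrightarrow> 0" "\<And>n. norm (Qs F n) \<le> 1 + d n" using Qs_norm[OF F] by metis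
  define c where "c n = d (n + 1) + norm (Ps F n - Qs F (n + 1))" for n
  have "c \<longlonglongrightarrow> 0 + 0" unfolding c_def
    using Ps_Qs[OF F] by (intro tendsto_add tendsto_norm_zero LIMSEQ_ignore_initial_segment d) (simp add: asymp_eq_def)
  moreover have "norm (Ps F n) \<le> 1 + c n" for n
    using norm_triangle_sub[of "Ps F n" "Qs F (n + 1)"] d(2)[of "n + 1"] by (simp add: c_def)
  ultimately show thesis using that by simp
qed

lemma Ss_bounded:
  assumes F: "e.orth F" obtains K where "\<And>n. norm (Ss F n) \<le> K"
proof -
  define M where "M k = (norm k * norm k) * (norm k * norm k)" for k :: 'a
  have rr: "norm (r k n * r k n) \<le> M k" for k n
    using norm_mult_ineq[of "r k n" "r k n"] mult_mono[OF norm_r[of k n] norm_r[of k n]] by (simp add: M_def)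
  have "\<forall>E\<in>edges F. \<exists>b. \<forall>n. norm (arrow E n) \<le> b"
  proof
    fix E assume E: "E \<in> edges F"
    obtain b where b: "b \<longlonglongrightarrow> 1" "\<And>n. norm (arrow E n) \<le> b n" using arrow_bound[OF F E] by blast
    obtain c where "\<And>n. norm (b n) \<le> c" using convergent_imp_Bseq[of b] b(1) by (auto simp: convergent_def Bseq_def)
    then show "\<exists>b. \<forall>n. norm (arrow E n) \<le> b" using b(2) by (intro exI[of _ c]) (metis abs_ge_self order_trans real_norm_def)
  qed
  then obtain b where b: "\<And>E n. E \<in> edges F \<Longrightarrow> norm (arrow E n) \<le> b E" by metis
  have "norm (Ss F n) \<le> (\<Sum>k\<in>F. M k) + (\<Sum>E\<in>edges F. M (left E) + M (right E) + 2 * b E)" for n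
  proof -
    have "norm (Ps F n) \<le> (\<Sum>k\<in>F. M k)" unfolding Ps_def by (intro sum_norm_le rr)
    moreover have "norm (\<Sum>E\<in>edges F. r (left E) (n + 2) * r (left E) (n + 2)
      + r (right E) (n + 2) * r (right E) (n + 2) - 2 *\<^sub>R arrow E (n + 2)) \<le> (\<Sum>E\<in>edges F. M (left E) + M (right E) + 2 * b E)"
    proof (intro sum_norm_le)
      fix E assume E: "E \<in> edges F"
      show "norm (r (left E) (n + 2) * r (left E) (n + 2)
      + r (right E) (n + 2) * r (right E) (n + 2) - 2 *\<^sub>R arrow E (n + 2)) \<le> M (left E) + M (right E) + 2 * b E"
        using norm_add_diff_le[of "r (left E) (n + 2) * r (left E) (n + 2)" "r (right E) (n + 2) * r (right E) (n + 2)" "2 *\<^sub>R arrow E (n + 2)"]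
          rr[of "left E" "n + 2"] rr[of "right E" "n + 2"] b[OF E, of "n + 2"] by simp
    qed
    ultimately show ?thesis unfolding Ss_def by (intro order_trans[OF norm_triangle_ineq4 add_mono])
  qed
  then show thesis using that by blast
qed

text \<open>The vector \<open>\<Sum>k\<in>F. k h\<close> is almost fixed by \<open>Qs F\<close>, and almost orthogonal to the defect of \<open>Ss F\<close>.\<close>
lemma lower_bound:
  assumes F: "e.orth F" "F \<noteq> {}" and t: "0 \<le> t" and \<epsilon>: "0 < \<epsilon>"
  shows "\<forall>\<^sub>F n in sequentially. 1 + t - \<epsilon> \<le> norm (Qs F n + t *\<^sub>R Ss F n)"
proof -
  define H where "H n = h (n + 3) * h (n + 3)" for n
  \<comment> \<open>The index \<open>n + 3\<close> exceeds \<open>n + 1\<close> in \<open>Qs\<close>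
    and \<open>n + 2\<close> in \<open>Ps\<close> and the arrows, so that all of them act on
    \<open>g n\<close> through their matrix entries.\<close>
  define g where "g n = (\<Sum>k\<in>F. k * h (n + 3))" for n
  have nkh: "norm (k * h (n + 3)) \<le> norm k" for k n using norm_mult_ineq[of k "h (n + 3)"] by (simp add: e.norm_h)
  have ng: "norm (st1 (g n)) \<le> (\<Sum>k\<in>F. norm k)" for n unfolding g_def by (simp add: sum_norm_le nkh)
  have 1: "(\<lambda>n. Qs F n * g n) \<simeq> g"
    unfolding g_def sum_distrib_left by (intro asymp_eq_sum Qs_fixes F) auto
  have rk: "(\<lambda>n. r i (n + 2) * (k * h (n + 3))) \<simeq> (\<lambda>n. if i = k then k * h (n + 3) else 0)" if "i \<in> F" "k \<in> F" for i k
    using r_compress[OF e.orthD(3)[OF F(1) that(1)] e.A_1 e.orthD(3)[OF F(1) that(2)], of 2 3] e.orthD(4)[OF F(1) that]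
    by (cases "i = k") auto
  have rg: "(\<lambda>n. r i (n + 2) * g n) \<simeq> (\<lambda>n. i * h (n + 3))" if "i \<in> F" for i
  proof -
    have "(\<lambda>n. \<Sum>k\<in>F. r i (n + 2) * (k * h (n + 3))) \<simeq> (\<lambda>n. \<Sum>k\<in>F. if i = k then k * h (n + 3) else 0)"
      by (intro asymp_eq_sum rk that)
    then show ?thesis using e.orthD(1)[OF F(1)] that by (simp add: g_def sum_distrib_left)
  qed
  have rrg: "(\<lambda>n. r i (n + 2) * r i (n + 2) * g n) \<simeq> (\<lambda>n. i * h (n + 3))" if "i \<in> F" for i
  proof -
    have "(\<lambda>n. r i (n + 2) * (r i (n + 2) * g n)) \<simeq> (\<lambda>n. r i (n + 2) * (i * h (n + 3)))"
      by (rule asymp_eq_mult_left[OF rg[OF that] norm_r])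
    also have "\<dots> \<simeq> (\<lambda>n. i * h (n + 3))" using rk[OF that that] by simp
    finally show ?thesis by (simp add: mult.assoc)
  qed
  have ag: "(\<lambda>n. arrow E (n + 2) * g n) \<simeq> (\<lambda>n. left E * h (n + 3))" if E: "E \<in> edges F" for E
  proof -
    obtain i x j where E': "E = (i, x, j)" "i \<in> F" "x \<in> X" "j \<in> F" "e.phi (st1 i * x * j) \<noteq> 0"
      using E by (auto simp: edges_def)
    have xA: "x \<in> e.A" using X(3) E'(3) by blast
    have "norm (r i (n + 2) * x) \<le> norm i * norm i * norm x" for n
      by (meson norm_mult_ineq norm_r mult_right_mono norm_ge_zero order_trans)
    then have "(\<lambda>n. r i (n + 2) * x * (r j (n + 2) * g n)) \<simeq> (\<lambda>n. r i (n + 2) * x * (j * h (n + 3)))"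
      by (rule asymp_eq_mult_left[OF rg[OF E'(4)]])
    also have "\<dots> \<simeq> (\<lambda>n. cs1 (e.phi (st1 i * x * j)) (i * h (n + 3)))"
      by (rule r_compress[OF e.orthD(3)[OF F(1) E'(2)] xA e.orthD(3)[OF F(1) E'(4)]]) simp
    finally have "(\<lambda>n. cs1 (1 / e.phi (st1 i * x * j)) (r i (n + 2) * x * (r j (n + 2) * g n))) \<simeq>
       (\<lambda>n. cs1 (1 / e.phi (st1 i * x * j)) (cs1 (e.phi (st1 i * x * j)) (i * h (n + 3))))" by (rule a.asymp_eq_cs)
    then show ?thesis using E'(5) by (simp add: E'(1) arrow_def left_def a.cs_cs a.cs_mult_left mult.assoc)
  qed
  have 2: "(\<lambda>n. Ss F n * g n) \<simeq> (\<lambda>n. g n - (\<Sum>E\<in>edges F. right E * h (n + 3) - left E * h (n + 3)))"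
  proof -
    have "(\<lambda>n. (\<Sum>k\<in>F. r k (n + 2) * r k (n + 2) * g n) - (\<Sum>E\<in>edges F. r (left E) (n + 2) * r (left E) (n + 2) * g n
      + r (right E) (n + 2) * r (right E) (n + 2) * g n - 2 *\<^sub>R (arrow E (n + 2) * g n))) \<simeq>
     (\<lambda>n. (\<Sum>k\<in>F. k * h (n + 3)) - (\<Sum>E\<in>edges F. left E * h (n + 3) + right E * h (n + 3) - 2 *\<^sub>R (left E * h (n + 3))))"
      by (intro asymp_eq_diff asymp_eq_sum asymp_eq_add asymp_eq_scaleR rrg ag edgesD)
    moreover have "left E * h (n + 3) + right E * h (n + 3) - 2 *\<^sub>R (left E * h (n + 3)) = right E * h (n + 3) - left E * h (n + 3)" for E n
      by (simp add: scaleR_2)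
    ultimately show ?thesis unfolding Ss_def Ps_def
      by (simp add: sum_distrib_right left_diff_distrib distrib_right g_def)
  qed
  have gk: "(\<lambda>n. st1 (g n) * (k * h (n + 3))) \<simeq> H" if k: "k \<in> F" for k
  proof -
    have "(\<lambda>n. h (n + 3) * (st1 l * k) * h (n + 3)) \<simeq> (\<lambda>n. if l = k then H n else 0)" if l: "l \<in> F" for l
    proof -
      have A: "st1 l * k \<in> e.A" by (intro e.A_intros e.orthD(3)[OF F(1)] k l)
      show ?thesis using excise[OF A, of 3] e.orthD(4)[OF F(1) l k] by (cases "l = k") (auto simp: H_def)
    qed
    then have "(\<lambda>n. \<Sum>l\<in>F. h (n + 3) * (st1 l * k) * h (n + 3)) \<simeq> (\<lambda>n. \<Sum>l\<in>F. if l = k then H n else 0)"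
      by (rule asymp_eq_sum)
    then show ?thesis using e.orthD(1)[OF F(1)] k
      by (simp add: g_def a.st_sum a.st_mult e.h_sa sum_distrib_right mult.assoc)
  qed
  have gg: "(\<lambda>n. st1 (g n) * g n) \<simeq> (\<lambda>n. real (card F) *\<^sub>R H n)"
  proof -
    have "(\<lambda>n. \<Sum>k\<in>F. st1 (g n) * (k * h (n + 3))) \<simeq> (\<lambda>n. \<Sum>k\<in>F. H n)" by (intro asymp_eq_sum gk)
    then show ?thesis by (simp add: g_def[of n for n, abs_def] sum_distrib_left scaleR_conv_of_real)
  qed
  have gSg: "(\<lambda>n. st1 (g n) * (Ss F n * g n)) \<simeq> (\<lambda>n. real (card F) *\<^sub>R H n)"
  proof -
    have "(\<lambda>n. st1 (g n) * (Ss F n * g n)) \<simeq> (\<lambda>n. st1 (g n) * (g n - (\<Sum>E\<in>edges F. right E * h (n + 3) - left E * h (n + 3))))"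
      by (rule asymp_eq_mult_left[OF 2 ng])
    also have "(\<lambda>n. st1 (g n) * (g n - (\<Sum>E\<in>edges F. right E * h (n + 3) - left E * h (n + 3))))
      = (\<lambda>n. st1 (g n) * g n - (\<Sum>E\<in>edges F. st1 (g n) * (right E * h (n + 3)) - st1 (g n) * (left E * h (n + 3))))"
      by (simp add: right_diff_distrib sum_distrib_left)
    also have "\<dots> \<simeq> (\<lambda>n. real (card F) *\<^sub>R H n - (\<Sum>E\<in>edges F. H n - H n))"
      by (intro asymp_eq_diff gg asymp_eq_sum gk edgesD)
    finally show ?thesis by simp
  qed
  have gQg: "(\<lambda>n. st1 (g n) * (Qs F n * g n)) \<simeq> (\<lambda>n. real (card F) *\<^sub>R H n)"
    using asymp_eq_trans[OF asymp_eq_mult_left[OF 1 ng] gg] .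
  have tot: "(\<lambda>n. st1 (g n) * ((Qs F n + t *\<^sub>R Ss F n) * g n)) \<simeq> (\<lambda>n. ((1 + t) * real (card F)) *\<^sub>R H n)"
    using asymp_eq_add[OF gQg asymp_eq_scaleR[OF gSg, of t]] by (simp add: distrib_left distrib_right scaleR_add_left)
  define N where "N = real (card F)"
  have N: "0 < N" using F e.orthD(1) by (simp add: N_def card_gt_0_iff)
  have nH: "norm (H n) = 1" for n unfolding H_def by (rule e.norm_hh)
  have l1: "(\<lambda>n. norm (st1 (g n) * ((Qs F n + t *\<^sub>R Ss F n) * g n))) \<longlonglongrightarrow> (1 + t) * N"
    using asymp_eq_norm[OF tot] t N by (simp add: nH N_def LIM_zero_iff)
  have l2: "(\<lambda>n. norm (st1 (g n) * g n)) \<longlonglongrightarrow> N"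
    using asymp_eq_norm[OF gg] by (simp add: nH N_def LIM_zero_iff)
  have "(\<lambda>n. norm (st1 (g n) * ((Qs F n + t *\<^sub>R Ss F n) * g n)) / norm (st1 (g n) * g n)) \<longlonglongrightarrow> (1 + t) * N / N"
    using N by (intro tendsto_divide l1 l2) auto
  then have "(\<lambda>n. norm (st1 (g n) * ((Qs F n + t *\<^sub>R Ss F n) * g n)) / norm (st1 (g n) * g n)) \<longlonglongrightarrow> 1 + t" using N by simp
  then have "\<forall>\<^sub>F n in sequentially. 1 + t - \<epsilon> < norm (st1 (g n) * ((Qs F n + t *\<^sub>R Ss F n) * g n)) / norm (st1 (g n) * g n)"
    using \<epsilon> by (intro order_tendstoD(1)) auto
  moreover have "\<forall>\<^sub>F n in sequentially. 0 < norm (st1 (g n) * g n)" using N by (intro order_tendstoD(1)[OF l2])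
  ultimately show ?thesis
  proof eventually_elim
    case (elim n)
    have "norm (st1 (g n) * ((Qs F n + t *\<^sub>R Ss F n) * g n)) \<le> norm (g n) * (norm (Qs F n + t *\<^sub>R Ss F n) * norm (g n))"
      using norm_mult_ineq[of "st1 (g n)" "(Qs F n + t *\<^sub>R Ss F n) * g n"] mult_left_mono[OF norm_mult_ineq[of "Qs F n + t *\<^sub>R Ss F n" "g n"], of "norm (g n)"]
      by simp
    also have "\<dots> = norm (Qs F n + t *\<^sub>R Ss F n) * norm (st1 (g n) * g n)"
      by (simp add: a.norm_st_mult power2_eq_square)
    finally have "norm (st1 (g n) * ((Qs F n + t *\<^sub>R Ss F n) * g n)) / norm (st1 (g n) * g n) \<le> norm (Qs F n + t *\<^sub>R Ss F n)"
      using elim(2) by (simp only: pos_divide_le_eq)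
    then show ?case using elim(1) by simp
  qed
qed

text \<open>\<open>Qs\<close> and \<open>Ss\<close> lie in \<open>A1\<close>, so the bound
  \<open>1 + t - t^2\<close> for the norm of \<open>Qs + t Ss\<close>, computed in the first
  algebra, holds for the images too. Its square supplies the lower bound in
  \<open>laplacian_vector\<close>, which is applied in the second algebra.\<close>

lemma almost_invariant_vector:
  assumes F: "e.orth F" "F \<noteq> {}" and \<delta>: "0 < \<delta>"
  shows "\<exists>n\<ge>n0. \<exists>z. norm z = 1 \<and> norm ((1 - u (Ps F n)) * z) \<le> \<delta> \<and>
    (\<forall>E\<in>edges F. norm ((u (arrow E n) * u (r (right E) (n + 2)) - u (r (left E) (n + 2))) * z) \<le> \<delta> \<and>
      norm ((st2 (u (arrow E n)) * u (r (left E) (n + 2)) - u (r (right E) (n + 2))) * z) \<le> \<delta>)"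
proof -
  obtain K0 where K0: "\<And>n. norm (Ss F n) \<le> K0" using Ss_bounded[OF F(1)] by blast
  define \<rho> where "\<rho> = K0\<^sup>2"
  have \<rho>: "(norm (Ss F n))\<^sup>2 \<le> \<rho>" for n unfolding \<rho>_def using K0 by (intro power_mono) auto
  have \<rho>0: "0 \<le> \<rho>" by (simp add: \<rho>_def)
  define K where "K = (\<Sum>k\<in>F. norm k * norm k)"
  have K: "norm (r k n) \<le> K" if "k \<in> F" for k n
    unfolding K_def using that e.orthD(1)[OF F(1)]
    by (intro order_trans[OF norm_r] member_le_sum[of k F "\<lambda>k. norm k * norm k"]) auto
  define c where "c = 7 + 2 * (real (card (edges F)) * (K\<^sup>2 + 2))"
  have c: "0 < c" unfolding c_def by (intro add_pos_nonneg) auto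
  \<comment> \<open>Chosen for \<open>t^2 (3 + \<rho>) \<le> t \<delta>^2\<close>, and \<epsilon>
    below for \<open>\<epsilon> c \<le> t \<delta>^2 / 2\<close>. With
    \<open>t \<delta>^2 / 2\<close> as its tolerance, the bound of \<open>laplacian_vector\<close>
    is then at most \<open>2 t \<delta>^2\<close>.\<close>
  define t where "t = min 1 (\<delta>\<^sup>2 / (3 + \<rho>))"
  have t: "0 < t" "t \<le> 1" using \<delta> \<rho>0 by (auto simp: t_def)
  have "t \<le> \<delta>\<^sup>2 / (3 + \<rho>)" by (simp add: t_def)
  then have t3: "t * (3 + \<rho>) \<le> \<delta>\<^sup>2" using \<rho>0 by (simp add: pos_le_divide_eq)
  define \<epsilon> where "\<epsilon> = min 1 (t * \<delta>\<^sup>2 / (2 * c))"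
  have \<epsilon>: "0 < \<epsilon>" "\<epsilon> \<le> 1" using \<delta> t c by (auto simp: \<epsilon>_def)
  have "\<epsilon> \<le> t * \<delta>\<^sup>2 / (2 * c)" by (simp add: \<epsilon>_def)
  then have \<epsilon>c: "\<epsilon> * c \<le> t * \<delta>\<^sup>2 / 2" using c by (simp add: field_simps)
  have ev1: "\<forall>\<^sub>F n in sequentially. (norm (arrow E n))\<^sup>2 \<le> 1 + \<epsilon>" if E: "E \<in> edges F" for E
  proof -
    obtain b where b: "b \<longlonglongrightarrow> 1" "\<And>n. norm (arrow E n) \<le> b n" using arrow_bound[OF F(1) E] by blast
    have "(\<lambda>n. (b n)\<^sup>2) \<longlonglongrightarrow> 1\<^sup>2" by (intro tendsto_intros b)
    then have "\<forall>\<^sub>F n in sequentially. (b n)\<^sup>2 < 1 + \<epsilon>" using \<epsilon> by (intro order_tendstoD(2)) auto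
    then show ?thesis
      by eventually_elim (meson b(2) less_imp_le norm_ge_zero order_trans power_mono)
  qed
  have ev2: "\<forall>\<^sub>F n in sequentially. norm (arrow E (n + 2) - r (left E) (n + 2) * arrow E n * r (right E) (n + 2)) \<le> \<epsilon>"
    if E: "E \<in> edges F" for E
    using null_eventually_le[OF tendsto_norm_zero[OF arrow_factor[OF F(1) E, unfolded asymp_eq_def]] \<epsilon>(1)] by simp
  have ev3: "\<forall>\<^sub>F n in sequentially. norm (Ps F n) \<le> 1 + \<epsilon>"
  proof -
    obtain d where d: "d \<longlonglongrightarrow> 0" "\<And>n. norm (Ps F n) \<le> 1 + d n" using Ps_norm[OF F(1)] by blast
    have "\<forall>\<^sub>F n in sequentially. d n < \<epsilon>" using d(1) \<epsilon> by (intro order_tendstoD(2))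
    then show ?thesis by eventually_elim (use d(2) in \<open>smt (verit)\<close>)
  qed
  have ev4: "\<forall>\<^sub>F n in sequentially. (norm (Qs F n))\<^sup>2 \<le> 1 + \<epsilon>"
  proof -
    obtain d where d: "d \<longlonglongrightarrow> 0" "\<And>n. norm (Qs F n) \<le> 1 + d n" using Qs_norm[OF F(1)] by metis
    have "(\<lambda>n. (1 + d n)\<^sup>2) \<longlonglongrightarrow> (1 + 0)\<^sup>2" by (intro tendsto_intros d)
    then have "\<forall>\<^sub>F n in sequentially. (1 + d n)\<^sup>2 < 1 + \<epsilon>" using \<epsilon> by (intro order_tendstoD(2)) auto
    then show ?thesis by eventually_elim (meson d(2) less_imp_le norm_ge_zero order_trans power_mono)
  qed
  have ev5: "\<forall>\<^sub>F n in sequentially. norm (Qs F n * Ss F n - Ss F n) \<le> \<epsilon>"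
    using null_eventually_le[OF tendsto_norm_zero[OF Qs_Ss[OF F(1), unfolded asymp_eq_def]] \<epsilon>(1)] by simp
  have ev6: "\<forall>\<^sub>F n in sequentially. 1 + t - t\<^sup>2 \<le> norm (Qs F n + t *\<^sub>R Ss F n)"
    using lower_bound[OF F, of t "t\<^sup>2"] t by simp
  have ev: "\<forall>\<^sub>F n in sequentially. n0 \<le> n \<and> (\<forall>E\<in>edges F. (norm (arrow E n))\<^sup>2 \<le> 1 + \<epsilon>) \<and>
      (\<forall>E\<in>edges F. norm (arrow E (n + 2) - r (left E) (n + 2) * arrow E n * r (right E) (n + 2)) \<le> \<epsilon>) \<and>
      norm (Ps F n) \<le> 1 + \<epsilon> \<and> (norm (Qs F n))\<^sup>2 \<le> 1 + \<epsilon> \<and> norm (Qs F n * Ss F n - Ss F n) \<le> \<epsilon> \<and>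
      1 + t - t\<^sup>2 \<le> norm (Qs F n + t *\<^sub>R Ss F n)"
    using ev1 ev2 ev3 ev4 ev5 ev6 finite_edges[OF F(1)]
    by (simp add: eventually_conj_iff eventually_ball_finite_distrib eventually_ge_at_top)
  then obtain n where n: "n0 \<le> n" "\<And>E. E \<in> edges F \<Longrightarrow> (norm (arrow E n))\<^sup>2 \<le> 1 + \<epsilon>"
      "\<And>E. E \<in> edges F \<Longrightarrow> norm (arrow E (n + 2) - r (left E) (n + 2) * arrow E n * r (right E) (n + 2)) \<le> \<epsilon>"
      "norm (Ps F n) \<le> 1 + \<epsilon>" "(norm (Qs F n))\<^sup>2 \<le> 1 + \<epsilon>" "norm (Qs F n * Ss F n - Ss F n) \<le> \<epsilon>"
      "1 + t - t\<^sup>2 \<le> norm (Qs F n + t *\<^sub>R Ss F n)"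
    using eventually_happens'[OF sequentially_bot ev] by auto
  define R where "R k = u (r k (n + 2))" for k
  have FW: "k \<in> W" if "k \<in> F" for k using e.orthD(2)[OF F(1) that] .
  have rA: "r k m \<in> A1" if "k \<in> F" for k m using r_A1[OF FW[OF that]] .
  have aA: "arrow E m \<in> A1" if "E \<in> edges F" for E m using arrow_A1[OF F(1) that] .
  have QA: "Qs F n \<in> A1" using Qs_D[OF F(1)] D_A1 by blast
  have SA: "Ss F n \<in> A1" and PA: "Ps F n \<in> A1" using Ss_A1[OF F(1)] Ps_A1[OF F(1)] by auto
  \<comment> \<open>The value 0 outside \<open>F\<close> is there because
    \<open>laplacian_vector\<close> asks for self-adjoint \<open>R i\<close> at every index.\<close>
  define R' where "R' k = (if k \<in> F then R k else 0)" for k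
  have R': "R' k = R k" if "k \<in> F" for k using that by (simp add: R'_def)
  have sR: "st2 (R k) = R k" if "k \<in> F" for k unfolding R_def by (rule u_r_sa[OF FW[OF that]])
  have uP: "u (Ps F n) = (\<Sum>k\<in>F. R k * R k)"
    unfolding Ps_def R_def using rA by (simp add: u_sum u_mult A1_mult)
  have uS: "u (Ss F n) = u (Ps F n) - (\<Sum>E\<in>edges F. R (left E) * R (left E) + R (right E) * R (right E) - 2 *\<^sub>R u (arrow E (n + 2)))"
  proof -
    have "u (r (left E) (n + 2) * r (left E) (n + 2) + r (right E) (n + 2) * r (right E) (n + 2) - 2 *\<^sub>R arrow E (n + 2))
      = R (left E) * R (left E) + R (right E) * R (right E) - 2 *\<^sub>R u (arrow E (n + 2))" if "E \<in> edges F" for E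
      unfolding R_def using rA aA edgesD that by (simp add: u_diff u_add u_mult u_scaleR A1_intros)
    then show ?thesis unfolding Ss_def using PA rA aA edgesD by (simp add: u_diff u_sum A1_intros)
  qed
  have "1 + 2 * t - 3 * t\<^sup>2 \<le> (norm (Qs F n + t *\<^sub>R Ss F n))\<^sup>2"
  proof -
    have "t * t \<le> t" using t mult_right_mono[of t 1 t] by simp
    then have "0 \<le> 1 + t - t\<^sup>2" using t(1) unfolding power2_eq_square by linarith
    then have "(1 + t - t\<^sup>2)\<^sup>2 \<le> (norm (Qs F n + t *\<^sub>R Ss F n))\<^sup>2" by (rule power_mono[OF n(7)])
    moreover have "(1 + t - t\<^sup>2)\<^sup>2 = 1 + 2 * t - 3 * t\<^sup>2 + (2 * (t * t) * (1 - t) + (t * t) * (t * t))"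
      by (simp add: power2_eq_square algebra_simps)
    moreover have "0 \<le> 2 * (t * t) * (1 - t) + (t * t) * (t * t)" using t by simp
    ultimately show ?thesis by linarith
  qed
  moreover have uQS: "u (Qs F n + t *\<^sub>R Ss F n) = u (Qs F n) + t *\<^sub>R u (Ss F n)"
    using QA SA by (simp add: u_add u_scaleR A1_intros)
  moreover have nQS: "norm (u (Qs F n + t *\<^sub>R Ss F n)) = norm (Qs F n + t *\<^sub>R Ss F n)"
    using QA SA by (intro iso A1_intros)
  ultimately have low: "1 + 2 * t - 3 * t\<^sup>2 \<le> (norm (u (Qs F n) + t *\<^sub>R u (Ss F n)))\<^sup>2" by simp
  have nz: "u (Qs F n) + t *\<^sub>R u (Ss F n) \<noteq> 0"
  proof -
    have "t\<^sup>2 \<le> t" using t mult_right_mono[of t 1 t] by (simp add: power2_eq_square)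
    then have "0 < norm (Qs F n + t *\<^sub>R Ss F n)" using n(7) by linarith
    then show ?thesis using nQS uQS by auto
  qed
  have td: "0 < t * \<delta>\<^sup>2 / 2" using t \<delta> by simp
  have "\<exists>z. norm z = 1 \<and>
     2 * t * (norm ((1 - u (Ps F n)) * z))\<^sup>2 \<le> t * \<delta>\<^sup>2 / 2 + (t\<^sup>2 * (3 + \<rho>) + \<epsilon> * (7 + 2 * (real (card (edges F)) * (K\<^sup>2 + 2)))) \<and>
     (\<forall>E\<in>edges F. 2 * t * (norm ((u (arrow E n) * R' (right E) - R' (left E)) * z))\<^sup>2 \<le> t * \<delta>\<^sup>2 / 2 + (t\<^sup>2 * (3 + \<rho>) + \<epsilon> * (7 + 2 * (real (card (edges F)) * (K\<^sup>2 + 2))))) \<and>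
     (\<forall>E\<in>edges F. 2 * t * (norm ((st2 (u (arrow E n)) * R' (left E) - R' (right E)) * z))\<^sup>2 \<le> t * \<delta>\<^sup>2 / 2 + (t\<^sup>2 * (3 + \<rho>) + \<epsilon> * (7 + 2 * (real (card (edges F)) * (K\<^sup>2 + 2)))))"
  proof (rule b.laplacian_vector[where E = "edges F" and R = R' and l = left and r = right and G = "\<lambda>E. u (arrow E n)" and P = "u (Ps F n)" and V = "\<lambda>E. u (arrow E (n + 2))" and S = "u (Ss F n)" and Q = "u (Qs F n)"])
    show "finite (edges F)" by (rule finite_edges[OF F(1)])
    show "st2 (R' i) = R' i" for i using sR by (simp add: R'_def)
    show "norm (R' (left E)) \<le> K" "norm (R' (right E)) \<le> K" if "E \<in> edges F" for E
      using that edgesD K rA iso by (auto simp: R' R_def)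
    show "(norm (u (arrow E n)))\<^sup>2 \<le> 1 + \<epsilon>" if "E \<in> edges F" for E using n(2)[OF that] iso[OF aA[OF that]] by simp
    show "norm (u (arrow E (n + 2)) - R' (left E) * u (arrow E n) * R' (right E)) \<le> \<epsilon>" if E: "E \<in> edges F" for E
    proof -
      have mem: "r (left E) (n + 2) \<in> A1" "r (right E) (n + 2) \<in> A1" "arrow E n \<in> A1" "arrow E (n + 2) \<in> A1"
        using rA aA edgesD[OF E] E by blast+
      have eq: "u (arrow E (n + 2)) - R' (left E) * u (arrow E n) * R' (right E) = u (arrow E (n + 2) - r (left E) (n + 2) * arrow E n * r (right E) (n + 2))"
        using edgesD[OF E] by (simp add: R' R_def u_diff u_mult A1_mult mem del: add_2_eq_Suc')
      have "arrow E (n + 2) - r (left E) (n + 2) * arrow E n * r (right E) (n + 2) \<in> A1"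
        by (intro A1_diff A1_mult mem)
      from iso[OF this] show ?thesis unfolding eq using n(3)[OF E] by simp
    qed
    show "b.pos (u (Ps F n))" unfolding uP by (intro b.pos_sum b.pos_square sR)
    show "norm (u (Ps F n)) \<le> 1 + \<epsilon>" using n(4) iso[OF PA] by simp
    show "u (Ss F n) + st2 (u (Ss F n)) = 2 *\<^sub>R u (Ps F n) - 2 *\<^sub>R (\<Sum>E\<in>edges F. R' (left E) * R' (left E) + R' (right E) * R' (right E) - u (arrow E (n + 2)) - st2 (u (arrow E (n + 2))))"
    proof -
      have "st2 (u (Ps F n)) = u (Ps F n)" unfolding uP using sR by (simp add: b.st_sum b.st_mult)
      moreover have "st2 (\<Sum>E\<in>edges F. R (left E) * R (left E) + R (right E) * R (right E) - 2 *\<^sub>R u (arrow E (n + 2)))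
        = (\<Sum>E\<in>edges F. R (left E) * R (left E) + R (right E) * R (right E) - 2 *\<^sub>R st2 (u (arrow E (n + 2))))"
        unfolding b.st_sum using sR edgesD by (intro sum.cong) (auto simp: b.st_diff b.st_add b.st_mult b.st_scaleR)
      ultimately have "u (Ss F n) + st2 (u (Ss F n)) = 2 *\<^sub>R u (Ps F n) -
          ((\<Sum>E\<in>edges F. R (left E) * R (left E) + R (right E) * R (right E) - 2 *\<^sub>R u (arrow E (n + 2)))
          + (\<Sum>E\<in>edges F. R (left E) * R (left E) + R (right E) * R (right E) - 2 *\<^sub>R st2 (u (arrow E (n + 2)))))"
        unfolding uS by (simp add: b.st_diff scaleR_2)
      also have "(\<Sum>E\<in>edges F. R (left E) * R (left E) + R (right E) * R (right E) - 2 *\<^sub>R u (arrow E (n + 2)))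
          + (\<Sum>E\<in>edges F. R (left E) * R (left E) + R (right E) * R (right E) - 2 *\<^sub>R st2 (u (arrow E (n + 2))))
        = 2 *\<^sub>R (\<Sum>E\<in>edges F. R' (left E) * R' (left E) + R' (right E) * R' (right E) - u (arrow E (n + 2)) - st2 (u (arrow E (n + 2))))"
        unfolding sum.distrib[symmetric] scaleR_sum_right using edgesD
        by (intro sum.cong) (auto simp: R' scaleR_diff_right scaleR_2)
      finally show ?thesis .
    qed
    show "st2 (u (Qs F n)) = u (Qs F n)" by (rule u_sa[OF e.D_sub D_A1 Qs_D[OF F(1)] Qs_sa])
    show "(norm (u (Qs F n)))\<^sup>2 \<le> 1 + \<epsilon>" using n(5) iso[OF QA] by simp
    have "u (Qs F n) * u (Ss F n) - u (Ss F n) = u (Qs F n * Ss F n - Ss F n)"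
      using QA SA by (simp add: u_diff u_mult A1_mult)
    then show "norm (u (Qs F n) * u (Ss F n) - u (Ss F n)) \<le> \<epsilon>"
      using n(6) iso[of "Qs F n * Ss F n - Ss F n"] QA SA by (simp add: A1_diff A1_mult)
    show "(norm (u (Ss F n)))\<^sup>2 \<le> \<rho>" using \<rho> iso[OF SA] by simp
  qed (use \<epsilon> t low nz td in auto)
  then obtain z where z: "norm z = 1" and
     z1: "2 * t * (norm ((1 - u (Ps F n)) * z))\<^sup>2 \<le> t * \<delta>\<^sup>2 / 2 + (t\<^sup>2 * (3 + \<rho>) + \<epsilon> * c)" and
     z2: "\<And>E. E\<in>edges F \<Longrightarrow> 2 * t * (norm ((u (arrow E n) * R' (right E) - R' (left E)) * z))\<^sup>2 \<le> t * \<delta>\<^sup>2 / 2 + (t\<^sup>2 * (3 + \<rho>) + \<epsilon> * c)"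
     "\<And>E. E\<in>edges F \<Longrightarrow> 2 * t * (norm ((st2 (u (arrow E n)) * R' (left E) - R' (right E)) * z))\<^sup>2 \<le> t * \<delta>\<^sup>2 / 2 + (t\<^sup>2 * (3 + \<rho>) + \<epsilon> * c)"
    unfolding c_def by blast
  have fin: "y \<le> \<delta>" if y: "2 * t * y\<^sup>2 \<le> t * \<delta>\<^sup>2 / 2 + (t\<^sup>2 * (3 + \<rho>) + \<epsilon> * c)" for y
  proof -
    have "t\<^sup>2 * (3 + \<rho>) \<le> t * \<delta>\<^sup>2" using mult_left_mono[OF t3, of t] t(1) by (simp add: power2_eq_square mult.assoc)
    then have "2 * t * y\<^sup>2 \<le> 2 * t * \<delta>\<^sup>2" using y \<epsilon>c by simp
    then have "y\<^sup>2 \<le> \<delta>\<^sup>2" using t(1) by simp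
    then show ?thesis using \<delta> power2_le_imp_le by fastforce
  qed
  show ?thesis
    using n(1) z fin[OF z1] fin[OF z2(1)] fin[OF z2(2)] edgesD R' R_def by (intro exI[of _ n] conjI exI[of _ z]) auto
qed

end

section \<open>Words in the letters of both algebras\<close>

text \<open>Pairs of values of one polynomial without constant term in paired letters. Products grow
  by one letter on the left, the form in which coordinates are propagated; closure under all
  products is derived from it.\<close>

inductive_set words :: "(complex \<Rightarrow> 'a::ring \<Rightarrow> 'a) \<Rightarrow> (complex \<Rightarrow> 'b::ring \<Rightarrow> 'b) \<Rightarrow> ('a \<times> 'b) set \<Rightarrow> ('a \<times> 'b) set"
  for cs1 cs2 L where
  letter: "l \<in> L \<Longrightarrow> l \<in> words cs1 cs2 L"
| mult: "(x, y) \<in> L \<Longrightarrow> (f, g) \<in> words cs1 cs2 L \<Longrightarrow> (x * f, y * g) \<in> words cs1 cs2 L"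
| add: "(f, g) \<in> words cs1 cs2 L \<Longrightarrow> (f', g') \<in> words cs1 cs2 L \<Longrightarrow> (f + f', g + g') \<in> words cs1 cs2 L"
| scale: "(f, g) \<in> words cs1 cs2 L \<Longrightarrow> (cs1 c f, cs2 c g) \<in> words cs1 cs2 L"

context isometric_hom
begin

definition letters_of :: "'a set \<Rightarrow> ('a \<times> 'b) set"
  where "letters_of Z = (\<lambda>x. (x, u x)) ` Z \<union> (\<lambda>x. (st1 x, st2 (u x))) ` Z"

lemma letters_of_cases:
  assumes "(x, y) \<in> letters_of Z"
  obtains "x \<in> Z" "y = u x" | x' where "x' \<in> Z" "x = st1 x'" "y = st2 (u x')"
  using assms by (auto simp: letters_of_def)

end

context excised_isometry
begin

definition Xs :: "'a set" where "Xs = X \<union> st1 ` X"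

abbreviation "letters \<equiv> letters_of X"

lemma letter_Xs: "(x, y) \<in> letters \<Longrightarrow> x \<in> Xs"
  by (auto simp: letters_of_def Xs_def)

lemma letter_A: "(x, y) \<in> letters \<Longrightarrow> x \<in> e.A"
  using X(3) by (auto simp: letters_of_def intro: e.A_st)

lemma Xs_A: "Xs \<subseteq> e.A" using X(3) by (auto simp: Xs_def intro: e.A_st)

lemma letter_norm: "(x, y) \<in> letters \<Longrightarrow> norm y = norm x"
  using X(2) iso by (auto simp: letters_of_def)

text \<open>A compression of an adjoint letter is the adjoint of a compression of an element of
  \<open>A1\<close>, so its norm is preserved. Mixed words of letters and adjoint letters have no
  such description, hence only single letters are compressed.\<close>

lemma letter_compress_norm:
  assumes xy: "(x, y) \<in> letters" and c: "c \<in> D" "st1 c = c" and d: "d \<in> D" "st1 d = d"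
  shows "norm (u c * y * u d) = norm (c * x * d)" "norm (y * u d - u c * y * u d) = norm (x * d - c * x * d)"
proof -
  have cd: "c \<in> A1" "d \<in> A1" "st2 (u c) = u c" "st2 (u d) = u d"
    using c d D_A1 u_sa[OF e.D_sub D_A1] by auto
  from xy show "norm (u c * y * u d) = norm (c * x * d)"
  proof (cases rule: letters_of_cases)
    case 1
    then have "x \<in> A1" using X by auto
    then have "u c * y * u d = u (c * x * d)" using 1 cd by (simp add: u_mult A1_mult)
    then show ?thesis using iso[of "c * x * d"] cd \<open>x \<in> A1\<close> by (simp add: A1_mult)
  next
    case (2 x')
    then have xA: "x' \<in> A1" using X by auto
    have "u c * y * u d = st2 (u (d * x' * c))" using 2 cd xA by (simp add: u_mult A1_mult b.st_mult mult.assoc)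
    moreover have "c * x * d = st1 (d * x' * c)" using 2 c d by (simp add: a.st_mult mult.assoc)
    ultimately show ?thesis using iso[of "d * x' * c"] cd xA by (simp add: A1_mult)
  qed
  from xy show "norm (y * u d - u c * y * u d) = norm (x * d - c * x * d)"
  proof (cases rule: letters_of_cases)
    case 1
    then have "x \<in> A1" using X by auto
    then have "y * u d - u c * y * u d = u (x * d - c * x * d)" using 1 cd by (simp add: u_diff u_mult A1_mult)
    then show ?thesis using iso[of "x * d - c * x * d"] cd \<open>x \<in> A1\<close> by (simp add: A1_mult A1_diff)
  next
    case (2 x')
    then have xA: "x' \<in> A1" using X by auto
    have "y * u d - u c * y * u d = st2 (u (d * x' - d * x' * c))"
      using 2 cd xA by (simp add: u_diff u_mult A1_mult b.st_mult b.st_diff mult.assoc)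
    moreover have "x * d - c * x * d = st1 (d * x' - d * x' * c)" using 2 c d by (simp add: a.st_mult a.st_diff mult.assoc)
    ultimately show ?thesis using iso[of "d * x' - d * x' * c"] cd xA by (simp add: A1_mult A1_diff)
  qed
qed

section \<open>Elements of the second algebra that imitate an orthonormal family\<close>

definition Rv :: "(nat \<Rightarrow> nat) \<Rightarrow> (nat \<Rightarrow> 'b) \<Rightarrow> 'a \<Rightarrow> nat \<Rightarrow> 'b"
  where "Rv \<nu> z k m = u (r k (\<nu> m + 2)) * z m"

text \<open>The vectors \<open>Rv \<nu> z k\<close> replace, in the second algebra, the vectors that \<open>k \<in> F\<close> defines in the
GNS representation of \<open>phi\<close>.\<close>
definition imitates :: "'a set \<Rightarrow> (nat \<Rightarrow> nat) \<Rightarrow> (nat \<Rightarrow> 'b) \<Rightarrow> bool"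
  where "imitates F \<nu> z \<longleftrightarrow> (\<forall>m. m \<le> \<nu> m) \<and> (\<forall>m. norm (z m) = 1) \<and>
    (\<exists>c>0. \<forall>\<^sub>F m in sequentially. c \<le> norm (Rv \<nu> z 1 m)) \<and>
    (\<forall>i\<in>F. (\<lambda>m. norm (Rv \<nu> z i m) - norm (Rv \<nu> z 1 m)) \<longlonglongrightarrow> 0) \<and>
    (\<forall>(x, y)\<in>letters. \<forall>i\<in>F. \<forall>j\<in>F.
      (\<lambda>m. u (r i (\<nu> m)) * y * Rv \<nu> z j m) \<simeq> (\<lambda>m. cs2 (e.phi (st1 i * x * j)) (Rv \<nu> z i m)))"

lemma Rv_bound:
  assumes F: "e.orth F" "k \<in> F" and z: "norm (z m) = 1" shows "norm (Rv \<nu> z k m) \<le> norm k * norm k"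
proof -
  have "norm (Rv \<nu> z k m) \<le> norm (u (r k (\<nu> m + 2))) * norm (z m)" unfolding Rv_def by (rule norm_mult_ineq)
  then show ?thesis using iso[OF r_A1[OF e.orthD(2)[OF F]]] norm_r[of k "\<nu> m + 2"] z by simp
qed

lemma u_r_Rv:
  assumes F: "e.orth F" "i \<in> F" "j \<in> F" and \<nu>: "\<And>m. m \<le> \<nu> m" and z: "\<And>m. norm (z m) = 1" and p: "p < 2"
  shows "(\<lambda>m. u (r i (\<nu> m + p)) * Rv \<nu> z j m) \<simeq> (\<lambda>m. if i = j then Rv \<nu> z j m else 0)"
proof -
  define d where "d n = r i (n + p) * r j (n + 2) - (if i = j then r j (n + 2) else 0)" for n
  have "d \<longlonglongrightarrow> 0" using r_r(1)[OF F p] unfolding asymp_eq_def d_def[abs_def] .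
  then have d: "(\<lambda>m. norm (d (\<nu> m))) \<longlonglongrightarrow> 0" using tendsto_norm_zero tendsto_subsequence \<nu> by blast
  have rA: "r i n \<in> A1" "r j n \<in> A1" for n using r_A1[OF e.orthD(2)[OF F(1)]] F by auto
  have dA: "d n \<in> A1" for n unfolding d_def using rA by (auto intro!: A1_intros)
  have "u (r i (\<nu> m + p)) * Rv \<nu> z j m - (if i = j then Rv \<nu> z j m else 0) = u (d (\<nu> m)) * z m" for m
    unfolding d_def Rv_def using rA by (auto simp: u_diff u_mult A1_mult left_diff_distrib mult.assoc)
  moreover have "norm (u (d (\<nu> m)) * z m) \<le> norm (d (\<nu> m))" for m
    using norm_mult_ineq[of "u (d (\<nu> m))" "z m"] iso[OF dA] z by simp
  ultimately show ?thesis unfolding asymp_eq_def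
    by (intro Lim_null_comparison[OF _ d]) auto
qed

text \<open>Arrows are asymptotic contractions, so almost invariance under an arrow and its adjoint
  makes the lengths at both ends asymptotically equal; linkedness spreads this over
  \<open>F\<close>. Nonzero matrix entries are then read off from the edges, and vanishing ones from
  the norms of the compressed letters.\<close>

lemma imitates_exists:
  assumes F: "e.orth F" "e.linked Xs F"
  obtains \<nu> z where "imitates F \<nu> z"
proof -
  have F1: "1 \<in> F" using F(2) by (simp add: e.linked_def)
  have "\<forall>m. \<exists>n z. m \<le> n \<and> norm z = 1 \<and> norm ((1 - u (Ps F n)) * z) \<le> 1 / real (Suc m) \<and>
    (\<forall>E\<in>edges F. norm ((u (arrow E n) * u (r (right E) (n + 2)) - u (r (left E) (n + 2))) * z) \<le> 1 / real (Suc m) \<and>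
      norm ((st2 (u (arrow E n)) * u (r (left E) (n + 2)) - u (r (right E) (n + 2))) * z) \<le> 1 / real (Suc m))"
    using almost_invariant_vector[OF F(1)] F1 by (metis empty_iff of_nat_0_less_iff zero_less_Suc zero_less_divide_1_iff)
  then obtain \<nu> z where \<nu>: "\<And>m. m \<le> \<nu> m" and z: "\<And>m. norm (z m) = 1"
    and zP: "\<And>m. norm ((1 - u (Ps F (\<nu> m))) * z m) \<le> 1 / real (Suc m)"
    and zE: "\<And>m E. E \<in> edges F \<Longrightarrow> norm ((u (arrow E (\<nu> m)) * u (r (right E) (\<nu> m + 2)) - u (r (left E) (\<nu> m + 2))) * z m) \<le> 1 / real (Suc m)"
      "\<And>m E. E \<in> edges F \<Longrightarrow> norm ((st2 (u (arrow E (\<nu> m))) * u (r (left E) (\<nu> m + 2)) - u (r (right E) (\<nu> m + 2))) * z m) \<le> 1 / real (Suc m)"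
    by metis
  define R where "R = Rv \<nu> z"
  have R: "R k m = u (r k (\<nu> m + 2)) * z m" for k m by (simp add: R_def Rv_def)
  have inv: "(\<lambda>m. 1 / real (Suc m)) \<longlonglongrightarrow> 0" by (rule LIMSEQ_Suc[OF lim_1_over_n])
  have rA: "r k n \<in> A1" if "k \<in> F" for k n using r_A1[OF e.orthD(2)[OF F(1) that]] .
  have E1: "(\<lambda>m. u (arrow E (\<nu> m)) * R (right E) m) \<simeq> R (left E)" if "E \<in> edges F" for E
    unfolding asymp_eq_def
    by (rule Lim_null_comparison[OF _ inv]) (use zE(1)[OF that] in \<open>simp add: R left_diff_distrib mult.assoc\<close>)
  have E2: "(\<lambda>m. st2 (u (arrow E (\<nu> m))) * R (left E) m) \<simeq> R (right E)" if "E \<in> edges F" for E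
    unfolding asymp_eq_def
    by (rule Lim_null_comparison[OF _ inv]) (use zE(2)[OF that] in \<open>simp add: R left_diff_distrib mult.assoc\<close>)
  have Rb: "norm (R k m) \<le> norm k * norm k" if "k \<in> F" for k m
    unfolding R_def by (rule Rv_bound[where F = F]) (use F z that in auto)
  have nE: "(\<lambda>m. norm (R (left E) m) - norm (R (right E) m)) \<longlonglongrightarrow> 0" if E: "E \<in> edges F" for E
  proof -
    obtain b where b: "b \<longlonglongrightarrow> 1" "\<And>n. norm (arrow E n) \<le> b n" using arrow_bound[OF F(1) E] by blast
    define K where "K = norm (left E) * norm (left E) + norm (right E) * norm (right E)"
    have K: "norm (R (left E) m) \<le> K" "norm (R (right E) m) \<le> K" "0 \<le> K" for m
      using Rb[OF edgesD(1)[OF E], of m] Rb[OF edgesD(2)[OF E], of m] by (auto simp: K_def intro: order_trans)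
    define e1 where "e1 m = norm (u (arrow E (\<nu> m)) * R (right E) m - R (left E) m)" for m
    define e2 where "e2 m = norm (st2 (u (arrow E (\<nu> m))) * R (left E) m - R (right E) m)" for m
    have e12: "e1 \<longlonglongrightarrow> 0" "e2 \<longlonglongrightarrow> 0" unfolding e1_def[abs_def] e2_def[abs_def]
      using E1[OF E] E2[OF E] by (auto simp: asymp_eq_def intro: tendsto_norm_zero)
    have "norm (norm (R (left E) m) - norm (R (right E) m)) \<le> e1 m + e2 m + \<bar>b (\<nu> m) - 1\<bar> * K" for m
    proof -
      have G: "norm (u (arrow E (\<nu> m))) \<le> b (\<nu> m)" using iso[OF arrow_A1[OF F(1) E]] b(2) by simp
      have s: "(b (\<nu> m) - 1) * y \<le> \<bar>b (\<nu> m) - 1\<bar> * K" if "0 \<le> y" "y \<le> K" for y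
        using that K(3) by (intro order_trans[OF mult_right_mono mult_left_mono]) auto
      have 1: "norm (R (left E) m) \<le> e1 m + b (\<nu> m) * norm (R (right E) m)"
      proof -
        have "norm (R (left E) m) \<le> norm (u (arrow E (\<nu> m)) * R (right E) m) + e1 m"
          unfolding e1_def by (metis norm_minus_commute norm_triangle_sub)
        also have "norm (u (arrow E (\<nu> m)) * R (right E) m) \<le> b (\<nu> m) * norm (R (right E) m)"
          by (rule order_trans[OF norm_mult_ineq mult_right_mono[OF G]]) simp
        finally show ?thesis by simp
      qed
      have 2: "norm (R (right E) m) \<le> e2 m + b (\<nu> m) * norm (R (left E) m)"
      proof -
        have "norm (R (right E) m) \<le> norm (st2 (u (arrow E (\<nu> m))) * R (left E) m) + e2 m"
          unfolding e2_def by (metis norm_minus_commute norm_triangle_sub)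
        also have "norm (st2 (u (arrow E (\<nu> m))) * R (left E) m) \<le> b (\<nu> m) * norm (R (left E) m)"
          by (rule order_trans[OF norm_mult_ineq mult_right_mono]) (use G in auto)
        finally show ?thesis by simp
      qed
      have "0 \<le> e1 m" "0 \<le> e2 m" by (auto simp: e1_def e2_def)
      moreover have "b (\<nu> m) * norm (R (right E) m) \<le> norm (R (right E) m) + \<bar>b (\<nu> m) - 1\<bar> * K"
        using s[OF norm_ge_zero K(2), of m] by (simp add: left_diff_distrib)
      moreover have "b (\<nu> m) * norm (R (left E) m) \<le> norm (R (left E) m) + \<bar>b (\<nu> m) - 1\<bar> * K"
        using s[OF norm_ge_zero K(1), of m] by (simp add: left_diff_distrib)
      ultimately show ?thesis using 1 2 by (simp add: abs_le_iff)
    qed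
    then have "\<forall>\<^sub>F m in sequentially. norm (norm (R (left E) m) - norm (R (right E) m)) \<le> e1 m + e2 m + \<bar>b (\<nu> m) - 1\<bar> * K"
      by (intro always_eventually allI)
    moreover have "(\<lambda>m. e1 m + e2 m + \<bar>b (\<nu> m) - 1\<bar> * K) \<longlonglongrightarrow> 0 + 0 + \<bar>1 - 1\<bar> * K"
      by (intro tendsto_intros e12 tendsto_subsequence[OF b(1) \<nu>])
    then have "(\<lambda>m. e1 m + e2 m + \<bar>b (\<nu> m) - 1\<bar> * K) \<longlonglongrightarrow> 0" by simp
    ultimately show ?thesis by (rule Lim_null_comparison)
  qed
  have nR: "(\<lambda>m. norm (R i m) - norm (R 1 m)) \<longlonglongrightarrow> 0" if i: "i \<in> F" for i
  proof -
    have "(1, i) \<in> {(j, k). j \<in> F \<and> k \<in> F \<and> (\<exists>x\<in>Xs. e.phi (st1 k * x * j) \<noteq> 0)}\<^sup>*"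
      using F(2) i by (simp add: e.linked_def)
    then show ?thesis
    proof (induction rule: rtrancl_induct)
      case (step j k)
      then have jk: "j \<in> F" "k \<in> F" by auto
      have "(\<lambda>m. norm (R k m) - norm (R j m)) \<longlonglongrightarrow> 0"
      proof -
        obtain x where x: "x \<in> Xs" "e.phi (st1 k * x * j) \<noteq> 0" using step by auto
        from x(1) consider "x \<in> X" | x' where "x' \<in> X" "x = st1 x'" by (auto simp: Xs_def)
        then show ?thesis
        proof cases
          case 1
          then have "(k, x, j) \<in> edges F" using jk x by (simp add: edges_def)
          from nE[OF this] show ?thesis by (simp add: left_def right_def)
        next
          case 2
          have A: "st1 j * x' * k \<in> e.A" using 2 X(3) e.orthD(3)[OF F(1)] jk by (auto intro!: e.A_mult e.A_st)
          have "st1 k * x * j = st1 (st1 j * x' * k)" using 2 by (simp add: a.st_mult mult.assoc)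
          then have "e.phi (st1 j * x' * k) \<noteq> 0" using x(2) e.phi_st[OF A] by auto
          then have "(j, x', k) \<in> edges F" using jk 2 by (simp add: edges_def)
          from tendsto_minus[OF nE[OF this]] show ?thesis by (simp add: left_def right_def)
        qed
      qed
      from tendsto_add[OF this step(3)] show ?case by simp
    qed simp
  qed
  \<comment> \<open>\<open>z m\<close> is nearly \<open>u (Ps F (\<nu> m)) * z m\<close>, a sum over
    \<open>F\<close> of vectors bounded by constants times \<parallel>R k m\<parallel>. As these
    lengths agree asymptotically, \<parallel>R 1 m\<parallel> stays away from 0.\<close>
  have low: "\<exists>c>0. \<forall>\<^sub>F m in sequentially. c \<le> norm (R 1 m)"
  proof -
    define K where "K = 1 + (\<Sum>k\<in>F. norm k * norm k)"
    have K: "norm k * norm k \<le> K" if "k \<in> F" for k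
      unfolding K_def using member_le_sum[OF that, of "\<lambda>k. norm k * norm k"] e.orthD(1)[OF F(1)] by auto
    have K0: "0 < K" unfolding K_def by (intro add_pos_nonneg sum_nonneg) auto
    define er where "er m = 1 / real (Suc m) + K * (\<Sum>k\<in>F. norm (R k m) - norm (R 1 m))" for m
    have "er \<longlonglongrightarrow> 0 + K * (\<Sum>k\<in>F. 0)" unfolding er_def[abs_def] by (intro tendsto_intros inv nR)
    then have "er \<longlonglongrightarrow> 0" by simp
    then have ev: "\<forall>\<^sub>F m in sequentially. er m < 1/2" by (rule order_tendstoD) simp
    define N where "N = real (card F)"
    have N: "0 < N" using F1 e.orthD(1)[OF F(1)] by (auto simp: N_def card_gt_0_iff)
    have main: "1 \<le> er m + K * N * norm (R 1 m)" for m
    proof -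
      have uP: "u (Ps F (\<nu> m)) * z m = (\<Sum>k\<in>F. u (r k (\<nu> m + 2)) * R k m)"
        unfolding Ps_def using rA by (simp add: u_sum u_mult A1_mult sum_distrib_right R mult.assoc)
      have "1 \<le> norm ((1 - u (Ps F (\<nu> m))) * z m) + norm (u (Ps F (\<nu> m)) * z m)"
        using norm_triangle_ineq[of "(1 - u (Ps F (\<nu> m))) * z m" "u (Ps F (\<nu> m)) * z m"] z[of m]
        by (simp add: left_diff_distrib)
      also have "norm (u (Ps F (\<nu> m)) * z m) \<le> (\<Sum>k\<in>F. K * norm (R k m))"
        unfolding uP
      proof (rule sum_norm_le)
        fix k assume k: "k \<in> F"
        have "norm (u (r k (\<nu> m + 2))) \<le> K" using iso[OF rA[OF k]] norm_r[of k "\<nu> m + 2"] K[OF k] by simp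
        then show "norm (u (r k (\<nu> m + 2)) * R k m) \<le> K * norm (R k m)"
          by (intro order_trans[OF norm_mult_ineq mult_right_mono]) auto
      qed
      also have "(\<Sum>k\<in>F. K * norm (R k m)) = K * (\<Sum>k\<in>F. norm (R k m) - norm (R 1 m)) + K * N * norm (R 1 m)"
        by (simp add: N_def sum_subtractf sum_distrib_left[symmetric] right_diff_distrib)
      finally show ?thesis using zP[of m] by (simp add: er_def)
    qed
    have "\<forall>\<^sub>F m in sequentially. 1 / (2 * K * N) \<le> norm (R 1 m)"
      using ev
    proof eventually_elim
      case (elim m)
      then have "1 \<le> 2 * K * N * norm (R 1 m)" using main[of m] by simp
      then show ?case using K0 N by (simp add: divide_le_eq mult.commute)
    qed
    then show ?thesis using K0 N by (intro exI[of _ "1 / (2 * K * N)"]) auto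
  qed
  have comp: "(\<lambda>m. u (r i (\<nu> m)) * y * R j m) \<simeq> (\<lambda>m. cs2 (e.phi (st1 i * x * j)) (R i m))"
    if xy: "(x, y) \<in> letters" and ij: "i \<in> F" "j \<in> F" for x y i j
  proof -
    define al where "al = e.phi (st1 i * x * j)"
    have xA: "x \<in> e.A" by (rule letter_A[OF xy])
    have nz: "(\<lambda>m. u (r i (\<nu> m)) * y * u (r j (\<nu> m)) * R j m) \<simeq> (\<lambda>m. cs2 al (R i m))"
    proof (cases "al = 0")
      case True
      obtain b where b: "b \<longlonglongrightarrow> cmod (e.phi (st1 i * x * j))" "\<And>n. norm (r i n * x * r j n) \<le> b n"
        using r_x_r_bound[OF F(1) ij xA] by blast
      have "(\<lambda>m. b (\<nu> m) * (norm j * norm j)) \<longlonglongrightarrow> 0 * (norm j * norm j)"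
        using b(1) True by (intro tendsto_intros tendsto_subsequence[OF _ \<nu>]) (simp add: al_def)
      moreover have "norm (u (r i (\<nu> m)) * y * u (r j (\<nu> m)) * R j m) \<le> b (\<nu> m) * (norm j * norm j)" for m
      proof -
        have "norm (u (r i (\<nu> m)) * y * u (r j (\<nu> m))) \<le> b (\<nu> m)"
          using letter_compress_norm(1)[OF xy r_D r_sa r_D r_sa] b(2)[of "\<nu> m"] e.orthD(2)[OF F(1)] ij by simp
        then show ?thesis using Rb[OF ij(2), of m]
          by (intro order_trans[OF norm_mult_ineq mult_mono]) (auto intro: order_trans[OF norm_ge_zero])
      qed
      then have "\<forall>\<^sub>F m in sequentially. norm (u (r i (\<nu> m)) * y * u (r j (\<nu> m)) * R j m) \<le> b (\<nu> m) * (norm j * norm j)"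
        by (intro always_eventually allI)
      ultimately have "(\<lambda>m. u (r i (\<nu> m)) * y * u (r j (\<nu> m)) * R j m) \<longlonglongrightarrow> 0"
        using Lim_null_comparison by fastforce
      then show ?thesis using True by (simp add: asymp_eq_def)
    next
      case False
      from xy show ?thesis
      proof (cases rule: letters_of_cases)
        case 1
        have E: "(i, x, j) \<in> edges F" using 1 ij False by (simp add: edges_def al_def)
        have xA1: "x \<in> A1" using 1 X by blast
        have "u (arrow (i, x, j) n) = cs2 (1 / al) (u (r i n) * y * u (r j n))" for n
          using 1 ij rA xA1 by (simp add: arrow_def al_def u_cs u_mult A1_mult)
        then have "(\<lambda>m. cs2 al (u (arrow (i, x, j) (\<nu> m)) * R j m)) = (\<lambda>m. u (r i (\<nu> m)) * y * u (r j (\<nu> m)) * R j m)"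
          using False by (simp add: b.cs_mult_left b.cs_cs)
        then show ?thesis using b.asymp_eq_cs[OF E1[OF E], of al] by (simp add: left_def right_def)
      next
        case (2 x')
        have x'A: "x' \<in> A1" using 2 X by blast
        have A: "st1 j * x' * i \<in> e.A" using 2 X(3) e.orthD(3)[OF F(1)] ij by (auto intro!: e.A_mult e.A_st)
        have "st1 i * x * j = st1 (st1 j * x' * i)" using 2 by (simp add: a.st_mult mult.assoc)
        then have al': "e.phi (st1 j * x' * i) = cnj al" using e.phi_st[OF A] by (simp add: al_def)
        then have E: "(j, x', i) \<in> edges F" using 2 ij False by (simp add: edges_def)
        have "arrow (j, x', i) n = cs1 (1 / cnj al) (r j n * x' * r i n)" for n by (simp add: arrow_def al')
        then have "st2 (u (arrow (j, x', i) n)) = cs2 (1 / al) (u (r i n) * y * u (r j n))" for n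
          using 2 ij rA x'A u_r_sa[OF e.orthD(2)[OF F(1)]]
          by (simp add: u_cs u_mult A1_mult b.st_cs b.st_mult mult.assoc)
        then have "(\<lambda>m. cs2 al (st2 (u (arrow (j, x', i) (\<nu> m))) * R j m)) = (\<lambda>m. u (r i (\<nu> m)) * y * u (r j (\<nu> m)) * R j m)"
          using False by (simp add: b.cs_mult_left b.cs_cs)
        then show ?thesis using b.asymp_eq_cs[OF E2[OF E], of al] by (simp add: left_def right_def)
      qed
    qed
    have "(\<lambda>m. u (r j (\<nu> m)) * R j m) \<simeq> R j"
      using u_r_Rv[OF F(1) ij(2,2) \<nu> z, of 0] by (simp add: R_def)
    moreover have "norm (u (r i (\<nu> m)) * y) \<le> norm i * norm i * norm y" for m
      using iso[OF rA[OF ij(1)]] norm_r[of i "\<nu> m"] by (intro order_trans[OF norm_mult_ineq mult_right_mono]) auto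
    ultimately have "(\<lambda>m. u (r i (\<nu> m)) * y * (u (r j (\<nu> m)) * R j m)) \<simeq> (\<lambda>m. u (r i (\<nu> m)) * y * R j m)"
      by (rule asymp_eq_mult_left)
    from asymp_eq_trans[OF asymp_eq_sym[OF this]] nz show ?thesis by (simp add: al_def mult.assoc)
  qed
  have "imitates F \<nu> z"
    unfolding imitates_def R_def[symmetric] using \<nu> z low nR comp by auto
  then show thesis by (rule that)
qed

section \<open>Pairs of polynomial values with common coordinates\<close>

definition approximates :: "real \<Rightarrow> 'a set \<Rightarrow> ('a \<Rightarrow> complex) \<Rightarrow> 'a \<Rightarrow> 'b \<Rightarrow> bool"
  where "approximates \<epsilon> F1 c f g \<longleftrightarrow> e.orth F1 \<and> e.linked Xs F1 \<and> e.N (f - (\<Sum>i\<in>F1. cs1 (c i) i)) \<le> \<epsilon> \<and>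
    (\<forall>F \<nu> z. e.orth F \<longrightarrow> F1 \<subseteq> F \<longrightarrow> imitates F \<nu> z \<longrightarrow>
      (\<forall>\<^sub>F m in sequentially. norm (g * Rv \<nu> z 1 m - (\<Sum>i\<in>F1. cs2 (c i) (Rv \<nu> z i m))) \<le> \<epsilon> * norm (Rv \<nu> z 1 m)))"

lemma approximatesD:
  assumes "approximates \<epsilon> F1 c f g"
  shows "e.orth F1" "e.linked Xs F1" "e.N (f - (\<Sum>i\<in>F1. cs1 (c i) i)) \<le> \<epsilon>"
    "e.orth F \<Longrightarrow> F1 \<subseteq> F \<Longrightarrow> imitates F \<nu> z \<Longrightarrow>
      \<forall>\<^sub>F m in sequentially. norm (g * Rv \<nu> z 1 m - (\<Sum>i\<in>F1. cs2 (c i) (Rv \<nu> z i m))) \<le> \<epsilon> * norm (Rv \<nu> z 1 m)"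
  using assms by (auto simp: approximates_def)

text \<open>The same coordinates describe \<open>f\<close> in the first algebra and \<open>g\<close>
  on every imitation of every larger family, and they are available beyond every starting family.
  Both universal quantifiers allow the families to grow while a word is built.\<close>

definition tracked :: "'a \<Rightarrow> 'b \<Rightarrow> bool"
  where "tracked f g \<longleftrightarrow> f \<in> e.A \<and> (\<forall>\<epsilon>>0. \<forall>F0. e.orth F0 \<longrightarrow> e.linked Xs F0 \<longrightarrow>
    (\<exists>F1 c. F0 \<subseteq> F1 \<and> approximates \<epsilon> F1 c f g))"

lemma trackedD:
  assumes "tracked f g" "0 < \<epsilon>" "e.orth F0" "e.linked Xs F0"
  obtains F1 c where "F0 \<subseteq> F1" "approximates \<epsilon> F1 c f g"
  using assms unfolding tracked_def by blast

lemma trackedI: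
  assumes "f \<in> e.A" "\<And>\<epsilon> F0. 0 < \<epsilon> \<Longrightarrow> e.orth F0 \<Longrightarrow> e.linked Xs F0 \<Longrightarrow> \<exists>F1 c. F0 \<subseteq> F1 \<and> approximates \<epsilon> F1 c f g"
  shows "tracked f g"
  using assms unfolding tracked_def by blast

lemma delta_sum:
  assumes "finite F" "1 \<in> F"
  shows "(\<Sum>i\<in>F. cs1 (if i = 1 then 1 else 0) (f i)) = f 1" "(\<Sum>i\<in>F. cs2 (if i = 1 then 1 else 0) (g i)) = g (1 :: 'a)"
proof -
  have "(\<Sum>i\<in>F. cs1 (if i = 1 then 1 else 0) (f i)) = (\<Sum>i\<in>F. if i = 1 then f i else 0)" by (intro sum.cong) auto
  then show "(\<Sum>i\<in>F. cs1 (if i = 1 then 1 else 0) (f i)) = f 1" using assms by simp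
  have "(\<Sum>i\<in>F. cs2 (if i = 1 then 1 else 0) (g i)) = (\<Sum>i\<in>F. if i = 1 then g i else 0)" by (intro sum.cong) auto
  then show "(\<Sum>i\<in>F. cs2 (if i = 1 then 1 else 0) (g i)) = g 1" using assms by simp
qed

lemma tracked_1: "tracked 1 1"
proof (rule trackedI[OF e.A_1])
  fix \<epsilon> :: real and F0 assume \<epsilon>: "0 < \<epsilon>" and F0: "e.orth F0" "e.linked Xs F0"
  have 1: "1 \<in> F0" using F0(2) by (simp add: e.linked_def)
  note d = delta_sum[OF e.orthD(1)[OF F0(1)] 1]
  have "approximates \<epsilon> F0 (\<lambda>i. if i = 1 then 1 else 0) 1 1"
    using F0 \<epsilon> by (simp add: approximates_def d e.N_0)
  then show "\<exists>F1 c. F0 \<subseteq> F1 \<and> approximates \<epsilon> F1 c 1 1" by blast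
qed

lemma tracked_add:
  assumes "tracked f g" "tracked f' g'" shows "tracked (f + f') (g + g')"
proof (rule trackedI)
  have A: "f \<in> e.A" "f' \<in> e.A" using assms by (auto simp: tracked_def)
  then show "f + f' \<in> e.A" by (rule e.A_add)
  fix \<epsilon> :: real and F0 assume \<epsilon>: "0 < \<epsilon>" and F0: "e.orth F0" "e.linked Xs F0"
  from \<epsilon> have \<epsilon>2: "0 < \<epsilon>/2" by simp
  obtain F1 c where B1: "F0 \<subseteq> F1" "approximates (\<epsilon>/2) F1 c f g"
    by (rule trackedD[OF assms(1) \<epsilon>2 F0])
  note 1 = approximatesD(1,2)[OF B1(2)] B1(1) approximatesD(3,4)[OF B1(2)]
  obtain F2 c' where B2: "F1 \<subseteq> F2" "approximates (\<epsilon>/2) F2 c' f' g'"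
    by (rule trackedD[OF assms(2) \<epsilon>2 1(1,2)])
  note 2 = approximatesD(1,2)[OF B2(2)] B2(1) approximatesD(3,4)[OF B2(2)]
  define d where "d i = (if i \<in> F1 then c i else 0) + c' i" for i
  have s1: "(\<Sum>i\<in>F2. cs1 (d i) i) = (\<Sum>i\<in>F1. cs1 (c i) i) + (\<Sum>i\<in>F2. cs1 (c' i) i)"
  proof -
    have "(\<Sum>i\<in>F1. cs1 (c i) i) = (\<Sum>i\<in>F2. cs1 (if i \<in> F1 then c i else 0) i)"
      using 2(3) e.orthD(1)[OF 2(1)] by (intro sum.mono_neutral_cong_left) auto
    then show ?thesis by (simp add: d_def a.cs_add_left sum.distrib)
  qed
  have s2: "(\<Sum>i\<in>F2. cs2 (d i) (v i)) = (\<Sum>i\<in>F1. cs2 (c i) (v i)) + (\<Sum>i\<in>F2. cs2 (c' i) (v i))" for v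
  proof -
    have "(\<Sum>i\<in>F1. cs2 (c i) (v i)) = (\<Sum>i\<in>F2. cs2 (if i \<in> F1 then c i else 0) (v i))"
      using 2(3) e.orthD(1)[OF 2(1)] by (intro sum.mono_neutral_cong_left) auto
    then show ?thesis by (simp add: d_def b.cs_add_left sum.distrib)
  qed
  have "e.N (f + f' - (\<Sum>i\<in>F2. cs1 (d i) i)) \<le> \<epsilon>"
  proof -
    have eq: "f + f' - (\<Sum>i\<in>F2. cs1 (d i) i) = (f - (\<Sum>i\<in>F1. cs1 (c i) i)) + (f' - (\<Sum>i\<in>F2. cs1 (c' i) i))"
      by (simp add: s1)
    have "e.N (f + f' - (\<Sum>i\<in>F2. cs1 (d i) i)) \<le> e.N (f - (\<Sum>i\<in>F1. cs1 (c i) i)) + e.N (f' - (\<Sum>i\<in>F2. cs1 (c' i) i))"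
      unfolding eq by (intro e.N_triangle e.A_diff A e.comb_A 1 2)
    then show ?thesis using 1(4) 2(4) by simp
  qed
  moreover have "\<forall>\<^sub>F m in sequentially. norm ((g + g') * Rv \<nu> z 1 m - (\<Sum>i\<in>F2. cs2 (d i) (Rv \<nu> z i m))) \<le> \<epsilon> * norm (Rv \<nu> z 1 m)"
    if F: "e.orth F" "F2 \<subseteq> F" "imitates F \<nu> z" for F \<nu> z
  proof -
    have "F1 \<subseteq> F" using F(2) 2(3) by blast
    from 1(5)[OF F(1) this F(3)] 2(5)[OF F] show ?thesis
    proof eventually_elim
      case (elim m)
      have "(g + g') * Rv \<nu> z 1 m - (\<Sum>i\<in>F2. cs2 (d i) (Rv \<nu> z i m)) =
          (g * Rv \<nu> z 1 m - (\<Sum>i\<in>F1. cs2 (c i) (Rv \<nu> z i m))) + (g' * Rv \<nu> z 1 m - (\<Sum>i\<in>F2. cs2 (c' i) (Rv \<nu> z i m)))"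
        by (simp add: s2 distrib_right)
      then show ?case using elim norm_triangle_ineq[of "g * Rv \<nu> z 1 m - (\<Sum>i\<in>F1. cs2 (c i) (Rv \<nu> z i m))"
          "g' * Rv \<nu> z 1 m - (\<Sum>i\<in>F2. cs2 (c' i) (Rv \<nu> z i m))"] by simp
    qed
  qed
  ultimately have "approximates \<epsilon> F2 d (f + f') (g + g')"
    unfolding approximates_def using 1(3) 2(1-3) by blast
  then show "\<exists>F1 c. F0 \<subseteq> F1 \<and> approximates \<epsilon> F1 c (f + f') (g + g')" using 1(3) 2(1-3) by blast
qed

lemma tracked_scale:
  assumes "tracked f g" shows "tracked (cs1 a f) (cs2 a g)"
proof (rule trackedI)
  have A: "f \<in> e.A" using assms by (auto simp: tracked_def)
  then show "cs1 a f \<in> e.A" by (rule e.A_cs)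
  fix \<epsilon> :: real and F0 assume \<epsilon>: "0 < \<epsilon>" and F0: "e.orth F0" "e.linked Xs F0"
  have na: "0 < cmod a + 1" by (simp add: add_nonneg_pos)
  then have \<epsilon>': "0 < \<epsilon> / (cmod a + 1)" using \<epsilon> by simp
  have le: "cmod a * y \<le> \<epsilon> * w" if "y \<le> \<epsilon> / (cmod a + 1) * w" "0 \<le> y" for y w
  proof -
    have "cmod a * y \<le> (cmod a + 1) * y" using that(2) by (simp add: distrib_right)
    also have "\<dots> \<le> (cmod a + 1) * (\<epsilon> / (cmod a + 1) * w)" using that(1) na by (intro mult_left_mono) auto
    also have "\<dots> = \<epsilon> * w" using na by simp
    finally show ?thesis .
  qed
  obtain F1 c where B1: "F0 \<subseteq> F1" "approximates (\<epsilon> / (cmod a + 1)) F1 c f g"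
    by (rule trackedD[OF assms(1) \<epsilon>' F0])
  note 1 = approximatesD(1,2)[OF B1(2)] B1(1) approximatesD(3,4)[OF B1(2)]
  have "cs1 a f - (\<Sum>i\<in>F1. cs1 (a * c i) i) = cs1 a (f - (\<Sum>i\<in>F1. cs1 (c i) i))"
    by (simp add: a.cs_diff_right a.cs_sum_right a.cs_cs)
  then have "e.N (cs1 a f - (\<Sum>i\<in>F1. cs1 (a * c i) i)) = cmod a * e.N (f - (\<Sum>i\<in>F1. cs1 (c i) i))"
    using e.N_cs[OF e.A_diff[OF A e.comb_A[OF 1(1)]]] by simp
  then have "e.N (cs1 a f - (\<Sum>i\<in>F1. cs1 (a * c i) i)) \<le> \<epsilon>" using le[of _ 1] 1(4) e.N_nonneg by simp
  moreover have "\<forall>\<^sub>F m in sequentially. norm (cs2 a g * Rv \<nu> z 1 m - (\<Sum>i\<in>F1. cs2 (a * c i) (Rv \<nu> z i m))) \<le> \<epsilon> * norm (Rv \<nu> z 1 m)"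
    if F: "e.orth F" "F1 \<subseteq> F" "imitates F \<nu> z" for F \<nu> z
    using 1(5)[OF F]
  proof eventually_elim
    case (elim m)
    have "cs2 a g * Rv \<nu> z 1 m - (\<Sum>i\<in>F1. cs2 (a * c i) (Rv \<nu> z i m)) = cs2 a (g * Rv \<nu> z 1 m - (\<Sum>i\<in>F1. cs2 (c i) (Rv \<nu> z i m)))"
      by (simp add: b.cs_diff_right b.cs_sum_right b.cs_cs b.cs_mult_left)
    then show ?case using le[OF elim norm_ge_zero] by (simp add: b.norm_cs)
  qed
  ultimately have "approximates \<epsilon> F1 (\<lambda>i. a * c i) (cs1 a f) (cs2 a g)"
    unfolding approximates_def using 1(1-3) by blast
  then show "\<exists>F1 c. F0 \<subseteq> F1 \<and> approximates \<epsilon> F1 c (cs1 a f) (cs2 a g)" using 1(1-3) by blast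
qed

text \<open>The part of \<open>x * j\<close> outside the span of \<open>F1\<close> is seen by the
  one-sided compression \<open>x * r j - T * x * r j\<close>, where \<open>T\<close> is the sum of
  the \<open>r i\<close>. Its norm is eventually at most \<open>2 \<epsilon>\<close> and is
  preserved on the second side, also for adjoint letters.\<close>

lemma letter_on_Rv:
  assumes xy: "(x, y) \<in> letters" and F1: "e.orth F1" and j: "j \<in> F1" and \<epsilon>: "0 < \<epsilon>"
    and err: "e.N (x * j - e.proj F1 (x * j)) \<le> \<epsilon>"
    and F: "e.orth F" "F1 \<subseteq> F" "imitates F \<nu> z"
  shows "\<forall>\<^sub>F m in sequentially. norm (y * Rv \<nu> z j m - (\<Sum>i\<in>F1. cs2 (e.phi (st1 i * x * j)) (Rv \<nu> z i m))) \<le> 5 * \<epsilon> * norm (Rv \<nu> z 1 m)"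
proof -
  define R where "R = Rv \<nu> z"
  have \<nu>: "m \<le> \<nu> m" and z: "norm (z m) = 1" for m using F(3) by (auto simp: imitates_def)
  obtain c where c: "0 < c" "\<forall>\<^sub>F m in sequentially. c \<le> norm (R 1 m)"
    using F(3) unfolding imitates_def R_def by blast
  have xA: "x \<in> e.A" by (rule letter_A[OF xy])
  have jF: "j \<in> F" using j F(2) by blast
  define T where "T n = (\<Sum>i\<in>F1. r i n)" for n
  have TD: "T n \<in> D" for n unfolding T_def
    by (rule a.csubspace_sum[OF e.D_closure(2)]) (intro r_D e.orthD(2)[OF F1])
  have Ts: "st1 (T n) = T n" for n by (simp add: T_def a.st_sum r_sa)
  have jW: "j \<in> W" using e.orthD(2)[OF F1 j] .
  have TA: "r k n \<in> A1" if "k \<in> F1" for k n using r_A1[OF e.orthD(2)[OF F1 that]] .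
  have uT: "u (T n) = (\<Sum>i\<in>F1. u (r i n))" for n unfolding T_def using TA by (simp add: u_sum)
  define w where "w = x * j - e.proj F1 (x * j)"
  have wA: "w \<in> e.A" unfolding w_def by (intro e.A_diff e.A_mult xA e.orthD(3)[OF F1 j] e.proj_A F1)
  have t1: "(\<lambda>n. x * r j (n + 1) - T n * x * r j (n + 1)) \<simeq> (\<lambda>n. w * h (n + 1) * st1 j)"
  proof -
    have "(\<lambda>n. \<Sum>i\<in>F1. r i (n + 0) * x * r j (n + 1)) \<simeq> (\<lambda>n. \<Sum>i\<in>F1. cs1 (e.phi (st1 i * x * j)) (i * h (n + 1) * st1 j))"
      by (intro asymp_eq_sum r_compress_r xA e.orthD(3)[OF F1] j) auto
    then have "(\<lambda>n. x * r j (n + 1) - (\<Sum>i\<in>F1. r i n * x * r j (n + 1))) \<simeq> (\<lambda>n. x * r j (n + 1) - (\<Sum>i\<in>F1. cs1 (e.phi (st1 i * x * j)) (i * h (n + 1) * st1 j)))"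
      by (intro asymp_eq_diff asymp_eq_refl) simp
    moreover have "x * r j (n + 1) - (\<Sum>i\<in>F1. cs1 (e.phi (st1 i * x * j)) (i * h (n + 1) * st1 j)) = w * h (n + 1) * st1 j" for n
      by (simp add: w_def e.proj_def r_def left_diff_distrib sum_distrib_right a.cs_mult_left mult.assoc)
    ultimately show ?thesis by (simp add: T_def sum_distrib_right)
  qed
  have "\<forall>\<^sub>F n in sequentially. norm (x * r j (n + 1) - T n * x * r j (n + 1)) \<le> 2 * \<epsilon>"
  proof -
    have "(\<lambda>n. norm (w * h n) * norm (j * h (n + 1)) + (norm (x * r j (n + 1) - T n * x * r j (n + 1)) - norm (w * h (n + 1) * st1 j))) \<longlonglongrightarrow> e.N w * 1 + 0"
      by (intro tendsto_intros e.N_lim wA asymp_eq_norm[OF t1] LIMSEQ_ignore_initial_segment[OF N_unit[OF F1 j]])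
    moreover have "e.N w * 1 + 0 < 2 * \<epsilon>" using err \<epsilon> by (simp add: w_def)
    ultimately have "\<forall>\<^sub>F n in sequentially. norm (w * h n) * norm (j * h (n + 1)) + (norm (x * r j (n + 1) - T n * x * r j (n + 1)) - norm (w * h (n + 1) * st1 j)) < 2 * \<epsilon>"
      by (rule order_tendstoD(2))
    then show ?thesis
    proof eventually_elim
      case (elim n)
      have "w * h (n + 1) * st1 j = w * h n * (h (n + 1) * st1 j)"
        using e.h_Suc[of n] by (simp add: mult.assoc) (simp add: mult.assoc[symmetric])
      then have "norm (w * h (n + 1) * st1 j) \<le> norm (w * h n) * norm (j * h (n + 1))"
        using norm_mult_ineq[of "w * h n" "h (n + 1) * st1 j"] by (simp add: norm_h_st)
      then show ?case using elim by simp
    qed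
  qed
  then have ev1: "\<forall>\<^sub>F m in sequentially. norm (y * u (r j (\<nu> m + 1)) - u (T (\<nu> m)) * y * u (r j (\<nu> m + 1))) \<le> 2 * \<epsilon>"
    using letter_compress_norm(2)[OF xy TD Ts r_D[OF jW] r_sa] filterlim_at_top_mono[OF filterlim_ident, of \<nu>] \<nu>
    by (auto simp: filterlim_iff)
  have RT: "(\<lambda>m. y * R j m - (\<Sum>i\<in>F1. cs2 (e.phi (st1 i * x * j)) (R i m))) \<simeq>
      (\<lambda>m. (y * u (r j (\<nu> m + 1)) - u (T (\<nu> m)) * y * u (r j (\<nu> m + 1))) * R j m)"
  proof -
    have "(\<lambda>m. u (r i (\<nu> m)) * y * R j m) \<simeq> (\<lambda>m. cs2 (e.phi (st1 i * x * j)) (R i m))" if "i \<in> F1" for i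
      using F(3) xy that F(2) jF unfolding imitates_def R_def by blast
    then have 1: "(\<lambda>m. \<Sum>i\<in>F1. u (r i (\<nu> m)) * y * R j m) \<simeq> (\<lambda>m. \<Sum>i\<in>F1. cs2 (e.phi (st1 i * x * j)) (R i m))"
      by (rule asymp_eq_sum)
    have 2: "(\<lambda>m. y * R j m - (\<Sum>i\<in>F1. cs2 (e.phi (st1 i * x * j)) (R i m))) \<simeq> (\<lambda>m. y * R j m - u (T (\<nu> m)) * y * R j m)"
      using asymp_eq_diff[OF asymp_eq_refl asymp_eq_sym[OF 1]] by (simp add: uT sum_distrib_right)
    have "R j \<simeq> (\<lambda>m. u (r j (\<nu> m + 1)) * R j m)"
      using asymp_eq_sym[OF u_r_Rv[OF F(1) jF jF \<nu> z, of 1]] by (simp add: R_def)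
    moreover have "norm (y - u (T (\<nu> m)) * y) \<le> norm y + (\<Sum>i\<in>F1. norm i * norm i) * norm y" for m
    proof -
      have "norm (u (T (\<nu> m))) \<le> (\<Sum>i\<in>F1. norm i * norm i)"
        unfolding uT using TA iso norm_r by (intro sum_norm_le) simp
      then have "norm (u (T (\<nu> m)) * y) \<le> (\<Sum>i\<in>F1. norm i * norm i) * norm y"
        by (intro order_trans[OF norm_mult_ineq mult_right_mono]) auto
      then show ?thesis using norm_triangle_ineq4[of y "u (T (\<nu> m)) * y"] by linarith
    qed
    ultimately have "(\<lambda>m. (y - u (T (\<nu> m)) * y) * R j m) \<simeq> (\<lambda>m. (y - u (T (\<nu> m)) * y) * (u (r j (\<nu> m + 1)) * R j m))"
      by (rule asymp_eq_mult_left)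
    then have "(\<lambda>m. y * R j m - u (T (\<nu> m)) * y * R j m) \<simeq> (\<lambda>m. (y * u (r j (\<nu> m + 1)) - u (T (\<nu> m)) * y * u (r j (\<nu> m + 1))) * R j m)"
      by (simp add: left_diff_distrib mult.assoc)
    with 2 show ?thesis by (rule asymp_eq_trans)
  qed
  have \<epsilon>c: "0 < \<epsilon> * c" using \<epsilon> c by simp
  have ev2: "\<forall>\<^sub>F m in sequentially. norm (norm (y * R j m - (\<Sum>i\<in>F1. cs2 (e.phi (st1 i * x * j)) (R i m))) -
       norm ((y * u (r j (\<nu> m + 1)) - u (T (\<nu> m)) * y * u (r j (\<nu> m + 1))) * R j m)) \<le> \<epsilon> * c"
    by (rule null_eventually_le[OF asymp_eq_norm[OF RT] \<epsilon>c])
  have "(\<lambda>m. norm (R j m) - norm (R 1 m)) \<longlonglongrightarrow> 0" using F(3) jF unfolding imitates_def R_def by blast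
  then have ev3: "\<forall>\<^sub>F m in sequentially. norm (norm (R j m) - norm (R 1 m)) \<le> c" by (rule null_eventually_le[OF _ c(1)])
  \<comment> \<open>The constant is \<open>5 = 2 * 2 + 1\<close>: \<open>2 \<epsilon>\<close> for
    the compression, a factor 2 because eventually \<parallel>R j m\<parallel> \<le> 2 \<parallel>R
    1 m\<parallel>, and one \<epsilon> for the asymptotic error, measured against the lower bound
    \<open>c\<close> of \<parallel>R 1 m\<parallel>.\<close>
  show ?thesis unfolding R_def[symmetric] using ev1 ev2 ev3 c(2)
  proof eventually_elim
    case (elim m)
    have "norm ((y * u (r j (\<nu> m + 1)) - u (T (\<nu> m)) * y * u (r j (\<nu> m + 1))) * R j m) \<le> 2 * \<epsilon> * norm (R j m)"
      by (rule order_trans[OF norm_mult_ineq mult_right_mono[OF elim(1)]]) simp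
    also have "\<dots> \<le> 2 * \<epsilon> * (2 * norm (R 1 m))" using elim(3,4) \<epsilon> by (intro mult_left_mono) auto
    finally have 1: "norm ((y * u (r j (\<nu> m + 1)) - u (T (\<nu> m)) * y * u (r j (\<nu> m + 1))) * R j m) \<le> 4 * (\<epsilon> * norm (R 1 m))" by simp
    have "\<epsilon> * c \<le> \<epsilon> * norm (R 1 m)" using elim(4) \<epsilon> by (intro mult_left_mono) auto
    then show ?case using elim(2) 1 by (simp add: abs_le_iff)
  qed
qed

text \<open>The matrix of \<open>x\<close> is applied to the coordinates of \<open>f\<close>, after
  enlarging the family until it nearly contains every \<open>x * j\<close>; on the imitating vectors
  \<open>y\<close> has the same matrix.\<close>

lemma tracked_letter_mult:
  assumes "tracked f g" and xy: "(x, y) \<in> letters" shows "tracked (x * f) (y * g)"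
proof (rule trackedI)
  have A: "f \<in> e.A" using assms by (auto simp: tracked_def)
  have xA: "x \<in> e.A" by (rule letter_A[OF xy])
  show "x * f \<in> e.A" by (rule e.A_mult[OF xA A])
  fix \<epsilon> :: real and F0 assume \<epsilon>: "0 < \<epsilon>" and F0: "e.orth F0" "e.linked Xs F0"
  define K where "K = norm x + 1"
  have K: "0 < K" "norm x \<le> K" by (auto simp: K_def add_nonneg_pos)
  define \<epsilon>1 where "\<epsilon>1 = \<epsilon> / (2 * K)"
  have \<epsilon>1: "0 < \<epsilon>1" "K * \<epsilon>1 = \<epsilon> / 2" using \<epsilon> K by (auto simp: \<epsilon>1_def)
  obtain F1 c where B1: "F0 \<subseteq> F1" "approximates \<epsilon>1 F1 c f g"
    by (rule trackedD[OF assms(1) \<epsilon>1(1) F0])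
  note 1 = approximatesD(1,2)[OF B1(2)] B1(1) approximatesD(3,4)[OF B1(2)]
  define M where "M = 1 + (\<Sum>j\<in>F1. cmod (c j))"
  have M: "0 < M" unfolding M_def by (intro add_pos_nonneg sum_nonneg) auto
  \<comment> \<open>The 10 combines the constant 5 of \<open>letter_on_Rv\<close> with the half of
    \<epsilon> reserved for this error.\<close>
  define \<epsilon>2 where "\<epsilon>2 = \<epsilon> / (10 * M)"
  have \<epsilon>2: "0 < \<epsilon>2" "M * (5 * \<epsilon>2) = \<epsilon> / 2" using \<epsilon> M by (auto simp: \<epsilon>2_def)
  have "\<exists>G. e.orth G \<and> e.linked Xs G \<and> F1 \<subseteq> G \<and> (\<forall>(x, j)\<in>{x} \<times> F1. e.N (x * j - e.proj G (x * j)) \<le> \<epsilon>2)"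
    by (rule e.linked_extend[OF 1(1,2) _ _ Xs_A \<epsilon>2(1)]) (use e.orthD(1)[OF 1(1)] letter_Xs[OF xy] in auto)
  then obtain F2 where F2: "e.orth F2" "e.linked Xs F2" "F1 \<subseteq> F2" "\<And>j. j \<in> F1 \<Longrightarrow> e.N (x * j - e.proj F2 (x * j)) \<le> \<epsilon>2"
    by auto
  define d where "d i = (\<Sum>j\<in>F1. c j * e.phi (st1 i * x * j))" for i
  have s1: "(\<Sum>i\<in>F2. cs1 (d i) i) = (\<Sum>j\<in>F1. cs1 (c j) (e.proj F2 (x * j)))"
    unfolding d_def e.proj_def by (simp add: a.cs_sum_left a.cs_sum_right a.cs_cs mult.assoc) (rule sum.swap)
  have s2: "(\<Sum>i\<in>F2. cs2 (d i) (v i)) = (\<Sum>j\<in>F1. cs2 (c j) (\<Sum>i\<in>F2. cs2 (e.phi (st1 i * x * j)) (v i)))" for v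
    unfolding d_def by (simp add: b.cs_sum_left b.cs_sum_right b.cs_cs mult.assoc) (rule sum.swap)
  have sumM: "(\<Sum>j\<in>F1. cmod (c j) * s) \<le> M * s" if "0 \<le> s" for s
    using that by (simp add: M_def sum_distrib_right[symmetric] distrib_right)
  have "e.N (x * f - (\<Sum>i\<in>F2. cs1 (d i) i)) \<le> \<epsilon>"
  proof -
    have jA: "j \<in> e.A" if "j \<in> F1" for j using e.orthD(3)[OF 1(1) that] .
    have eq: "x * f - (\<Sum>i\<in>F2. cs1 (d i) i) = x * (f - (\<Sum>i\<in>F1. cs1 (c i) i)) + (\<Sum>j\<in>F1. cs1 (c j) (x * j - e.proj F2 (x * j)))"
      unfolding s1 by (simp add: right_diff_distrib sum_distrib_left a.cs_mult_right a.cs_diff_right sum_subtractf)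
    have "e.N (x * f - (\<Sum>i\<in>F2. cs1 (d i) i)) \<le> e.N (x * (f - (\<Sum>i\<in>F1. cs1 (c i) i))) + e.N (\<Sum>j\<in>F1. cs1 (c j) (x * j - e.proj F2 (x * j)))"
      unfolding eq
      by (intro e.N_triangle e.A_mult e.A_diff e.A_sum e.A_cs A xA e.comb_A[OF 1(1)] e.proj_A F2 jA)
    also have "e.N (x * (f - (\<Sum>i\<in>F1. cs1 (c i) i))) \<le> K * \<epsilon>1"
      by (rule order_trans[OF e.N_mult[OF xA e.A_diff[OF A e.comb_A[OF 1(1)]]] mult_mono[OF K(2) 1(4)]]) (use K e.N_nonneg in auto)
    also have "e.N (\<Sum>j\<in>F1. cs1 (c j) (x * j - e.proj F2 (x * j))) \<le> (\<Sum>j\<in>F1. e.N (cs1 (c j) (x * j - e.proj F2 (x * j))))"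
      by (intro e.N_sum e.A_cs e.A_diff e.A_mult xA jA e.proj_A F2)
    also have "\<dots> \<le> (\<Sum>j\<in>F1. cmod (c j) * (5 * \<epsilon>2))"
    proof (rule sum_mono)
      fix j assume j: "j \<in> F1"
      have "e.N (cs1 (c j) (x * j - e.proj F2 (x * j))) = cmod (c j) * e.N (x * j - e.proj F2 (x * j))"
        by (intro e.N_cs e.A_diff e.A_mult xA jA[OF j] e.proj_A F2)
      then show "e.N (cs1 (c j) (x * j - e.proj F2 (x * j))) \<le> cmod (c j) * (5 * \<epsilon>2)"
        using F2(4)[OF j] \<epsilon>2(1) by (simp add: mult_left_mono)
    qed
    also have "\<dots> \<le> M * (5 * \<epsilon>2)" using \<epsilon>2(1) by (intro sumM) simp
    finally show ?thesis using \<epsilon>1 \<epsilon>2 by simp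
  qed
  moreover have "\<forall>\<^sub>F m in sequentially. norm (y * g * Rv \<nu> z 1 m - (\<Sum>i\<in>F2. cs2 (d i) (Rv \<nu> z i m))) \<le> \<epsilon> * norm (Rv \<nu> z 1 m)"
    if F: "e.orth F" "F2 \<subseteq> F" "imitates F \<nu> z" for F \<nu> z
  proof -
    have F1F: "F1 \<subseteq> F" using F(2) F2(3) by blast
    define S where "S j m = y * Rv \<nu> z j m - (\<Sum>i\<in>F2. cs2 (e.phi (st1 i * x * j)) (Rv \<nu> z i m))" for j m
    have "\<forall>j\<in>F1. \<forall>\<^sub>F m in sequentially. norm (S j m) \<le> 5 * \<epsilon>2 * norm (Rv \<nu> z 1 m)"
      unfolding S_def using letter_on_Rv[OF xy F2(1) _ \<epsilon>2(1) F2(4) F] F2(3) by blast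
    then have "\<forall>\<^sub>F m in sequentially. \<forall>j\<in>F1. norm (S j m) \<le> 5 * \<epsilon>2 * norm (Rv \<nu> z 1 m)"
      using e.orthD(1)[OF 1(1)] by (simp add: eventually_ball_finite)
    with 1(5)[OF F(1) F1F F(3)] show ?thesis
    proof eventually_elim
      case (elim m)
      define \<rho> where "\<rho> = norm (Rv \<nu> z 1 m)"
      have eq: "y * g * Rv \<nu> z 1 m - (\<Sum>i\<in>F2. cs2 (d i) (Rv \<nu> z i m)) =
          y * (g * Rv \<nu> z 1 m - (\<Sum>i\<in>F1. cs2 (c i) (Rv \<nu> z i m))) + (\<Sum>j\<in>F1. cs2 (c j) (S j m))"
        unfolding s2 S_def by (simp add: right_diff_distrib sum_distrib_left b.cs_mult_right b.cs_diff_right sum_subtractf mult.assoc)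
      have "norm (y * (g * Rv \<nu> z 1 m - (\<Sum>i\<in>F1. cs2 (c i) (Rv \<nu> z i m)))) \<le> K * (\<epsilon>1 * \<rho>)"
        using elim(1) K letter_norm[OF xy] by (intro order_trans[OF norm_mult_ineq mult_mono]) (auto simp: \<rho>_def)
      moreover have "norm (\<Sum>j\<in>F1. cs2 (c j) (S j m)) \<le> M * (5 * \<epsilon>2 * \<rho>)"
      proof -
        have "norm (\<Sum>j\<in>F1. cs2 (c j) (S j m)) \<le> (\<Sum>j\<in>F1. cmod (c j) * (5 * \<epsilon>2 * \<rho>))"
          using elim(2) by (intro sum_norm_le) (auto simp: b.norm_cs \<rho>_def intro!: mult_left_mono)
        also have "\<dots> \<le> M * (5 * \<epsilon>2 * \<rho>)" using \<epsilon>2(1) by (intro sumM) (simp add: \<rho>_def)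
        finally show ?thesis .
      qed
      ultimately have "norm (y * g * Rv \<nu> z 1 m - (\<Sum>i\<in>F2. cs2 (d i) (Rv \<nu> z i m))) \<le> K * (\<epsilon>1 * \<rho>) + M * (5 * \<epsilon>2 * \<rho>)"
        unfolding eq by (intro norm_triangle_le add_mono)
      also have "\<dots> = (K * \<epsilon>1 + M * (5 * \<epsilon>2)) * \<rho>" by (simp add: algebra_simps)
      finally show ?case using \<epsilon>1 \<epsilon>2 by (simp add: \<rho>_def)
    qed
  qed
  ultimately have "approximates \<epsilon> F2 d (x * f) (y * g)"
    unfolding approximates_def using F2(1-3) 1(3) by blast
  then show "\<exists>F1 c. F0 \<subseteq> F1 \<and> approximates \<epsilon> F1 c (x * f) (y * g)" using F2(1-3) 1(3) by blast
qed

lemma tracked_words: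
  assumes "(f, g) \<in> words cs1 cs2 letters" shows "tracked f g"
  using assms
proof (induction rule: words.induct[split_format(complete)])
  case (letter x y)
  then show ?case using tracked_letter_mult[OF tracked_1, of x y] by simp
qed (auto intro: tracked_letter_mult tracked_add tracked_scale)

text \<open>\<open>phi f\<close> is nearly the coordinate \<open>c 1\<close>. On the second side
  \<open>u (r 1 n)\<close>, a contraction, extracts from \<open>g * R 1 m\<close> nearly the
  component \<open>c 1\<close> times \<open>R 1 m\<close>; hence \<parallel>g\<parallel> bounds
  \<open>c 1\<close> up to \<epsilon>.\<close>

lemma tracked_phi_le:
  assumes fg: "tracked f g" shows "cmod (e.phi f) \<le> norm g"
proof (rule field_le_epsilon)
  fix \<eta> :: real assume \<eta>: "0 < \<eta>"
  define \<epsilon> where "\<epsilon> = \<eta> / 2"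
  have \<epsilon>: "0 < \<epsilon>" using \<eta> by (simp add: \<epsilon>_def)
  have fA: "f \<in> e.A" using fg by (simp add: tracked_def)
  obtain F c where "approximates \<epsilon> F c f g" by (rule trackedD[OF fg \<epsilon> e.orth_singleton e.linked_singleton])
  note F = approximatesD[OF this]
  have F1: "1 \<in> F" using F(2) by (simp add: e.linked_def)
  obtain \<nu> z where im: "imitates F \<nu> z" using imitates_exists[OF F(1,2)] .
  define R where "R = Rv \<nu> z"
  have \<nu>: "m \<le> \<nu> m" and z: "norm (z m) = 1" for m using im by (auto simp: imitates_def)
  obtain k where k: "0 < k" "\<forall>\<^sub>F m in sequentially. k \<le> norm (R 1 m)" using im unfolding imitates_def R_def by blast
  have ev1: "\<forall>\<^sub>F m in sequentially. norm (g * R 1 m - (\<Sum>i\<in>F. cs2 (c i) (R i m))) \<le> \<epsilon> * norm (R 1 m)"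
    using F(4)[OF F(1) order_refl im] by (simp add: R_def)
  have r1: "norm (u (r 1 n)) \<le> 1" for n
    using iso[OF r_A1[OF e.W_1]] norm_r[of 1 n] by simp
  have "(\<lambda>m. \<Sum>i\<in>F. cs2 (c i) (u (r 1 (\<nu> m)) * R i m)) \<simeq> (\<lambda>m. \<Sum>i\<in>F. cs2 (c i) (if 1 = i then R i m else 0))"
    unfolding R_def using u_r_Rv[OF F(1) F1 _ \<nu> z, of _ 0] by (intro asymp_eq_sum b.asymp_eq_cs) simp
  moreover have "(\<Sum>i\<in>F. cs2 (c i) (if 1 = i then R i m else 0)) = cs2 (c 1) (R 1 m)" for m
  proof -
    have "(\<Sum>i\<in>F. cs2 (c i) (if 1 = i then R i m else 0)) = (\<Sum>i\<in>F. if 1 = i then cs2 (c i) (R i m) else 0)"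
      by (intro sum.cong) auto
    then show ?thesis using e.orthD(1)[OF F(1)] F1 by simp
  qed
  ultimately have "(\<lambda>m. u (r 1 (\<nu> m)) * (\<Sum>i\<in>F. cs2 (c i) (R i m))) \<simeq> (\<lambda>m. cs2 (c 1) (R 1 m))"
    by (simp add: sum_distrib_left b.cs_mult_right)
  then have "(\<lambda>m. norm (u (r 1 (\<nu> m)) * (\<Sum>i\<in>F. cs2 (c i) (R i m))) - norm (cs2 (c 1) (R 1 m))) \<longlonglongrightarrow> 0"
    by (rule asymp_eq_norm)
  from order_tendstoD(1)[OF this, of "- \<epsilon>' * k" for \<epsilon>']
  have ev2: "\<forall>\<^sub>F m in sequentially. - \<epsilon>' * k < norm (u (r 1 (\<nu> m)) * (\<Sum>i\<in>F. cs2 (c i) (R i m))) - norm (cs2 (c 1) (R 1 m))"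
    if "0 < \<epsilon>'" for \<epsilon>' using that k(1) by simp
  have c1: "cmod (c 1) \<le> norm g + \<epsilon>"
  proof (rule field_le_epsilon)
    fix \<epsilon>' :: real assume \<epsilon>': "0 < \<epsilon>'"
    have "\<forall>\<^sub>F m in sequentially. cmod (c 1) \<le> norm g + \<epsilon> + \<epsilon>'"
      using ev1 ev2[OF \<epsilon>'] k(2)
    proof eventually_elim
      case (elim m)
      have "cmod (c 1) * norm (R 1 m) = norm (cs2 (c 1) (R 1 m))" by (simp add: b.norm_cs)
      also have "\<dots> \<le> norm (u (r 1 (\<nu> m)) * (\<Sum>i\<in>F. cs2 (c i) (R i m))) + \<epsilon>' * k" using elim(2) by simp
      also have "norm (u (r 1 (\<nu> m)) * (\<Sum>i\<in>F. cs2 (c i) (R i m))) \<le> norm (\<Sum>i\<in>F. cs2 (c i) (R i m))"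
        using norm_mult_ineq[of "u (r 1 (\<nu> m))" "\<Sum>i\<in>F. cs2 (c i) (R i m)"] mult_right_mono[OF r1[of "\<nu> m"], of "norm (\<Sum>i\<in>F. cs2 (c i) (R i m))"]
        by simp
      also have "norm (\<Sum>i\<in>F. cs2 (c i) (R i m)) \<le> norm (g * R 1 m) + \<epsilon> * norm (R 1 m)"
        using elim(1) norm_triangle_sub[of "\<Sum>i\<in>F. cs2 (c i) (R i m)" "g * R 1 m"] by (simp add: norm_minus_commute)
      also have "norm (g * R 1 m) \<le> norm g * norm (R 1 m)" by (rule norm_mult_ineq)
      also have "\<epsilon>' * k \<le> \<epsilon>' * norm (R 1 m)" using elim(3) \<epsilon>' by (intro mult_left_mono) auto
      finally have "cmod (c 1) * norm (R 1 m) \<le> (norm g + \<epsilon> + \<epsilon>') * norm (R 1 m)" by (simp add: distrib_right)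
      moreover have "0 < norm (R 1 m)" using elim(3) k(1) by linarith
      ultimately show ?case by (simp only: mult_le_cancel_right_pos)
    qed
    then show "cmod (c 1) \<le> norm g + \<epsilon> + \<epsilon>'" by simp
  qed
  have "e.phi (f - (\<Sum>i\<in>F. cs1 (c i) i)) = e.phi f - c 1"
    using e.phi_diff[OF fA e.comb_A[OF F(1)]] e.phi_comb[OF F(1) F1] by simp
  then have "cmod (e.phi f - c 1) \<le> \<epsilon>"
    using e.phi_le_N[OF e.A_diff[OF fA e.comb_A[OF F(1)]]] F(3) by (metis order_trans)
  then show "cmod (e.phi f) \<le> norm g + \<eta>"
    using c1 norm_triangle_sub[of "e.phi f" "c 1"] by (simp add: \<epsilon>_def)
qed

end

section \<open>The graph of the extension\<close>

lemma words_mono: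
  assumes "w \<in> words cs1 cs2 L" "L \<subseteq> L'" shows "w \<in> words cs1 cs2 L'"
  using assms(1) by induction (use assms(2) in \<open>auto intro: words.intros\<close>)

lemma words_converse:
  assumes "(f, g) \<in> words cs1 cs2 L" shows "(g, f) \<in> words cs2 cs1 (L\<inverse>)"
  using assms by (induction rule: words.induct[split_format(complete)]) (auto intro: words.intros)

lemma closure_converse: "(closure K)\<inverse> = closure (K\<inverse>)"
proof -
  have "(closure K)\<inverse> \<subseteq> closure (K\<inverse>)" for K :: "('c::topological_space \<times> 'd::topological_space) set"
  proof -
    have "prod.swap ` closure K \<subseteq> closure (K\<inverse>)"
    proof (rule image_closure_subset)
      show "prod.swap ` K \<subseteq> closure (K\<inverse>)" using closure_subset[of "K\<inverse>"] by auto
    qed (auto intro: continuous_on_swap)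
    then show ?thesis by force
  qed
  from this[of K] this[of "K\<inverse>"] show ?thesis by auto
qed

section \<open>Algebraic closure of words, and uniqueness of star-homomorphisms\<close>

locale cstar_pair =
  a: cstar_algebra cs1 st1 + b: cstar_algebra cs2 st2
  for cs1 :: "complex \<Rightarrow> 'a::{real_normed_algebra_1,banach} \<Rightarrow> 'a" and st1
    and cs2 :: "complex \<Rightarrow> 'b::{real_normed_algebra_1,banach} \<Rightarrow> 'b" and st2
begin

lemma words_mult:
  assumes "(f, g) \<in> words cs1 cs2 L" "(f', g') \<in> words cs1 cs2 L"
  shows "(f * f', g * g') \<in> words cs1 cs2 L"
  using assms(1)
proof (induction rule: words.induct[split_format(complete)])
  case (letter x y)
  then show ?case by (rule words.mult[OF _ assms(2)])
next
  case (mult x y f g)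
  then show ?case by (auto simp: mult.assoc intro: words.mult)
next
  case (add f g f' g')
  then show ?case by (auto simp: distrib_right intro: words.add)
next
  case (scale f g c)
  then show ?case by (auto simp: a.cs_mult_left b.cs_mult_left intro: words.scale)
qed

lemma words_st:
  assumes L: "\<And>x y. (x, y) \<in> L \<Longrightarrow> (st1 x, st2 y) \<in> L" and "(f, g) \<in> words cs1 cs2 L"
  shows "(st1 f, st2 g) \<in> words cs1 cs2 L"
  using assms(2)
proof (induction rule: words.induct[split_format(complete)])
  case (letter x y)
  then show ?case by (intro words.letter L)
next
  case (mult x y f g)
  then show ?case unfolding a.st_mult b.st_mult using words_mult[OF mult(3) words.letter[OF L[OF mult(1)]]] by simp
next
  case (add f g f' g')
  then show ?case unfolding a.st_add b.st_add by (intro words.add)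
next
  case (scale f g c)
  then show ?case unfolding a.st_cs b.st_cs by (intro words.scale)
qed

lemma words_0: "L \<noteq> {} \<Longrightarrow> (0, 0) \<in> words cs1 cs2 L"
  using words.scale[OF words.letter, where c = 0 and ?cs1.0 = cs1 and ?cs2.0 = cs2] by fastforce

lemma words_in_subalgebra:
  assumes B: "cstar_subalg cs1 st1 B" and L: "Domain L \<subseteq> B"
    and xy: "(x, y) \<in> closure (words cs1 cs2 L)"
  shows "x \<in> B"
proof -
  have "f \<in> B" if "(f, g) \<in> words cs1 cs2 L" for f g
    using that
  proof (induction rule: words.induct[split_format(complete)])
    case (mult x y f g)
    then have "x \<in> B" using L by auto
    then show ?case using mult by (intro a.cstar_subalgD(5)[OF B])
  qed (use L in \<open>auto intro: a.cstar_subalgD[OF B]\<close>)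
  then have "fst ` words cs1 cs2 L \<subseteq> B" by auto
  then have "fst ` closure (words cs1 cs2 L) \<subseteq> B"
    by (intro image_closure_subset a.cstar_subalgD(1)[OF B] continuous_intros)
  then show ?thesis using xy by force
qed

text \<open>For a self-adjoint contraction \<open>h\<close> the element \<open>cosqrt h\<close> lies
  in the possibly non-unital \<open>A\<close>, and its image exhibits \<open>1 - V h\<close> as a
  square. Applied to \<open>h\<close> and \<open>- h\<close> this bounds \<open>V\<close> on
  self-adjoint elements; the C*-identity gives the rest.\<close>

lemma star_hom_contractive:
  assumes A: "cstar_subalg cs1 st1 A" and lin: "clinear_on cs1 cs2 A V" and mult: "multiplicative_on A V"
    and star: "\<And>x. x \<in> A \<Longrightarrow> V (st1 x) = st2 (V x)" and x: "x \<in> A"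
  shows "norm (V x) \<le> norm x"
proof -
  note AD = a.cstar_subalgD[OF A]
  have add: "V (x + y) = V x + V y" if "x \<in> A" "y \<in> A" for x y
    using lin that by (simp add: clinear_on_def)
  have scale: "V (c *\<^sub>R x) = c *\<^sub>R V x" if "x \<in> A" for c x
    using lin that a.cs_of_real b.cs_of_real unfolding clinear_on_def by metis
  have one: "b.pos (1 - V h)" if h: "h \<in> A" "st1 h = h" "norm h \<le> 1" for h
  proof -
    have Y: "cosqrt h \<in> A" by (rule cosqrt_in[OF h(3) AD(1,4)]) (intro AD h)
    have sY: "st2 (V (cosqrt h)) = V (cosqrt h)"
      using star[OF Y] a.st_cosqrt[OF h(3,2)] by simp
    have "2 *\<^sub>R V (cosqrt h) = V h + V (cosqrt h) * V (cosqrt h)"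
      using cosqrt_fixpoint[OF h(3)] add[OF h(1) AD(5)[OF Y Y]] scale[OF Y, of 2] mult Y
      by (simp add: multiplicative_on_def)
    then have "1 - V h = (1 - V (cosqrt h)) * (1 - V (cosqrt h))"
      by (simp add: algebra_simps scaleR_2)
    then show ?thesis using b.pos_square[of "1 - V (cosqrt h)"] sY by (simp add: b.st_diff)
  qed
  have sa1: "norm (V h) \<le> 1" if h: "h \<in> A" "st1 h = h" "norm h \<le> 1" for h
  proof -
    have "- h \<in> A" using AD(10)[OF h(1), of "-1"] by simp
    moreover have "V (- h) = - V h" using scale[OF h(1), of "-1"] by simp
    ultimately have "b.pos (1 + V h)" using one[of "- h"] h by (simp add: a.st_minus)
    then show ?thesis
      using b.norm_le_of_pos_pair[of "V h" 1] one[OF h] star[OF h(1)] h by simp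
  qed
  have sa: "norm (V h) \<le> norm h" if h: "h \<in> A" "st1 h = h" for h
  proof (cases "h = 0")
    case True
    then show ?thesis using scale[OF h(1), of 0] by simp
  next
    case False
    then have "norm (V ((1 / norm h) *\<^sub>R h)) \<le> 1" using h by (intro sa1 AD) (auto simp: a.st_scaleR)
    then show ?thesis using False scale[OF h(1)] by (simp add: divide_le_eq)
  qed
  have "(norm (V x))\<^sup>2 = norm (V (st1 x * x))"
    using star[OF x] mult x AD(6)[OF x] by (simp add: multiplicative_on_def b.norm_st_mult)
  also have "\<dots> \<le> norm (st1 x * x)" by (intro sa AD x) (simp add: a.st_mult)
  also have "\<dots> = (norm x)\<^sup>2" by (rule a.norm_st_mult)
  finally show ?thesis by (rule power2_le_imp_le) simp
qed

text \<open>Both maps are contractive, so the set where they agree is closed, hence a C*-subalgebra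
  containing \<open>S\<close>.\<close>

lemma star_homs_agree:
  assumes G: "cstar_subalg cs1 st1 (generated_cstar cs1 st1 S)"
    and V: "clinear_on cs1 cs2 (generated_cstar cs1 st1 S) V" "multiplicative_on (generated_cstar cs1 st1 S) V"
      "\<And>x. x \<in> generated_cstar cs1 st1 S \<Longrightarrow> V (st1 x) = st2 (V x)"
    and U: "clinear_on cs1 cs2 (generated_cstar cs1 st1 S) U" "multiplicative_on (generated_cstar cs1 st1 S) U"
      "\<And>x. x \<in> generated_cstar cs1 st1 S \<Longrightarrow> U (st1 x) = st2 (U x)"
    and eq: "\<And>x. x \<in> S \<Longrightarrow> V x = U x" and x: "x \<in> generated_cstar cs1 st1 S"
  shows "V x = U x"
proof -
  define A where "A = generated_cstar cs1 st1 S"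
  note AD = a.cstar_subalgD[OF G, folded A_def]
  note V = V[folded A_def] and U = U[folded A_def]
  have lip: "norm (V x - V y) \<le> norm (x - y)" "norm (U x - U y) \<le> norm (x - y)" if "x \<in> A" "y \<in> A" for x y
  proof -
    have "f (x - y) = f x - f y" if f: "clinear_on cs1 cs2 A f" for f
    proof -
      have "f x = f ((x - y) + y)" by simp
      also have "\<dots> = f (x - y) + f y" using f AD(8) \<open>x \<in> A\<close> \<open>y \<in> A\<close> unfolding clinear_on_def by blast
      finally show ?thesis by simp
    qed
    then show "norm (V x - V y) \<le> norm (x - y)" "norm (U x - U y) \<le> norm (x - y)"
      using star_hom_contractive[OF G[folded A_def] V, of "x - y"]
        star_hom_contractive[OF G[folded A_def] U, of "x - y"] V(1) U(1) AD(8)[OF that] by auto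
  qed
  define E where "E = {x\<in>A. V x = U x}"
  have "closed E"
    unfolding closed_sequential_limits
  proof (intro allI impI)
    fix f l assume f: "(\<forall>n. f n \<in> E) \<and> f \<longlonglongrightarrow> l"
    then have fA: "f n \<in> A" "V (f n) = U (f n)" for n by (auto simp: E_def)
    then have l: "l \<in> A" using AD(1) f unfolding closed_sequential_limits by blast
    have 0: "(\<lambda>n. norm (f n - l)) \<longlonglongrightarrow> 0" using f by (simp add: tendsto_norm_zero LIM_zero)
    have "(\<lambda>n. V (f n)) \<longlonglongrightarrow> V l"
      by (rule LIM_zero_cancel, rule Lim_null_comparison[OF _ 0]) (use lip(1)[OF fA(1) l] in simp)
    moreover have "(\<lambda>n. V (f n)) \<longlonglongrightarrow> U l"
      unfolding fA(2)
      by (rule LIM_zero_cancel, rule Lim_null_comparison[OF _ 0]) (use lip(2)[OF fA(1) l] in simp)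
    ultimately show "l \<in> E" using LIMSEQ_unique l by (auto simp: E_def)
  qed
  moreover have "csubspace cs1 E"
  proof -
    have "V 0 = U 0"
      using V(1) U(1) AD(4) unfolding clinear_on_def by (metis a.cs_0 b.cs_0)
    then show ?thesis using V(1) U(1) AD unfolding csubspace_def clinear_on_def E_def by auto
  qed
  ultimately have "cstar_subalg cs1 st1 E"
    using V(2,3) U(2,3) AD unfolding cstar_subalg_def banach_subalg_def multiplicative_on_def E_def by auto
  moreover have "S \<subseteq> E" using eq unfolding E_def A_def generated_cstar_def by blast
  ultimately have "A \<subseteq> E" unfolding A_def generated_cstar_def by blast
  then show ?thesis using x by (auto simp: E_def A_def)
qed

end

section \<open>Closed star-algebras of pairs as graphs\<close>

locale star_graph = cstar_pair +
  fixes K :: "('a::{real_normed_algebra_1,banach} \<times> 'b::{real_normed_algebra_1,banach}) set"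
  assumes K_closed: "closed K" and K_0: "(0, 0) \<in> K"
    and K_add: "(x, y) \<in> K \<Longrightarrow> (x', y') \<in> K \<Longrightarrow> (x + x', y + y') \<in> K"
    and K_cs: "(x, y) \<in> K \<Longrightarrow> (cs1 c x, cs2 c y) \<in> K"
    and K_mult: "(x, y) \<in> K \<Longrightarrow> (x', y') \<in> K \<Longrightarrow> (x * x', y * y') \<in> K"
    and K_st: "(x, y) \<in> K \<Longrightarrow> (st1 x, st2 y) \<in> K"
    and K_zero: "(0, y) \<in> K \<Longrightarrow> y = 0"
begin

lemma K_scaleR: "(x, y) \<in> K \<Longrightarrow> (r *\<^sub>R x, r *\<^sub>R y) \<in> K"
  using K_cs[of x y "complex_of_real r"] by (simp add: a.cs_of_real b.cs_of_real)

lemma K_diff: "(x, y) \<in> K \<Longrightarrow> (x', y') \<in> K \<Longrightarrow> (x - x', y - y') \<in> K"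
  using K_add[of x y "(-1) *\<^sub>R x'" "(-1) *\<^sub>R y'"] K_scaleR[of x' y' "-1"] by simp

lemma K_power: "(x, y) \<in> K \<Longrightarrow> (x ^ Suc n, y ^ Suc n) \<in> K"
  by (induction n) (auto intro: K_mult)

lemma K_unique: "(x, y) \<in> K \<Longrightarrow> (x, y') \<in> K \<Longrightarrow> y = y'"
  using K_zero[of "y - y'"] K_diff[of x y x y'] by simp

lemma K_limit:
  assumes "\<And>n. (f n, g n) \<in> K" "f \<longlonglongrightarrow> x" "g \<longlonglongrightarrow> y" shows "(x, y) \<in> K"
  by (rule closed_sequentially[OF K_closed assms(1) tendsto_Pair[OF assms(2,3)]])

lemma K_cosqrt:
  assumes "(x, y) \<in> K" "norm x \<le> 1" "norm y \<le> 1" shows "(cosqrt x, cosqrt y) \<in> K"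
proof (rule K_limit[OF _ sqrt_iter_tendsto sqrt_iter_tendsto])
  show "(sqrt_iter x n, sqrt_iter y n) \<in> K" for n
    by (induction n) (auto intro!: K_0 K_scaleR K_add K_mult assms)
qed (use assms in auto)

text \<open>A pair whose first component is smaller than the second is amplified to a pair \<open>k\<close> of positive
elements of norms at most \<open>1/2\<close> and exactly \<open>1\<close>. Then \<open>2 k - (1 - \<bar>1 - 2 k\<bar>)\<close> vanishes in the
first component only.\<close>
lemma norm_snd_le:
  assumes xy: "(x, y) \<in> K" shows "norm y \<le> norm x"
proof (rule ccontr)
  assume "\<not> norm y \<le> norm x"
  then have less: "norm x < norm y" by simp
  then have y0: "0 < norm y" using norm_ge_zero[of x] by linarith
  define s where "s = 1 / (norm y)\<^sup>2"
  have s: "0 < s" using y0 by (simp add: s_def)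
  define a1 a2 where "a1 = s *\<^sub>R (st1 x * x)" and "a2 = s *\<^sub>R (st2 y * y)"
  have aK: "(a1, a2) \<in> K" unfolding a1_def a2_def by (intro K_scaleR K_mult K_st xy)
  have a_pos: "a.pos a1" "b.pos a2" unfolding a1_def a2_def
    using s by (auto intro: a.pos_scaleR b.pos_scaleR a.pos_st_mult b.pos_st_mult)
  have "norm a1 = (norm x / norm y)\<^sup>2" using s by (simp add: a1_def a.norm_st_mult s_def power_divide)
  then have n1: "norm a1 < 1" using less y0 by (simp add: power_less_one_iff abs_square_less_1)
  have n2: "norm a2 = 1" using y0 s by (simp add: a2_def b.norm_st_mult s_def)
  have "(\<lambda>n. norm a1 ^ n) \<longlonglongrightarrow> 0" using n1 by (intro LIMSEQ_realpow_zero) auto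
  then have "\<forall>\<^sub>F n in sequentially. norm a1 ^ n < 1/2" by (rule order_tendstoD) simp
  then obtain n where n: "norm a1 ^ m < 1/2" if "n \<le> m" for m by (auto simp: eventually_sequentially)
  define k1 k2 where "k1 = a1 ^ 2 ^ n" and "k2 = a2 ^ 2 ^ n"
  have kK: "(k1, k2) \<in> K"
    using K_power[OF aK, of "2 ^ n - 1"] by (simp add: k1_def k2_def del: power_Suc)
  have k_pos: "a.pos k1" "b.pos k2" unfolding k1_def k2_def by (auto intro: a.pos_power b.pos_power a_pos)
  have k1: "norm k1 \<le> 1/2"
    using norm_power_ineq[of a1 "2 ^ n"] n[of "2 ^ n"] by (simp add: k1_def less_imp_le)
  have k2: "norm k2 = 1" using b.norm_power_sa[OF b.pos_sa[OF a_pos(2)]] n2 by (simp add: k2_def)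
  define x1 x2 where "x1 = 4 *\<^sub>R (k1 - k1 * k1)" and "x2 = 4 *\<^sub>R (k2 - k2 * k2)"
  have xK: "(x1, x2) \<in> K" unfolding x1_def x2_def by (intro K_scaleR K_diff K_mult kK)
  have eq1: "1 - x1 = (1 - 2 *\<^sub>R k1) * (1 - 2 *\<^sub>R k1)" and eq2: "1 - x2 = (1 - 2 *\<^sub>R k2) * (1 - 2 *\<^sub>R k2)"
    by (simp_all add: x1_def x2_def left_diff_distrib right_diff_distrib scaleR_diff_right)
      (simp_all flip: scaleR_left_distrib scaleR_minus_left scaleR_left_diff_distrib add: algebra_simps)
  have x1n: "norm x1 \<le> 1"
  proof (rule a.norm_le_one_of_pos)
    have "a.pos (k1 * (1 - k1))"
      using k1 k_pos by (intro a.pos_mult_commute a.pos_one_minus) (auto simp: a.pos_sa algebra_simps)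
    then show "a.pos x1" using a.pos_scaleR[of "k1 * (1 - k1)" 4] by (simp add: x1_def right_diff_distrib)
    show "a.pos (1 - x1)" unfolding eq1 by (rule a.pos_square) (simp add: a.st_diff a.st_scaleR a.pos_sa k_pos)
  qed
  have x2n: "norm x2 \<le> 1"
  proof (rule b.norm_le_one_of_pos)
    have "b.pos (k2 * (1 - k2))"
      using k2 k_pos by (intro b.pos_mult_commute b.pos_one_minus) (auto simp: b.pos_sa algebra_simps)
    then show "b.pos x2" using b.pos_scaleR[of "k2 * (1 - k2)" 4] by (simp add: x2_def right_diff_distrib)
    show "b.pos (1 - x2)" unfolding eq2 by (rule b.pos_square) (simp add: b.st_diff b.st_scaleR b.pos_sa k_pos)
  qed
  have sx: "st1 x1 = x1" by (simp add: x1_def a.st_scaleR a.st_diff a.st_mult a.pos_sa k_pos)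
  \<comment> \<open>\<open>r\<close> and \<open>q\<close> are commuting positive roots of the same
    element, hence equal; positivity of \<open>q\<close> uses \<parallel>k1\<parallel> \<le> 1/2. So
    \<open>cosqrt x1 = 2 k1\<close>, whereas \<open>cosqrt x2\<close> has norm at most 1 and
    \<open>2 k2\<close> has norm 2.\<close>
  define r where "r = 1 - cosqrt x1"
  define q where "q = 1 - 2 *\<^sub>R k1"
  have r: "a.pos r" unfolding r_def by (rule a.pos_one_minus[OF a.st_cosqrt[OF x1n sx] norm_cosqrt[OF x1n]])
  have q: "a.pos q" unfolding q_def using k1 by (intro a.pos_one_minus) (auto simp: a.st_scaleR a.pos_sa k_pos)
  have rq: "r * r = q * q" using cosqrt_square[OF x1n] eq1 by (simp add: r_def q_def)
  have "x1 * q = q * x1" by (simp add: x1_def q_def algebra_simps)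
  then have "cosqrt x1 * q = q * cosqrt x1" by (rule cosqrt_commute[OF x1n])
  then have c: "r * q = q * r" by (simp add: r_def algebra_simps)
  have "a.pos (r - q)" using a.pos_abs_minus[OF r a.pos_sa[OF q] rq c] .
  moreover have "a.pos (- (r - q))" using a.pos_abs_minus[OF q a.pos_sa[OF r] rq[symmetric] c[symmetric]] by simp
  ultimately have "r - q = 0" by (rule a.pos_antisym)
  then have "cosqrt x1 = 2 *\<^sub>R k1" by (simp add: r_def q_def)
  then have "(0, 2 *\<^sub>R k2 - cosqrt x2) \<in> K"
    using K_diff[OF K_scaleR[OF kK, of 2] K_cosqrt[OF xK x1n x2n]] by simp
  then have "cosqrt x2 = 2 *\<^sub>R k2" using K_zero by force
  then show False using norm_cosqrt[OF x2n] k2 by simp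
qed

text \<open>By \<open>norm_snd_le\<close> convergence of first components makes the second
  components Cauchy, so closedness of \<open>K\<close> passes to its domain.\<close>

lemma Domain_subalg: "cstar_subalg cs1 st1 (Domain K)"
proof -
  have "closed (Domain K)"
    unfolding closed_sequential_limits
  proof (intro allI impI)
    fix f l assume f: "(\<forall>n. f n \<in> Domain K) \<and> f \<longlonglongrightarrow> l"
    then have "\<forall>n. \<exists>y. (f n, y) \<in> K" by blast
    then obtain g where g: "\<And>n. (f n, g n) \<in> K" by metis
    have "Cauchy f" using f LIMSEQ_imp_Cauchy by blast
    then have "Cauchy g"
      unfolding Cauchy_def dist_norm using norm_snd_le[OF K_diff[OF g g]] by (meson le_less_trans)
    then obtain y where "g \<longlonglongrightarrow> y" using Cauchy_convergent_iff convergent_def by blast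
    then show "l \<in> Domain K" using K_limit[of f g l y] g f by blast
  qed
  then show ?thesis
    unfolding cstar_subalg_def banach_subalg_def csubspace_def
    by (auto intro: K_0 K_add K_cs K_mult K_st)
qed

definition K_map :: "'a \<Rightarrow> 'b" where "K_map x = (THE y. (x, y) \<in> K)"

lemma K_map_eq: "(x, y) \<in> K \<Longrightarrow> K_map x = y"
  unfolding K_map_def using K_unique by blast

lemma star_iso_K_map:
  assumes "\<And>x. (x, 0) \<in> K \<Longrightarrow> x = 0"
  shows "star_iso cs1 st1 cs2 st2 (Domain K) (Range K) K_map"
proof -
  have "inj_on K_map (Domain K)"
  proof (rule inj_onI)
    fix x x' assume "x \<in> Domain K" "x' \<in> Domain K" "K_map x = K_map x'"
    then obtain y where "(x, y) \<in> K" "(x', y) \<in> K" using K_map_eq by auto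
    from K_diff[OF this] show "x = x'" using assms[of "x - x'"] by simp
  qed
  moreover have "K_map ` Domain K = Range K" using K_map_eq by force
  moreover have "clinear_on cs1 cs2 (Domain K) K_map" unfolding clinear_on_def
    by (auto simp: K_map_eq[OF K_add] K_map_eq[OF K_cs] K_map_eq)
  moreover have "multiplicative_on (Domain K) K_map" unfolding multiplicative_on_def
    by (auto simp: K_map_eq[OF K_mult] K_map_eq)
  ultimately show ?thesis unfolding star_iso_def bij_betw_def
    by (auto simp: K_map_eq[OF K_st] K_map_eq)
qed

end

lemma (in cstar_pair) star_graph_closure_words:
  assumes ne: "L \<noteq> {}" and st: "\<And>x y. (x, y) \<in> L \<Longrightarrow> (st1 x, st2 y) \<in> L"
    and inj: "\<And>y. (0, y) \<in> closure (words cs1 cs2 L) \<Longrightarrow> y = 0"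
  shows "star_graph cs1 st1 cs2 st2 (closure (words cs1 cs2 L))"
proof -
  let ?W = "words cs1 cs2 L"
  have seq: "\<exists>f g. (\<forall>n. (f n, g n) \<in> ?W) \<and> f \<longlonglongrightarrow> x \<and> g \<longlonglongrightarrow> y" if xy: "(x, y) \<in> closure ?W" for x y
  proof -
    obtain s where s: "\<And>n. s n \<in> ?W" "s \<longlonglongrightarrow> (x, y)" using xy unfolding closure_sequential by blast
    then show ?thesis using tendsto_fst[OF s(2)] tendsto_snd[OF s(2)]
      by (intro exI[of _ "\<lambda>n. fst (s n)"] exI[of _ "\<lambda>n. snd (s n)"]) auto
  qed
  have lim: "(x, y) \<in> closure ?W" if "\<And>n. (f n, g n) \<in> ?W" "f \<longlonglongrightarrow> x" "g \<longlonglongrightarrow> y" for f g x y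
    unfolding closure_sequential using that tendsto_Pair[OF that(2,3)] by (intro exI[of _ "\<lambda>n. (f n, g n)"]) auto
  show ?thesis
  proof (intro star_graph.intro cstar_pair_axioms star_graph_axioms.intro)
    show "(0, 0) \<in> closure ?W" using words_0[OF ne] closure_subset by blast
  next
    fix x y x' y' assume "(x, y) \<in> closure ?W" "(x', y') \<in> closure ?W"
    then obtain f g f' g' where *: "\<And>n. (f n, g n) \<in> ?W" "f \<longlonglongrightarrow> x" "g \<longlonglongrightarrow> y"
      "\<And>n. (f' n, g' n) \<in> ?W" "f' \<longlonglongrightarrow> x'" "g' \<longlonglongrightarrow> y'" by (metis seq)
    show "(x + x', y + y') \<in> closure ?W"
      by (rule lim[of "\<lambda>n. f n + f' n" "\<lambda>n. g n + g' n"]) (intro words.add tendsto_add *)+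
    show "(x * x', y * y') \<in> closure ?W"
      by (rule lim[of "\<lambda>n. f n * f' n" "\<lambda>n. g n * g' n"]) (intro words_mult tendsto_mult *)+
  next
    fix x y c assume "(x, y) \<in> closure ?W"
    then obtain f g where *: "\<And>n. (f n, g n) \<in> ?W" "f \<longlonglongrightarrow> x" "g \<longlonglongrightarrow> y" by (metis seq)
    show "(cs1 c x, cs2 c y) \<in> closure ?W"
      by (rule lim[of "\<lambda>n. cs1 c (f n)" "\<lambda>n. cs2 c (g n)"])
        (intro words.scale a.tendsto_cs b.tendsto_cs tendsto_const *)+
    show "(st1 x, st2 y) \<in> closure ?W"
      by (rule lim[OF words_st[OF st *(1)] a.tendsto_st[OF *(2)] b.tendsto_st[OF *(3)]])
  qed (use inj in auto)
qed

section \<open>Reduction to finitely many letters\<close>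

context isometric_hom
begin

sublocale cstar_pair ..

lemma letters_of_st: "(x, y) \<in> letters_of Z \<Longrightarrow> (st1 x, st2 y) \<in> letters_of Z"
  by (auto simp: letters_of_def)

lemma letters_of_mono: "Z \<subseteq> Z' \<Longrightarrow> letters_of Z \<subseteq> letters_of Z'"
  by (auto simp: letters_of_def)

lemma words_finite:
  assumes "(f, g) \<in> words cs1 cs2 (letters_of Z)"
  shows "\<exists>X. finite X \<and> X \<subseteq> Z \<and> (f, g) \<in> words cs1 cs2 (letters_of X)"
proof -
  have l: "\<exists>X. finite X \<and> X \<subseteq> Z \<and> (x, y) \<in> letters_of X" if "(x, y) \<in> letters_of Z" for x y
    using that
  proof (cases rule: letters_of_cases)
    case 1
    then show ?thesis by (intro exI[of _ "{x}"]) (auto simp: letters_of_def)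
  next
    case (2 x')
    then show ?thesis by (intro exI[of _ "{x'}"]) (auto simp: letters_of_def)
  qed
  from assms show ?thesis
  proof (induction rule: words.induct[split_format(complete)])
    case (letter x y)
    then show ?case using l[of x y] words.letter by blast
  next
    case (mult x y f g)
    then obtain X X' where X: "finite X" "X \<subseteq> Z" "(x, y) \<in> letters_of X"
      "finite X'" "X' \<subseteq> Z" "(f, g) \<in> words cs1 cs2 (letters_of X')" using l by metis
    have "(x, y) \<in> letters_of (X \<union> X')" using X(3) letters_of_mono[of X "X \<union> X'"] by blast
    moreover have "(f, g) \<in> words cs1 cs2 (letters_of (X \<union> X'))" by (rule words_mono[OF X(6) letters_of_mono]) simp
    ultimately show ?case using X by (intro exI[of _ "X \<union> X'"]) (auto intro: words.mult)
  next
    case (add f g f' g')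
    then obtain X X' where X: "finite X" "X \<subseteq> Z" "(f, g) \<in> words cs1 cs2 (letters_of X)"
      "finite X'" "X' \<subseteq> Z" "(f', g') \<in> words cs1 cs2 (letters_of X')" by metis
    have "(f, g) \<in> words cs1 cs2 (letters_of (X \<union> X'))" by (rule words_mono[OF X(3) letters_of_mono]) simp
    moreover have "(f', g') \<in> words cs1 cs2 (letters_of (X \<union> X'))" by (rule words_mono[OF X(6) letters_of_mono]) simp
    ultimately show ?case using X by (intro exI[of _ "X \<union> X'"]) (auto intro: words.add)
  next
    case (scale f g c)
    then show ?case by (blast intro: words.scale)
  qed
qed

end

locale cartan_isometric_hom = isometric_hom cs1 st1 cs2 st2 A1 u + p: pseudo_cartan_inclusion cs1 st1 C D
  for cs1 :: "complex \<Rightarrow> 'a::{real_normed_algebra_1,banach} \<Rightarrow> 'a" and st1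
    and cs2 :: "complex \<Rightarrow> 'b::{real_normed_algebra_1,banach} \<Rightarrow> 'b" and st2 and A1 u C D +
  assumes D_A1: "D \<subseteq> A1" and A1_C: "A1 \<subseteq> C"
begin

lemma Domain_letters_C: "Domain (letters_of A1) \<subseteq> C"
  using A1_C by (auto simp: letters_of_def intro: p.C_closure)

text \<open>Where \<open>x\<close> is not small, a word \<open>f\<close> approximating \<open>x\<^sup>* x\<close> has a large value at some
excision, whereas the corresponding \<open>g\<close> is small.\<close>
lemma words_closure_injective:
  assumes x0: "(x, 0) \<in> closure (words cs1 cs2 (letters_of A1))" shows "x = 0"
proof (rule p.locally_small_zero, rule ccontr)
  assume "x \<notin> p.locally_small"
  moreover have "x \<in> C" by (rule words_in_subalgebra[OF p.C_sub Domain_letters_C x0])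
  ultimately obtain e I where e: "0 < e" and I: "p.ideal I"
    and big: "\<And>J. p.ideal J \<Longrightarrow> J \<subseteq> I \<Longrightarrow> \<exists>q\<in>J. e * norm q < norm (x * q)"
    unfolding p.locally_small_def by (auto simp: not_le)
  \<comment> \<open>A third of \<open>e^2\<close> for each of three errors: replacing
    \<open>st1 x * x\<close> by \<open>f\<close>, the excision of \<open>f\<close>, and the value
    \<open>phi f\<close>.\<close>
  define t where "t = e\<^sup>2 / 3"
  have t: "0 < t" using e by (simp add: t_def)
  obtain s where s: "\<And>n. s n \<in> words cs1 cs2 (letters_of A1)" "s \<longlonglongrightarrow> (x, 0)"
    using x0 unfolding closure_sequential by blast
  have f: "(\<lambda>n. st1 (fst (s n)) * fst (s n)) \<longlonglongrightarrow> st1 x * x"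
    and g: "(\<lambda>n. st2 (snd (s n)) * snd (s n)) \<longlonglongrightarrow> st2 0 * 0"
    using tendsto_mult[OF a.tendsto_st[OF tendsto_fst[OF s(2)]] tendsto_fst[OF s(2)]]
      tendsto_mult[OF b.tendsto_st[OF tendsto_snd[OF s(2)]] tendsto_snd[OF s(2)]] by simp_all
  have "\<forall>\<^sub>F n in sequentially. norm (st1 (fst (s n)) * fst (s n) - st1 x * x) < t \<and> norm (st2 (snd (s n)) * snd (s n)) < t"
    using tendstoD[OF f t] tendstoD[OF g t] by (simp add: dist_norm eventually_conj_iff)
  then obtain n where n: "norm (st1 (fst (s n)) * fst (s n) - st1 x * x) < t" "norm (st2 (snd (s n)) * snd (s n)) < t"
    by (auto simp: eventually_sequentially)
  define f where "f = st1 (fst (s n)) * fst (s n)"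
  define g where "g = st2 (snd (s n)) * snd (s n)"
  have fg: "(f, g) \<in> words cs1 cs2 (letters_of A1)"
    unfolding f_def g_def using s(1)[of n] by (intro words_mult words_st letters_of_st) auto
  then obtain X where X: "finite X" "X \<subseteq> A1" "(f, g) \<in> words cs1 cs2 (letters_of X)" using words_finite[OF fg] by blast
  have XC: "X \<subseteq> C" using X(2) A1_C by blast
  obtain W h where W: "excision cs1 st1 D W h" "X \<subseteq> closure (cspan cs1 W)"
    and h: "\<And>n. p.ideal (p.U (h n))" "\<And>n. p.U (h n) \<subseteq> I"
    using p.excision_exists[OF X(1) XC I] by blast
  interpret ex: excision cs1 st1 D W h by (rule W(1))
  interpret x: excised_isometry cs1 st1 cs2 st2 A1 u D W h X
    by unfold_locales (use D_A1 X W(2) in \<open>auto simp: ex.A_def\<close>)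
  have tr: "x.tracked f g" by (rule x.tracked_words[OF X(3)])
  have phi: "cmod (ex.phi f) < t" using x.tracked_phi_le[OF tr] n(2) by (simp add: g_def)
  have fA: "f \<in> ex.A" using tr by (simp add: x.tracked_def)
  obtain m where m: "norm (h m * f * h m - cs1 (ex.phi f) (h m * h m)) < t"
    using LIMSEQ_D[OF ex.phi_lim[OF fA] t] by auto
  obtain q where q: "q \<in> p.U (h m)" "e * norm q < norm (x * q)" using big[OF h] by blast
  have hq: "h m * q = q" using q by (simp add: p.U_def)
  have qh: "st1 q * h m = st1 q" using arg_cong[OF hq, of st1] by (simp add: a.st_mult ex.h_sa)
  have qhz: "st1 q * (h m * z) = st1 q * z" for z using qh by (metis mult.assoc)
  have nq: "norm (st1 q * z * q) \<le> norm z * (norm q)\<^sup>2" for z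
    using norm_mult_ineq[of "st1 q * z" q] mult_right_mono[OF norm_mult_ineq[of "st1 q" z], of "norm q"]
    by (simp add: power2_eq_square mult_ac)
  have "st1 (x * q) * (x * q) = st1 q * (st1 x * x - f) * q + st1 q * (h m * f * h m - cs1 (ex.phi f) (h m * h m)) * q
      + cs1 (ex.phi f) (st1 q * 1 * q)"
    by (simp add: a.st_mult left_diff_distrib right_diff_distrib mult.assoc hq qhz a.cs_mult_left a.cs_mult_right)
  then have "(norm (x * q))\<^sup>2 \<le> norm (st1 q * (st1 x * x - f) * q)
      + norm (st1 q * (h m * f * h m - cs1 (ex.phi f) (h m * h m)) * q) + norm (cs1 (ex.phi f) (st1 q * 1 * q))"
    by (metis a.norm_st_mult norm_triangle_le norm_triangle_ineq add_mono order_refl)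
  also have "\<dots> \<le> t * (norm q)\<^sup>2 + t * (norm q)\<^sup>2 + t * (norm q)\<^sup>2"
  proof (intro add_mono)
    show "norm (st1 q * (st1 x * x - f) * q) \<le> t * (norm q)\<^sup>2"
      using n(1) by (intro order_trans[OF nq mult_right_mono]) (auto simp: f_def norm_minus_commute)
    show "norm (st1 q * (h m * f * h m - cs1 (ex.phi f) (h m * h m)) * q) \<le> t * (norm q)\<^sup>2"
      using m by (intro order_trans[OF nq mult_right_mono]) auto
    show "norm (cs1 (ex.phi f) (st1 q * 1 * q)) \<le> t * (norm q)\<^sup>2"
      using phi nq[of 1] t unfolding a.norm_cs by (intro mult_mono) auto
  qed
  also have "\<dots> = (e * norm q)\<^sup>2" by (simp add: t_def power_mult_distrib field_simps)
  finally have "norm (x * q) \<le> e * norm q" by (rule power2_le_imp_le) (use e in simp)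
  then show False using q(2) by simp
qed

end

theorem theorem7p6:
  fixes cs1 :: "complex \<Rightarrow> 'a::{real_normed_algebra_1,banach} \<Rightarrow> 'a" and st1 :: "'a \<Rightarrow> 'a"
    and cs2 :: "complex \<Rightarrow> 'b::{real_normed_algebra_1,banach} \<Rightarrow> 'b" and st2 :: "'b \<Rightarrow> 'b"
    and C1 D1 A1 :: "'a set" and C2 D2 A2 :: "'b set" and u :: "'a \<Rightarrow> 'b"
  assumes ops1: "cstar_ops cs1 st1" and ops2: "cstar_ops cs2 st2"
    and pc1: "pseudo_cartan cs1 st1 C1 D1"
    and pc2: "pseudo_cartan cs2 st2 C2 D2"
    and tpc1: "pseudo_cartan cs1 st1 (tildeC cs1 C1) (tildeD cs1 C1 D1)"
    and tpc2: "pseudo_cartan cs2 st2 (tildeC cs2 C2) (tildeD cs2 C2 D2)"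
    and A1: "banach_subalg cs1 A1" "D1 \<subseteq> A1" "A1 \<subseteq> C1"
    and A2: "banach_subalg cs2 A2" "D2 \<subseteq> A2" "A2 \<subseteq> C2"
    and u: "isometric_alg_iso cs1 cs2 A1 A2 u"
  shows "\<exists>U. star_iso cs1 st1 cs2 st2 (generated_cstar cs1 st1 A1) (generated_cstar cs2 st2 A2) U
             \<and> (\<forall>a\<in>A1. U a = u a)
             \<and> (\<forall>V. star_iso cs1 st1 cs2 st2 (generated_cstar cs1 st1 A1) (generated_cstar cs2 st2 A2) V
                    \<and> (\<forall>a\<in>A1. V a = u a)
                    \<longrightarrow> (\<forall>x\<in>generated_cstar cs1 st1 A1. V x = U x))"
proof -
  define v where "v = inv_into A1 u"
  have bij: "bij_betw u A1 A2" and lin: "clinear_on cs1 cs2 A1 u" and mult: "multiplicative_on A1 u"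
    and iso: "\<And>x. x \<in> A1 \<Longrightarrow> norm (u x) = norm x"
    using u by (auto simp: isometric_alg_iso_def)
  have uA: "u x \<in> A2" "v (u x) = x" if "x \<in> A1" for x
    using bij that by (auto simp: v_def bij_betw_def)
  have vA: "v y \<in> A1" "u (v y) = y" if "y \<in> A2" for y
    using bij that by (auto simp: v_def bij_betw_def inv_into_into f_inv_into_f)
  have A1c: "x + x' \<in> A1" "x * x' \<in> A1" "cs1 c x \<in> A1" if "x \<in> A1" "x' \<in> A1" for x x' c
    using A1(1) that by (auto simp: banach_subalg_def csubspace_def)
  interpret i: cartan_isometric_hom cs1 st1 cs2 st2 A1 u C1 D1
    by unfold_locales (use ops1 ops2 pc1 A1 lin mult iso in auto)
  have v_add: "v (y + y') = v y + v y'" if "y \<in> A2" "y' \<in> A2" for y y'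
    using uA(2)[OF A1c(1)[OF vA(1)[OF that(1)] vA(1)[OF that(2)]]] vA that by (simp add: i.u_add)
  have v_mult: "v (y * y') = v y * v y'" if "y \<in> A2" "y' \<in> A2" for y y'
    using uA(2)[OF A1c(2)[OF vA(1)[OF that(1)] vA(1)[OF that(2)]]] vA that by (simp add: i.u_mult)
  have v_cs: "v (cs2 c y) = cs1 c (v y)" if "y \<in> A2" for y c
    using uA(2)[OF A1c(3)[OF vA(1)[OF that] vA(1)[OF that]]] vA that by (simp add: i.u_cs)
  \<comment> \<open>The inverse isometry satisfies the same hypotheses; the converse of
    \<open>K\<close> is its graph, which settles the pairs \<open>(0, y)\<close>.\<close>
  interpret j: cartan_isometric_hom cs2 st2 cs1 st1 A2 v C2 D2
    by unfold_locales
      (use ops1 ops2 pc2 A2 v_add v_mult v_cs vA iso[OF vA(1)] in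
        \<open>auto simp: clinear_on_def multiplicative_on_def\<close>)
  define K where "K = closure (words cs1 cs2 (i.letters_of A1))"
  have L: "j.letters_of A2 = (i.letters_of A1)\<inverse>"
    using uA vA unfolding i.letters_of_def j.letters_of_def by force
  have W: "words cs2 cs1 ((i.letters_of A1)\<inverse>) = (words cs1 cs2 (i.letters_of A1))\<inverse>"
    using words_converse[of _ _ cs1 cs2 "i.letters_of A1"] words_converse[of _ _ cs2 cs1 "(i.letters_of A1)\<inverse>"] by auto
  have K': "K\<inverse> = closure (words cs2 cs1 (j.letters_of A2))" unfolding K_def L W by (rule closure_converse)
  have ne: "i.letters_of A1 \<noteq> {}" "j.letters_of A2 \<noteq> {}"
    using i.A1_0 j.A1_0 by (auto simp: i.letters_of_def j.letters_of_def)
  have inj1: "x = 0" if "(x, 0) \<in> K" for x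
    using that unfolding K_def by (rule i.words_closure_injective)
  have inj2: "y = 0" if "(0, y) \<in> K" for y
    using that j.words_closure_injective[of y] K' by auto
  interpret k: star_graph cs1 st1 cs2 st2 K
    unfolding K_def using inj2 by (intro i.star_graph_closure_words ne i.letters_of_st) (auto simp: K_def)
  \<comment> \<open>The range of \<open>K\<close> is the domain of the converse graph, which is how
    it is seen to be a C*-subalgebra.\<close>
  interpret k': star_graph cs2 st2 cs1 st1 "K\<inverse>"
    unfolding K' using inj1 by (intro j.star_graph_closure_words ne j.letters_of_st) (auto simp flip: K')
  have uK: "(x, u x) \<in> K" if "x \<in> A1" for x
  proof -
    have "(x, u x) \<in> words cs1 cs2 (i.letters_of A1)" using that by (intro words.letter) (auto simp: i.letters_of_def)
    then show ?thesis unfolding K_def using closure_subset by blast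
  qed
  have dom: "Domain K = generated_cstar cs1 st1 A1"
  proof
    show "Domain K \<subseteq> generated_cstar cs1 st1 A1"
      unfolding generated_cstar_def
    proof (intro Inter_greatest)
      fix B assume "B \<in> {B. cstar_subalg cs1 st1 B \<and> A1 \<subseteq> B}"
      then have B: "cstar_subalg cs1 st1 B" "A1 \<subseteq> B" by auto
      have "Domain (i.letters_of A1) \<subseteq> B" using B i.a.cstar_subalgD(6)[OF B(1)] by (auto simp: i.letters_of_def)
      from i.words_in_subalgebra[OF B(1) this, folded K_def] show "Domain K \<subseteq> B" by auto
    qed
    show "generated_cstar cs1 st1 A1 \<subseteq> Domain K"
      unfolding generated_cstar_def using k.Domain_subalg uK by blast
  qed
  have ran: "Range K = generated_cstar cs2 st2 A2"
  proof
    show "Range K \<subseteq> generated_cstar cs2 st2 A2"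
      unfolding generated_cstar_def
    proof (intro Inter_greatest)
      fix B assume "B \<in> {B. cstar_subalg cs2 st2 B \<and> A2 \<subseteq> B}"
      then have B: "cstar_subalg cs2 st2 B" "A2 \<subseteq> B" by auto
      have "Domain (j.letters_of A2) \<subseteq> B" using B i.b.cstar_subalgD(6)[OF B(1)] by (auto simp: j.letters_of_def)
      from j.words_in_subalgebra[OF B(1) this, folded K'] show "Range K \<subseteq> B" by auto
    qed
    have "A2 \<subseteq> Domain (K\<inverse>)" using uK[OF vA(1)] vA(2) by auto
    then show "generated_cstar cs2 st2 A2 \<subseteq> Range K"
      unfolding generated_cstar_def using k'.Domain_subalg by auto
  qed
  have U: "star_iso cs1 st1 cs2 st2 (generated_cstar cs1 st1 A1) (generated_cstar cs2 st2 A2) k.K_map"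
    using k.star_iso_K_map[OF inj1] by (simp add: dom ran)
  have Uu: "k.K_map x = u x" if "x \<in> A1" for x using k.K_map_eq[OF uK[OF that]] .
  have "V x = k.K_map x" if V: "star_iso cs1 st1 cs2 st2 (generated_cstar cs1 st1 A1) (generated_cstar cs2 st2 A2) V"
    "\<forall>a\<in>A1. V a = u a" and x: "x \<in> generated_cstar cs1 st1 A1" for V x
    by (rule i.star_homs_agree[OF k.Domain_subalg[unfolded dom] _ _ _ _ _ _ _ x])
      (use U V Uu in \<open>auto simp: star_iso_def\<close>)
  with U Uu show ?thesis by (intro exI[of _ k.K_map]) blast
qed

end
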